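(* The action of $\exp(\mathcal Z^0(\mathsf{dfGC}))$ on SFQs, given on the corresponding Maurer-Cartan elements by $\alpha\mapsto\exp(\mathrm{ad}_{J(\gamma)})\,\alpha$ for $\gamma\in\mathcal Z^0(\mathsf{dfGC})$, descends to an action of $\exp(H^0(\mathsf{dfGC}))$ on homotopy classes of SFQs.
   Context: Conventions. $\mathbb K$ is a field of characteristic $0$; graded means $\mathbb Z$-graded; $\mathrm{Sh}_{p,q}\subset S_{p+q}$ is the set of $(p,q)$-shuffles ($\sigma(1)<\dots<\sigma(p)$ and $\sigma(p+1)<\dots<\sigma(p+q)$). Graphs. $\mathsf{dGra}(n)$, $n\ge 1$, is spanned by directed graphs with vertex set $\{1,\dots,n\}$, without loops and without multiple edges of the same direction, with a total order on the edges, modulo the relation that reordering the edges by a permutation $\sigma$ multiplies the graph by $(-1)^{|\sigma|}$; a graph with $e$ edges has degree $-e$; $\mathsf{dGra}(0)=0$. $\mathsf{KGra}(n,k)^{\mathfrak o}$ ($n,k\ge0$, $n+k\geq 1$) is defined in the same way using graphs with $n$ black vertices labeled $1,\dots,n$ and $k$ white vertices labeled $1,\dots,k$ such that no edge originates at a white vertex. $S_n$ (resp. $S_n\times S_k$) acts by relabeling vertices ($\sigma$ changes label $i$ to $\sigma(i)$). The insertion of $\Gamma$ into a vertex $v$ of $\widetilde\Gamma$ is the sum of all graphs obtained by replacing $v$ by $\Gamma$ and reconnecting the edges incident to $v$ to vertices of $\Gamma$ in all possible ways, all edges of $\widetilde\Gamma$ being declared smaller than all edges of $\Gamma$. For $\Gamma\in\mathsf{dGra}(n)$,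 $\widetilde\Gamma\circ_{i,\mathfrak c}\Gamma$ (or $\widetilde\Gamma\circ_i\Gamma$) inserts $\Gamma$ into the black vertex $i$; labels of $\Gamma$ are shifted up by $i-1$ and black labels $>i$ of $\widetilde\Gamma$ are shifted up by $n-1$. For $\Gamma\in\mathsf{KGra}(n,q)^{\mathfrak o}$, $\widetilde\Gamma\in\mathsf{KGra}(m,p)^{\mathfrak o}$, $\widetilde\Gamma\circ_{i,\mathfrak o}\Gamma$ inserts $\Gamma$ into the white vertex $i$; black labels of $\Gamma$ are shifted up by $m$, white labels of $\Gamma$ by $i-1$, and white labels $>i$ of $\widetilde\Gamma$ by $q-1$. Special elements: $\Gamma_{\bullet-\bullet}\in\mathsf{dGra}(2)$ is the sum of the graph with single edge $(1,2)$ and the graph with single edge $(2,1)$; $\Gamma_{\circ\circ}\in\mathsf{KGra}(0,2)^{\mathfrak o}$ is the graph with two white vertices and no edges; $\Gamma^{\mathrm{br}}_k\in\mathsf{KGra}(1,k)^{\mathfrak o}$ has one black vertex, $k$ white vertices and one edge from the black vertex to each white vertex, ordered by the labels of white vertices. The Lie algebra $\mathcal L=\mathrm{Conv}(\mathfrak{oc}^\vee_\circ,\mathsf{KGra})$. An element $f\in\mathcal L$ of degree $d$ is a family consisting of $f^{\mathfrak c}_n\in\mathsf{dGra}(n)^{S_n}$ of degree $d+2-2n$ for $n\ge2$, and $f_{n,k}\in(\mathsf{KGra}(n,k)^{\mathfrak o})^{S_n}$ of degree $d+1-2n-k$ for all $(n,k)$ with $n\ge1,k\ge0$ or $n=0,k\ge2$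 (put $f_{0,0}=f_{0,1}=0$). Define $$(f\bullet g)^{\mathfrak c}_n=\sum_{p=2}^{n-1}\sum_{\tau\in\mathrm{Sh}_{p,n-p}}\tau\big(f^{\mathfrak c}_{n-p+1}\circ_1 g^{\mathfrak c}_p\big),$$ $$(f\bullet g)_{n,k}=(-1)^{|g|(k+1)}\sum_{p=2}^{n}\sum_{\tau\in\mathrm{Sh}_{p,n-p}}(\tau,\mathrm{id})\big(f_{n-p+1,k}\circ_{1,\mathfrak c}g^{\mathfrak c}_p\big)+\sum_{r=0}^n\sum_{\sigma\in\mathrm{Sh}_{r,n-r}}\sum_{0\le p\le q\le k}(-1)^{(k-q)(q-p+1)+|g|(k-q+p)}(\sigma,\mathrm{id})\big(f_{r,k-q+p+1}\circ_{p+1,\mathfrak o}g_{n-r,q-p}\big),$$ and $[f,g]=f\bullet g-(-1)^{|f||g|}g\bullet f$. This is a graded Lie algebra with zero differential, complete with respect to $\mathcal F_m\mathcal L=\{f: f^{\mathfrak c}_n=0 \text{ for } n\le m,\ f_{n,k}=0\text{ for }n+k\le m\}$. A Maurer-Cartan (MC) element is a degree $1$ element $\alpha$ with $[\alpha,\alpha]=0$. SFQs. Stable formality quasi-isomorphisms (SFQs) correspond bijectively to MC elements $\alpha$ of $\mathcal L$ satisfying the boundary conditions $\alpha^{\mathfrak c}_2=\Gamma_{\bullet-\bullet}$, $\alpha^{\mathfrak c}_n=0$ ($n\ge3$), $\alpha_{0,2}=\Gamma_{\circ\circ}$, $\alpha_{1,k}=\frac1{k!}\Gamma^{\mathrm{br}}_k$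 ($k\ge0$). Two SFQs with MC elements $\alpha,\widetilde\alpha$ are homotopy equivalent if $\widetilde\alpha=\exp(\mathrm{ad}_\xi)\alpha$ for some degree $0$ element $\xi\in\mathcal F_1\mathcal L$ with $\xi^{\mathfrak c}_n=0$ for all $n\ge2$; this is an equivalence relation, whose classes are the homotopy classes. The graph complex. $\mathsf{dfGC}$ is the dg Lie algebra whose elements of degree $d$ are families $\gamma=(\gamma_n)_{n\ge1}$ with $\gamma_n\in\mathsf{dGra}(n)^{S_n}$ of degree $d+2-2n$ (so a graph with $n$ vertices and $e$ edges has degree $2n-2-e$), with $(\gamma\bullet\gamma')_n=\sum_{p=1}^n\sum_{\tau\in\mathrm{Sh}_{p,n-p}}\tau(\gamma_{n-p+1}\circ_1\gamma'_p)$, bracket $[\gamma,\gamma']=\gamma\bullet\gamma'-(-1)^{|\gamma||\gamma'|}\gamma'\bullet\gamma$ and differential $\partial=[\Gamma_{\bullet-\bullet},\ \cdot\ ]$. Every cocycle $\gamma$ has $\gamma_1=0$. The Lie algebra $\mathcal Z^0(\mathsf{dfGC})$ of degree $0$ cocycles and its quotient $H^0(\mathsf{dfGC})$ are pro-nilpotent; $\exp$ of such a Lie algebra is the same set with the Campbell-Hausdorff product. For a cocycle $\gamma$, $J(\gamma)\in\mathcal L$ is defined by $J(\gamma)^{\mathfrak c}_n=\gamma_n$, $J(\gamma)_{n,k}=0$; $\exp(\mathrm{ad}_{J(\gamma)})$, $\gamma\in\mathcal Z^0(\mathsf{dfGC})$, maps MC elements corresponding to SFQs to such elements. *)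

theory Defs
  imports
    "HOL-Algebra.Group_Action"
    "HOL-Combinatorics.Permutations"
    "HOL-Library.Function_Algebras"
    "HOL-Library.Product_Plus"
    "HOL-Library.Groups_Big_Fun"
begin

section \<open>Spaces of graphs\<close>

text \<open>
  A graph on a given vertex set is determined by its edges, so a graph together with a total order
  on its edges is a list of edges; the numbers of black and white vertices are carried separately.
\<close>

datatype vertex = Black nat | White nat

type_synonym ograph = "(vertex \<times> vertex) list"

definition ographs :: "nat \<Rightarrow> nat \<Rightarrow> ograph set" where
  "ographs n k = {G. distinct G \<and>
     (\<forall>(u, v) \<in> set G. u \<in> Black ` {1..n} \<and> v \<in> Black ` {1..n} \<union> White ` {1..k} \<and> u \<noteq> v)}"

text \<open>
  A vector is given by its coefficient function. The coefficient of an ordered graph in a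
  combination of graphs, taken modulo the relation identifying a graph whose edges are reordered
  by a permutation with the sign of that permutation times the graph, is well defined, since the
  edges of a graph are pairwise distinct; such coefficient functions are exactly the alternating
  ones.

  \<open>KGra n k\<close> is the space with \<open>n\<close> black and \<open>k\<close> white vertices; for \<open>n \<ge> 1\<close>, \<open>KGra n 0\<close> is also
  the space of directed graphs on \<open>n\<close> vertices.
\<close>

type_synonym 'k gvec = "ograph \<Rightarrow> 'k"

definition KGra :: "nat \<Rightarrow> nat \<Rightarrow> ('k::field_char_0) gvec set" where
  "KGra n k = {x. (\<forall>G. x G \<noteq> 0 \<longrightarrow> G \<in> ographs n k) \<and>
     (\<forall>G \<sigma>. \<sigma> permutes {..<length G} \<longrightarrow> x (permute_list \<sigma> G) = of_int (sign \<sigma>) * x G)}"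

text \<open>The class of a single ordered graph.\<close>

definition gr :: "ograph \<Rightarrow> ('k::field_char_0) gvec" where
  "gr G = (\<lambda>H. \<Sum>\<sigma> | \<sigma> permutes {..<length G} \<and> permute_list \<sigma> G = H. of_int (sign \<sigma>))"

text \<open>
  Linear extension of a map \<open>T\<close> on ordered graphs that picks up the sign when edges are reordered.
  Each graph with \<open>e\<close> edges occurs in the sum with its \<open>e!\<close> orderings, all contributing equally.
\<close>

definition lin_ext :: "nat \<Rightarrow> nat \<Rightarrow> (ograph \<Rightarrow> 'k gvec) \<Rightarrow> 'k gvec \<Rightarrow> ('k::field_char_0) gvec" where
  "lin_ext n k T x = (\<lambda>L. \<Sum>G\<in>ographs n k. x G / fact (length G) * T G L)"

fun relabel_black :: "(nat \<Rightarrow> nat) \<Rightarrow> vertex \<Rightarrow> vertex" where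
  "relabel_black \<tau> (Black i) = Black (\<tau> i)"
| "relabel_black \<tau> (White j) = White j"

definition act :: "nat \<Rightarrow> nat \<Rightarrow> (nat \<Rightarrow> nat) \<Rightarrow> 'k gvec \<Rightarrow> ('k::field_char_0) gvec" where
  "act n k \<tau> = lin_ext n k (\<lambda>G. gr (map (map_prod (relabel_black \<tau>) (relabel_black \<tau>)) G))"

text \<open>The \<open>S\<^sub>n\<close>-invariants of degree \<open>d\<close>; a graph with \<open>e\<close> edges has degree \<open>-e\<close>.\<close>

definition KGra_inv :: "nat \<Rightarrow> nat \<Rightarrow> int \<Rightarrow> ('k::field_char_0) gvec set" where
  "KGra_inv n k d = {x \<in> KGra n k. (\<forall>G. x G \<noteq> 0 \<longrightarrow> - int (length G) = d) \<and>
     (\<forall>\<tau>. \<tau> permutes {1..n} \<longrightarrow> act n k \<tau> x = x)}"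

section \<open>Insertions\<close>

text \<open>
  If \<open>R v\<close> is the set of vertices that may take the place of the vertex \<open>v\<close>, then \<open>reconnect R G\<close>
  is the set of all edge lists obtained from \<open>G\<close> by choosing, edge by edge, new endpoints.
\<close>

definition reconnect :: "(vertex \<Rightarrow> vertex set) \<Rightarrow> ograph \<Rightarrow> ograph set" where
  "reconnect R G = listset (map (\<lambda>(u, v). R u \<times> R v) G)"

text \<open>
  \<open>black_repl i n\<close>: black vertex \<open>i\<close> is replaced by a graph with \<open>n \<ge> 1\<close> black vertices.
  \<open>white_repl m i n q\<close>: in a graph with \<open>m\<close> black vertices, white vertex \<open>i\<close> is replaced by a graph
  with \<open>n\<close> black and \<open>q\<close> white vertices. Other vertices get their shifted label.
\<close>

fun black_repl :: "nat \<Rightarrow> nat \<Rightarrow> vertex \<Rightarrow> vertex set" where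
  "black_repl i n (Black j) =
     (if j = i then Black ` {i..<i + n} else if j > i then {Black (j + n - 1)} else {Black j})"
| "black_repl i n (White j) = {White j}"

fun white_repl :: "nat \<Rightarrow> nat \<Rightarrow> nat \<Rightarrow> nat \<Rightarrow> vertex \<Rightarrow> vertex set" where
  "white_repl m i n q (Black j) = {Black j}"
| "white_repl m i n q (White j) =
     (if j = i then Black ` {m + 1..m + n} \<union> White ` {i..<i + q}
      else if j > i then {White (j + q - 1)} else {White j})"

fun shift :: "nat \<Rightarrow> nat \<Rightarrow> vertex \<Rightarrow> vertex" where
  "shift a b (Black j) = Black (j + a)"
| "shift a b (White j) = White (j + b)"

text \<open>
  \<open>ins_c (m, p) i n x y\<close> is \<open>x \<circ>\<^bsub>i,c\<^esub> y\<close> for \<open>x \<in> KGra m p\<close>, \<open>y \<in> KGra n 0\<close>;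
  \<open>ins_o (m, p) i (n, q) x y\<close> is \<open>x \<circ>\<^bsub>i,o\<^esub> y\<close> for \<open>x \<in> KGra m p\<close>, \<open>y \<in> KGra n q\<close>.
\<close>

definition ins_c :: "nat \<times> nat \<Rightarrow> nat \<Rightarrow> nat \<Rightarrow> 'k gvec \<Rightarrow> 'k gvec \<Rightarrow> ('k::field_char_0) gvec" where
  "ins_c = (\<lambda>(m, p) i n x y. lin_ext m p (\<lambda>G. lin_ext n 0 (\<lambda>H.
     \<Sum>G'\<in>reconnect (black_repl i n) G.
       gr (G' @ map (map_prod (shift (i - 1) 0) (shift (i - 1) 0)) H)) y) x)"

definition ins_o ::
    "nat \<times> nat \<Rightarrow> nat \<Rightarrow> nat \<times> nat \<Rightarrow> 'k gvec \<Rightarrow> 'k gvec \<Rightarrow> ('k::field_char_0) gvec" where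
  "ins_o = (\<lambda>(m, p) i (n, q) x y. lin_ext m p (\<lambda>G. lin_ext n q (\<lambda>H.
     \<Sum>G'\<in>reconnect (white_repl m i n q) G.
       gr (G' @ map (map_prod (shift m (i - 1)) (shift m (i - 1))) H)) y) x)"

definition shuffles_perm :: "nat \<Rightarrow> nat \<Rightarrow> (nat \<Rightarrow> nat) set" where
  "shuffles_perm p q = {\<sigma>. \<sigma> permutes {1..p + q} \<and>
     strict_mono_on {1..p} \<sigma> \<and> strict_mono_on {p + 1..p + q} \<sigma>}"

definition edge_graph :: "('k::field_char_0) gvec" where
  "edge_graph = gr [(Black 1, Black 2)] + gr [(Black 2, Black 1)]"

definition brush :: "nat \<Rightarrow> ('k::field_char_0) gvec" where
  "brush k = gr (map (\<lambda>j. (Black 1, White j)) [1..<k + 1])"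

section \<open>The convolution Lie algebra\<close>

text \<open>
  An element is a pair of its closed components \<open>f\<^sup>c\<^sub>n\<close> and its open components \<open>f\<^bsub>n,k\<^esub>\<close>;
  components with indices outside the index range are zero.
\<close>

type_synonym 'k conv = "(nat \<Rightarrow> 'k gvec) \<times> (nat \<Rightarrow> nat \<Rightarrow> 'k gvec)"

definition conv_deg :: "int \<Rightarrow> ('k::field_char_0) conv set" where
  "conv_deg d = {(fc, fo).
     fc 0 = 0 \<and> fc 1 = 0 \<and> (\<forall>n\<ge>2. fc n \<in> KGra_inv n 0 (d + 2 - 2 * int n)) \<and>
     fo 0 0 = 0 \<and> fo 0 1 = 0 \<and>
     (\<forall>n k. n \<ge> 1 \<or> k \<ge> 2 \<longrightarrow> fo n k \<in> KGra_inv n k (d + 1 - 2 * int n - int k))}"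

text \<open>
  The operations below depend on the degrees of the arguments through signs; these degrees are
  passed explicitly: \<open>dg\<close> is the degree of \<open>g\<close>.
\<close>

definition conv_bullet :: "int \<Rightarrow> 'k conv \<Rightarrow> 'k conv \<Rightarrow> ('k::field_char_0) conv" where
  "conv_bullet dg = (\<lambda>(fc, fo) (gc, go).
    (\<lambda>n. \<Sum>p = 2..n - 1. \<Sum>\<tau>\<in>shuffles_perm p (n - p).
        act n 0 \<tau> (ins_c (n - p + 1, 0) 1 p (fc (n - p + 1)) (gc p)),
     \<lambda>n k L.
       (-1) powi (dg * (int k + 1)) *
         (\<Sum>p = 2..n. \<Sum>\<tau>\<in>shuffles_perm p (n - p).
            act n k \<tau> (ins_c (n - p + 1, k) 1 p (fo (n - p + 1) k) (gc p)) L)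
       + (\<Sum>r = 0..n. \<Sum>\<sigma>\<in>shuffles_perm r (n - r). \<Sum>q = 0..k. \<Sum>p = 0..q.
            (-1) powi (int (k - q) * int (q - p + 1) + dg * int (k - q + p)) *
            act n k \<sigma> (ins_o (r, k - q + p + 1) (p + 1) (n - r, q - p)
                          (fo r (k - q + p + 1)) (go (n - r) (q - p))) L)))"

definition conv_bracket :: "int \<Rightarrow> int \<Rightarrow> 'k conv \<Rightarrow> 'k conv \<Rightarrow> ('k::field_char_0) conv" where
  "conv_bracket df dg f g =
    ((\<lambda>n L. fst (conv_bullet dg f g) n L - (-1) powi (df * dg) * fst (conv_bullet df g f) n L),
     (\<lambda>n k L. snd (conv_bullet dg f g) n k L - (-1) powi (df * dg) * snd (conv_bullet df g f) n k L))"

definition conv_filt :: "nat \<Rightarrow> ('k::field_char_0) conv set" where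
  "conv_filt m = {(fc, fo). (\<forall>n\<le>m. fc n = 0) \<and> (\<forall>n k. n + k \<le> m \<longrightarrow> fo n k = 0)}"

text \<open>
  \<open>exp_ad d \<xi> f\<close> is \<open>exp(ad\<^sub>\<xi>) f\<close> for \<open>\<xi>\<close> of degree 0 and \<open>f\<close> of degree \<open>d\<close>. The sum is taken coefficientwise.
  For \<open>\<xi>\<close> in the first filtration step, \<open>ad\<^sub>\<xi>\<close> raises the filtration, so that only finitely
  many terms contribute to each coefficient (\<^const>\<open>Sum_any\<close> is a finite-support sum) and the result
  is the limit of the partial sums in the complete filtered Lie algebra.
\<close>

definition exp_ad :: "int \<Rightarrow> 'k conv \<Rightarrow> 'k conv \<Rightarrow> ('k::field_char_0) conv" where
  "exp_ad d \<xi> f =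
    ((\<lambda>n L. Sum_any (\<lambda>j. fst ((conv_bracket 0 d \<xi> ^^ j) f) n L / fact j)),
     (\<lambda>n k L. Sum_any (\<lambda>j. snd ((conv_bracket 0 d \<xi> ^^ j) f) n k L / fact j)))"

definition MC :: "('k::field_char_0) conv set" where
  "MC = {\<alpha> \<in> conv_deg 1. conv_bracket 1 1 \<alpha> \<alpha> = 0}"

text \<open>Stable formality quasi-isomorphisms, identified with their Maurer-Cartan elements.\<close>

definition SFQ :: "('k::field_char_0) conv set" where
  "SFQ = {\<alpha> \<in> MC. fst \<alpha> 2 = edge_graph \<and> (\<forall>n\<ge>3. fst \<alpha> n = 0) \<and>
     snd \<alpha> 0 2 = gr [] \<and> (\<forall>k. snd \<alpha> 1 k = (\<lambda>L. 1 / fact k * brush k L))}"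

definition homotopy_rel :: "(('k::field_char_0) conv \<times> 'k conv) set" where
  "homotopy_rel = {(\<alpha>, \<alpha>'). \<alpha> \<in> SFQ \<and> \<alpha>' \<in> SFQ \<and>
     (\<exists>\<xi> \<in> conv_deg 0 \<inter> conv_filt 1. (\<forall>n\<ge>2. fst \<xi> n = 0) \<and> \<alpha>' = exp_ad 1 \<xi> \<alpha>)}"

section \<open>The full directed graph complex\<close>

type_synonym 'k gfam = "nat \<Rightarrow> 'k gvec"

definition dfGC :: "int \<Rightarrow> ('k::field_char_0) gfam set" where
  "dfGC d = {\<gamma>. \<gamma> 0 = 0 \<and> (\<forall>n\<ge>1. \<gamma> n \<in> KGra_inv n 0 (d + 2 - 2 * int n))}"

definition dfGC_bullet :: "'k gfam \<Rightarrow> 'k gfam \<Rightarrow> ('k::field_char_0) gfam" where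
  "dfGC_bullet \<gamma> \<gamma>' = (\<lambda>n. \<Sum>p = 1..n. \<Sum>\<tau>\<in>shuffles_perm p (n - p).
     act n 0 \<tau> (ins_c (n - p + 1, 0) 1 p (\<gamma> (n - p + 1)) (\<gamma>' p)))"

definition dfGC_bracket :: "int \<Rightarrow> int \<Rightarrow> 'k gfam \<Rightarrow> 'k gfam \<Rightarrow> ('k::field_char_0) gfam" where
  "dfGC_bracket d d' \<gamma> \<gamma>' = (\<lambda>n L.
     dfGC_bullet \<gamma> \<gamma>' n L - (-1) powi (d * d') * dfGC_bullet \<gamma>' \<gamma> n L)"

text \<open>The element \<^const>\<open>edge_graph\<close> has degree 1 in the graph complex.\<close>

definition dfGC_diff :: "int \<Rightarrow> 'k gfam \<Rightarrow> ('k::field_char_0) gfam" where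
  "dfGC_diff d = dfGC_bracket 1 d (\<lambda>n. if n = 2 then edge_graph else 0)"

definition Z0 :: "('k::field_char_0) gfam set" where
  "Z0 = {\<gamma> \<in> dfGC 0. dfGC_diff 0 \<gamma> = 0}"

definition cohomologous :: "(('k::field_char_0) gfam \<times> 'k gfam) set" where
  "cohomologous = {(\<gamma>, \<gamma>'). \<gamma> \<in> Z0 \<and> \<gamma>' \<in> Z0 \<and> (\<exists>\<eta> \<in> dfGC (-1). \<gamma>' - \<gamma> = dfGC_diff (-1) \<eta>)}"

section \<open>The groups of the Lie algebras of degree 0 cocycles and cohomology classes\<close>

fun right_nested :: "('a \<Rightarrow> 'a \<Rightarrow> 'a::zero) \<Rightarrow> 'a list \<Rightarrow> 'a" where
  "right_nested br [] = 0"
| "right_nested br [x] = x"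
| "right_nested br (x # y # zs) = br x (right_nested br (y # zs))"

text \<open>
  The Campbell-Hausdorff product, i.e. the logarithm of \<open>exp x exp y\<close>, by Dynkin's formula:
  the sum over \<open>m \<ge> 1\<close> and pairs \<open>(r\<^sub>1, s\<^sub>1), \<dots>, (r\<^sub>m, s\<^sub>m)\<close> with \<open>r\<^sub>i + s\<^sub>i > 0\<close> of
  \<open>(-1)^(m-1) / m\<close> times the right-nested bracket of the word \<open>x^r\<^sub>1 y^s\<^sub>1 \<dots> x^r\<^sub>m y^s\<^sub>m\<close>, divided by
  \<open>(\<Sum>i. r\<^sub>i + s\<^sub>i) * (\<Prod>i. r\<^sub>i! s\<^sub>i!)\<close>. For degree 0 cocycles, which vanish on one vertex, a nested
  bracket of \<open>N\<close> of them vanishes on at most \<open>N\<close> vertices, so each coefficient is a finite sum.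
\<close>

definition CH :: "'k gfam \<Rightarrow> 'k gfam \<Rightarrow> ('k::field_char_0) gfam" where
  "CH x y = (\<lambda>n L. Sum_any (\<lambda>ps :: (nat \<times> nat) list.
     if ps \<noteq> [] \<and> (\<forall>(r, s) \<in> set ps. r + s > 0) then
       (-1) ^ (length ps - 1) / of_nat (length ps) *
       (right_nested (dfGC_bracket 0 0)
          (concat (map (\<lambda>(r, s). replicate r x @ replicate s y) ps)) n L /
        (of_nat (\<Sum>(r, s)\<leftarrow>ps. r + s) * (\<Prod>(r, s)\<leftarrow>ps. fact r * fact s)))
     else 0))"

definition exp_Z0 :: "(('k::field_char_0) gfam) monoid" where
  "exp_Z0 = \<lparr>carrier = Z0, monoid.mult = CH, one = 0\<rparr>"

text \<open>
  The bracket on cohomology is induced from the one on cocycles, hence the Campbell-Hausdorff product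
  of two classes is the class of the product of arbitrary representatives.
\<close>

definition exp_H0 :: "(('k::field_char_0) gfam set) monoid" where
  "exp_H0 = \<lparr>carrier = Z0 // cohomologous,
     monoid.mult = (\<lambda>A B. \<Union>\<gamma>\<in>A. \<Union>\<gamma>'\<in>B. cohomologous `` {CH \<gamma> \<gamma>'}),
     one = cohomologous `` {0}\<rparr>"

text \<open>
  \<open>J_conv \<gamma>\<close> is an element of the convolution Lie algebra if \<open>\<gamma>\<close> vanishes on one vertex, as cocycles do.
\<close>

definition J_conv :: "'k gfam \<Rightarrow> ('k::field_char_0) conv" where
  "J_conv \<gamma> = (\<gamma>, 0)"

end

(*
The proof is formal once L is known to be a complete filtered graded Lie algebra and the
Campbell-Hausdorff product is known to satisfy exp(ad CH(x, y)) = exp(ad x) exp(ad y).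

The bracket of L is the graded commutator of a graded pre-Lie product. An invariant family of
graphs can be evaluated on arbitrary finite sets of black vertices and arbitrary lists of white
vertices. In terms of these evaluations insertion followed by the sum over shuffles becomes the
coproduct-like sum over all subsets T of vertices: contract T in the given graph, and multiply the
coefficient of the quotient by that of the induced subgraph on T. The associator is then the sum
over pairs of disjoint subsets, which is symmetric up to sign.

Dynkin's coefficients are treated in noncommutative power series in two letters, where the logarithm
of exp x exp y is shown to be fixed by the normalised right-nested bracket map; applying words in
ad x and ad y then gives the identity of exponentials above.

The closed part of an SFQ is the edge graph, so exp(ad J(g)) preserves SFQs for a cocycle g, and it
conjugates homotopies to homotopies. Associativity of the product on cocycles follows from the
faithfulness of the adjoint action. If g and g' are cohomologous, then CH(-g, g') is a coboundary
[edge, z]; for an SFQ a, the element [a, z] has the same closed part and fixes a, hence exp of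
[edge, z] moves a by a homotopy.
*)

theory Submission
  imports Defs "HOL-Computational_Algebra.Formal_Power_Series" "HOL-Combinatorics.Multiset_Permutations"
begin

section \<open>Free noncommutative series in two letters, and Dynkin's formula for log (exp x exp
  y)\<close>

section \<open>Noncommutative power series in two variables\<close>

text \<open>Dynkin's formula expresses the logarithm by brackets only if the right-nested bracket
  map \<open>r\<close> multiplies every homogeneous part of \<open>log (exp x exp y)\<close> by its
  degree. Usually this follows from that series being a Lie series; here it is computed. For
  \<open>g\<close> without constant term, \<open>r (exp x g) = exp x r(g) exp (-x)\<close>. Hence
  \<open>r\<close> maps the powers of \<open>V = exp x exp y - 1\<close> to double series in left
  and right multiplication by \<open>V\<close>, applied to the degree derivation of
  \<open>V\<close>, and the logarithm series adds them up to the degree derivation of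
  \<open>log (1 + V)\<close>.

  On the side of graphs the difficulty is strictness: contracting two sets one after the other has
  to give the same graph on the same vertices, not an isomorphic one. This is achieved by naming a
  contracted set after its minimum.

  The adjoint action is faithful on closed elements because the graph with one black vertex and no
  edges, taken as an open element, returns every component up to sign. Projecting to closed
  components respects brackets, so whether a product of exponentials is a homotopy is decided on
  closed components alone.\<close>

typedef 'k ncps = "UNIV :: (bool list \<Rightarrow> 'k) set"
  morphisms cf NC by auto

lemma cf_NC [simp]: "cf (NC f) = f"
  by (simp add: NC_inverse)

lemma ncps_eqI: "(\<And>w. cf f w = cf g w) \<Longrightarrow> f = g"
  using cf_inject by blast

text \<open>The Cauchy product, by recursion on the word: its first letter is either left to
  \<open>g\<close> together with the rest, or absorbed into the argument of \<open>f\<close>. This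
  makes associativity a short induction.\<close>

primrec ncmul :: "(bool list \<Rightarrow> 'k) \<Rightarrow> (bool list \<Rightarrow> 'k) \<Rightarrow> bool list \<Rightarrow> 'k::field_char_0" where
  "ncmul f g [] = f [] * g []"
| "ncmul f g (a # w) = f [] * g (a # w) + ncmul (\<lambda>u. f (a # u)) g w"

lemma ncmul_eq_sum: "ncmul f g w = (\<Sum>i\<le>length w. f (take i w) * g (drop i w))"
proof (induction w arbitrary: f)
  case (Cons a w)
  show ?case
    by (simp only: length_Cons sum.atMost_Suc_shift ncmul.simps Cons) simp
qed simp

lemma ncmul_add_left: "ncmul (\<lambda>u. f u + g u) h w = ncmul f h w + ncmul g h w"
  by (simp add: ncmul_eq_sum algebra_simps sum.distrib)

lemma ncmul_scale_left: "ncmul (\<lambda>u. c * f u) h w = c * ncmul f h w"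
  by (simp add: ncmul_eq_sum algebra_simps sum_distrib_left)

lemma ncmul_assoc: "ncmul (ncmul f g) h w = ncmul f (ncmul g h) w"
proof (induction w arbitrary: f)
  case (Cons a w)
  show ?case
    by (simp add: ncmul_add_left ncmul_scale_left Cons algebra_simps)
qed simp

instantiation ncps :: (field_char_0) ring_1
begin
definition "zero_ncps = NC (\<lambda>w. 0 :: 'a)"
definition "one_ncps = NC (\<lambda>w. if w = [] then 1 else 0 :: 'a)"
definition "plus_ncps f g = NC (\<lambda>w. cf f w + cf g w :: 'a)"
definition "minus_ncps f g = NC (\<lambda>w. cf f w - cf g w :: 'a)"
definition "uminus_ncps f = NC (\<lambda>w. - cf f w :: 'a)"
definition "times_ncps f g = NC (ncmul (cf f) (cf g) :: bool list \<Rightarrow> 'a)"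
lemma ncmul_one_left: "ncmul (\<lambda>w. if w = [] then 1 else 0) f w = f w"
proof (cases w)
  case (Cons a v)
  have "ncmul (\<lambda>w. 0) f u = 0" for u by (simp add: ncmul_eq_sum)
  with Cons show ?thesis by simp
qed simp
lemma ncmul_one_right: "ncmul f (\<lambda>w. if w = [] then 1 else 0) w = f w"
proof (induction w arbitrary: f)
  case (Cons a w)
  show ?case by (simp add: Cons)
qed simp
instance
proof
  fix a b c :: "'a ncps"
  show "a * b * c = a * (b * c)"
    by (rule ncps_eqI) (simp add: times_ncps_def ncmul_assoc)
  show "1 * a = a" by (rule ncps_eqI) (simp add: times_ncps_def one_ncps_def ncmul_one_left)
  show "a * 1 = a" by (rule ncps_eqI) (simp add: times_ncps_def one_ncps_def ncmul_one_right)
  show "(a + b) * c = a * c + b * c"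
    by (rule ncps_eqI) (simp add: times_ncps_def plus_ncps_def ncmul_eq_sum algebra_simps sum.distrib)
  show "a * (b + c) = a * b + a * c"
    by (rule ncps_eqI) (simp add: times_ncps_def plus_ncps_def ncmul_eq_sum algebra_simps sum.distrib)
  show "a + b + c = a + (b + c)" by (rule ncps_eqI) (simp add: plus_ncps_def)
  show "a + b = b + a" by (rule ncps_eqI) (simp add: plus_ncps_def add.commute)
  show "0 + a = a" by (rule ncps_eqI) (simp add: plus_ncps_def zero_ncps_def)
  show "- a + a = 0" by (rule ncps_eqI) (simp add: plus_ncps_def zero_ncps_def uminus_ncps_def)
  show "a - b = a + - b"
    by (rule ncps_eqI) (simp add: plus_ncps_def minus_ncps_def uminus_ncps_def)
  have "cf (0 :: 'a ncps) [] \<noteq> cf 1 []" by (simp add: zero_ncps_def one_ncps_def)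
  then show "(0 :: 'a ncps) \<noteq> 1" by metis
qed
end

lemma cf_0 [simp]: "cf 0 w = 0" by (simp add: zero_ncps_def)
lemma cf_1: "cf 1 w = (if w = [] then 1 else 0)" by (simp add: one_ncps_def)
lemma cf_add [simp]: "cf (f + g) w = cf f w + cf g w" by (simp add: plus_ncps_def)
lemma cf_diff [simp]: "cf (f - g) w = cf f w - cf g w" by (simp add: minus_ncps_def)
lemma cf_uminus [simp]: "cf (- g) w = - cf g w" by (simp add: uminus_ncps_def)
lemma cf_mult: "cf (f * g) w = (\<Sum>i\<le>length w. cf f (take i w) * cf g (drop i w))"
  by (simp add: times_ncps_def ncmul_eq_sum)
lemma cf_mult_Nil [simp]: "cf (f * g) [] = cf f [] * cf g []"
  by (simp add: cf_mult)
lemma cf_mult_Cons: "cf (f * g) (a # w) = cf f [] * cf g (a # w) + cf (NC (\<lambda>u. cf f (a # u)) * g) w"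
  by (simp add: times_ncps_def)
lemma cf_sum: "cf (sum f A) w = (\<Sum>a\<in>A. cf (f a) w)"
  by (induction A rule: infinite_finite_induct) auto

definition ncc :: "'k \<Rightarrow> 'k::field_char_0 ncps" where
  "ncc c = NC (\<lambda>w. if w = [] then c else 0)"

lemma cf_ncc: "cf (ncc c) w = (if w = [] then c else 0)" by (simp add: ncc_def)

lemma cf_ncc_mult [simp]: "cf (ncc c * f) w = c * cf f w"
proof -
  have "cf (ncc c * f) w = c * cf (1 * f) w"
    by (simp only: cf_mult sum_distrib_left) (auto intro!: sum.cong simp: cf_ncc cf_1)
  then show ?thesis by simp
qed

lemma ncc_mult_commute: "ncc c * f = f * ncc c"
proof (rule ncps_eqI)
  fix w
  have "cf (f * ncc c) w = c * cf (f * 1) w"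
    by (simp only: cf_mult sum_distrib_left) (auto intro!: sum.cong simp: cf_ncc cf_1)
  then show "cf (ncc c * f) w = cf (f * ncc c) w" by simp
qed

lemma mult_ncc_left: "f * (ncc c * g) = ncc c * (f * g)"
  by (metis mult.assoc ncc_mult_commute)

lemma ncc_mult_ncc: "ncc c * (ncc d * f) = ncc (c * d) * f"
  by (rule ncps_eqI) simp

lemma ncc_mult_shuffle: "ncc c * f * (ncc d * g) = ncc (c * d) * (f * g)"
  by (metis mult.assoc mult_ncc_left ncc_mult_ncc)

lemma ncc_add: "ncc (c + d) = ncc c + ncc d" by (rule ncps_eqI) (simp add: cf_ncc)
lemma ncc_of_nat: "ncc (of_nat n) = of_nat n"
proof (induction n)
  case 0 show ?case by (rule ncps_eqI) (simp add: cf_ncc)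
next
  case (Suc n)
  then show ?case by (simp add: ncc_add) (rule ncps_eqI, simp add: cf_ncc cf_1)
qed

subsection \<open>Order of vanishing and infinite sums\<close>

definition vord :: "nat \<Rightarrow> 'k::field_char_0 ncps \<Rightarrow> bool" where
  "vord n f \<longleftrightarrow> (\<forall>w. length w < n \<longrightarrow> cf f w = 0)"

lemma vord_mult: assumes "vord m f" "vord n g" shows "vord (m + n) (f * g)"
  unfolding vord_def
proof (intro allI impI)
  fix w :: "bool list" assume w: "length w < m + n"
  show "cf (f * g) w = 0" unfolding cf_mult
  proof (rule sum.neutral, intro ballI)
    fix i assume i: "i \<in> {..length w}"
    show "cf f (take i w) * cf g (drop i w) = 0"
    proof (cases "i < m")
      case True with i assms(1) show ?thesis by (simp add: vord_def)
    next
      case False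
      with w i have "length (drop i w) < n" by simp
      with assms(2) show ?thesis by (simp add: vord_def)
    qed
  qed
qed

lemma vord_0 [simp]: "vord 0 f" by (simp add: vord_def)
lemma vord_ncc: "vord n f \<Longrightarrow> vord n (ncc c * f)" by (simp add: vord_def)
lemma vord_power: "vord 1 f \<Longrightarrow> vord n (f ^ n)"
proof (induction n)
  case (Suc n) then show ?case using vord_mult[of 1 f n "f ^ n"] by simp
qed simp

text \<open>Cutting off at the length of the word loses nothing for families whose
  \<open>n\<close>-th member has order at least \<open>n\<close>, so infinite sums become finite
  sums of coefficients.\<close>

definition ncsum :: "(nat \<Rightarrow> 'k::field_char_0 ncps) \<Rightarrow> 'k ncps" where
  "ncsum \<phi> = NC (\<lambda>w. \<Sum>n\<le>length w. cf (\<phi> n) w)"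

lemma cf_ncsum: assumes "\<And>n. vord n (\<phi> n)" "length w \<le> N"
  shows "cf (ncsum \<phi>) w = (\<Sum>n\<le>N. cf (\<phi> n) w)"
  unfolding ncsum_def cf_NC
  by (rule sum.mono_neutral_left) (use assms in \<open>auto simp: vord_def\<close>)

lemma cf_ncsum_length: "cf (ncsum \<phi>) w = (\<Sum>n\<le>length w. cf (\<phi> n) w)"
  by (simp add: ncsum_def)

lemma ncsum_cong: "(\<And>n. \<phi> n = \<psi> n) \<Longrightarrow> ncsum \<phi> = ncsum \<psi>"
  by (simp add: ncsum_def)

lemma cf_mult_cong: assumes "\<And>u. length u \<le> length w \<Longrightarrow> cf f u = cf f' u"
    "\<And>u. length u \<le> length w \<Longrightarrow> cf g u = cf g' u"
  shows "cf (f * g) w = cf (f' * g') w"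
  unfolding cf_mult by (rule sum.cong) (auto simp: assms)

lemma ncsum_mult:
  assumes "\<And>n. vord n (\<phi> n)" "\<And>n. vord n (\<psi> n)"
  shows "ncsum \<phi> * ncsum \<psi> = ncsum (\<lambda>n. \<Sum>k\<le>n. \<phi> k * \<psi> (n - k))"
proof (rule ncps_eqI)
  fix w :: "bool list"
  let ?N = "length w"
  have v: "cf (\<phi> i * \<psi> j) w = 0" if "\<not> i + j \<le> ?N" for i j
    using vord_mult[OF assms(1)[of i] assms(2)[of j]] that by (simp add: vord_def)
  have "cf (ncsum \<phi> * ncsum \<psi>) w = cf ((\<Sum>i\<le>?N. \<phi> i) * (\<Sum>j\<le>?N. \<psi> j)) w"
    by (rule cf_mult_cong) (simp_all add: cf_sum cf_ncsum assms)
  also have "\<dots> = (\<Sum>(i,j)\<in>{..?N} \<times> {..?N}. cf (\<phi> i * \<psi> j) w)"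
    by (simp add: sum_product cf_sum sum.cartesian_product case_prod_unfold)
  also have "\<dots> = (\<Sum>(i,j)\<in>{(i,j). i + j \<le> ?N}. cf (\<phi> i * \<psi> j) w)"
    by (rule sum.mono_neutral_right) (auto intro!: v)
  also have "\<dots> = (\<Sum>k\<le>?N. \<Sum>i\<le>k. cf (\<phi> i * \<psi> (k - i)) w)"
    by (rule sum.triangle_reindex_eq)
  finally show "cf (ncsum \<phi> * ncsum \<psi>) w = cf (ncsum (\<lambda>n. \<Sum>k\<le>n. \<phi> k * \<psi> (n - k))) w"
    by (simp add: cf_ncsum_length cf_sum)
qed

lemma ncsum_mult_right: assumes "\<And>n. vord n (\<phi> n)" shows "ncsum \<phi> * g = ncsum (\<lambda>n. \<phi> n * g)"
proof (rule ncps_eqI)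
  fix w :: "bool list"
  have "cf (ncsum \<phi> * g) w = cf ((\<Sum>i\<le>length w. \<phi> i) * g) w"
    by (rule cf_mult_cong) (simp_all add: cf_sum cf_ncsum assms)
  then show "cf (ncsum \<phi> * g) w = cf (ncsum (\<lambda>n. \<phi> n * g)) w"
    by (simp add: sum_distrib_right cf_sum cf_ncsum_length)
qed

subsection \<open>Letters, exponentials and the right-nested bracket map\<close>

definition letter :: "bool \<Rightarrow> 'k::field_char_0 ncps" where
  "letter a = NC (\<lambda>w. if w = [a] then 1 else 0)"

lemma cf_letter: "cf (letter a) w = (if w = [a] then 1 else 0)" by (simp add: letter_def)

lemma vord_letter: "vord 1 (letter a)" by (auto simp: vord_def cf_letter)

lemma cf_letter_mult_Cons [simp]: "cf (letter a * f) (b # w) = (if a = b then cf f w else 0)"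
proof -
  have "NC (\<lambda>u. cf (letter a) (b # u)) = ncc (if a = b then 1 else 0 :: 'a)"
    by (rule ncps_eqI) (auto simp: cf_letter cf_ncc)
  then show ?thesis by (simp add: cf_mult_Cons cf_letter)
qed

lemma cf_mult_letter_snoc [simp]: "cf (f * letter a :: 'k::field_char_0 ncps) (w @ [b]) = (if a = b then cf f w else 0)"
proof -
  have 1: "cf (letter a) (drop i (w @ [b])) = (if i = length w \<and> a = b then 1 else (0 :: 'k))"
    if "i \<le> length (w @ [b])" for i
  proof (cases "i \<le> length w")
    case True
    then have "drop i (w @ [b]) = [a] \<longleftrightarrow> i = length w \<and> a = b"
      by (auto simp: append_eq_Cons_conv)
    then show ?thesis by (simp add: cf_letter)
  qed (use that in \<open>auto simp: cf_letter\<close>)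
  have "cf (f * letter a) (w @ [b]) = (\<Sum>i\<le>length (w @ [b]). if i = length w then (if a = b then cf f w else 0) else 0)"
    unfolding cf_mult by (rule sum.cong) (simp, subst 1, auto)
  then show ?thesis by simp
qed

abbreviation ncomm :: "'a \<Rightarrow> 'a \<Rightarrow> 'a::ring_1" where "ncomm x y \<equiv> x * y - y * x"

definition ncr :: "bool list \<Rightarrow> 'k::field_char_0 ncps" where
  "ncr w = right_nested ncomm (map letter w)"

lemma ncr_Nil [simp]: "ncr [] = 0" by (simp add: ncr_def)
lemma ncr_single [simp]: "ncr [a] = letter a" by (simp add: ncr_def)
lemma ncr_Cons: "w \<noteq> [] \<Longrightarrow> ncr (a # w) = letter a * ncr w - ncr w * letter a"
  by (cases w) (simp_all add: ncr_def)

lemma ncr_hom: "length u \<noteq> length w \<Longrightarrow> cf (ncr w :: 'k::field_char_0 ncps) u = 0"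
proof (induction w arbitrary: u)
  case (Cons a w)
  show ?case
  proof (cases "w = []")
    case True with Cons show ?thesis by (auto simp: cf_letter)
  next
    case False
    have "cf (letter a * ncr w :: 'k ncps) u = 0"
      using Cons.IH[of "tl u"] Cons.prems by (cases u) (auto simp: cf_letter)
    moreover have "cf (ncr w * letter a :: 'k ncps) u = 0"
      using Cons.IH[of "butlast u"] Cons.prems by (cases u rule: rev_cases) (auto simp: cf_letter)
    ultimately show ?thesis using False by (simp add: ncr_Cons)
  qed
qed simp

abbreviation words :: "nat \<Rightarrow> bool list set" where "words n \<equiv> {w. length w = n}"

lemma finite_words [simp]: "finite (words n)"
  using finite_lists_length_eq[of "UNIV :: bool set" n] by simp

lemma sum_words_Suc: "(\<Sum>w\<in>words (Suc n). f w) = (\<Sum>a\<in>UNIV. \<Sum>w\<in>words n. f (a # w))"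
proof -
  have "(\<Sum>w\<in>words (Suc n). f w) = (\<Sum>p\<in>UNIV \<times> words n. f (fst p # snd p))"
    by (rule sum.reindex_bij_witness[of _ "\<lambda>p. fst p # snd p" "\<lambda>w. (hd w, tl w)"])
      (auto simp: length_Suc_conv)
  then show ?thesis by (simp add: sum.cartesian_product case_prod_unfold)
qed

text \<open>The linear extension of \<open>ncr\<close> from words to series. Since
  \<open>ncr w\<close> is homogeneous of the length of \<open>w\<close> (\<open>ncr_hom\<close>),
  only words as long as \<open>u\<close> can contribute at \<open>u\<close>, and the sum is
  finite.\<close>

definition rhat :: "'k::field_char_0 ncps \<Rightarrow> 'k ncps" where
  "rhat f = NC (\<lambda>u. \<Sum>w\<in>words (length u). cf f w * cf (ncr w) u)"

lemma cf_rhat: "cf (rhat f) u = (\<Sum>w\<in>words (length u). cf f w * cf (ncr w) u)"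
  by (simp add: rhat_def)

lemma cf_rhat_Nil [simp]: "cf (rhat f) [] = 0" by (simp add: cf_rhat)
lemma rhat_add: "rhat (f + g) = rhat f + rhat g"
  by (rule ncps_eqI) (simp add: cf_rhat algebra_simps sum.distrib)
lemma rhat_diff: "rhat (f - g) = rhat f - rhat g"
  by (rule ncps_eqI) (simp add: cf_rhat algebra_simps sum_subtractf)
lemma rhat_ncc: "rhat (ncc c * f) = ncc c * rhat f"
  by (rule ncps_eqI) (simp add: cf_rhat algebra_simps sum_distrib_left)
lemma vord_rhat: "vord n f \<Longrightarrow> vord n (rhat f)"
  by (simp add: vord_def cf_rhat)
lemma rhat_ncsum: "rhat (ncsum \<phi>) = ncsum (\<lambda>n. rhat (\<phi> n))"
proof (rule ncps_eqI)
  fix u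
  have "cf (rhat (ncsum \<phi>)) u = (\<Sum>w\<in>words (length u). \<Sum>n\<le>length u. cf (\<phi> n) w * cf (ncr w) u)"
    unfolding cf_rhat by (rule sum.cong) (auto simp: cf_ncsum_length sum_distrib_right)
  also have "\<dots> = cf (ncsum (\<lambda>n. rhat (\<phi> n))) u"
    unfolding cf_ncsum_length cf_rhat by (rule sum.swap)
  finally show "cf (rhat (ncsum \<phi>)) u = cf (ncsum (\<lambda>n. rhat (\<phi> n))) u" .
qed

text \<open>This is the recursion for nested brackets. A constant term has to be excluded because
  \<open>ncr [a]\<close> is the letter itself, not its commutator with
  \<open>ncr [] = 0\<close>.\<close>

lemma rhat_letter_mult:
  assumes "cf g [] = 0"
  shows "rhat (letter a * g) = letter a * rhat g - rhat g * letter a"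
proof (rule ncps_eqI)
  fix u
  show "cf (rhat (letter a * g)) u = cf (letter a * rhat g - rhat g * letter a) u"
  proof (cases u)
    case Nil then show ?thesis by (simp add: cf_letter)
  next
    case (Cons b v)
    \<comment> \<open>Left multiplication by a letter is read off at the first letter of
      \<open>u\<close>, right multiplication at the last one, so \<open>u\<close> is split at both
      ends.\<close>
    obtain v' b' where u': "u = v' @ [b']" using Cons by (metis list.distinct(1) rev_exhaust)
    have l: "length v' = length v" using Cons u' by (metis length_Cons length_append_singleton nat.inject)
    have "cf (rhat (letter a * g)) u = (\<Sum>c\<in>UNIV. \<Sum>w\<in>words (length v). cf (letter a * g) (c # w) * cf (ncr (c # w)) u)"
      by (simp only: cf_rhat Cons length_Cons sum_words_Suc)
    also have "\<dots> = (\<Sum>c\<in>UNIV. if a = c then \<Sum>w\<in>words (length v). cf g w * cf (ncr (a # w)) u else 0)"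
      by (rule sum.cong) auto
    also have "\<dots> = (\<Sum>w\<in>words (length v). cf g w * cf (ncr (a # w)) u)" by simp
    also have "\<dots> = (\<Sum>w\<in>words (length v). cf g w * (cf (letter a * ncr w) u - cf (ncr w * letter a) u))"
    proof (rule sum.cong)
      fix w show "cf g w * cf (ncr (a # w)) u = cf g w * (cf (letter a * ncr w) u - cf (ncr w * letter a) u)"
        using assms by (cases "w = []") (simp_all add: ncr_Cons)
    qed simp
    also have "\<dots> = (\<Sum>w\<in>words (length v). cf g w * cf (letter a * ncr w) u)
        - (\<Sum>w\<in>words (length v'). cf g w * cf (ncr w * letter a) u)"
      by (simp add: right_diff_distrib sum_subtractf l)
    also have "(\<Sum>w\<in>words (length v). cf g w * cf (letter a * ncr w) u) = cf (letter a * rhat g) u"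
      by (simp add: Cons cf_rhat)
    also have "(\<Sum>w\<in>words (length v'). cf g w * cf (ncr w * letter a) u) = cf (rhat g * letter a) u"
      by (simp add: u' cf_rhat)
    finally show ?thesis by simp
  qed
qed

definition ncexp :: "bool \<Rightarrow> 'k::field_char_0 ncps" where
  "ncexp a = ncsum (\<lambda>n. ncc (1 / fact n) * letter a ^ n)"

lemma cf_letter_power: "cf (letter a ^ n) w = (if w = replicate n a then 1 else 0)"
proof (induction n arbitrary: w)
  case (Suc n) then show ?case by (cases w) (auto simp: cf_letter)
qed (simp add: cf_1)

lemma cf_ncexp: "cf (ncexp a) w = (if w = replicate (length w) a then 1 / fact (length w) else 0)"
proof -
  have "cf (ncexp a) w = (\<Sum>n\<le>length w. if n = length w then (if w = replicate (length w) a then 1 / fact (length w) else 0) else 0)"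
    unfolding ncexp_def cf_ncsum_length by (rule sum.cong) (auto simp: cf_letter_power)
  then show ?thesis by simp
qed

lemma vord_letter_power: "vord n (ncc c * letter a ^ n)"
  by (intro vord_ncc vord_power vord_letter)

text \<open>Left multiplication by \<open>x\<close> is the sum of two commuting operators, right
  multiplication by \<open>x\<close> and the commutator with \<open>x\<close>; this is the binomial
  theorem for them, with \<open>A k\<close> the \<open>k\<close>-fold commutator.\<close>

lemma power_mult_ad_binomial:
  fixes x :: "'a::ring_1"
  assumes "\<And>k. A (Suc k) = x * A k - A k * x"
  shows "x ^ n * A m = (\<Sum>k\<le>n. of_nat (n choose k) * (A (m + k) * x ^ (n - k)))"
proof (induction n arbitrary: m)
  case (Suc n)
  have "x ^ Suc n * A m = x ^ n * A (Suc m) + x ^ n * A m * x"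
    by (simp add: assms power_Suc2 algebra_simps del: power_Suc)
  also have "x ^ n * A (Suc m) = (\<Sum>k\<le>n. of_nat (n choose k) * (A (m + Suc k) * x ^ (Suc n - Suc k)))"
    by (simp add: Suc)
  also have "x ^ n * A m * x = (\<Sum>k\<le>n. of_nat (n choose k) * (A (m + k) * x ^ (Suc n - k)))"
    unfolding Suc sum_distrib_right
    by (rule sum.cong) (simp_all add: Suc_diff_le power_Suc2 mult.assoc del: power_Suc)
  also have "\<dots> = (\<Sum>k\<le>Suc n. of_nat (n choose k) * (A (m + k) * x ^ (Suc n - k)))"
    by (simp add: binomial_eq_0)
  also have "\<dots> = A m * x ^ Suc n + (\<Sum>k\<le>n. of_nat (n choose Suc k) * (A (m + Suc k) * x ^ (Suc n - Suc k)))"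
    by (simp only: sum.atMost_Suc_shift) simp
  finally show ?case
    by (simp only: sum.atMost_Suc_shift binomial_Suc_Suc of_nat_add distrib_right sum.distrib) (simp add: algebra_simps)
qed simp

text \<open>By \<open>rhat_letter_mult\<close> the exponential of a letter becomes the exponential
  of its adjoint action, that is, conjugation. Multiplying by \<open>ncexp a\<close> on the right
  avoids the inverse series.\<close>

lemma rhat_ncexp_mult:
  assumes "cf g [] = 0"
  shows "rhat (ncexp a * g) * ncexp a = ncexp a * rhat g"
proof -
  let ?x = "letter a :: 'a ncps"
  define A where "A k = rhat (?x ^ k * g)" for k
  have A: "A (Suc k) = ?x * A k - A k * ?x" for k
    using rhat_letter_mult[of "?x ^ k * g" a] assms by (simp add: A_def mult.assoc)
  have vA: "vord n (ncc c * A n)" for n c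
    unfolding A_def using vord_mult[OF vord_power[OF vord_letter] vord_0, of n a g]
    by (intro vord_ncc vord_rhat) simp
  have "rhat (ncexp a * g) = ncsum (\<lambda>n. ncc (1 / fact n) * A n)"
    unfolding ncexp_def
    by (subst ncsum_mult_right) (auto simp: vord_letter_power rhat_ncsum rhat_ncc A_def mult.assoc)
  then have "rhat (ncexp a * g) * ncexp a
      = ncsum (\<lambda>n. \<Sum>k\<le>n. (ncc (1 / fact k) * A k) * (ncc (1 / fact (n - k)) * ?x ^ (n - k)))"
    unfolding ncexp_def by (simp add: ncsum_mult vord_letter_power vA)
  also have "\<dots> = ncsum (\<lambda>n. ncc (1 / fact n) * (?x ^ n * A 0))"
  proof (rule ncsum_cong)
    fix n
    have "ncc (1 / fact k) * A k * (ncc (1 / fact (n - k)) * ?x ^ (n - k))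
        = ncc (1 / fact n) * (of_nat (n choose k) * (A k * ?x ^ (n - k)))" if "k \<le> n" for k
      unfolding ncc_mult_shuffle ncc_of_nat[symmetric] ncc_mult_ncc
      using that by (simp add: binomial_fact)
    then show "(\<Sum>k\<le>n. (ncc (1 / fact k) * A k) * (ncc (1 / fact (n - k)) * ?x ^ (n - k)))
        = ncc (1 / fact n) * (?x ^ n * A 0)"
      unfolding power_mult_ad_binomial[of A, OF A] by (simp add: sum_distrib_left)
  qed
  also have "\<dots> = ncexp a * A 0"
    unfolding ncexp_def by (simp add: ncsum_mult_right vord_letter_power mult.assoc)
  finally show ?thesis by (simp add: A_def)
qed

subsection \<open>The logarithm of a product of two exponentials\<close>

definition ncW :: "'k::field_char_0 ncps" where "ncW = ncexp True * ncexp False"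
definition ncV :: "'k::field_char_0 ncps" where "ncV = ncW - 1"

lemma cf_ncW_Nil: "cf ncW [] = 1" by (simp add: ncW_def cf_ncexp)

lemma vord_ncV: "vord 1 ncV"
  by (simp add: vord_def ncV_def cf_ncW_Nil cf_1)

lemma cf_ncV_Nil [simp]: "cf ncV [] = 0" by (simp add: ncV_def cf_ncW_Nil cf_1)

text \<open>The degree derivation. The aim is that \<open>rhat\<close> and \<open>euler\<close>
  agree on the logarithm \<open>ncZ\<close>.\<close>

definition euler :: "'k::field_char_0 ncps \<Rightarrow> 'k ncps" where
  "euler f = NC (\<lambda>w. of_nat (length w) * cf f w)"

lemma cf_euler: "cf (euler f) w = of_nat (length w) * cf f w" by (simp add: euler_def)

lemma euler_diff: "euler (f - g) = euler f - euler g"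
  by (rule ncps_eqI) (simp add: cf_euler algebra_simps)

lemma euler_1: "euler 1 = 0"
  by (rule ncps_eqI) (simp add: cf_euler cf_1)

lemma euler_ncc: "euler (ncc c * f) = ncc c * euler f"
  by (rule ncps_eqI) (simp add: cf_euler algebra_simps)

lemma euler_mult: "euler (f * g) = euler f * g + f * euler g"
proof (rule ncps_eqI)
  fix w
  show "cf (euler (f * g)) w = cf (euler f * g + f * euler g) w"
    unfolding cf_euler cf_add cf_mult sum_distrib_left sum.distrib[symmetric]
  proof (rule sum.cong)
    fix i assume "i \<in> {..length w}"
    then have "of_nat (length w) = of_nat (length (take i w)) + (of_nat (length (drop i w)) :: 'a)"
      by (simp flip: of_nat_add)
    then show "of_nat (length w) * (cf f (take i w) * cf g (drop i w)) =
         of_nat (length (take i w)) * cf f (take i w) * cf g (drop i w) +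
         cf f (take i w) * (of_nat (length (drop i w)) * cf g (drop i w))"
      by (simp only: algebra_simps)
  qed simp
qed

lemma euler_ncsum: "euler (ncsum \<phi>) = ncsum (\<lambda>n. euler (\<phi> n))"
  by (rule ncps_eqI) (simp add: cf_euler cf_ncsum_length sum_distrib_left)

lemma euler_ncexp: "euler (ncexp a) = letter a * ncexp a"
proof (rule ncps_eqI)
  fix w
  show "cf (euler (ncexp a)) w = cf (letter a * ncexp a) w"
  proof (cases w)
    case Nil then show ?thesis by (simp add: cf_euler cf_letter)
  next
    case (Cons b v)
    have "of_nat (Suc (length v)) \<noteq> (0 :: 'a)" by (rule of_nat_neq_0)
    with Cons show ?thesis by (auto simp add: cf_euler cf_ncexp simp del: of_nat_Suc)
  qed
qed

lemma rhat_1: "rhat 1 = 0"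
  by (rule ncps_eqI) (auto simp: cf_rhat cf_1 intro!: sum.neutral)

lemma rhat_letter: "rhat (letter a) = letter a"
  by (rule ncps_eqI) (auto simp: cf_rhat cf_letter ncr_hom if_distrib[of "\<lambda>x. x * _"] cong: if_cong)

lemma rhat_letter_power: "rhat (letter a ^ n :: 'k::field_char_0 ncps) = (if n = 1 then letter a else 0)"
proof (induction n)
  case (Suc n)
  show ?case
  proof (cases "n = 0")
    case False
    then have "cf (letter a ^ n :: 'k ncps) [] = 0" by (simp add: cf_letter_power)
    from rhat_letter_mult[OF this] Suc False show ?thesis by auto
  qed (simp add: rhat_letter)
qed (simp add: rhat_1)

lemma rhat_ncexp: "rhat (ncexp a) = letter a"
proof -
  have "rhat (ncexp a) = ncsum (\<lambda>n. if n = 1 then letter a else 0)"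
    unfolding ncexp_def rhat_ncsum by (rule ncsum_cong) (simp add: rhat_ncc rhat_letter_power, auto intro: ncps_eqI)
  also have "\<dots> = letter a"
    by (rule ncps_eqI) (auto simp: cf_ncsum_length cf_letter if_distrib[of "\<lambda>x. cf x _"] cong: if_cong)
  finally show ?thesis .
qed

lemma rhat_ncW_mult: assumes "cf g [] = 0" shows "rhat (ncW * g) * ncW = ncW * rhat g"
proof -
  have "rhat (ncW * g) * ncW = rhat (ncexp True * (ncexp False * g)) * ncexp True * ncexp False"
    by (simp add: ncW_def mult.assoc)
  also have "\<dots> = ncexp True * (rhat (ncexp False * g) * ncexp False)"
    using assms by (simp add: rhat_ncexp_mult mult.assoc)
  also have "\<dots> = ncW * rhat g"
    using assms by (simp add: rhat_ncexp_mult ncW_def mult.assoc)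
  finally show ?thesis .
qed

text \<open>With the exponentials \<open>X\<close>, \<open>Y\<close> of the letters
  \<open>x\<close>, \<open>y\<close>, conjugation gives \<open>X y Y + x X Y\<close>, which is what
  the Leibniz rule gives for the degree derivation of \<open>X Y\<close>.\<close>

lemma rhat_ncV: "rhat ncV * ncW = euler ncV"
proof -
  let ?X = "ncexp True :: 'a ncps" and ?Y = "ncexp False :: 'a ncps"
  \<comment> \<open>Splitting off \<open>?X\<close> leaves the factor \<open>?Y - 1\<close>, which
    has no constant term, as \<open>rhat_ncexp_mult\<close> requires.\<close>
  have "rhat ncV = rhat (?X * (?Y - 1)) + rhat ?X"
    by (simp add: ncV_def ncW_def rhat_diff rhat_1 algebra_simps flip: rhat_add)
  then have "rhat ncV * ncW = rhat (?X * (?Y - 1)) * ?X * ?Y + letter True * ncW"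
    by (simp add: ncW_def algebra_simps rhat_ncexp)
  also have "rhat (?X * (?Y - 1)) * ?X = ?X * letter False"
    by (subst rhat_ncexp_mult) (simp_all add: cf_ncexp cf_1 rhat_diff rhat_1 rhat_ncexp)
  finally show ?thesis
    by (simp add: ncV_def ncW_def euler_diff euler_1 euler_mult euler_ncexp mult.assoc)
qed

text \<open>Under \<open>rhat\<close>, a further factor \<open>ncV\<close> thus turns into the
  commutator with \<open>ncV\<close> followed by division by \<open>ncW\<close> on the
  right.\<close>

lemma rhat_ncV_mult: assumes "cf g [] = 0"
  shows "rhat (ncV * g) * ncW = ncV * rhat g - rhat g * ncV"
proof -
  have "rhat (ncV * g) = rhat (ncW * g) - rhat g"
    by (simp add: ncV_def algebra_simps rhat_diff)
  then show ?thesis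
    using rhat_ncW_mult[OF assms] by (simp add: left_diff_distrib) (simp add: ncV_def algebra_simps)
qed

text \<open>The constant term of \<open>ncW\<close> is 1, so the coefficients of a series
  annihilated by \<open>ncW\<close> vanish one length after the other.\<close>

lemma mult_ncW_cancel: assumes "f * ncW = g * ncW" shows "f = g"
proof -
  define h where "h = f - g"
  have h: "h * ncW = 0" using assms by (simp add: h_def algebra_simps)
  have "cf h w = 0" for w
  proof (induction "length w" arbitrary: w rule: less_induct)
    case less
    have "0 = (\<Sum>i\<le>length w. cf h (take i w) * cf ncW (drop i w))"
      using h by (simp flip: cf_mult)
    also have "\<dots> = (\<Sum>i\<le>length w. if i = length w then cf h w else 0)"
      by (rule sum.cong) (auto simp: cf_ncW_Nil less)
    finally show ?case by simp
  qed
  then have "h = 0" by (intro ncps_eqI) simp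
  then show ?thesis by (simp add: h_def)
qed

text \<open>
  The operators of left and right multiplication by \<open>ncV\<close> commute; \<open>bis k\<close> is the power series
  with coefficients \<open>k\<close> in these two operators, applied to \<open>euler ncV\<close>.
\<close>

definition bis1 :: "nat \<Rightarrow> nat \<Rightarrow> 'k::field_char_0 ncps" where
  "bis1 i j = ncV ^ i * euler ncV * ncV ^ j"

definition bis :: "(nat \<Rightarrow> nat \<Rightarrow> 'k) \<Rightarrow> 'k::field_char_0 ncps" where
  "bis k = NC (\<lambda>w. \<Sum>i\<le>length w. \<Sum>j\<le>length w. k i j * cf (bis1 i j) w)"

lemma vord_bis1: "vord (i + j + 1) (bis1 i j)"
proof -
  have "vord 1 (euler ncV)" by (simp add: vord_def cf_euler)
  from vord_mult[OF vord_mult[OF vord_power[OF vord_ncV] this] vord_power[OF vord_ncV], of i j]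
  show ?thesis by (simp add: bis1_def add_ac)
qed

lemma cf_bis1_eq_0: "length w \<le> i + j \<Longrightarrow> cf (bis1 i j :: 'k::field_char_0 ncps) w = 0"
  using vord_bis1[of i j, where 'a = 'k] by (simp add: vord_def)

lemma cf_bis:
  assumes "length w \<le> N" "length w \<le> M"
  shows "cf (bis k) w = (\<Sum>i\<le>N. \<Sum>j\<le>M. k i j * cf (bis1 i j) w)"
proof -
  have "(\<Sum>j\<le>M. k i j * cf (bis1 i j) w) = (\<Sum>j\<le>length w. k i j * cf (bis1 i j) w)" for i
    by (rule sum.mono_neutral_right) (use assms in \<open>auto simp: cf_bis1_eq_0\<close>)
  then have "(\<Sum>i\<le>N. \<Sum>j\<le>M. k i j * cf (bis1 i j) w) = (\<Sum>i\<le>N. \<Sum>j\<le>length w. k i j * cf (bis1 i j) w)"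
    by simp
  also have "\<dots> = (\<Sum>i\<le>length w. \<Sum>j\<le>length w. k i j * cf (bis1 i j) w)"
    by (rule sum.mono_neutral_right) (use assms in \<open>auto simp: cf_bis1_eq_0 intro!: sum.neutral\<close>)
  finally show ?thesis by (simp add: bis_def)
qed

lemma cf_mult_bis:
  "cf (ncV * bis k) w = (\<Sum>i\<le>length w. \<Sum>j\<le>length w. k i j * cf (bis1 (Suc i) j) w)"
  "cf (bis k * ncV) w = (\<Sum>i\<le>length w. \<Sum>j\<le>length w. k i j * cf (bis1 i (Suc j)) w)"
proof -
  let ?b = "\<Sum>i\<le>length w. \<Sum>j\<le>length w. ncc (k i j) * bis1 i j"
  have b: "cf (bis k) u = cf ?b u" if "length u \<le> length w" for u
    using that by (simp add: cf_sum cf_bis)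
  have "cf (ncV * bis k) w = cf (ncV * ?b) w" by (rule cf_mult_cong) (auto simp: b)
  then show "cf (ncV * bis k) w = (\<Sum>i\<le>length w. \<Sum>j\<le>length w. k i j * cf (bis1 (Suc i) j) w)"
    by (simp add: sum_distrib_left mult_ncc_left cf_sum) (simp add: bis1_def mult.assoc)
  have "cf (bis k * ncV) w = cf (?b * ncV) w" by (rule cf_mult_cong) (auto simp: b)
  then show "cf (bis k * ncV) w = (\<Sum>i\<le>length w. \<Sum>j\<le>length w. k i j * cf (bis1 i (Suc j)) w)"
    by (simp add: sum_distrib_right mult.assoc cf_sum) (simp add: bis1_def mult.assoc power_commutes)
qed

lemma ncV_mult_bis: "ncV * bis k = bis (\<lambda>i j. if i = 0 then 0 else k (i - 1) j)"
  by (rule ncps_eqI, subst cf_mult_bis, subst cf_bis[of _ "Suc (length _)" "length _"])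
    (simp_all add: sum.atMost_Suc_shift del: sum.atMost_Suc)

lemma bis_mult_ncV: "bis k * ncV = bis (\<lambda>i j. if j = 0 then 0 else k i (j - 1))"
  by (rule ncps_eqI, subst cf_mult_bis, subst cf_bis[of _ "length _" "Suc (length _)"])
    (simp_all add: sum.atMost_Suc_shift del: sum.atMost_Suc)

lemma bis_add: "bis k + bis l = bis (\<lambda>i j. k i j + l i j)"
  by (rule ncps_eqI) (simp add: bis_def sum.distrib algebra_simps)
lemma bis_diff: "bis k - bis l = bis (\<lambda>i j. k i j - l i j)"
  by (rule ncps_eqI) (simp add: bis_def sum_subtractf algebra_simps)

text \<open>The expansion of \<open>(l - r)^m (1 + r)^(-m-1)\<close> for commuting \<open>l\<close> and \<open>r\<close>.\<close>

definition adcoef :: "nat \<Rightarrow> nat \<Rightarrow> nat \<Rightarrow> 'k::field_char_0" where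
  "adcoef m i j = (-1) ^ j * of_nat (m choose i) * of_nat ((i + j) choose m)"

text \<open>Let \<open>l\<close> and \<open>r\<close> be left and right multiplication by
  \<open>ncV\<close>. The first power gives \<open>(1 + r)^(-1)\<close> by \<open>rhat_ncV\<close>,
  and each further one a factor \<open>(l - r) (1 + r)^(-1)\<close> by \<open>rhat_ncV_mult\<close>.
  Compared after multiplication by \<open>ncW\<close>, that is by \<open>1 + r\<close>, the claim is
  a recursion for \<open>adcoef\<close> that follows from Pascal's rule.\<close>

lemma rhat_ncV_power: "rhat (ncV ^ Suc m) = bis (adcoef m :: nat \<Rightarrow> nat \<Rightarrow> 'k::field_char_0)"
proof (induction m)
  case 0
  have "bis (adcoef 0 :: nat \<Rightarrow> nat \<Rightarrow> 'k) * ncW = bis (adcoef 0) + bis (adcoef 0) * ncV"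
    by (simp add: ncV_def algebra_simps)
  also have "\<dots> = bis (\<lambda>i j. if i = 0 \<and> j = 0 then 1 else 0)"
    unfolding bis_mult_ncV bis_add
  proof (rule arg_cong[where f = bis], intro ext)
    fix i j :: nat
    show "adcoef 0 i j + (if j = 0 then 0 else adcoef 0 i (j - 1)) = (if i = 0 \<and> j = 0 then 1 else 0 :: 'k)"
      by (cases j) (auto simp: adcoef_def binomial_eq_0)
  qed
  also have "\<dots> = euler ncV"
  proof (rule ncps_eqI)
    fix w
    have "(\<Sum>j\<le>n. (if i = 0 \<and> j = 0 then 1 else 0) * c j) = (if i = 0 then c 0 else 0)" for c :: "nat \<Rightarrow> 'k" and i n :: nat
      by (simp add: if_distrib[of "\<lambda>x. x * _"] cong: if_cong)
    then show "cf (bis (\<lambda>i j. if i = 0 \<and> j = 0 then 1 else 0)) w = (cf (euler ncV) w :: 'k)"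
      by (simp add: bis_def) (simp add: bis1_def)
  qed
  finally show ?case using mult_ncW_cancel rhat_ncV by (metis power_one_right One_nat_def)
next
  case (Suc m)
  have "bis (adcoef (Suc m) :: nat \<Rightarrow> nat \<Rightarrow> 'k) * ncW = bis (adcoef (Suc m)) + bis (adcoef (Suc m)) * ncV"
    by (simp add: ncV_def algebra_simps)
  also have "\<dots> = ncV * bis (adcoef m) - bis (adcoef m) * ncV"
    unfolding ncV_mult_bis bis_mult_ncV bis_add bis_diff
  proof (rule arg_cong[where f = bis], intro ext)
    fix i j :: nat
    show "adcoef (Suc m) i j + (if j = 0 then 0 else adcoef (Suc m) i (j - 1)) =
      (if i = 0 then 0 else adcoef m (i - 1) j) - (if j = 0 then 0 else adcoef m i (j - 1) :: 'k)"
    proof (cases j)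
      case 0
      then show ?thesis
        by (cases i; cases "i - 1" m rule: linorder_cases) (auto simp: adcoef_def binomial_eq_0 algebra_simps)
    next
      case (Suc j')
      then show ?thesis
        by (cases i) (simp_all add: adcoef_def algebra_simps)
    qed
  qed
  also have "\<dots> = rhat (ncV ^ Suc (Suc m)) * ncW"
  proof -
    have "cf (ncV ^ Suc m :: 'k ncps) [] = 0" by simp
    from rhat_ncV_mult[OF this] Suc show ?thesis by (simp only: power_Suc[of _ "Suc m"])
  qed
  finally show ?case using mult_ncW_cancel by metis
qed

text \<open>Pascal's rule splits off the same sum for the smaller upper index. The remaining sum is,
  up to a factor, the alternating sum of a full row of binomial coefficients, so it vanishes unless
  \<open>i\<close> is the top index.\<close>

lemma alternating_binomial_product:
  assumes "i \<le> n"
  shows "(\<Sum>m\<le>n. (-1) ^ m * of_nat (Suc n choose Suc m) * of_nat (m choose i)) = ((-1) ^ i :: 'k::field_char_0)"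
  using assms
proof (induction n)
  case (Suc n)
  have "(\<Sum>m\<le>Suc n. (-1) ^ m * of_nat (Suc (Suc n) choose Suc m) * of_nat (m choose i))
    = (\<Sum>m\<le>Suc n. (-1) ^ m * of_nat (Suc n choose m) * of_nat (m choose i)) +
      (\<Sum>m\<le>Suc n. (-1) ^ m * of_nat (Suc n choose Suc m) * of_nat (m choose i) :: 'k)"
    by (subst binomial_Suc_Suc) (simp only: of_nat_add algebra_simps sum.distrib)
  also have "(\<Sum>m\<le>Suc n. (-1) ^ m * of_nat (Suc n choose Suc m) * of_nat (m choose i) :: 'k)
     = (if i \<le> n then (-1) ^ i else 0)"
  proof (cases "i \<le> n")
    case False
    then have "i = Suc n" using Suc.prems by simp
    then show ?thesis by (auto simp: binomial_eq_0 intro!: sum.neutral)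
  qed (use Suc.IH in \<open>simp add: binomial_eq_0\<close>)
  also have "(\<Sum>m\<le>Suc n. (-1) ^ m * of_nat (Suc n choose m) * of_nat (m choose i) :: 'k)
     = (if i \<le> n then 0 else (-1) ^ i)"
  proof -
    have "(\<Sum>m\<le>Suc n. (-1) ^ m * of_nat (Suc n choose m) * of_nat (m choose i) :: 'k)
      = (\<Sum>m\<in>{i..Suc n}. (-1) ^ m * of_nat (Suc n choose m) * of_nat (m choose i))"
      by (rule sum.mono_neutral_right) (auto simp: binomial_eq_0 not_le)
    also have "\<dots> = (\<Sum>m\<in>{i..Suc n}. of_nat (Suc n choose i) * ((-1) ^ m * of_nat ((Suc n - i) choose (m - i))))"
    proof (rule sum.cong)
      fix m assume "m \<in> {i..Suc n}"
      then have "of_nat (Suc n choose m) * of_nat (m choose i) = (of_nat (Suc n choose i) * of_nat (Suc n - i choose (m - i)) :: 'k)"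
        by (simp only: choose_mult atLeastAtMost_iff flip: of_nat_mult)
      then show "(-1) ^ m * of_nat (Suc n choose m) * of_nat (m choose i) = of_nat (Suc n choose i) * ((-1) ^ m * (of_nat (Suc n - i choose (m - i)) :: 'k))"
        by (metis mult.assoc mult.left_commute)
    qed simp
    also have "\<dots> = (\<Sum>m\<le>Suc n - i. of_nat (Suc n choose i) * ((-1) ^ (m + i) * of_nat ((Suc n - i) choose m)))"
      by (rule sum.reindex_bij_witness[of _ "\<lambda>m. m + i" "\<lambda>m. m - i"]) (use Suc.prems in auto)
    also have "\<dots> = of_nat (Suc n choose i) * (-1) ^ i * (\<Sum>m\<le>Suc n - i. (-1) ^ m * of_nat ((Suc n - i) choose m))"
      by (simp add: sum_distrib_left power_add algebra_simps)
    also have "\<dots> = (if i \<le> n then 0 else (-1) ^ i)"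
    proof (cases "i \<le> n")
      case True
      then have "0 < Suc n - i" by simp
      from choose_alternating_sum[OF this, where 'a='k] True show ?thesis by simp
    next
      case False
      then have "i = Suc n" using Suc.prems by simp
      then show ?thesis by simp
    qed
    finally show ?thesis .
  qed
  finally show ?case using Suc.prems by auto
qed simp

text \<open>The coefficient of \<open>l^i r^j\<close> in the identity
  \<open>log (1 + (l - r) / (1 + r)) = log (1 + l) - log (1 + r)\<close>, divided by
  \<open>l - r\<close>.\<close>

lemma adcoef_log:
  assumes "i + j \<le> N"
  shows "(\<Sum>m\<le>N. (-1) ^ m / of_nat (Suc m) * adcoef m i j) = ((-1) ^ (i + j) / of_nat (Suc (i + j)) :: 'k::field_char_0)"
proof -
  let ?n = "i + j"
  have nz: "of_nat (Suc k) \<noteq> (0 :: 'k)" for k by (rule of_nat_neq_0)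
  have "(\<Sum>m\<le>N. (-1) ^ m / of_nat (Suc m) * adcoef m i j)
      = (\<Sum>m\<le>?n. (-1) ^ m / of_nat (Suc m) * adcoef m i j :: 'k)"
    by (rule sum.mono_neutral_right) (use assms in \<open>auto simp: adcoef_def binomial_eq_0\<close>)
  also have "\<dots> = (\<Sum>m\<le>?n. (-1) ^ j / of_nat (Suc ?n) * ((-1) ^ m * of_nat (Suc ?n choose Suc m) * of_nat (m choose i)))"
  proof (rule sum.cong)
    fix m
    have eq: "of_nat (Suc m) * of_nat (Suc ?n choose Suc m) = (of_nat (Suc ?n) * of_nat (?n choose m) :: 'k)"
      by (simp only: Suc_times_binomial flip: of_nat_mult)
    have "(-1) ^ m / of_nat (Suc m) * adcoef m i j
      = (-1) ^ j * (-1) ^ m * of_nat (m choose i) * (of_nat (?n choose m) / of_nat (Suc m) :: 'k)"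
      by (simp add: adcoef_def del: of_nat_Suc)
    also have "of_nat (?n choose m) / of_nat (Suc m) = (of_nat (Suc ?n choose Suc m) / of_nat (Suc ?n) :: 'k)"
      using eq nz[of m] nz[of ?n] by (simp add: divide_simps mult_ac del: of_nat_Suc binomial_Suc_Suc)
    finally show "(-1) ^ m / of_nat (Suc m) * adcoef m i j =
      ((-1) ^ j / of_nat (Suc ?n) * ((-1) ^ m * of_nat (Suc ?n choose Suc m) * of_nat (m choose i)) :: 'k)"
      by (simp del: of_nat_Suc binomial_Suc_Suc)
  qed simp
  also have "\<dots> = (-1) ^ j / of_nat (Suc ?n) * (-1) ^ i"
    by (subst sum_distrib_left[symmetric], subst alternating_binomial_product) auto
  finally show ?thesis by (simp add: power_add mult_ac)
qed

text \<open>Substitution of \<open>ncV\<close> for the variable. It is multiplicative, so identities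
  between ordinary power series can be transferred.\<close>

definition ncphi :: "'k fps \<Rightarrow> 'k::field_char_0 ncps" where
  "ncphi f = ncsum (\<lambda>n. ncc (fps_nth f n) * ncV ^ n)"

definition ncZ :: "'k::field_char_0 ncps" where "ncZ = ncphi (fps_ln 1)"

lemma vord_ncV_power: "vord n (ncc c * ncV ^ n)"
  by (intro vord_ncc vord_power vord_ncV)

lemma ncphi_mult: "ncphi (f * g) = ncphi f * ncphi g"
  unfolding ncphi_def
  by (subst ncsum_mult, rule vord_ncV_power, rule vord_ncV_power, rule ncsum_cong)
    (simp add: ncc_mult_shuffle fps_mult_nth atLeast0AtMost flip: power_add,
     rule ncps_eqI, simp add: cf_sum sum_distrib_right)

lemma ncphi_1: "ncphi 1 = 1"
proof (rule ncps_eqI)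
  fix w
  have "cf (ncphi 1) w = (\<Sum>n\<le>length w. if n = 0 then cf 1 w else (0 :: 'a))"
    unfolding ncphi_def cf_ncsum_length by (rule sum.cong) auto
  then show "cf (ncphi 1) w = (cf 1 w :: 'a)" by simp
qed

lemma ncphi_power: "ncphi (f ^ n) = ncphi f ^ n"
  by (induction n) (simp_all add: ncphi_1 ncphi_mult)

lemma cf_ncphi: "length w \<le> N \<Longrightarrow> cf (ncphi f) w = (\<Sum>n\<le>N. fps_nth f n * cf (ncV ^ n) w)"
  unfolding ncphi_def by (subst cf_ncsum[of _ _ N]) (auto simp: vord_ncV_power)

lemma vord_ncZ: "vord 1 ncZ"
  by (auto simp: vord_def ncZ_def cf_ncphi[of _ 0])

text \<open>Transferred from exp composed with log being \<open>1 + X\<close>. The exponential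
  series may be cut off at \<open>N\<close> since the logarithm has no constant term.\<close>

theorem cf_exp_ncZ:
  assumes "length w \<le> N"
  shows "(\<Sum>j\<le>N. cf (ncZ ^ j) w / fact j) = cf ncW w"
proof -
  let ?ln = "fps_ln 1 :: 'a fps"
  have exp_ln: "fps_exp 1 oo ?ln = 1 + fps_X"
  proof -
    have "(fps_exp 1 - 1) oo ?ln = fps_X"
      by (simp add: fps_ln_fps_exp_inv fps_inv_right)
    then show ?thesis by (simp add: fps_compose_sub_distrib algebra_simps)
  qed
  have lnj: "fps_nth (?ln ^ j) n = 0" if "n < j" for j n
    using that by (intro startsby_zero_power_prefix[rule_format]) auto
  have "(\<Sum>j\<le>N. cf (ncZ ^ j) w / fact j) = (\<Sum>j\<le>N. \<Sum>n\<le>N. fps_nth (?ln ^ j) n / fact j * cf (ncV ^ n) w)"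
    using assms by (simp add: ncZ_def cf_ncphi[of _ N] sum_divide_distrib flip: ncphi_power)
  also have "\<dots> = (\<Sum>n\<le>N. (\<Sum>j\<le>N. fps_nth (?ln ^ j) n / fact j) * cf (ncV ^ n) w)"
    by (subst sum.swap) (simp add: sum_distrib_right)
  also have "\<dots> = (\<Sum>n\<le>N. fps_nth (1 + fps_X) n * cf (ncV ^ n) w)"
  proof (rule sum.cong)
    fix n assume n: "n \<in> {..N}"
    have "(\<Sum>j\<le>N. fps_nth (?ln ^ j) n / fact j) = (\<Sum>j\<le>n. fps_nth (?ln ^ j) n / fact j)"
      by (rule sum.mono_neutral_right) (use n in \<open>auto simp: lnj\<close>)
    also have "\<dots> = fps_nth (fps_exp 1 oo ?ln) n"
      by (simp add: fps_compose_nth atLeast0AtMost)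
    finally show "(\<Sum>j\<le>N. fps_nth (?ln ^ j) n / fact j) * cf (ncV ^ n) w = fps_nth (1 + fps_X) n * cf (ncV ^ n) w"
      by (simp add: exp_ln)
  qed simp
  \<comment> \<open>The additional index makes room for the first power of \<open>ncV\<close> even
    if \<open>N = 0\<close>; the added term has order \<open>Suc N\<close> and does not reach
    \<open>w\<close>.\<close>
  also have "\<dots> = (\<Sum>n\<le>Suc N. fps_nth (1 + fps_X) n * cf (ncV ^ n) w)"
    using assms vord_power[OF vord_ncV, of "Suc N", where 'a='a] by (simp add: vord_def)
  also have "\<dots> = (\<Sum>n\<in>{0,1}. fps_nth (1 + fps_X) n * cf (ncV ^ n) w)"
    by (rule sum.mono_neutral_right) auto
  also have "\<dots> = cf ncW w" by (simp add: ncV_def)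
  finally show ?thesis .
qed

lemma euler_ncV_power: "euler (ncV ^ Suc n :: 'k::field_char_0 ncps) = (\<Sum>i\<le>n. bis1 i (n - i))"
proof (induction n)
  case (Suc n)
  have "euler (ncV ^ Suc (Suc n)) = euler ncV * ncV ^ Suc n + ncV * euler (ncV ^ Suc n :: 'k ncps)"
    by (simp only: power_Suc[of _ "Suc n"] euler_mult)
  also have "\<dots> = bis1 0 (Suc n) + ncV * (\<Sum>i\<le>n. bis1 i (n - i))"
    by (simp only: Suc) (simp add: bis1_def)
  also have "\<dots> = (\<Sum>i\<le>Suc n. bis1 i (Suc n - i))"
    by (simp add: sum.atMost_Suc_shift sum_distrib_left del: sum.atMost_Suc) (simp add: bis1_def mult.assoc)
  finally show ?case .
qed (simp add: bis1_def)

text \<open>Both sides are the double series with coefficients \<open>(-1)^(i+j) / (i+j+1)\<close>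
  at \<open>bis1 i j\<close>: the left one by \<open>adcoef_log\<close>, the right one by the
  Leibniz rule for the powers of \<open>ncV\<close>.\<close>

theorem rhat_ncZ: "rhat ncZ = (euler ncZ :: 'k::field_char_0 ncps)"
proof (rule ncps_eqI)
  fix w :: "bool list"
  let ?N = "length w"
  let ?c = "\<lambda>m. (-1) ^ m / of_nat (Suc m) :: 'k"
  \<comment> \<open>The logarithm series starts at the exponent 1, and the power
    \<open>ncV ^ Suc ?N\<close> vanishes at \<open>w\<close>; so the exponent can be shifted by one
    while the range stays the same.\<close>
  have split: "(\<Sum>n\<le>?N. fps_nth (fps_ln 1) n * cf (h (ncV ^ n)) w) = (\<Sum>m\<le>?N. ?c m * cf (h (ncV ^ Suc m)) w)"
    if "\<And>f. vord (Suc ?N) f \<Longrightarrow> vord (Suc ?N) (h f)" for h :: "'k ncps \<Rightarrow> 'k ncps"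
  proof -
    have "cf (h (ncV ^ Suc ?N)) w = 0"
      using that[OF vord_power[OF vord_ncV]] by (simp add: vord_def)
    then have "(\<Sum>n\<le>?N. fps_nth (fps_ln 1) n * cf (h (ncV ^ n)) w) = (\<Sum>n\<le>Suc ?N. fps_nth (fps_ln 1) n * cf (h (ncV ^ n)) w)"
      by simp
    then show ?thesis
      by (simp add: sum.atMost_Suc_shift fps_ln_nth del: sum.atMost_Suc)
  qed
  have ve: "vord n f \<Longrightarrow> vord n (euler f)" for n and f :: "'k ncps" by (simp add: vord_def cf_euler)
  have "cf (rhat ncZ) w = (\<Sum>m\<le>?N. ?c m * cf (rhat (ncV ^ Suc m)) w)"
    unfolding ncZ_def ncphi_def by (simp only: rhat_ncsum rhat_ncc cf_ncsum_length cf_ncc_mult split[of rhat, OF vord_rhat])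
  also have "\<dots> = (\<Sum>m\<le>?N. \<Sum>i\<le>?N. \<Sum>j\<le>?N. ?c m * adcoef m i j * cf (bis1 i j) w)"
    by (simp only: rhat_ncV_power) (simp add: cf_bis[of w ?N ?N] sum_distrib_left sum_divide_distrib mult.assoc)
  also have "\<dots> = (\<Sum>i\<le>?N. \<Sum>j\<le>?N. (\<Sum>m\<le>?N. ?c m * adcoef m i j) * cf (bis1 i j) w)"
    by (subst sum.swap, rule sum.cong[OF refl], subst sum.swap) (simp add: sum_distrib_right)
  also have "\<dots> = (\<Sum>i\<le>?N. \<Sum>j\<le>?N. ?c (i + j) * cf (bis1 i j) w)"
  proof (intro sum.cong refl)
    fix i j
    show "(\<Sum>m\<le>?N. ?c m * adcoef m i j) * cf (bis1 i j) w = ?c (i + j) * cf (bis1 i j) w"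
      by (cases "i + j \<le> ?N") (simp_all only: adcoef_log, simp add: cf_bis1_eq_0)
  qed
  also have "\<dots> = (\<Sum>(i,j)\<in>{..?N} \<times> {..?N}. ?c (i + j) * cf (bis1 i j) w)"
    by (simp only: sum.cartesian_product)
  also have "\<dots> = (\<Sum>(i,j)\<in>{(i,j). i + j \<le> ?N}. ?c (i + j) * cf (bis1 i j) w)"
  proof (rule sum.mono_neutral_right)
    have "cf (bis1 i j :: 'k ncps) w = 0" if "(i, j) \<notin> {(i, j). i + j \<le> ?N}" for i j
      using that by (intro cf_bis1_eq_0) simp
    then show "\<forall>p\<in>{..?N} \<times> {..?N} - {(i, j). i + j \<le> ?N}. (case p of (i, j) \<Rightarrow> ?c (i + j) * cf (bis1 i j) w) = 0"
      by (metis (no_types, lifting) DiffE case_prod_conv mult_zero_right surj_pair)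
  qed auto
  also have "\<dots> = (\<Sum>m\<le>?N. \<Sum>i\<le>m. ?c (i + (m - i)) * cf (bis1 i (m - i)) w)"
    by (rule sum.triangle_reindex_eq)
  also have "\<dots> = (\<Sum>m\<le>?N. ?c m * cf (euler (ncV ^ Suc m)) w)"
    by (simp only: euler_ncV_power cf_sum sum_distrib_left) (intro sum.cong refl, simp)
  also have "\<dots> = cf (euler ncZ) w"
    unfolding ncZ_def ncphi_def by (simp only: euler_ncsum euler_ncc cf_ncsum_length cf_ncc_mult split[of euler, OF ve])
  finally show "cf (rhat ncZ) w = (cf (euler ncZ) w :: 'k)" .
qed

subsection \<open>Dynkin's coefficients\<close>

definition pword :: "(nat \<times> nat) list \<Rightarrow> bool list" where
  "pword ps = concat (map (\<lambda>(r, s). replicate r True @ replicate s False) ps)"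

definition pieces :: "nat \<Rightarrow> bool list \<Rightarrow> (nat \<times> nat) list set" where
  "pieces m w = {ps. length ps = m \<and> (\<forall>(r, s) \<in> set ps. r + s > 0) \<and> pword ps = w}"

definition pfact :: "(nat \<times> nat) list \<Rightarrow> 'k::field_char_0" where
  "pfact ps = (\<Prod>(r, s)\<leftarrow>ps. fact r * fact s)"

lemma length_pword: "length (pword ps) = (\<Sum>(r, s)\<leftarrow>ps. r + s)"
  by (induction ps) (auto simp: pword_def)

lemma length_le_length_pword: "\<forall>(r, s) \<in> set ps. r + s > 0 \<Longrightarrow> length ps \<le> length (pword ps)"
  by (induction ps) (auto simp: pword_def)

lemma pword_parts_le: "(r, s) \<in> set ps \<Longrightarrow> r + s \<le> length (pword ps)"
  by (induction ps) (auto simp: pword_def)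

lemma finite_pieces: "finite (pieces m w)"
proof (rule finite_subset)
  show "pieces m w \<subseteq> {ps. set ps \<subseteq> {..length w} \<times> {..length w} \<and> length ps = m}"
    using pword_parts_le by (fastforce simp: pieces_def)
qed (rule finite_lists_length_eq, simp)

text \<open>At most one pair: the word determines its two exponents. The empty word has none, which
  matches the missing constant term of \<open>ncV\<close>.\<close>

definition piece :: "bool list \<Rightarrow> (nat \<times> nat) set" where
  "piece t = {(r, s). r + s > 0 \<and> replicate r True @ replicate s False = t}"

lemma finite_piece: "finite (piece t)"
  by (rule finite_subset[of _ "{..length t} \<times> {..length t}"]) (auto simp: piece_def)

lemma cf_ncV: "cf (ncV :: 'k::field_char_0 ncps) t = (\<Sum>(r, s)\<in>piece t. 1 / (fact r * fact s))"
proof (cases "t = []")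
  case True
  then have "piece t = {}" by (auto simp: piece_def)
  with True show ?thesis by simp
next
  case False
  have "cf (ncV :: 'k ncps) t = (\<Sum>i\<le>length t. cf (ncexp True) (take i t) * cf (ncexp False) (drop i t))"
    using False by (simp add: ncV_def cf_1 ncW_def cf_mult)
  also have "\<dots> = (\<Sum>i\<in>{i. i \<le> length t \<and> replicate i True @ replicate (length t - i) False = t}.
      cf (ncexp True) (take i t) * cf (ncexp False) (drop i t))"
  proof (rule sum.mono_neutral_right)
    show "\<forall>i\<in>{..length t} - {i. i \<le> length t \<and> replicate i True @ replicate (length t - i) False = t}.
       cf (ncexp True) (take i t) * cf (ncexp False) (drop i t) = (0 :: 'k)"
      by (auto simp: cf_ncexp min_def) (metis append_take_drop_id)
  qed auto
  also have "\<dots> = (\<Sum>(r, s)\<in>piece t. 1 / (fact r * fact s))"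
  proof (rule sum.reindex_bij_witness[of _ "\<lambda>(r, s). r" "\<lambda>i. (i, length t - i)"])
    fix i assume i: "i \<in> {i. i \<le> length t \<and> replicate i True @ replicate (length t - i) False = t}"
    then have "take i t = replicate i True" "drop i t = replicate (length t - i) False"
      by (auto simp: append_eq_conv_conj dest: sym)
    with i show "(case (i, length t - i) of (r, s) \<Rightarrow> 1 / (fact r * fact s)) =
        (cf (ncexp True) (take i t) * cf (ncexp False) (drop i t) :: 'k)"
      by (simp add: cf_ncexp)
  qed (use False in \<open>auto simp: piece_def\<close>)
  finally show ?thesis .
qed

lemma cf_ncV_power: "cf (ncV ^ m :: 'k::field_char_0 ncps) w = (\<Sum>ps\<in>pieces m w. 1 / pfact ps)"
proof (induction m arbitrary: w)
  case 0
  have "pieces 0 w = (if w = [] then {[]} else {})" by (auto simp: pieces_def pword_def)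
  then show ?case by (simp add: cf_1 pfact_def)
next
  case (Suc m)
  let ?S = "SIGMA i:{..length w}. piece (take i w) \<times> pieces m (drop i w)"
  have "cf (ncV ^ Suc m :: 'k ncps) w = (\<Sum>i\<le>length w. \<Sum>p\<in>piece (take i w). \<Sum>ps\<in>pieces m (drop i w).
      (case p of (r, s) \<Rightarrow> 1 / (fact r * fact s)) * (1 / pfact ps))"
    by (simp only: power_Suc cf_mult cf_ncV Suc sum_product)
  also have "\<dots> = (\<Sum>(i, p, ps)\<in>?S. (case p of (r, s) \<Rightarrow> 1 / (fact r * fact s)) * (1 / pfact ps))"
    by (simp add: sum.cartesian_product sum.Sigma finite_piece finite_pieces case_prod_unfold)
  also have "\<dots> = (\<Sum>ps\<in>pieces (Suc m) w. 1 / pfact ps)"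
  proof (rule sum.reindex_bij_witness[of _ "\<lambda>ps. (fst (hd ps) + snd (hd ps), hd ps, tl ps)" "\<lambda>(i, p, ps). p # ps"])
    fix ps assume "ps \<in> pieces (Suc m) w"
    then obtain r s qs where *: "ps = (r, s) # qs" "length qs = m" "r + s > 0"
      "\<forall>(r, s)\<in>set qs. r + s > 0" "w = replicate r True @ replicate s False @ pword qs"
      by (auto simp: pieces_def length_Suc_conv pword_def)
    have "take (r + s) w = replicate r True @ replicate s False" "drop (r + s) w = pword qs"
      using *(5) by (simp_all only: append_assoc[symmetric]) simp_all
    with * show "(fst (hd ps) + snd (hd ps), hd ps, tl ps) \<in> ?S"
      by (auto simp: piece_def pieces_def)
  next
    fix x assume "x \<in> ?S"
    then obtain i r s ps where *: "x = (i, (r, s), ps)" "i \<le> length w" "r + s > 0"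
      "replicate r True @ replicate s False = take i w" "ps \<in> pieces m (drop i w)"
      by (auto simp: piece_def)
    then have "r + s = i" by (metis length_append length_replicate length_take min.absorb2)
    with * show "(fst (hd (case x of (i, p, ps) \<Rightarrow> p # ps)) + snd (hd (case x of (i, p, ps) \<Rightarrow> p # ps)),
         hd (case x of (i, p, ps) \<Rightarrow> p # ps), tl (case x of (i, p, ps) \<Rightarrow> p # ps)) = x"
      by simp
    have "replicate r True @ replicate s False @ pword ps = w"
      using *(4,5) by (simp add: pieces_def flip: append_assoc)
    with * show "(case x of (i, p, ps) \<Rightarrow> p # ps) \<in> pieces (Suc m) w"
      by (auto simp: pieces_def pword_def)
    show "1 / (pfact (case x of (i, p, ps) \<Rightarrow> p # ps) :: 'k) =
        (case x of (i, p, ps) \<Rightarrow> (case p of (r, s) \<Rightarrow> 1 / (fact r * fact s)) * (1 / pfact ps))"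
      by (simp add: * pfact_def)
  qed (auto simp: pieces_def length_Suc_conv)
  finally show ?case .
qed

text \<open>Division by the length undoes \<open>euler\<close>: by \<open>rhat_ncZ\<close> the
  nested brackets weighted in this way add up to \<open>ncZ\<close>
  (\<open>dynkin_words\<close>).\<close>

definition dynkin :: "bool list \<Rightarrow> 'k::field_char_0" where
  "dynkin w = cf ncZ w / of_nat (length w)"

lemma dynkin_Nil: "dynkin [] = 0" by (simp add: dynkin_def)

text \<open>The link to the sum defining \<open>CH\<close>: expanding the logarithm, the coefficient
  of \<open>ncV ^ m\<close> at a word runs over its factorisations into \<open>m\<close> nonempty
  pieces.\<close>

lemma dynkin_eq:
  shows "(dynkin w :: 'k::field_char_0) = (\<Sum>ps | ps \<noteq> [] \<and> (\<forall>(r, s) \<in> set ps. r + s > 0) \<and> pword ps = w.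
     (-1) ^ (length ps - 1) / of_nat (length ps) / (of_nat (length w) * pfact ps))"
proof -
  have "(cf ncZ w :: 'k) = (\<Sum>m\<le>length w. \<Sum>ps\<in>pieces m w. fps_nth (fps_ln 1) (length ps) / pfact ps)"
    by (simp add: ncZ_def cf_ncphi[of _ "length w"] cf_ncV_power sum_distrib_left) (auto intro!: sum.cong simp: pieces_def)
  also have "\<dots> = (\<Sum>ps\<in>(\<Union>m\<le>length w. pieces m w). fps_nth (fps_ln 1) (length ps) / pfact ps)"
    by (rule sum.UNION_disjoint[symmetric]) (auto simp: finite_pieces, auto simp: pieces_def)
  also have "\<dots> = (\<Sum>ps | ps \<noteq> [] \<and> (\<forall>(r, s) \<in> set ps. r + s > 0) \<and> pword ps = w.
     (-1) ^ (length ps - 1) / of_nat (length ps) / pfact ps)"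
  proof (rule sum.mono_neutral_cong)
    show "finite (\<Union>m\<le>length w. pieces m w)" by (simp add: finite_pieces)
    show "finite {ps. ps \<noteq> [] \<and> (\<forall>(r, s) \<in> set ps. r + s > 0) \<and> pword ps = w}"
      by (rule finite_subset[of _ "\<Union>m\<le>length w. pieces m w"])
        (use length_le_length_pword in \<open>auto simp: finite_pieces, auto simp: pieces_def\<close>)
  qed (use length_le_length_pword in \<open>auto simp: pieces_def fps_ln_nth\<close>)
  finally show ?thesis
    by (simp add: dynkin_def sum_divide_distrib mult_ac)
qed

lemma dynkin_words:
  assumes "length u = n"
  shows "(\<Sum>w\<in>words n. dynkin w * cf (ncr w) u) = (cf ncZ u :: 'k::field_char_0)"
proof (cases "n = 0")
  case True
  then show ?thesis using assms vord_ncZ by (auto simp: vord_def)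
next
  case False
  have "(\<Sum>w\<in>words n. dynkin w * cf (ncr w) u) = (cf (rhat ncZ) u / of_nat n :: 'k)"
    unfolding cf_rhat assms sum_divide_distrib by (rule sum.cong) (auto simp: dynkin_def)
  then show ?thesis using assms False by (simp add: rhat_ncZ cf_euler)
qed

section \<open>Coefficients of insertions and of the symmetric group action\<close>

section \<open>Coefficients of insertions\<close>

subsection \<open>Alternating functions of lists\<close>

definition alt :: "('e list \<Rightarrow> 'k::field_char_0) \<Rightarrow> bool" where
  "alt x \<longleftrightarrow> (\<forall>G \<sigma>. \<sigma> permutes {..<length G} \<longrightarrow> x (permute_list \<sigma> G) = of_int (sign \<sigma>) * x G)"

lemma permute_list_transpose_adjacent:
  "permute_list (Transposition.transpose (length A) (Suc (length A))) (A @ a # b # B) = A @ b # a # B"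
proof (rule nth_equalityI)
  fix i assume "i < length (permute_list (Transposition.transpose (length A) (Suc (length A))) (A @ a # b # B))"
  then show "permute_list (Transposition.transpose (length A) (Suc (length A))) (A @ a # b # B) ! i = (A @ b # a # B) ! i"
    by (simp add: permute_list_nth permutes_swap_id Transposition.transpose_def)
      (auto simp: nth_append nth_Cons' permute_list_def Transposition.transpose_def)
qed simp

lemma alt_swap: assumes "alt x" shows "x (A @ a # b # B) = - x (A @ b # a # B)"
proof -
  let ?t = "Transposition.transpose (length A) (Suc (length A))"
  have "?t permutes {..<length (A @ b # a # B)}" by (intro permutes_swap_id) auto
  with assms have "x (permute_list ?t (A @ b # a # B)) = of_int (sign ?t) * x (A @ b # a # B)"
    unfolding alt_def by blast
  then show ?thesis by (simp only: permute_list_transpose_adjacent sign_swap_id) simp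
qed

lemma swap_move:
  fixes x :: "'e list \<Rightarrow> 'k::field_char_0"
  assumes "\<And>A a b B. x (A @ a # b # B) = - x (A @ b # a # B)"
  shows "x (A @ a # M @ B) = (-1) ^ length M * x (A @ M @ a # B)"
proof (induction M arbitrary: A)
  case (Cons m M)
  have "x (A @ a # (m # M) @ B) = - x ((A @ [m]) @ a # M @ B)" using assms[of A a m] by simp
  then show ?case using Cons[of "A @ [m]"] by simp
qed simp

text \<open>Adjacent swaps suffice: any permutation is a product of transpositions, and each
  transposition is reduced to adjacent swaps.\<close>

lemma altI:
  fixes x :: "'e list \<Rightarrow> 'k::field_char_0"
  assumes "\<And>A a b B. x (A @ a # b # B) = - x (A @ b # a # B)"
  shows "alt x"
  unfolding alt_def
proof (intro allI impI)
  fix G :: "'e list" and \<sigma>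
  assume "\<sigma> permutes {..<length G}"
  then show "x (permute_list \<sigma> G) = of_int (sign \<sigma>) * x G"
  proof (induction "length G" arbitrary: G rule: less_induct)
    case less
    have trans: "x (permute_list (Transposition.transpose i j) K) = - x K"
      if "i < j" "j < length K" for i j and K :: "'e list"
    proof -
      have ij: "i < length K" "Suc i \<le> j" "j < length K" using that by auto
      obtain A a M b B where K: "K = A @ a # M @ b # B" and lA: "length A = i" "length M = j - Suc i"
      proof
        have "K = take i K @ K ! i # drop (Suc i) K" by (rule id_take_nth_drop) (rule ij)
        also have "drop (Suc i) K = take (j - Suc i) (drop (Suc i) K) @ drop j K"
          using ij by (metis add.commute append_take_drop_id drop_drop le_add_diff_inverse2)
        also have "drop j K = K ! j # drop (Suc j) K" using ij by (simp add: Cons_nth_drop_Suc)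
        finally show "K = take i K @ K ! i # take (j - Suc i) (drop (Suc i) K) @ K ! j # drop (Suc j) K" .
      qed (use ij in auto)
      have "permute_list (Transposition.transpose i j) K = A @ b # M @ a # B"
      proof (rule nth_equalityI)
        fix l assume "l < length (permute_list (Transposition.transpose i j) K)"
        then have l': "l < length K" by simp
        have "permute_list (Transposition.transpose i j) K ! l = K ! Transposition.transpose i j l"
          using l' by (simp add: permute_list_def)
        also have "\<dots> = (A @ b # M @ a # B) ! l"
          unfolding K using that lA by (auto simp: Transposition.transpose_def nth_append nth_Cons')
        finally show "permute_list (Transposition.transpose i j) K ! l = (A @ b # M @ a # B) ! l" .
      qed (simp add: K)
      \<comment> \<open>One entry is moved across \<open>M\<close>, the two are swapped, and the
        other entry is moved back across \<open>M\<close>; the two signs from crossing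
        \<open>M\<close> cancel.\<close>
      also have "x (A @ b # M @ a # B) = (-1) ^ length M * x (A @ M @ b # a # B)"
        by (rule swap_move) fact
      also have "x (A @ M @ b # a # B) = - x ((A @ M) @ a # b # B)"
        using assms[of "A @ M" b a B] by (simp only: append_assoc)
      also have "(-1) ^ length M * - x ((A @ M) @ a # b # B) = - x (A @ a # M @ b # B)"
        using swap_move[of x, OF assms, of A a M "b # B"] by simp
      finally show ?thesis using K by simp
    qed
    have "finite {..<length G}" by simp
    from this less.prems show ?case
    proof (induction \<sigma> rule: permutes_rev_induct)
      case id then show ?case by simp
    next
      case (swap i j p)
      have p: "p permutes {..<length G}" by fact
      show ?case
      proof (cases "i = j")
        case True
        with swap show ?thesis by simp
      next
        case False
        have tr: "Transposition.transpose i j permutes {..<length G}" using swap by (intro permutes_swap_id) auto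
        have "x (permute_list (p \<circ> Transposition.transpose i j) G) = x (permute_list (Transposition.transpose i j) (permute_list p G))"
          by (subst permute_list_compose) (use tr in auto)
        also have "\<dots> = - x (permute_list p G)"
        proof (cases "i < j")
          case True then show ?thesis using swap by (intro trans) auto
        next
          case False
          then have "j < i" using \<open>i \<noteq> j\<close> by simp
          then show ?thesis using swap trans[of j i "permute_list p G"] by (simp add: transpose_commute)
        qed
        finally have "x (permute_list (p \<circ> Transposition.transpose i j) G) = - x (permute_list p G)" .
        moreover have "sign (p \<circ> Transposition.transpose i j) = - sign p"
          using p False by (subst sign_compose) (auto simp: sign_swap_id permutation_swap_id intro: permutes_imp_permutation[of "{..<length G}"])
        ultimately show ?thesis using swap by (simp only: of_int_minus mult_minus_left)
      qed
    qed
  qed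
qed

lemma permutes_ex_mset: assumes "mset K = mset L"
  obtains \<sigma> where "\<sigma> permutes {..<length K}" "permute_list \<sigma> K = L"
  using mset_eq_permutation[OF assms[symmetric]] by (metis assms mset_eq_length)

lemma permute_list_inj:
  assumes "distinct K" "\<sigma> permutes {..<length K}" "\<tau> permutes {..<length K}" "permute_list \<sigma> K = permute_list \<tau> K"
  shows "\<sigma> = \<tau>"
proof
  fix i
  show "\<sigma> i = \<tau> i"
  proof (cases "i < length K")
    case True
    then have "K ! \<sigma> i = K ! \<tau> i" using assms by (metis permute_list_nth)
    moreover have "\<sigma> i < length K" "\<tau> i < length K"
      using True assms(2,3) permutes_in_image by (metis lessThan_iff)+
    ultimately show ?thesis using assms(1) by (simp add: nth_eq_iff_index_eq)
  next
    case False
    then show ?thesis using assms(2,3) by (simp add: permutes_def)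
  qed
qed

lemma gr_permute:
  assumes "distinct K" "\<sigma> permutes {..<length K}" "permute_list \<sigma> K = L"
  shows "gr K L = (of_int (sign \<sigma>) :: 'k::field_char_0)"
proof -
  have "{\<tau>. \<tau> permutes {..<length K} \<and> permute_list \<tau> K = L} = {\<sigma>}"
    using assms permute_list_inj by blast
  then show ?thesis by (simp add: gr_def)
qed

text \<open>All orderings of one graph contribute equally to a linear extension; their number
  cancels the factorial in \<open>lin_ext\<close>.\<close>

lemma gr_alt:
  assumes "distinct K" "mset K = mset L" "alt z"
  shows "z K * gr K L = (z L :: 'k::field_char_0)"
proof -
  obtain \<sigma> where s: "\<sigma> permutes {..<length K}" "permute_list \<sigma> K = L"
    using permutes_ex_mset[OF assms(2)] .
  show ?thesis using assms(3) s gr_permute[OF assms(1) s] unfolding alt_def by (auto simp: mult.commute)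
qed

lemma gr_eq_0: "mset K \<noteq> mset L \<Longrightarrow> gr K L = 0"
  by (auto simp: gr_def intro!: sum.neutral)

text \<open>Reindexing by \<open>\<sigma> \<mapsto> \<sigma> \<circ> \<rho>\<close> works for every
  list \<open>K\<close>, so linear extensions built from \<open>gr\<close> are alternating whatever
  lists occur in them.\<close>

lemma alt_gr: "alt (gr K :: ograph \<Rightarrow> 'k::field_char_0)"
  unfolding alt_def
proof (intro allI impI)
  fix G :: ograph and \<rho>
  assume \<rho>: "\<rho> permutes {..<length G}"
  show "gr K (permute_list \<rho> G) = (of_int (sign \<rho>) * gr K G :: 'k)"
  proof (cases "length K = length G")
    case False
    then have "mset K \<noteq> mset G" "mset K \<noteq> mset (permute_list \<rho> G)"
      by (metis size_mset, metis length_permute_list size_mset)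
    then show ?thesis by (simp add: gr_eq_0)
  next
    case True
    have \<rho>': "\<rho> permutes {..<length K}" using \<rho> True by simp
    have inv: "inv_into UNIV \<rho> permutes {..<length K}" using \<rho>' by (rule permutes_inv)
    have c: "permute_list (\<sigma> \<circ> \<rho>) K = permute_list \<rho> (permute_list \<sigma> K)" for \<sigma>
      by (rule permute_list_compose[OF \<rho>'])
    have "gr K (permute_list \<rho> G) = (\<Sum>\<sigma> | \<sigma> permutes {..<length K} \<and> permute_list \<sigma> K = G. of_int (sign (\<sigma> \<circ> \<rho>)) :: 'k)"
      unfolding gr_def
    proof (rule sum.reindex_bij_witness[of _ "\<lambda>\<sigma>. \<sigma> \<circ> \<rho>" "\<lambda>\<sigma>. \<sigma> \<circ> inv_into UNIV \<rho>"])
      fix \<sigma> assume s: "\<sigma> \<in> {\<sigma>. \<sigma> permutes {..<length K} \<and> permute_list \<sigma> K = permute_list \<rho> G}"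
      show "(\<sigma> \<circ> inv_into UNIV \<rho>) \<circ> \<rho> = \<sigma>"
        using permutes_inv_o(2)[OF \<rho>'] by (simp add: comp_assoc)
      have "permute_list (\<sigma> \<circ> inv_into UNIV \<rho>) K = permute_list (inv_into UNIV \<rho>) (permute_list \<rho> G)"
        using s by (subst permute_list_compose[OF inv]) simp
      also have "\<dots> = permute_list (\<rho> \<circ> inv_into UNIV \<rho>) G"
        using inv True by (subst permute_list_compose) auto
      finally show "\<sigma> \<circ> inv_into UNIV \<rho> \<in> {\<sigma>. \<sigma> permutes {..<length K} \<and> permute_list \<sigma> K = G}"
        using s permutes_inv_o(1)[OF \<rho>'] permutes_compose[OF inv, of \<sigma>] by simp
    next
      fix \<sigma> assume s: "\<sigma> \<in> {\<sigma>. \<sigma> permutes {..<length K} \<and> permute_list \<sigma> K = G}"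
      show "(\<sigma> \<circ> \<rho>) \<circ> inv_into UNIV \<rho> = \<sigma>"
        using permutes_inv_o(1)[OF \<rho>'] by (simp add: comp_assoc)
      show "\<sigma> \<circ> \<rho> \<in> {\<sigma>. \<sigma> permutes {..<length K} \<and> permute_list \<sigma> K = permute_list \<rho> G}"
        using s c permutes_compose[OF \<rho>', of \<sigma>] by simp
    qed (use permutes_inv_o(2)[OF \<rho>'] in \<open>simp add: comp_assoc\<close>)
    also have "\<dots> = (\<Sum>\<sigma> | \<sigma> permutes {..<length K} \<and> permute_list \<sigma> K = G. of_int (sign \<rho>) * of_int (sign \<sigma>))"
    proof (rule sum.cong)
      fix \<sigma> assume "\<sigma> \<in> {\<sigma>. \<sigma> permutes {..<length K} \<and> permute_list \<sigma> K = G}"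
      then have "sign (\<sigma> \<circ> \<rho>) = sign \<sigma> * sign \<rho>"
        using \<rho>' by (intro sign_compose) (auto intro: permutes_imp_permutation[of "{..<length K}"])
      then show "(of_int (sign (\<sigma> \<circ> \<rho>)) :: 'k) = of_int (sign \<rho>) * of_int (sign \<sigma>)" by simp
    qed simp
    finally show ?thesis by (simp add: gr_def sum_distrib_left)
  qed
qed

subsection \<open>Inversions and the coefficient formula\<close>

text \<open>With \<open>P\<close> for inner and \<open>Q\<close> for outer edges, this counts the
  inversions against the order in which all edges of the outer graph precede those of the inserted
  one.\<close>

primrec xinv :: "('e \<Rightarrow> bool) \<Rightarrow> ('e \<Rightarrow> bool) \<Rightarrow> 'e list \<Rightarrow> nat" where
  "xinv P Q [] = 0"
| "xinv P Q (e # L) = (if P e then length (filter Q L) else 0) + xinv P Q L"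

lemma xinv_append: "xinv P Q (A @ B) = xinv P Q A + xinv P Q B + length (filter P A) * length (filter Q B)"
  by (induction A) auto

lemma xinv_map: "xinv P Q (map f L) = xinv (P \<circ> f) (Q \<circ> f) L"
  by (induction L) (auto simp: filter_map comp_def)

lemma xinv_cong: "(\<And>e. e \<in> set L \<Longrightarrow> P e = P' e) \<Longrightarrow> (\<And>e. e \<in> set L \<Longrightarrow> Q e = Q' e) \<Longrightarrow> xinv P Q L = xinv P' Q' L"
proof (induction L)
  case (Cons e L)
  then have "filter Q L = filter Q' L" by (intro filter_cong) auto
  with Cons show ?case by simp
qed simp

text \<open>Swapping an inner with an outer edge changes only the number of inversions, by one;
  swapping two edges of the same kind changes only the factor that contains them.\<close>

lemma alt_split:
  assumes "alt x" "alt y"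
  shows "alt (\<lambda>L. (-1) ^ xinv P (\<lambda>e. \<not> P e) L * (x (map c (filter (\<lambda>e. \<not> P e) L)) * y (map d (filter P L))) :: 'k::field_char_0)"
proof (rule altI)
  fix A a b B
  show "(-1) ^ xinv P (\<lambda>e. \<not> P e) (A @ a # b # B) * (x (map c (filter (\<lambda>e. \<not> P e) (A @ a # b # B))) * y (map d (filter P (A @ a # b # B)))) =
     - ((-1) ^ xinv P (\<lambda>e. \<not> P e) (A @ b # a # B) * (x (map c (filter (\<lambda>e. \<not> P e) (A @ b # a # B))) * y (map d (filter P (A @ b # a # B)))))"
    using alt_swap[OF assms(1), of "map c (filter (\<lambda>e. \<not> P e) A)" "c a" "c b" "map c (filter (\<lambda>e. \<not> P e) B)"]
      alt_swap[OF assms(2), of "map d (filter P A)" "d a" "d b" "map d (filter P B)"]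
    by (cases "P a"; cases "P b") (auto simp: xinv_append power_add)
qed

abbreviation emap :: "('v \<Rightarrow> 'w) \<Rightarrow> 'v \<times> 'v \<Rightarrow> 'w \<times> 'w" where "emap f \<equiv> map_prod f f"

definition inE :: "'v set \<Rightarrow> 'v \<times> 'v \<Rightarrow> bool" where "inE X e \<longleftrightarrow> fst e \<in> X \<and> snd e \<in> X"

definition verts :: "nat \<Rightarrow> nat \<Rightarrow> vertex set" where
  "verts n k = Black ` {1..n} \<union> White ` {1..k}"

lemma ographs_iff: "G \<in> ographs n k \<longleftrightarrow> distinct G \<and>
  (\<forall>e\<in>set G. fst e \<in> Black ` {1..n} \<and> snd e \<in> verts n k \<and> fst e \<noteq> snd e)"
  unfolding ographs_def verts_def by (auto simp: case_prod_unfold)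

lemma finite_ographs: "finite (ographs n k)"
proof (rule finite_subset)
  let ?E = "verts n k \<times> verts n k"
  have E: "finite ?E" by (simp add: verts_def)
  show "ographs n k \<subseteq> {G. set G \<subseteq> ?E \<and> length G \<le> card ?E}"
  proof
    fix G assume "G \<in> ographs n k"
    then have G: "distinct G" "set G \<subseteq> ?E" unfolding ographs_iff by (auto simp: verts_def)
    then have "length G \<le> card ?E" using E by (metis card_mono distinct_card)
    with G show "G \<in> {G. set G \<subseteq> ?E \<and> length G \<le> card ?E}" by simp
  qed
  show "finite {G. set G \<subseteq> ?E \<and> length G \<le> card ?E}" by (rule finite_lists_length_le[OF E])
qed

lemma reconnect_iff: "G' \<in> reconnect R G \<longleftrightarrow> list_all2 (\<lambda>e' e. fst e' \<in> R (fst e) \<and> snd e' \<in> R (snd e)) G' G"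
proof (induction G arbitrary: G')
  case Nil then show ?case by (auto simp: reconnect_def)
next
  case (Cons e G)
  then show ?case
    by (cases e) (auto simp: reconnect_def set_Cons_def list_all2_Cons2 case_prod_unfold)
qed

lemma sum_fun_apply: "(\<Sum>a\<in>A. f a) x = (\<Sum>a\<in>A. f a x)"
  by (induction A rule: infinite_finite_induct) auto

lemma card_mset_eq: assumes "distinct L" shows "finite {K. mset K = mset L}" "card {K. mset K = mset L} = fact (length L)"
proof -
  have eq: "{K. mset K = mset L} = permutations_of_set (set L)"
    using assms by (auto simp: permutations_of_set_def set_eq_iff_mset_eq_distinct dest: mset_eq_setD mset_eq_imp_distinct_iff)
  show "finite {K. mset K = mset L}" "card {K. mset K = mset L} = fact (length L)"
    using assms unfolding eq by (simp_all add: distinct_card)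
qed

text \<open>Here \<open>c\<close> contracts the inserted graph to the vertex \<open>v0\<close>, the
  set \<open>R u\<close> is the fibre of \<open>c\<close> over \<open>u\<close>, and
  \<open>sh\<close> embeds the inserted vertices into \<open>X\<close> with inverse
  \<open>ush\<close>. Up to orderings \<open>L\<close> arises in one way only: the inserted graph
  consists of the edges inside \<open>X\<close>, the outer one of the remaining edges after
  contraction. Both insertions are instances.\<close>

theorem insertion_coeff:
  fixes x y :: "'k::field_char_0 gvec"
  assumes x: "x \<in> KGra m p" and y: "y \<in> KGra n q"
    and R: "\<And>u. u \<in> verts m p \<Longrightarrow> R u = {u' \<in> verts N K. c u' = u}"
    and sh: "\<And>v. v \<in> verts n q \<Longrightarrow> sh v \<in> X \<and> ush (sh v) = v"
    and ush: "\<And>u. u \<in> X \<Longrightarrow> sh (ush u) = u"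
    and X: "X \<subseteq> verts N K" "\<And>u. u \<in> X \<Longrightarrow> c u = v0"
    and L: "L \<in> ographs N K"
  shows "lin_ext m p (\<lambda>G. lin_ext n q (\<lambda>H. \<Sum>G'\<in>reconnect R G. gr (G' @ map (emap sh) H)) y) x L
    = (-1) ^ xinv (inE X) (\<lambda>e. \<not> inE X e) L *
       (x (map (emap c) (filter (\<lambda>e. \<not> inE X e) L)) * y (map (emap ush) (filter (inE X) L)))"
proof -
  define z where "z L = (-1) ^ xinv (inE X) (\<lambda>e. \<not> inE X e) L *
       (x (map (emap c) (filter (\<lambda>e. \<not> inE X e) L)) * y (map (emap ush) (filter (inE X) L)))" for L
  have ax: "alt x" and ay: "alt y" using x y by (auto simp: KGra_def alt_def)
  have sx: "x G \<noteq> 0 \<Longrightarrow> G \<in> ographs m p" and sy: "y G \<noteq> 0 \<Longrightarrow> G \<in> ographs n q" for G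
    using x y by (auto simp: KGra_def)
  have az: "alt z" unfolding z_def by (rule alt_split[OF ax ay])
  have dL: "distinct L" using L by (simp add: ographs_iff)
  define Out where "Out = filter (\<lambda>e. \<not> inE X e) L"
  define Inn where "Inn = filter (inE X) L"
  have dOI: "distinct Out" "distinct Inn" using dL by (auto simp: Out_def Inn_def)
  define T where "T = (SIGMA GH:ographs m p \<times> ographs n q. reconnect R (fst GH))"
  define S where "S = {G'. mset G' = mset Out} \<times> {H'. mset H' = mset Inn}"
  define s where "s GH = x (map (emap c) (fst GH)) / fact (length (fst GH)) *
    (y (map (emap ush) (snd GH)) / fact (length (snd GH)) * gr (fst GH @ snd GH) L)" for GH
  define t where "t a = x (fst (fst a)) / fact (length (fst (fst a))) *
    (y (snd (fst a)) / fact (length (snd (fst a))) * gr (snd a @ map (emap sh) (snd (fst a))) L)" for a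
  have finR: "finite (reconnect R G)" if "G \<in> ographs m p" for G
  proof (rule finite_subset)
    show "reconnect R G \<subseteq> {G'. set G' \<subseteq> verts N K \<times> verts N K \<and> length G' = length G}"
    proof
      fix G' assume "G' \<in> reconnect R G"
      then have a: "list_all2 (\<lambda>e' e. fst e' \<in> R (fst e) \<and> snd e' \<in> R (snd e)) G' G" by (simp add: reconnect_iff)
      have "e' \<in> verts N K \<times> verts N K" if "e' \<in> set G'" for e'
      proof -
        obtain i where i: "i < length G'" "e' = G' ! i" using \<open>e' \<in> set G'\<close> by (metis in_set_conv_nth)
        then have g: "fst e' \<in> R (fst (G ! i))" "snd e' \<in> R (snd (G ! i))" "G ! i \<in> set G"
          using a by (auto simp: list_all2_conv_all_nth)
        then have "fst (G ! i) \<in> verts m p" "snd (G ! i) \<in> verts m p"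
          using \<open>G \<in> ographs m p\<close> by (auto simp: ographs_iff verts_def)
        with g show ?thesis using R by (cases e') auto
      qed
      then show "G' \<in> {G'. set G' \<subseteq> verts N K \<times> verts N K \<and> length G' = length G}"
        using a by (auto dest: list_all2_lengthD)
    qed
  qed (rule finite_lists_length_eq, simp add: verts_def)
  have finT: "finite T" unfolding T_def by (auto simp: finite_ographs finR)
  have finS: "finite S" unfolding S_def by (simp add: card_mset_eq dOI)
  \<comment> \<open>A reconnected edge never lies inside \<open>X\<close>: both its ends would
    contract to \<open>v0\<close>, and the edges of \<open>G\<close> are not loops.\<close>
  have recon: "map (emap c) G' = G \<and> (\<forall>e\<in>set G'. \<not> inE X e) \<and> distinct G'"
    if G: "G \<in> ographs m p" and G': "G' \<in> reconnect R G" for G G'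
  proof -
    have a: "list_all2 (\<lambda>e' e. fst e' \<in> R (fst e) \<and> snd e' \<in> R (snd e)) G' G" using G' by (simp add: reconnect_iff)
    have b: "emap c e' = e \<and> \<not> inE X e'" if "e \<in> set G" "fst e' \<in> R (fst e)" "snd e' \<in> R (snd e)" for e e'
    proof -
      have v: "fst e \<in> verts m p" "snd e \<in> verts m p" "fst e \<noteq> snd e"
        using that(1) G by (auto simp: ographs_iff verts_def)
      then have "c (fst e') = fst e" "c (snd e') = snd e" using that R by auto
      moreover from this v(3) have "\<not> inE X e'" using X(2) by (auto simp: inE_def)
      ultimately show ?thesis by (simp add: prod_eq_iff)
    qed
    have "list_all2 (\<lambda>e' e. emap c e' = e \<and> \<not> inE X e') G' G"
      using a b nth_mem unfolding list_all2_conv_all_nth by metis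
    then have 1: "map (emap c) G' = G" "\<forall>e\<in>set G'. \<not> inE X e"
      by (auto simp: list_all2_conv_all_nth intro!: nth_equalityI) (metis in_set_conv_nth)
    moreover have "distinct G'" using 1(1) G by (auto simp: ographs_iff distinct_map)
    ultimately show ?thesis by simp
  qed
  have shin: "inE X (emap sh e) \<and> emap ush (emap sh e) = e" if "e \<in> set H" "H \<in> ographs n q" for e H
  proof -
    have "fst e \<in> verts n q" "snd e \<in> verts n q" using that by (auto simp: ographs_iff verts_def)
    with sh show ?thesis by (cases e) (simp add: inE_def)
  qed
  have mapsh: "map (emap ush) (map (emap sh) H) = H" if "H \<in> ographs n q" for H
    using shin[OF _ that] by (simp add: map_idI)
  have key: "mset G' = mset Out \<and> mset (map (emap sh) H) = mset Inn"
    if "G \<in> ographs m p" "G' \<in> reconnect R G" "H \<in> ographs n q" "mset (G' @ map (emap sh) H) = mset L" for G G' H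
  proof -
    have "filter (inE X) (G' @ map (emap sh) H) = map (emap sh) H"
      using recon[OF that(1,2)] shin[OF _ that(3)] by (auto simp: filter_empty_conv filter_id_conv)
    moreover have "filter (\<lambda>e. \<not> inE X e) (G' @ map (emap sh) H) = G'"
      using recon[OF that(1,2)] shin[OF _ that(3)] by (auto simp: filter_empty_conv filter_id_conv)
    ultimately show ?thesis unfolding Out_def Inn_def by (metis mset_filter that(4))
  qed
  have "lin_ext m p (\<lambda>G. lin_ext n q (\<lambda>H. \<Sum>G'\<in>reconnect R G. gr (G' @ map (emap sh) H)) y) x L
    = (\<Sum>G\<in>ographs m p. \<Sum>H\<in>ographs n q. \<Sum>G'\<in>reconnect R G. t ((G, H), G'))"
    by (simp add: lin_ext_def sum_fun_apply sum_distrib_left t_def mult.assoc)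
  also have "\<dots> = (\<Sum>GH\<in>ographs m p \<times> ographs n q. \<Sum>G'\<in>reconnect R (fst GH). t (GH, G'))"
    by (subst sum.cartesian_product) (simp add: case_prod_unfold)
  also have "\<dots> = sum t T"
    unfolding T_def using finite_ographs finR by (subst sum.Sigma) auto
  also have "\<dots> = sum s S"
  \<comment> \<open>A triple is recovered from its reconnected and its embedded edges by applying
    \<open>c\<close> and \<open>ush\<close>. Lists whose images are not graphs are among the neutral
    terms, since \<open>x\<close> and \<open>y\<close> vanish on those images.\<close>
  proof (rule sum.reindex_bij_witness_not_neutral[of "{a \<in> T. t a = 0}" "{b \<in> S. s b = 0}" _
        "\<lambda>b. ((map (emap c) (fst b), map (emap ush) (snd b)), fst b)" "\<lambda>a. (snd a, map (emap sh) (snd (fst a)))"])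
    have ts: "s (snd a, map (emap sh) (snd (fst a))) = t a" if a: "a \<in> T" for a
    proof -
      have g: "fst (fst a) \<in> ographs m p" "snd (fst a) \<in> ographs n q" "snd a \<in> reconnect R (fst (fst a))"
        using a by (auto simp: T_def)
      have "length (snd a) = length (fst (fst a))" using recon[OF g(1,3)] by (metis length_map)
      moreover have "map (emap c) (snd a) = fst (fst a)" using recon[OF g(1,3)] by simp
      ultimately show ?thesis using mapsh[OF g(2)] by (simp add: s_def t_def del: map_map)
    qed
    show "\<And>a. a \<in> T \<Longrightarrow> s (snd a, map (emap sh) (snd (fst a))) = t a" by (rule ts)
    fix a assume a: "a \<in> T - {a \<in> T. t a = 0}"
    have g: "fst (fst a) \<in> ographs m p" "snd (fst a) \<in> ographs n q" "snd a \<in> reconnect R (fst (fst a))"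
      using a by (auto simp: T_def)
    have "gr (snd a @ map (emap sh) (snd (fst a))) L \<noteq> (0 :: 'k)" using a by (auto simp: t_def)
    then have "mset (snd a @ map (emap sh) (snd (fst a))) = mset L" using gr_eq_0 by blast
    from key[OF g(1,3,2) this] have "(snd a, map (emap sh) (snd (fst a))) \<in> S" by (simp add: S_def)
    then show "(snd a, map (emap sh) (snd (fst a))) \<in> S - {b \<in> S. s b = 0}" using ts[of a] a by simp
    show "((map (emap c) (fst (snd a, map (emap sh) (snd (fst a)))), map (emap ush) (snd (snd a, map (emap sh) (snd (fst a))))), fst (snd a, map (emap sh) (snd (fst a)))) = a"
      using recon[OF g(1,3)] mapsh[OF g(2)] by (simp add: prod_eq_iff)
  next
    fix b assume b: "b \<in> S - {b \<in> S. s b = 0}"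
    have m: "mset (fst b) = mset Out" "mset (snd b) = mset Inn" using b by (auto simp: S_def)
    have st: "set (fst b) = set Out" "set (snd b) = set Inn" using m mset_eq_setD by blast+
    have g: "map (emap c) (fst b) \<in> ographs m p" "map (emap ush) (snd b) \<in> ographs n q"
      using b sx sy by (auto simp: s_def)
    have shb: "map (emap sh) (map (emap ush) (snd b)) = snd b"
    proof -
      have "emap sh (emap ush e) = e" if "e \<in> set (snd b)" for e
      proof -
        have "e \<in> set Inn" using that st by simp
        then have "fst e \<in> X" "snd e \<in> X" by (auto simp: Inn_def inE_def)
        with ush show ?thesis by (cases e) simp
      qed
      then show ?thesis by (simp add: map_idI)
    qed
    show bb: "(snd ((map (emap c) (fst b), map (emap ush) (snd b)), fst b),
         map (emap sh) (snd (fst ((map (emap c) (fst b), map (emap ush) (snd b)), fst b)))) = b"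
      using shb by (simp add: prod_eq_iff)
    have "fst b \<in> reconnect R (map (emap c) (fst b))"
    proof -
      have "fst e \<in> R (c (fst e)) \<and> snd e \<in> R (c (snd e))" if e: "e \<in> set (fst b)" for e
      proof -
        have "fst e \<in> verts N K" "snd e \<in> verts N K"
          using e st L by (auto simp: Out_def ographs_iff verts_def)
        moreover have "c (fst e) \<in> verts m p" "c (snd e) \<in> verts m p"
          using g(1) e unfolding ographs_iff by (auto simp: verts_def simp del: One_nat_def)
        ultimately show ?thesis using R by auto
      qed
      then show ?thesis by (auto simp: reconnect_iff list_all2_conv_all_nth)
    qed
    then have "((map (emap c) (fst b), map (emap ush) (snd b)), fst b) \<in> T" using g by (simp add: T_def)
    moreover have "t ((map (emap c) (fst b), map (emap ush) (snd b)), fst b) = s b"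
      using shb by (simp add: t_def s_def)
    ultimately show "((map (emap c) (fst b), map (emap ush) (snd b)), fst b) \<in> T - {a \<in> T. t a = 0}"
      using b by simp
  qed (use finT finS in auto)
  \<comment> \<open>The concatenation of a pair in \<open>S\<close> is an ordering of
    \<open>L\<close> without inversions, so \<open>gr_alt\<close> for the alternating function
    \<open>z\<close> evaluates each term.\<close>
  also have "\<dots> = (\<Sum>b\<in>S. z L / (fact (length Out) * fact (length Inn)))"
  proof (rule sum.cong)
    fix b assume b: "b \<in> S"
    have m: "mset (fst b) = mset Out" "mset (snd b) = mset Inn" using b by (auto simp: S_def)
    have st: "set (fst b) = set Out" "set (snd b) = set Inn" using m mset_eq_setD by blast+
    have l: "length (fst b) = length Out" "length (snd b) = length Inn" using m by (metis size_mset)+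
    have ml: "mset (fst b @ snd b) = mset L" using m by (simp add: Out_def Inn_def)
    then have db: "distinct (fst b @ snd b)" using dL mset_eq_imp_distinct_iff by blast
    have f: "filter (inE X) (fst b @ snd b) = snd b" "filter (\<lambda>e. \<not> inE X e) (fst b @ snd b) = fst b"
      using st by (auto simp: filter_empty_conv filter_id_conv Out_def Inn_def)
    have "xinv (inE X) (\<lambda>e. \<not> inE X e) (fst b @ snd b) = 0"
    proof -
      have 0: "xinv P Q K = 0" if "filter P K = [] \<or> filter Q K = []" for P Q and K :: ograph
        using that by (induction K) (auto split: if_splits)
      have "filter (inE X) (fst b) = []" "filter (\<lambda>e. \<not> inE X e) (snd b) = []"
        using st by (auto simp: filter_empty_conv Out_def Inn_def)
      then show ?thesis by (simp add: xinv_append 0)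
    qed
    then have "z (fst b @ snd b) = x (map (emap c) (fst b)) * y (map (emap ush) (snd b))"
      unfolding z_def f by simp
    then have "s b = z (fst b @ snd b) * gr (fst b @ snd b) L / (fact (length Out) * fact (length Inn))"
      by (simp add: s_def l)
    then show "s b = z L / (fact (length Out) * fact (length Inn))"
      by (simp add: gr_alt[OF db ml az])
  qed simp
  also have "\<dots> = z L" using dOI by (simp add: S_def card_mset_eq card_cartesian_product)
  finally show ?thesis by (simp add: z_def)
qed

lemma relabel_black_verts:
  "\<tau> permutes {1..n} \<Longrightarrow> relabel_black \<tau> v \<in> Black ` {1..n} \<longleftrightarrow> v \<in> Black ` {1..n}"
  "\<tau> permutes {1..n} \<Longrightarrow> relabel_black \<tau> v \<in> verts n k \<longleftrightarrow> v \<in> verts n k"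
  using permutes_in_image[of \<tau> "{1..n}"] by (cases v; auto simp: verts_def image_iff; fail)+

lemma relabel_black_inj: "inj \<tau> \<Longrightarrow> relabel_black \<tau> u = relabel_black \<tau> v \<longleftrightarrow> u = v"
  by (cases u; cases v) (auto simp: inj_eq)

lemma relabel_black_comp: "relabel_black f (relabel_black g v) = relabel_black (f \<circ> g) v"
  by (cases v) auto

lemma relabel_black_id: "relabel_black id v = v" by (cases v) auto

lemma map_relabel_ographs:
  assumes "\<tau> permutes {1..n}"
  shows "map (emap (relabel_black \<tau>)) G \<in> ographs n k \<longleftrightarrow> G \<in> ographs n k"
proof -
  have i: "inj \<tau>" using assms by (rule permutes_inj)
  have "inj (emap (relabel_black \<tau>))" using i by (auto simp: inj_on_def relabel_black_inj)
  then show ?thesis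
    using assms i unfolding ographs_iff by (auto simp: distinct_map relabel_black_verts[OF assms] relabel_black_inj simp del: One_nat_def intro: inj_on_subset)
qed

text \<open>The case distinction is there because \<open>act\<close> sums over graphs only and so
  cuts an alternating function down to them; it is applied to insertions, of which only the
  alternating property has been shown.\<close>

theorem act_coeff:
  fixes z :: "'k::field_char_0 gvec"
  assumes az: "alt z" and \<tau>: "\<tau> permutes {1..n}"
  shows "act n k \<tau> z L = (if L \<in> ographs n k then z (map (emap (relabel_black (inv_into UNIV \<tau>))) L) else 0)"
proof -
  let ?f = "emap (relabel_black \<tau>)" and ?g = "emap (relabel_black (inv_into UNIV \<tau>))"
  have inv: "inv_into UNIV \<tau> permutes {1..n}" using \<tau> by (rule permutes_inv)
  have fg: "map ?f (map ?g K) = K" "map ?g (map ?f K) = K" for K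
    using permutes_inv_o[OF \<tau>] by (simp_all add: relabel_black_comp relabel_black_id map_prod.comp comp_def[of "relabel_black _"])
  have m0: "mset (map ?f G) = mset L \<longleftrightarrow> mset G = mset (map ?g L)" for G
    by (metis fg mset_map)
  have "act n k \<tau> z L = (\<Sum>G\<in>ographs n k. z G / fact (length G) * gr (map ?f G) L)"
    by (simp add: act_def lin_ext_def)
  also have "\<dots> = (if map ?g L \<in> ographs n k then z (map ?g L) else 0)"
  proof (cases "map ?g L \<in> ographs n k")
    case False
    have "z G / fact (length G) * gr (map ?f G) L = 0" if "G \<in> ographs n k" for G
    proof -
      have "mset (map ?f G) \<noteq> mset L"
      proof
        assume "mset (map ?f G) = mset L"
        then have m: "mset G = mset (map ?g L)" by (simp only: m0)
        then have "set G = set (map ?g L)" "distinct (map ?g L)"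
          using that mset_eq_setD mset_eq_imp_distinct_iff unfolding ographs_iff by blast+
        then have "map ?g L \<in> ographs n k" using that unfolding ographs_iff by simp
        with False show False by simp
      qed
      then show ?thesis by (simp add: gr_eq_0)
    qed
    then have "(\<Sum>G\<in>ographs n k. z G / fact (length G) * gr (map ?f G) L) = 0" by (rule sum.neutral[OF ballI])
    then show ?thesis using False by (simp only: if_False)
  next
    case True
    have d: "distinct (map ?g L)" using True by (simp add: ographs_iff)
    have "(\<Sum>G\<in>ographs n k. z G / fact (length G) * gr (map ?f G) L)
      = (\<Sum>G | mset G = mset (map ?g L). z (map ?g L) / fact (length L))"
    proof (rule sum.mono_neutral_cong)
      show "finite {G. mset G = mset (map ?g L)}" by (rule card_mset_eq[OF d])
      fix G assume "G \<in> {G. mset G = mset (map ?g L)} - ographs n k"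
      then have "mset G = mset (map ?g L)" "G \<notin> ographs n k" by auto
      then show "z (map ?g L) / fact (length L) = 0"
        using True mset_eq_setD mset_eq_imp_distinct_iff unfolding ographs_iff by metis
    next
      fix G assume "G \<in> ographs n k \<inter> {G. mset G = mset (map ?g L)}"
      then have G: "G \<in> ographs n k" "mset G = mset (map ?g L)" by auto
      have "map ?f G \<in> ographs n k" using G \<tau> by (simp only: map_relabel_ographs)
      then have df: "distinct (map ?f G)" by (simp add: ographs_iff)
      have al: "alt (\<lambda>K. z (map ?g K))"
        by (intro altI) (simp, rule alt_swap[OF az])
      have "z (map ?g (map ?f G)) * gr (map ?f G) L = z (map ?g L)"
        by (rule gr_alt[OF df _ al]) (use G(2) in \<open>simp only: m0\<close>)
      then have "z G * gr (map ?f G) L = z (map ?g L)" by (simp only: fg)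
      moreover have "length G = length L" using G(2) by (metis length_map size_mset)
      ultimately show "z G / fact (length G) * gr (map ?f G) L = z (map ?g L) / fact (length L)"
        by (simp del: map_map)
    next
      fix G assume "G \<in> ographs n k - {G. mset G = mset (map ?g L)}"
      then have "mset (map ?f G) \<noteq> mset L" using m0 by blast
      then show "z G / fact (length G) * gr (map ?f G) L = 0" by (simp add: gr_eq_0)
    qed (rule finite_ographs)
    also have "\<dots> = z (map ?g L)" using card_mset_eq(2)[OF d] by simp
    finally show ?thesis using True by (simp only: if_True)
  qed
  finally show ?thesis by (simp only: map_relabel_ographs[OF inv])
qed

lemma alt_KGra: "z \<in> KGra n k \<Longrightarrow> alt z" by (auto simp: KGra_def alt_def)

lemma act_coeff_KGra:
  assumes "z \<in> KGra n k" "\<tau> permutes {1..n}"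
  shows "act n k \<tau> z L = z (map (emap (relabel_black (inv_into UNIV \<tau>))) L)"
proof -
  have "L \<in> ographs n k" if "z (map (emap (relabel_black (inv_into UNIV \<tau>))) L) \<noteq> 0"
    using that assms(1) map_relabel_ographs[OF permutes_inv[OF assms(2)]] by (auto simp: KGra_def)
  then show ?thesis using act_coeff[OF alt_KGra[OF assms(1)] assms(2)] by auto
qed

lemma alt_sum: "(\<And>a. a \<in> A \<Longrightarrow> alt (f a)) \<Longrightarrow> alt (\<lambda>L. \<Sum>a\<in>A. f a L)"
  by (simp add: alt_def sum_distrib_left)

lemma alt_scale: "alt f \<Longrightarrow> alt (\<lambda>L. c * f L)"
  by (simp add: alt_def mult.left_commute)

lemma alt_add: "alt f \<Longrightarrow> alt g \<Longrightarrow> alt (\<lambda>L. f L + g L)"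
  by (simp add: alt_def distrib_left)

lemma alt_lin_ext: "(\<And>G. alt (T G)) \<Longrightarrow> alt (lin_ext n k T x)"
  unfolding lin_ext_def by (intro alt_sum alt_scale)

lemma alt_sum_fun: "(\<And>a. a \<in> A \<Longrightarrow> alt (f a)) \<Longrightarrow> alt (\<Sum>a\<in>A. f a :: ograph \<Rightarrow> 'k::field_char_0)"
proof -
  assume "\<And>a. a \<in> A \<Longrightarrow> alt (f a)"
  from alt_sum[OF this] have "alt (\<lambda>L. \<Sum>a\<in>A. f a L)" .
  moreover have "(\<Sum>a\<in>A. f a) = (\<lambda>L. \<Sum>a\<in>A. f a L)" by (rule ext) (rule sum_fun_apply)
  ultimately show ?thesis by (simp only:)
qed

lemma alt_ins_c: "alt (ins_c mp i n x y)"
  unfolding ins_c_def by (cases mp) (auto intro!: alt_lin_ext alt_sum_fun alt_gr)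

lemma alt_ins_o: "alt (ins_o mp i nq x y)"
  unfolding ins_o_def by (cases mp; cases nq) (auto intro!: alt_lin_ext alt_sum_fun alt_gr)

lemma alt_act: "alt (act n k \<tau> x)"
  unfolding act_def by (intro alt_lin_ext alt_gr)

section \<open>Evaluation of invariant vectors on graphs with arbitrary vertex sets\<close>

section \<open>Graphs on arbitrary vertex sets\<close>

subsection \<open>Ranks and shuffles\<close>

definition rk :: "nat set \<Rightarrow> nat \<Rightarrow> nat" where "rk S v = card {u \<in> S. u \<le> v}"

lemma rk_mono: assumes "finite S" "v \<in> S" "u < v" shows "rk S u < rk S v"
proof -
  have "v \<in> {w \<in> S. w \<le> v}" "v \<notin> {w \<in> S. w \<le> u}" "{w \<in> S. w \<le> u} \<subseteq> {w \<in> S. w \<le> v}" using assms by auto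
  then have "{w \<in> S. w \<le> u} \<subset> {w \<in> S. w \<le> v}" by blast
  then show ?thesis unfolding rk_def by (rule psubset_card_mono[rotated]) (use assms in simp)
qed

lemma rk_le_iff: "finite S \<Longrightarrow> u \<in> S \<Longrightarrow> v \<in> S \<Longrightarrow> rk S u \<le> rk S v \<longleftrightarrow> u \<le> v"
  by (metis linorder_not_le order.refl order_less_imp_le rk_mono linorder_less_linear)

lemma rk_inj: "finite S \<Longrightarrow> inj_on (rk S) S"
  by (metis (no_types, lifting) inj_onI order.eq_iff rk_le_iff)

lemma rk_range: assumes "finite S" "v \<in> S" shows "rk S v \<in> {1..card S}"
proof -
  have "card {u \<in> S. u \<le> v} \<le> card S" by (rule card_mono) (use assms in auto)
  moreover have "card {u \<in> S. u \<le> v} > 0" using assms by (auto simp: card_gt_0_iff)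
  ultimately show ?thesis by (auto simp: rk_def)
qed

lemma rk_bij: assumes "finite S" shows "bij_betw (rk S) S {1..card S}"
proof -
  have "rk S ` S = {1..card S}"
    by (rule card_subset_eq) (use assms rk_range rk_inj in \<open>auto simp: card_image simp del: One_nat_def\<close>)
  then show ?thesis using rk_inj[OF assms] by (simp add: bij_betw_def)
qed

lemma rk_rk:
  assumes "finite S" "T \<subseteq> S" "v \<in> S"
  shows "rk (rk S ` T) (rk S v) = rk T v"
proof -
  have "{u \<in> rk S ` T. u \<le> rk S v} = rk S ` {u \<in> T. u \<le> v}"
    using rk_le_iff[OF assms(1) _ assms(3)] assms(2) by blast
  moreover have "inj_on (rk S) {u \<in> T. u \<le> v}"
    using rk_inj[OF assms(1)] by (rule inj_on_subset) (use assms in auto)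
  ultimately show ?thesis unfolding rk_def[of "rk S ` T"] rk_def[of T] by (simp only: card_image)
qed

lemma bij_betw_plus: "bij_betw ((+) a) {1..m} {a + 1..a + m :: nat}"
  by (rule bij_betw_byWitness[where f' = "\<lambda>x. x - a"]) auto

text \<open>The inverse of the shuffle whose first block is mapped onto \<open>A\<close>. The
  inverse is what relabels the argument in \<open>act_coeff\<close>.\<close>

definition shinv :: "nat set \<Rightarrow> nat \<Rightarrow> nat \<Rightarrow> nat" where
  "shinv A n i = (if i \<in> A then rk A i else if i \<in> {1..n} then card A + rk ({1..n} - A) i else i)"

lemma shinv_permutes: assumes "A \<subseteq> {1..n}" shows "shinv A n permutes {1..n}"
proof (rule bij_imp_permutes)
  have f: "finite A" "finite ({1..n} - A)" using assms finite_subset by auto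
  have c: "card ({1..n} - A) = n - card A" using assms by (simp add: card_Diff_subset f)
  have le: "card A \<le> n" using card_mono[OF _ assms] by simp
  have "bij_betw (shinv A n) A {1..card A}"
    using rk_bij[OF f(1)] by (rule bij_betw_cong[THEN iffD1, rotated]) (simp add: shinv_def)
  moreover have "bij_betw (shinv A n) ({1..n} - A) {card A + 1..n}"
  proof -
    have "bij_betw ((+) (card A) \<circ> rk ({1..n} - A)) ({1..n} - A) {card A + 1..n}"
    proof -
      have "card A + card ({1..n} - A) = n" using c le by linarith
      then show ?thesis using bij_betw_trans[OF rk_bij[OF f(2)] bij_betw_plus[of "card A"]] by (simp only:)
    qed
    then show ?thesis by (rule bij_betw_cong[THEN iffD1, rotated]) (simp add: shinv_def)
  qed
  ultimately have "bij_betw (shinv A n) (A \<union> ({1..n} - A)) ({1..card A} \<union> {card A + 1..n})"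
    by (rule bij_betw_combine) auto
  moreover have "A \<union> ({1..n} - A) = {1..n}" "{1..card A} \<union> {card A + 1..n} = {1..n}" using assms le by auto
  ultimately show "bij_betw (shinv A n) {1..n} {1..n}" by simp
  show "\<And>x. x \<notin> {1..n} \<Longrightarrow> shinv A n x = x" using assms by (auto simp: shinv_def)
qed

lemma rk_image_strict_mono:
  assumes "strict_mono_on {a+1..a+m} \<tau>" "j \<in> {a+1..a+m}"
  shows "rk (\<tau> ` {a+1..a+m}) (\<tau> j) = j - (a :: nat)"
proof -
  have le: "\<tau> i \<le> \<tau> j \<longleftrightarrow> i \<le> j" if "i \<in> {a+1..a+m}" for i
    using assms that strict_mono_on_leD[OF assms(1)] by (meson linorder_not_le strict_mono_onD)
  have "{u \<in> \<tau> ` {a+1..a+m}. u \<le> \<tau> j} = \<tau> ` {a+1..j}"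
    using le assms(2) by fastforce
  moreover have "inj_on \<tau> {a+1..j}"
    using strict_mono_on_imp_inj_on[OF assms(1)] by (rule inj_on_subset) (use assms(2) in auto)
  ultimately show ?thesis by (simp add: rk_def card_image)
qed

lemma shuffle_inv:
  assumes "\<tau> \<in> shuffles_perm p q"
  shows "inv_into UNIV \<tau> = shinv (\<tau> ` {1..p}) (p + q)"
proof
  fix i
  have t: "\<tau> permutes {1..p+q}" and m1: "strict_mono_on {0+1..0+p} \<tau>" and m2: "strict_mono_on {p+1..p+q} \<tau>"
    using assms by (auto simp: shuffles_perm_def)
  define j where "j = inv_into UNIV \<tau> i"
  have i: "i = \<tau> j" unfolding j_def using permutes_inverses(1)[OF t] by simp
  have inj: "inj \<tau>" using t by (rule permutes_inj)
  have img: "\<tau> ` {1..p+q} = {1..p+q}" using t by (rule permutes_image)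
  have "{1..p+q} = {1..p} \<union> {p+1..p+q}" by auto
  then have D: "{1..p+q} - \<tau> ` {1..p} = \<tau> ` {p+1..p+q}"
  proof -
    have "\<tau> ` {1..p+q} - \<tau> ` {1..p} = \<tau> ` ({1..p+q} - {1..p})" using inj by (simp add: image_set_diff)
    also have "{1..p+q} - {1..p} = {p+1..p+q}" by auto
    finally show ?thesis by (simp only: img)
  qed
  have card: "card (\<tau> ` {1..p}) = p" using inj by (simp add: card_image inj_on_subset)
  have mem: "i \<in> \<tau> ` X \<longleftrightarrow> j \<in> X" for X using inj i by (auto simp: inj_image_mem_iff)
  have mem2: "i \<in> {1..p+q} \<longleftrightarrow> j \<in> {1..p+q}" using mem[of "{1..p+q}"] by (simp only: img)
  consider "j \<in> {1..p}" | "j \<in> {p+1..p+q}" | "j \<notin> {1..p+q}" by fastforce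
  then show "inv_into UNIV \<tau> i = shinv (\<tau> ` {1..p}) (p + q) i"
  proof cases
    case 1
    then have "i \<in> \<tau> ` {1..p}" using mem[of "{1..p}"] by blast
    then show ?thesis using rk_image_strict_mono[OF m1, of j] 1 unfolding shinv_def j_def[symmetric] i[symmetric]
      by simp
  next
    case 2
    then have "j \<notin> {1..p}" "j \<in> {1..p+q}" by auto
    then have *: "i \<notin> \<tau> ` {1..p}" "i \<in> {1..p+q}" using mem[of "{1..p}"] mem2 by auto
    have "rk ({1..p+q} - \<tau> ` {1..p}) i = j - p" unfolding D i using rk_image_strict_mono[OF m2 2] .
    then show ?thesis using * 2 unfolding shinv_def j_def[symmetric] card by simp
  next
    case 3
    then have "j \<notin> {1..p}" by auto
    then have *: "i \<notin> \<tau> ` {1..p}" "i \<notin> {1..p+q}" using mem[of "{1..p}"] mem2 3 by blast+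
    have "i = j" using i 3 t by (simp add: permutes_def)
    show ?thesis unfolding shinv_def j_def[symmetric] using * \<open>i = j\<close>[symmetric] by (simp only: if_False)
  qed
qed

lemma shinv_shuffle:
  assumes "A \<subseteq> {1..p+q}" "card A = p"
  shows "inv_into UNIV (shinv A (p + q)) \<in> shuffles_perm p q" (is "?\<tau> \<in> _")
    and "inv_into UNIV (shinv A (p + q)) ` {1..p} = A"
proof -
  let ?s = "shinv A (p + q)"
  have s: "?s permutes {1..p+q}" by (rule shinv_permutes) fact
  have t: "?\<tau> permutes {1..p+q}" using s by (rule permutes_inv)
  have fA: "finite A" using assms(1) finite_subset by blast
  have st: "?s (?\<tau> i) = i" "?\<tau> (?s i) = i" for i using permutes_inverses[OF s] by auto
  have A: "?s ` A = {1..p}"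
    using rk_bij[OF fA] assms by (auto simp: shinv_def bij_betw_def image_def)
  then show img: "?\<tau> ` {1..p} = A" by (metis (no_types, lifting) image_comp image_ident image_cong comp_apply st(2))
  have mono: "strict_mono_on X ?\<tau>" if X: "X \<subseteq> {1..p+q}"
    and cmp: "\<And>i j. i \<in> X \<Longrightarrow> j \<in> X \<Longrightarrow> ?\<tau> j \<le> ?\<tau> i \<Longrightarrow> j \<le> i" for X
    by (rule strict_mono_onI) (meson cmp linorder_not_le)
  have "strict_mono_on {1..p} ?\<tau>"
  proof (rule mono)
    fix i j assume ij: "i \<in> {1..p}" "j \<in> {1..p}" and le: "?\<tau> j \<le> ?\<tau> i"
    then have "?\<tau> i \<in> A" "?\<tau> j \<in> A" using img by blast+
    then have "?s (?\<tau> j) \<le> ?s (?\<tau> i)" using le rk_le_iff[OF fA] by (simp add: shinv_def)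
    then show "j \<le> i" by (simp only: st)
  qed auto
  moreover have "strict_mono_on {p+1..p+q} ?\<tau>"
  proof (rule mono)
    fix i j assume ij: "i \<in> {p+1..p+q}" "j \<in> {p+1..p+q}" and le: "?\<tau> j \<le> ?\<tau> i"
    have "?\<tau> l \<in> {1..p+q} - A" if "l \<in> {p+1..p+q}" for l
    proof -
      have "l \<in> {1..p+q}" using that by auto
      then have "?\<tau> l \<in> {1..p+q}" using permutes_in_image[OF t] by blast
      moreover have "?\<tau> l \<notin> A"
      proof
        assume "?\<tau> l \<in> A"
        then have "?s (?\<tau> l) \<in> {1..p}" using A by blast
        with that show False by (simp add: st)
      qed
      ultimately show ?thesis by simp
    qed
    from this[OF ij(1)] this[OF ij(2)] have "?s (?\<tau> j) \<le> ?s (?\<tau> i)"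
      using le rk_le_iff[of "{1..p+q} - A"] by (simp add: shinv_def del: One_nat_def)
    then show "j \<le> i" by (simp only: st)
  qed auto
  ultimately show "?\<tau> \<in> shuffles_perm p q" using t by (simp add: shuffles_perm_def)
qed

text \<open>A shuffle is determined by the image of its first block; these images are transported
  from \<open>{1..p + q}\<close> to subsets of \<open>S\<close> along the ranks.\<close>

lemma sum_shuffles:
  assumes S: "finite S" "card S = p + q"
  shows "(\<Sum>\<tau>\<in>shuffles_perm p q. F (inv_into UNIV \<tau>)) = (\<Sum>T | T \<subseteq> S \<and> card T = p. F (shinv (rk S ` T) (p + q)))"
proof -
  have "(\<Sum>\<tau>\<in>shuffles_perm p q. F (inv_into UNIV \<tau>)) = (\<Sum>A | A \<subseteq> {1..p+q} \<and> card A = p. F (shinv A (p + q)))"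
  proof (rule sum.reindex_bij_witness[of _ "\<lambda>A. inv_into UNIV (shinv A (p + q))" "\<lambda>\<tau>. \<tau> ` {1..p}"])
    fix \<tau> assume t: "\<tau> \<in> shuffles_perm p q"
    then have tp: "\<tau> permutes {1..p+q}" by (simp add: shuffles_perm_def)
    show "inv_into UNIV (shinv (\<tau> ` {1..p}) (p + q)) = \<tau>"
      using shuffle_inv[OF t] permutes_inv_inv[OF tp] by simp
    have "\<tau> ` {1..p} \<subseteq> \<tau> ` {1..p+q}" by (rule image_mono) auto
    moreover have "card (\<tau> ` {1..p}) = p" using permutes_inj[OF tp] by (simp add: card_image inj_on_subset)
    ultimately show "\<tau> ` {1..p} \<in> {A. A \<subseteq> {1..p+q} \<and> card A = p}" using permutes_image[OF tp] by simp
    show "F (shinv (\<tau> ` {1..p}) (p + q)) = F (inv_into UNIV \<tau>)" using shuffle_inv[OF t] by simp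
  qed (use shinv_shuffle in auto)
  also have "\<dots> = (\<Sum>T | T \<subseteq> S \<and> card T = p. F (shinv (rk S ` T) (p + q)))"
  proof (rule sum.reindex_bij_witness[of _ "\<lambda>T. rk S ` T" "\<lambda>A. {v \<in> S. rk S v \<in> A}"])
    have b: "rk S ` S = {1..p+q}" using rk_bij[OF S(1)] S(2) by (auto simp: bij_betw_def)
    have inj: "inj_on (rk S) S" by (rule rk_inj[OF S(1)])
    fix A assume A: "A \<in> {A. A \<subseteq> {1..p+q} \<and> card A = p}"
    show e: "rk S ` {v \<in> S. rk S v \<in> A} = A" using A b by auto
    have "card (rk S ` {v \<in> S. rk S v \<in> A}) = card {v \<in> S. rk S v \<in> A}"
      by (rule card_image) (use inj in \<open>auto intro: inj_on_subset\<close>)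
    then show "{v \<in> S. rk S v \<in> A} \<in> {T. T \<subseteq> S \<and> card T = p}" using A e by simp
    show "F (shinv (rk S ` {v \<in> S. rk S v \<in> A}) (p + q)) = F (shinv A (p + q))" by (simp only: e)
  next
    have b: "rk S ` S = {1..p+q}" using rk_bij[OF S(1)] S(2) by (auto simp: bij_betw_def)
    have inj: "inj_on (rk S) S" by (rule rk_inj[OF S(1)])
    fix T assume T: "T \<in> {T. T \<subseteq> S \<and> card T = p}"
    show "{v \<in> S. rk S v \<in> rk S ` T} = T" using T inj by (auto simp: inj_on_def)
    have "card (rk S ` T) = card T" by (rule card_image) (use inj T in \<open>auto intro: inj_on_subset\<close>)
    moreover have "rk S ` T \<subseteq> rk S ` S" using T by blast
    ultimately show "rk S ` T \<in> {A. A \<subseteq> {1..p+q} \<and> card A = p}" using T b by simp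
  qed
  finally show ?thesis .
qed

lemma shinv_rk:
  assumes S: "finite S" "card S = n" "T \<subseteq> S" "v \<in> S"
  shows "shinv (rk S ` T) n (rk S v) = (if v \<in> T then rk T v else card T + rk (S - T) v)"
proof -
  have inj: "inj_on (rk S) S" by (rule rk_inj[OF S(1)])
  have b: "rk S ` S = {1..n}" using rk_bij[OF S(1)] S(2) by (auto simp: bij_betw_def)
  have m: "rk S v \<in> rk S ` T \<longleftrightarrow> v \<in> T" using inj S by (auto simp: inj_on_def)
  have D: "{1..n} - rk S ` T = rk S ` (S - T)"
    unfolding b[symmetric] by (rule inj_on_image_set_diff[OF inj, symmetric]) (use S in auto)
  have c: "card (rk S ` T) = card T" by (rule card_image) (use inj S in \<open>auto intro: inj_on_subset\<close>)
  have "rk S v \<in> {1..n}" using b S by blast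
  then show ?thesis
    unfolding shinv_def m D c using S by (simp add: rk_rk)
qed

subsection \<open>Labellings and evaluation\<close>

definition wpos :: "nat list \<Rightarrow> nat \<Rightarrow> nat" where
  "wpos ws v = Suc (length (takeWhile (\<lambda>u. u \<noteq> v) ws))"

lemma wpos_append: "wpos (a @ c) v = (if v \<in> set a then wpos a v else length a + wpos c v)"
  by (induction a) (auto simp: wpos_def)

lemma wpos_single: "wpos (v # c) v = 1" by (simp add: wpos_def)

lemma wpos_Cons: "wpos (u # c) v = (if u = v then 1 else Suc (wpos c v))" by (simp add: wpos_def)

lemma wpos_range: "v \<in> set ws \<Longrightarrow> wpos ws v \<in> {1..length ws}"
  by (induction ws) (auto simp: wpos_Cons)

lemma wpos_nth: "v \<in> set ws \<Longrightarrow> ws ! (wpos ws v - 1) = v"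
  by (induction ws) (auto simp: wpos_Cons nth_Cons' dest: wpos_range)

lemma wpos_inj: "v \<in> set ws \<Longrightarrow> u \<in> set ws \<Longrightarrow> wpos ws u = wpos ws v \<Longrightarrow> u = v"
  by (metis wpos_nth)

text \<open>The default \<open>Black 0\<close> is a vertex of no graph, so evaluation of a vector of
  \<open>KGra\<close> vanishes when an edge has an end outside \<open>S\<close> and
  \<open>ws\<close>.\<close>

definition glab :: "(nat \<Rightarrow> nat) \<Rightarrow> nat set \<Rightarrow> nat list \<Rightarrow> nat \<Rightarrow> vertex" where
  "glab \<phi> S ws v = (if v \<in> S then Black (\<phi> v) else if v \<in> set ws then White (wpos ws v) else Black 0)"

abbreviation lab :: "nat set \<Rightarrow> nat list \<Rightarrow> nat \<Rightarrow> vertex" where "lab S \<equiv> glab (rk S) S"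

type_synonym ngraph = "(nat \<times> nat) list"

text \<open>Subgraphs and quotients can be evaluated on their own vertices without renaming them.
  Black vertices form a set because of invariance, white ones a list because their order
  matters.\<close>

definition ev :: "'k::field_char_0 gvec \<Rightarrow> nat set \<Rightarrow> nat list \<Rightarrow> ngraph \<Rightarrow> 'k" where
  "ev x S ws L = x (map (emap (lab S ws)) L)"

lemma KGra_inv_relabel:
  assumes "x \<in> KGra_inv n k d" "\<pi> permutes {1..n}"
  shows "x (map (emap (relabel_black \<pi>)) L) = x L"
proof -
  have "act n k (inv_into UNIV \<pi>) x = x" and x: "x \<in> KGra n k"
    using assms(1) permutes_inv[OF assms(2)] unfolding KGra_inv_def by blast+
  moreover from this(1) have "act n k (inv_into UNIV \<pi>) x L = x L" by simp
  ultimately show ?thesis using act_coeff_KGra[OF x permutes_inv[OF assms(2)], of L] by (simp only: permutes_inv_inv[OF assms(2)])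
qed

text \<open>Two numberings of the black vertices differ by a permutation of labels, which an
  invariant vector does not see.\<close>

lemma ev_glab:
  assumes x: "x \<in> KGra_inv n k d" and S: "finite S" "card S = n" and \<phi>: "bij_betw \<phi> S {1..n}"
  shows "x (map (emap (glab \<phi> S ws)) L) = ev x S ws L"
proof -
  let ?g = "inv_into S (rk S)"
  define \<pi> where "\<pi> i = (if i \<in> {1..n} then \<phi> (?g i) else i)" for i
  have r: "bij_betw (rk S) S {1..n}" using rk_bij[OF S(1)] S(2) by simp
  have "bij_betw (\<phi> \<circ> ?g) {1..n} {1..n}" using bij_betw_trans[OF bij_betw_inv_into[OF r] \<phi>] .
  then have "bij_betw \<pi> {1..n} {1..n}" by (rule bij_betw_cong[THEN iffD1, rotated]) (simp add: \<pi>_def)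
  then have p: "\<pi> permutes {1..n}" by (rule bij_imp_permutes) (auto simp: \<pi>_def)
  have "relabel_black \<pi> (lab S ws v) = glab \<phi> S ws v" for v
    using r bij_betw_inv_into_left[OF r] bij_betwE[OF r] by (auto simp: glab_def \<pi>_def simp del: One_nat_def)
  then have "map (emap (relabel_black \<pi>)) (map (emap (lab S ws)) L) = map (emap (glab \<phi> S ws)) L"
    by (simp add: map_prod_def case_prod_unfold)
  then show ?thesis using KGra_inv_relabel[OF x p, of "map (emap (lab S ws)) L"] by (simp add: ev_def del: map_map)
qed

lemma lab_mem:
  assumes "finite S"
  shows "lab S ws v \<in> Black ` {1..card S} \<longleftrightarrow> v \<in> S"
    and "lab S ws v \<in> verts (card S) (length ws) \<longleftrightarrow> v \<in> S \<union> set ws"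
  using rk_range[OF assms, of v] wpos_range[of v ws] by (auto simp: glab_def verts_def)

lemma lab_inj: assumes "finite S" shows "inj_on (lab S ws) (S \<union> set ws)"
  using rk_inj[OF assms] by (auto simp: inj_on_def glab_def dest: wpos_inj)

lemma lab_ographs:
  assumes S: "finite S"
  shows "map (emap (lab S ws)) L \<in> ographs (card S) (length ws) \<longleftrightarrow>
    distinct L \<and> (\<forall>e\<in>set L. fst e \<in> S \<and> snd e \<in> S \<union> set ws \<and> fst e \<noteq> snd e)"
proof -
  have *: "inj_on (emap (lab S ws)) (set L)" if "\<forall>e\<in>set L. fst e \<in> S \<union> set ws \<and> snd e \<in> S \<union> set ws"
  proof (rule inj_onI)
    fix e e' assume e: "e \<in> set L" "e' \<in> set L" "emap (lab S ws) e = emap (lab S ws) e'"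
    then have "lab S ws (fst e) = lab S ws (fst e')" "lab S ws (snd e) = lab S ws (snd e')"
      by (auto simp: map_prod_def case_prod_unfold)
    then show "e = e'" using that e lab_inj[OF S, of ws] by (simp add: inj_on_eq_iff prod_eq_iff)
  qed
  show ?thesis
  proof
    assume "map (emap (lab S ws)) L \<in> ographs (card S) (length ws)"
    then have a: "distinct (map (emap (lab S ws)) L)"
      "\<forall>e\<in>set L. lab S ws (fst e) \<in> Black ` {1..card S} \<and> lab S ws (snd e) \<in> verts (card S) (length ws) \<and> lab S ws (fst e) \<noteq> lab S ws (snd e)"
      unfolding ographs_iff by auto
    then show "distinct L \<and> (\<forall>e\<in>set L. fst e \<in> S \<and> snd e \<in> S \<union> set ws \<and> fst e \<noteq> snd e)"
      unfolding lab_mem[OF S] by (auto simp: distinct_map)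
  next
    assume a: "distinct L \<and> (\<forall>e\<in>set L. fst e \<in> S \<and> snd e \<in> S \<union> set ws \<and> fst e \<noteq> snd e)"
    then have b: "\<forall>e\<in>set L. fst e \<in> S \<union> set ws \<and> snd e \<in> S \<union> set ws" by auto
    have "lab S ws (fst e) \<noteq> lab S ws (snd e)" if "e \<in> set L" for e
      using a b that lab_inj[OF S, of ws] unfolding inj_on_def by blast
    then show "map (emap (lab S ws)) L \<in> ographs (card S) (length ws)"
      using a *[OF b] unfolding ographs_iff by (auto simp: distinct_map lab_mem[OF S] simp del: One_nat_def)
  qed
qed

subsection \<open>Contraction of a set of vertices\<close>

text \<open>A set is contracted to one of its own elements, so the quotient graph again has natural
  numbers as vertices.\<close>

definition cn :: "nat set \<Rightarrow> nat \<Rightarrow> nat" where "cn X v = (if v \<in> X then Min X else v)"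

definition sub :: "nat set \<Rightarrow> ngraph \<Rightarrow> ngraph" where "sub X L = filter (inE X) L"

definition quo :: "nat set \<Rightarrow> ngraph \<Rightarrow> ngraph" where
  "quo X L = map (emap (cn X)) (filter (\<lambda>e. \<not> inE X e) L)"

text \<open>The sign of sorting the edges so that the edges inside \<open>X\<close> come last, as
  they do in an insertion.\<close>

definition eps :: "nat set \<Rightarrow> ngraph \<Rightarrow> 'k::field_char_0" where
  "eps X L = (-1) ^ xinv (inE X) (\<lambda>e. \<not> inE X e) L"

definition ctr :: "nat set \<Rightarrow> nat set \<Rightarrow> nat set" where "ctr S T = insert (Min T) (S - T)"

text \<open>The shuffle belonging to \<open>T\<close> numbers \<open>T\<close> first. The contracted
  vertex therefore gets the label 1 instead of the rank of \<open>Min T\<close>, and this is where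
  invariance of \<open>x\<close> enters, through \<open>ev_glab\<close>.\<close>

lemma ins_c_ev:
  fixes x y :: "'k::field_char_0 gvec"
  assumes S: "finite S" "card S = n" "distinct ws" "S \<inter> set ws = {}" and T: "T \<subseteq> S" "T \<noteq> {}" "card T = p"
    and x: "x \<in> KGra_inv (n - p + 1) (length ws) d" and y: "y \<in> KGra p 0"
    and L: "\<forall>e\<in>set L. fst e \<in> S \<and> snd e \<in> S \<union> set ws \<and> fst e \<noteq> snd e" "distinct L"
  shows "ins_c (n - p + 1, length ws) 1 p x y
      (map (emap (relabel_black (shinv (rk S ` T) n))) (map (emap (lab S ws)) L))
    = eps T L * (ev x (ctr S T) ws (quo T L) * ev y T [] (sub T L))"
proof -
  let ?k = "length ws"
  define l where "l v = relabel_black (shinv (rk S ` T) n) (lab S ws v)" for v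
  define c where "c u = (case u of Black j \<Rightarrow> Black (if j \<le> p then 1 else j - p + 1) | White j \<Rightarrow> White j)" for u
  define \<phi> where "\<phi> v = (if v = Min T then 1 else 1 + rk (S - T) v)" for v
  have fT: "finite T" using T S finite_subset by blast
  have p: "1 \<le> p" "p \<le> n" using T fT S card_mono[OF S(1) T(1)] by (auto simp: card_gt_0_iff Suc_le_eq)
  have MT: "Min T \<in> T" using fT T by simp
  have lT: "l v = Black (rk T v)" if "v \<in> T" for v
    using that T shinv_rk[OF S(1,2) T(1), of v] by (auto simp: l_def glab_def)
  have lS: "l v = Black (p + rk (S - T) v)" if "v \<in> S - T" for v
    using that T shinv_rk[OF S(1,2) T(1), of v] by (auto simp: l_def glab_def)
  have lw: "l v = White (wpos ws v)" if "v \<in> set ws" for v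
    using that S by (auto simp: l_def glab_def)
  have rT: "rk T v \<in> {1..p}" if "v \<in> T" for v using rk_range[OF fT that] T by simp
  have cST: "card (S - T) = n - p" using S T fT by (simp add: card_Diff_subset)
  have rS: "rk (S - T) v \<in> {1..n - p}" if "v \<in> S - T" for v using rk_range[OF _ that] S cST by simp
  have mapl: "map (emap (relabel_black (shinv (rk S ` T) n))) (map (emap (lab S ws)) L) = map (emap l) L"
    by (simp add: l_def map_prod_def case_prod_unfold)
  have "rk S ` T \<subseteq> {1..n}" using rk_range[OF S(1)] T(1) S(2) by auto
  then have perm: "shinv (rk S ` T) n permutes {1..n}" by (rule shinv_permutes)
  have Lo: "map (emap l) L \<in> ographs n ?k"
    unfolding mapl[symmetric] map_relabel_ographs[OF perm] using lab_ographs[OF S(1), of ws L] S(2) L by simp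
  have lX: "l v \<in> Black ` {1..p} \<longleftrightarrow> v \<in> T" if "v \<in> S \<union> set ws" for v
    using that lT[of v] lS[of v] lw[of v] rT[of v] rS[of v] by (cases "v \<in> T"; cases "v \<in> S") auto
  have inX: "inE (Black ` {1..p}) (emap l e) \<longleftrightarrow> inE T e" if "e \<in> set L" for e
    using that L(1) lX[of "fst e"] lX[of "snd e"] by (auto simp: inE_def simp del: One_nat_def)
  have "ins_c (n - p + 1, ?k) 1 p x y (map (emap l) L)
    = (-1) ^ xinv (inE (Black ` {1..p})) (\<lambda>e. \<not> inE (Black ` {1..p}) e) (map (emap l) L) *
       (x (map (emap c) (filter (\<lambda>e. \<not> inE (Black ` {1..p}) e) (map (emap l) L)))
         * y (map (emap id) (filter (inE (Black ` {1..p})) (map (emap l) L))))"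
    unfolding ins_c_def prod.case
  proof (rule insertion_coeff[OF _ y])
    show "x \<in> KGra (n - p + 1) ?k" using x by (simp add: KGra_inv_def)
    fix u assume u: "u \<in> verts (n - p + 1) ?k"
    show "black_repl 1 p u = {u' \<in> verts n ?k. c u' = u}"
    proof (cases u)
      case (Black j)
      have j: "1 \<le> j" "j \<le> n - p + 1" using u Black by (auto simp: verts_def)
      show ?thesis unfolding Black
      proof (rule Set.set_eqI)
        fix w
        show "w \<in> black_repl 1 p (Black j) \<longleftrightarrow> w \<in> {u' \<in> verts n ?k. c u' = Black j}"
        proof (cases w)
          case (Black i) then show ?thesis
            using j p by (cases "i \<le> p"; cases "j = 1") (auto simp: verts_def c_def image_iff)
        qed (simp add: c_def image_iff)
      qed
    next
      case (White j)
      have "j \<in> {1..?k}" using u White by (auto simp: verts_def)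
      show ?thesis unfolding White
      proof (rule Set.set_eqI)
        fix w
        show "w \<in> black_repl 1 p (White j) \<longleftrightarrow> w \<in> {u' \<in> verts n ?k. c u' = White j}"
          using \<open>j \<in> {1..?k}\<close> by (cases w) (auto simp: verts_def c_def)
      qed
    qed
  next
    show "Black ` {1..p} \<subseteq> verts n ?k" using p by (auto simp: verts_def)
    show "c u = Black 1" if "u \<in> Black ` {1..p}" for u using that by (auto simp: c_def)
    show "shift (1 - 1) 0 v \<in> Black ` {1..p} \<and> id (shift (1 - 1) 0 v) = v" if "v \<in> verts p 0" for v
      using that by (auto simp: verts_def)
    show "shift (1 - 1) 0 (id u) = u" for u by (cases u) auto
  qed (rule Lo)
  also have "xinv (inE (Black ` {1..p})) (\<lambda>e. \<not> inE (Black ` {1..p}) e) (map (emap l) L)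
      = xinv (inE T) (\<lambda>e. \<not> inE T e) L"
    unfolding xinv_map by (rule xinv_cong) (simp_all add: inX del: One_nat_def)
  also have "filter (inE (Black ` {1..p})) (map (emap l) L) = map (emap l) (sub T L)"
    unfolding filter_map sub_def comp_def by (simp add: inX cong: filter_cong del: One_nat_def)
  also have "map (emap id) (map (emap l) (sub T L)) = map (emap (lab T [])) (sub T L)"
    using lT by (auto simp: sub_def inE_def glab_def)
  also have "filter (\<lambda>e. \<not> inE (Black ` {1..p}) e) (map (emap l) L) = map (emap l) (filter (\<lambda>e. \<not> inE T e) L)"
    unfolding filter_map comp_def by (simp add: inX cong: filter_cong del: One_nat_def)
  also have "map (emap c) (map (emap l) (filter (\<lambda>e. \<not> inE T e) L)) = map (emap (glab \<phi> (ctr S T) ws)) (quo T L)"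
  proof -
    have g: "c (l v) = glab \<phi> (ctr S T) ws (cn T v)" if vin: "v \<in> S \<union> set ws" for v
    proof -
      consider "v \<in> T" | "v \<in> S - T" | "v \<in> set ws" "v \<notin> S" using vin by blast
      then show ?thesis
      proof cases
        case 1 then show ?thesis using rT[OF 1] by (simp add: lT c_def cn_def glab_def ctr_def \<phi>_def)
      next
        case 2 then show ?thesis using rS[OF 2] MT by (auto simp: lS c_def cn_def glab_def ctr_def \<phi>_def)
      next
        case 3
        then have "v \<notin> T" "v \<noteq> Min T" using T MT by auto
        with 3 show ?thesis by (simp add: lw c_def cn_def glab_def ctr_def)
      qed
    qed
    show ?thesis unfolding quo_def using g L(1) by auto
  qed
  also have "x (map (emap (glab \<phi> (ctr S T) ws)) (quo T L)) = ev x (ctr S T) ws (quo T L)"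
  proof (rule ev_glab[OF x])
    show "finite (ctr S T)" using S by (simp add: ctr_def)
    show "card (ctr S T) = n - p + 1" using S MT cST by (simp add: ctr_def)
    have "bij_betw (\<lambda>v. 1 + rk (S - T) v) (S - T) {2..n - p + 1}"
      using bij_betw_trans[OF rk_bij[of "S - T"], of "(+) 1"] bij_betw_plus[of 1 "n - p"] S(1)
      by (simp add: cST comp_def numeral_2_eq_2)
    then have "bij_betw \<phi> (S - T) {2..n - p + 1}"
      by (rule bij_betw_cong[THEN iffD1, rotated]) (use MT in \<open>auto simp: \<phi>_def\<close>)
    moreover have "bij_betw \<phi> {Min T} {1}" by (simp add: \<phi>_def bij_betw_def)
    ultimately have "bij_betw \<phi> ((S - T) \<union> {Min T}) ({2..n - p + 1} \<union> {1})" by (rule bij_betw_combine) auto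
    moreover have "{2..n - p + 1} \<union> {1} = {1..n - p + 1}" by auto
    ultimately show "bij_betw \<phi> (ctr S T) {1..n - p + 1}" by (simp add: ctr_def)
  qed
  finally show ?thesis unfolding mapl by (simp add: eps_def ev_def)
qed

text \<open>Here the black vertices of the outer graph are numbered first, so the shuffle belongs to
  \<open>S - T\<close>, and both factors come out labelled by ranks. The contracted vertex is white
  and takes its place between \<open>a\<close> and \<open>b\<close>.\<close>

lemma ins_o_ev:
  fixes x y :: "'k::field_char_0 gvec"
  assumes S: "finite S" "card S = n" "distinct (a @ I @ b)" "S \<inter> set (a @ I @ b) = {}"
    and T: "T \<subseteq> S" "T \<union> set I \<noteq> {}"
    and x: "x \<in> KGra (card (S - T)) (length a + 1 + length b)" and y: "y \<in> KGra (card T) (length I)"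
    and L: "\<forall>e\<in>set L. fst e \<in> S \<and> snd e \<in> S \<union> set (a @ I @ b) \<and> fst e \<noteq> snd e" "distinct L"
  shows "ins_o (card (S - T), length a + 1 + length b) (length a + 1) (card T, length I) x y
      (map (emap (relabel_black (shinv (rk S ` (S - T)) n))) (map (emap (lab S (a @ I @ b))) L))
    = eps (T \<union> set I) L * (ev x (S - T) (a @ [Min (T \<union> set I)] @ b) (quo (T \<union> set I) L) * ev y T I (sub (T \<union> set I) L))"
proof -
  let ?ws = "a @ I @ b" and ?r = "card (S - T)" and ?t = "card T" and ?i = "length a + 1" and ?q = "length I"
  let ?Y = "T \<union> set I"
  let ?X = "Black ` {?r + 1..?r + ?t} \<union> White ` {?i..<?i + ?q}"
  define l where "l v = relabel_black (shinv (rk S ` (S - T)) n) (lab S ?ws v)" for v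
  define c where "c u = (case u of Black j \<Rightarrow> if j \<le> ?r then Black j else White ?i
     | White j \<Rightarrow> White (if j < ?i then j else if j < ?i + ?q then ?i else j - ?q + 1))" for u
  define ush where "ush u = (case u of Black j \<Rightarrow> Black (j - ?r) | White j \<Rightarrow> White (j - length a))" for u
  have fT: "finite T" using T S finite_subset by blast
  have n: "n = ?r + ?t" using S T fT card_mono[OF S(1) T(1)] by (simp add: card_Diff_subset)
  have MY: "Min ?Y \<in> ?Y" using fT T by (intro Min_in) auto
  have lT: "l v = Black (?r + rk T v)" if "v \<in> T" for v
  proof -
    have "S - (S - T) = T" using T by auto
    with that T shinv_rk[OF S(1,2), of "S - T" v] show ?thesis by (auto simp: l_def glab_def)
  qed
  have lS: "l v = Black (rk (S - T) v)" if "v \<in> S - T" for v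
    using that T shinv_rk[OF S(1,2), of "S - T" v] by (auto simp: l_def glab_def)
  have lw: "l v = White (wpos ?ws v)" if "v \<in> set ?ws" for v
    using that S by (auto simp: l_def glab_def)
  have rT: "rk T v \<in> {1..?t}" if "v \<in> T" for v using rk_range[OF fT that] by simp
  have rS: "rk (S - T) v \<in> {1..?r}" if "v \<in> S - T" for v using rk_range[OF _ that] S by simp
  have wa: "wpos ?ws v = wpos a v \<and> wpos a v \<in> {1..length a}" if "v \<in> set a" for v
    using that wpos_range[OF that] by (simp add: wpos_append)
  have wI: "wpos ?ws v = length a + wpos I v \<and> wpos I v \<in> {1..?q}" if "v \<in> set I" for v
    using that wpos_range[OF that] S by (auto simp: wpos_append)
  have wb: "wpos ?ws v = length a + ?q + wpos b v \<and> wpos b v \<in> {1..length b}" if "v \<in> set b" for v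
    using that wpos_range[OF that] S by (auto simp: wpos_append)
  have mapl: "map (emap (relabel_black (shinv (rk S ` (S - T)) n))) (map (emap (lab S ?ws)) L) = map (emap l) L"
    by (simp add: l_def map_prod_def case_prod_unfold)
  have "rk S ` (S - T) \<subseteq> {1..n}" using rk_range[OF S(1)] S(2) by auto
  then have perm: "shinv (rk S ` (S - T)) n permutes {1..n}" by (rule shinv_permutes)
  have Lo: "map (emap l) L \<in> ographs n (length ?ws)"
    unfolding mapl[symmetric] map_relabel_ographs[OF perm] using lab_ographs[OF S(1), of ?ws L] S(2) L by simp
  have cases: "v \<in> T \<or> v \<in> S - T \<or> v \<in> set a \<or> v \<in> set I \<or> v \<in> set b" if "v \<in> S \<union> set ?ws" for v
    using that by auto
  have dis: "v \<notin> T" "v \<notin> S" if "v \<in> set ?ws" for v using that S T by auto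
  have dab: "v \<notin> set I" if "v \<in> set a \<union> set b" for v using that S by auto
  have lX: "l v \<in> ?X \<longleftrightarrow> v \<in> ?Y" if "v \<in> S \<union> set ?ws" for v
    using cases[OF that]
  proof (elim disjE)
    assume "v \<in> T" then show ?thesis using rT[of v] by (auto simp: lT)
  next
    assume v: "v \<in> S - T"
    then have "v \<notin> set I" using S by auto
    with v show ?thesis using rS[OF v] by (auto simp: lS)
  next
    assume v: "v \<in> set a"
    then have "v \<notin> ?Y" using dis[of v] dab[of v] by auto
    with v show ?thesis using wa[OF v] by (auto simp: lw)
  next
    assume v: "v \<in> set I" then show ?thesis using wI[OF v] by (auto simp: lw)
  next
    assume v: "v \<in> set b"
    then have "v \<notin> ?Y" using dis[of v] dab[of v] by auto
    with v show ?thesis using wb[OF v] by (auto simp: lw)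
  qed
  have inX: "inE ?X (emap l e) \<longleftrightarrow> inE ?Y e" if "e \<in> set L" for e
    using that L(1) lX[of "fst e"] lX[of "snd e"] unfolding inE_def by simp
  have "ins_o (?r, length a + 1 + length b) ?i (?t, ?q) x y (map (emap l) L)
    = (-1) ^ xinv (inE ?X) (\<lambda>e. \<not> inE ?X e) (map (emap l) L) *
       (x (map (emap c) (filter (\<lambda>e. \<not> inE ?X e) (map (emap l) L)))
         * y (map (emap ush) (filter (inE ?X) (map (emap l) L))))"
    unfolding ins_o_def prod.case
  proof (rule insertion_coeff[OF x y])
    fix u assume u: "u \<in> verts ?r (length a + 1 + length b)"
    show "white_repl ?r ?i ?t ?q u = {u' \<in> verts n (length ?ws). c u' = u}"
    proof (cases u)
      case (Black j)
      have j: "1 \<le> j" "j \<le> ?r" using u Black by (auto simp: verts_def)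
      show ?thesis unfolding Black
      proof (rule Set.set_eqI)
        fix w
        show "w \<in> white_repl ?r ?i ?t ?q (Black j) \<longleftrightarrow> w \<in> {u' \<in> verts n (length ?ws). c u' = Black j}"
        proof (cases w)
          case (Black l) then show ?thesis
            using j n by (cases "l \<le> ?r") (auto simp: verts_def c_def image_iff)
        qed (simp add: c_def image_iff)
      qed
    next
      case (White j)
      have j: "j \<in> {1..length a + 1 + length b}" using u White by (auto simp: verts_def)
      show ?thesis unfolding White
      proof (rule Set.set_eqI)
        fix w
        show "w \<in> white_repl ?r ?i ?t ?q (White j) \<longleftrightarrow> w \<in> {u' \<in> verts n (length ?ws). c u' = White j}"
        proof (cases w)
          case (Black l)
          then show ?thesis using j n
            by (cases j ?i rule: linorder_cases; cases "l \<le> ?r") (auto simp: verts_def c_def image_iff)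
        next
          case (White l)
          consider "j < ?i" | "j = ?i" | "j > ?i" by linarith
          then show ?thesis
          proof cases
            case 1
            have "w \<in> {u' \<in> verts n (length ?ws). c u' = White j} \<longleftrightarrow> l = j"
              using White 1 j by (cases "l < ?i"; cases "l < ?i + ?q") (auto simp: verts_def c_def image_iff)
            with White 1 show ?thesis by simp
          next
            case 2
            have "w \<in> {u' \<in> verts n (length ?ws). c u' = White j} \<longleftrightarrow> ?i \<le> l \<and> l < ?i + ?q"
              using White 2 by (cases "l < ?i"; cases "l < ?i + ?q") (auto simp: verts_def c_def image_iff)
            with White 2 show ?thesis by (auto simp: image_iff)
          next
            case 3
            have "w \<in> {u' \<in> verts n (length ?ws). c u' = White j} \<longleftrightarrow> l = j + ?q - 1"
              using White 3 j by (cases "l < ?i"; cases "l < ?i + ?q") (auto simp: verts_def c_def image_iff)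
            with White 3 show ?thesis by simp
          qed
        qed
      qed
    qed
  next
    show "?X \<subseteq> verts n (length ?ws)" using n by (auto simp: verts_def)
    show "c u = White ?i" if "u \<in> ?X" for u using that by (auto simp: c_def)
    show "shift ?r (?i - 1) v \<in> ?X \<and> ush (shift ?r (?i - 1) v) = v" if "v \<in> verts ?t ?q" for v
      using that by (auto simp: verts_def ush_def)
    show "shift ?r (?i - 1) (ush u) = u" if "u \<in> ?X" for u using that by (auto simp: ush_def)
  qed (rule Lo)
  also have "xinv (inE ?X) (\<lambda>e. \<not> inE ?X e) (map (emap l) L)
      = xinv (inE ?Y) (\<lambda>e. \<not> inE ?Y e) L"
    unfolding xinv_map by (rule xinv_cong) (simp_all only: comp_apply inX)
  also have "filter (inE ?X) (map (emap l) L) = map (emap l) (sub ?Y L)"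
    unfolding filter_map sub_def by (rule arg_cong[where f = "map _"], rule filter_cong) (simp_all only: comp_apply inX)
  also have "map (emap ush) (map (emap l) (sub ?Y L)) = map (emap (lab T I)) (sub ?Y L)"
  proof -
    have "ush (l v) = lab T I v" if v: "v \<in> ?Y" for v
    proof (cases "v \<in> T")
      case True then show ?thesis by (simp add: lT ush_def glab_def)
    next
      case False
      then have "v \<in> set I" using v by simp
      with False show ?thesis using wI[of v] lw[of v] by (simp add: ush_def glab_def)
    qed
    then show ?thesis by (auto simp: sub_def inE_def)
  qed
  also have "filter (\<lambda>e. \<not> inE ?X e) (map (emap l) L) = map (emap l) (filter (\<lambda>e. \<not> inE ?Y e) L)"
    unfolding filter_map by (rule arg_cong[where f = "map _"], rule filter_cong) (simp_all only: comp_apply inX)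
  also have "map (emap c) (map (emap l) (filter (\<lambda>e. \<not> inE ?Y e) L)) = map (emap (lab (S - T) (a @ [Min ?Y] @ b))) (quo ?Y L)"
  proof -
    have MS: "Min ?Y \<notin> S - T" "Min ?Y \<notin> set a" "Min ?Y \<notin> set b"
      using MY T dis[of "Min ?Y"] dab[of "Min ?Y"] by auto
    have g: "c (l v) = lab (S - T) (a @ [Min ?Y] @ b) (cn ?Y v)" if "v \<in> S \<union> set ?ws" for v
    proof (cases "v \<in> ?Y")
      case True
      then have "l v \<in> ?X" using lX that by blast
      then have "c (l v) = White ?i" by (auto simp: c_def)
      with True MS show ?thesis by (simp add: cn_def glab_def wpos_append wpos_single)
    next
      case False
      then have cn: "cn ?Y v = v" "v \<noteq> Min ?Y" using MY by (auto simp: cn_def)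
      from cases[OF that] False show ?thesis
      proof (elim disjE)
        assume v: "v \<in> S - T" then show ?thesis using rS[OF v] by (simp add: lS c_def cn glab_def)
      next
        assume v: "v \<in> set a"
        then have "v \<notin> S" using dis by auto
        with v show ?thesis using wa[OF v] by (simp add: lw c_def cn glab_def wpos_append)
      next
        assume v: "v \<in> set b"
        then have "v \<notin> S" "v \<notin> set a" using dis S by auto
        with v cn show ?thesis using wb[OF v] by (simp add: lw c_def cn(1) glab_def wpos_append wpos_Cons)
      qed auto
    qed
    show ?thesis unfolding quo_def using g L(1) by auto
  qed
  finally show ?thesis unfolding mapl by (simp add: eps_def ev_def)
qed

section \<open>The product as a sum over subgraphs and quotients\<close>

section \<open>The pre-Lie product on arbitrary vertex sets\<close>

definition subc :: "nat set \<Rightarrow> nat set set" where "subc S = {T. T \<subseteq> S \<and> T \<noteq> {}}"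

text \<open>What replaces a white vertex is an arbitrary set of black vertices with a consecutive
  block of white ones. Either may be empty, but not both, since their minimum names the contracted
  vertex.\<close>

definition subo :: "nat set \<Rightarrow> nat list \<Rightarrow> (nat set \<times> nat list \<times> nat list \<times> nat list) set" where
  "subo S ws = {(T, a, I, b). T \<subseteq> S \<and> ws = a @ I @ b \<and> T \<union> set I \<noteq> {}}"

type_synonym 'k chat = "nat set \<Rightarrow> ngraph \<Rightarrow> 'k"
type_synonym 'k ohat = "nat set \<Rightarrow> nat list \<Rightarrow> ngraph \<Rightarrow> 'k"

definition starC :: "'k chat \<Rightarrow> 'k chat \<Rightarrow> 'k::field_char_0 chat" where
  "starC F G S L = (\<Sum>T\<in>subc S. eps T L * (F (ctr S T) (quo T L) * G T (sub T L)))"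

definition starO :: "(nat \<Rightarrow> nat \<Rightarrow> nat \<Rightarrow> 'k) \<Rightarrow> 'k ohat \<Rightarrow> 'k ohat \<Rightarrow> 'k::field_char_0 ohat" where
  "starO s F G S ws L = (\<Sum>(T, a, I, b)\<in>subo S ws. s (length a) (length I) (length b) *
     (eps (T \<union> set I) L * (F (S - T) (a @ [Min (T \<union> set I)] @ b) (quo (T \<union> set I) L) * G T I (sub (T \<union> set I) L))))"

abbreviation splits :: "'a list \<Rightarrow> ('a list \<times> 'a list \<times> 'a list) set" where
  "splits ws \<equiv> {(a, I, b). ws = a @ I @ b}"

lemma finite_splits: "finite (splits ws)"
proof (rule finite_subset)
  let ?A = "{xs. set xs \<subseteq> set ws \<and> length xs \<le> length ws}"
  show "splits ws \<subseteq> ?A \<times> ?A \<times> ?A" by auto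
  show "finite (?A \<times> ?A \<times> ?A)" by (intro finite_cartesian_product finite_lists_length_le) auto
qed

lemma sum_splits:
  "(\<Sum>q = 0..length ws. \<Sum>p = 0..q. \<psi> (take p ws) (drop p (take q ws)) (drop q ws)) = (\<Sum>(a, I, b)\<in>splits ws. \<psi> a I b)"
proof -
  have "(\<Sum>q = 0..length ws. \<Sum>p = 0..q. \<psi> (take p ws) (drop p (take q ws)) (drop q ws))
    = (\<Sum>(q, p)\<in>(SIGMA q:{0..length ws}. {0..q}). \<psi> (take p ws) (drop p (take q ws)) (drop q ws))"
    by (simp add: sum.Sigma)
  also have "\<dots> = (\<Sum>(a, I, b)\<in>splits ws. \<psi> a I b)"
  proof (rule sum.reindex_bij_witness[of _ "\<lambda>(a, I, b). (length a + length I, length a)"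
        "\<lambda>(q, p). (take p ws, drop p (take q ws), drop q ws)"])
    fix x assume "x \<in> (SIGMA q:{0..length ws}. {0..q})"
    then obtain q p where x: "x = (q, p)" "q \<le> length ws" "p \<le> q" by auto
    then show "(case case x of (q, p) \<Rightarrow> (take p ws, drop p (take q ws), drop q ws) of (a, I, b) \<Rightarrow> (length a + length I, length a)) = x"
      by simp
    have "take p ws = take p (take q ws)" using x by (simp add: min_def)
    then have "take p ws @ drop p (take q ws) @ drop q ws = ws"
      by (metis append.assoc append_take_drop_id)
    then show "(case x of (q, p) \<Rightarrow> (take p ws, drop p (take q ws), drop q ws)) \<in> splits ws" by (simp add: x)
    show "(case case x of (q, p) \<Rightarrow> (take p ws, drop p (take q ws), drop q ws) of (a, I, b) \<Rightarrow> \<psi> a I b) =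
         (case x of (q, p) \<Rightarrow> \<psi> (take p ws) (drop p (take q ws)) (drop q ws))" by (simp add: x)
  qed auto
  finally show ?thesis .
qed

lemma finite_subc: "finite S \<Longrightarrow> finite (subc S)"
  by (rule finite_subset[of _ "Pow S"]) (auto simp: subc_def)

lemma finite_subo: "finite S \<Longrightarrow> finite (subo S ws)"
  by (rule finite_subset[of _ "Pow S \<times> splits ws"]) (auto simp: subo_def finite_splits)

lemma distinct_filter_split: "distinct (filter P L) \<Longrightarrow> distinct (filter (\<lambda>e. \<not> P e) L) \<Longrightarrow> distinct L"
  by (induction L) (auto split: if_splits)

lemma sum_subsets_card:
  assumes "finite S" "finite P"
  shows "(\<Sum>p\<in>P. \<Sum>T | T \<subseteq> S \<and> card T = p. \<phi> T) = (\<Sum>T | T \<subseteq> S \<and> card T \<in> P. \<phi> T)"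
proof -
  have "(\<Sum>T\<in>(\<Union>p\<in>P. {T. T \<subseteq> S \<and> card T = p}). \<phi> T) = (\<Sum>p\<in>P. \<Sum>T | T \<subseteq> S \<and> card T = p. \<phi> T)"
    by (rule sum.UNION_disjoint) (use assms in auto)
  moreover have "(\<Union>p\<in>P. {T. T \<subseteq> S \<and> card T = p}) = {T. T \<subseteq> S \<and> card T \<in> P}" by auto
  ultimately show ?thesis by simp
qed

definition valid :: "nat set \<Rightarrow> nat list \<Rightarrow> ngraph \<Rightarrow> bool" where
  "valid S ws L \<longleftrightarrow> distinct L \<and> (\<forall>e\<in>set L. fst e \<in> S \<and> snd e \<in> S \<union> set ws \<and> fst e \<noteq> snd e)"

text \<open>For a list \<open>L\<close> that is not a graph on the given vertices the insertions
  vanish; by contraposition every term of the sum over subsets vanishes then, too.\<close>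

lemma valid_quo_sub_c:
  assumes "finite S" "T \<subseteq> S" "T \<noteq> {}" "S \<inter> set ws = {}" "valid (ctr S T) ws (quo T L)" "valid T [] (sub T L)"
  shows "valid S ws L"
proof -
  have M: "Min T \<in> T" using assms finite_subset by (intro Min_in) auto
  have "fst e \<in> S \<and> snd e \<in> S \<union> set ws \<and> fst e \<noteq> snd e" if e: "e \<in> set L" for e
  proof (cases "inE T e")
    case True
    then have "e \<in> set (sub T L)" using e by (simp add: sub_def)
    then show ?thesis using assms(2,6) unfolding valid_def by auto
  next
    case False
    then have "emap (cn T) e \<in> set (quo T L)" using e by (simp add: quo_def)
    then have "fst (emap (cn T) e) \<in> ctr S T \<and> snd (emap (cn T) e) \<in> ctr S T \<union> set ws \<and> fst (emap (cn T) e) \<noteq> snd (emap (cn T) e)"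
      using assms(5) unfolding valid_def by blast
    then show ?thesis using M assms(2) unfolding ctr_def cn_def by (auto split: if_splits)
  qed
  moreover have "distinct L"
    using assms(5,6) by (auto simp: valid_def sub_def quo_def distinct_map intro: distinct_filter_split[of "inE T"])
  ultimately show ?thesis by (simp add: valid_def)
qed

lemma valid_quo_sub_o:
  assumes "finite S" "T \<subseteq> S" "T \<union> set I \<noteq> {}" "S \<inter> set (a @ I @ b) = {}"
    "valid (S - T) (a @ [Min (T \<union> set I)] @ b) (quo (T \<union> set I) L)" "valid T I (sub (T \<union> set I) L)"
  shows "valid S (a @ I @ b) L"
proof -
  let ?X = "T \<union> set I"
  have M: "Min ?X \<in> ?X" using assms finite_subset by (intro Min_in) auto
  then have M': "Min ?X \<notin> S - T" using assms(4) by auto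
  have "fst e \<in> S \<and> snd e \<in> S \<union> set (a @ I @ b) \<and> fst e \<noteq> snd e" if e: "e \<in> set L" for e
  proof (cases "inE ?X e")
    case True
    then have "e \<in> set (sub ?X L)" using e by (simp add: sub_def)
    then show ?thesis using assms(2,6) unfolding valid_def by auto
  next
    case False
    then have "emap (cn ?X) e \<in> set (quo ?X L)" using e by (simp add: quo_def)
    then have *: "cn ?X (fst e) \<in> S - T" "cn ?X (snd e) \<in> (S - T) \<union> set (a @ [Min ?X] @ b)" "cn ?X (fst e) \<noteq> cn ?X (snd e)"
      using assms(5) unfolding valid_def by fastforce+
    have "fst e \<notin> ?X" using *(1) M' by (auto simp: cn_def)
    then have "fst e \<in> S - T" using *(1) by (simp add: cn_def)
    moreover have "snd e \<in> S \<union> set (a @ I @ b)"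
      using *(2) assms(2) M by (cases "snd e \<in> ?X") (auto simp: cn_def)
    moreover have "fst e \<noteq> snd e" using *(3) by auto
    ultimately show ?thesis by auto
  qed
  moreover have "distinct L"
    using assms(5,6) by (auto simp: valid_def sub_def quo_def distinct_map intro: distinct_filter_split[of "inE ?X"])
  ultimately show ?thesis by (simp add: valid_def)
qed

lemma ev_valid:
  assumes "x \<in> KGra (card S) (length ws)" "finite S" "ev x S ws L \<noteq> 0"
  shows "valid S ws L"
  using assms lab_ographs[of S ws L] by (auto simp: KGra_def ev_def valid_def)

lemma card_ctr: assumes "finite S" "T \<subseteq> S" "T \<noteq> {}" shows "card (ctr S T) = card S - card T + 1"
proof -
  have "finite T" using assms finite_subset by auto
  then have "Min T \<in> T" using assms by simp
  then show ?thesis using assms \<open>finite T\<close> by (simp add: ctr_def card_Diff_subset)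
qed

lemma KGra_inv_KGra: "x \<in> KGra_inv n k d \<Longrightarrow> x \<in> KGra n k" by (simp add: KGra_inv_def)

lemma sum_shuffles_ins_c:
  fixes x y :: "'k::field_char_0 gvec"
  assumes S: "finite S" "card S = n" "distinct ws" "S \<inter> set ws = {}" and p: "1 \<le> p" "p \<le> n"
    and x: "x \<in> KGra_inv (n - p + 1) (length ws) d" and y: "y \<in> KGra p 0"
  shows "(\<Sum>\<tau>\<in>shuffles_perm p (n - p). act n (length ws) \<tau> (ins_c (n - p + 1, length ws) 1 p x y) (map (emap (lab S ws)) L))
    = (\<Sum>T | T \<subseteq> S \<and> card T = p. eps T L * (ev x (ctr S T) ws (quo T L) * ev y T [] (sub T L)))"
proof (cases "valid S ws L")
  case True
  then have V: "map (emap (lab S ws)) L \<in> ographs n (length ws)" using lab_ographs[OF S(1), of ws L] S(2) by (simp add: valid_def)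
  have "(\<Sum>\<tau>\<in>shuffles_perm p (n - p). act n (length ws) \<tau> (ins_c (n - p + 1, length ws) 1 p x y) (map (emap (lab S ws)) L))
    = (\<Sum>\<tau>\<in>shuffles_perm p (n - p). ins_c (n - p + 1, length ws) 1 p x y (map (emap (relabel_black (inv_into UNIV \<tau>))) (map (emap (lab S ws)) L)))"
  proof (rule sum.cong[OF refl])
    fix \<tau> assume "\<tau> \<in> shuffles_perm p (n - p)"
    then have "\<tau> permutes {1..n}" using p by (simp add: shuffles_perm_def)
    from act_coeff[OF alt_ins_c this, of "length ws" "(n - p + 1, length ws)" 1 p x y "map (emap (lab S ws)) L"] V
    show "act n (length ws) \<tau> (ins_c (n - p + 1, length ws) 1 p x y) (map (emap (lab S ws)) L)
      = ins_c (n - p + 1, length ws) 1 p x y (map (emap (relabel_black (inv_into UNIV \<tau>))) (map (emap (lab S ws)) L))"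
      by (simp only: if_True)
  qed
  also have "\<dots> = (\<Sum>T | T \<subseteq> S \<and> card T = p. ins_c (n - p + 1, length ws) 1 p x y (map (emap (relabel_black (shinv (rk S ` T) n))) (map (emap (lab S ws)) L)))"
    using sum_shuffles[OF S(1), of p "n - p" "\<lambda>\<tau>. ins_c (n - p + 1, length ws) 1 p x y (map (emap (relabel_black \<tau>)) (map (emap (lab S ws)) L))"]
      S(2) p by (simp only: le_add_diff_inverse)
  also have "\<dots> = (\<Sum>T | T \<subseteq> S \<and> card T = p. eps T L * (ev x (ctr S T) ws (quo T L) * ev y T [] (sub T L)))"
  proof (rule sum.cong[OF refl])
    fix T assume T: "T \<in> {T. T \<subseteq> S \<and> card T = p}"
    then have "T \<noteq> {}" using p by auto
    with T True show "ins_c (n - p + 1, length ws) 1 p x y (map (emap (relabel_black (shinv (rk S ` T) n))) (map (emap (lab S ws)) L))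
      = eps T L * (ev x (ctr S T) ws (quo T L) * ev y T [] (sub T L))"
      by (intro ins_c_ev[OF S _ _ _ x y]) (auto simp: valid_def)
  qed
  finally show ?thesis .
next
  case False
  then have V: "map (emap (lab S ws)) L \<notin> ographs n (length ws)" using lab_ographs[OF S(1), of ws L] S(2) by (simp add: valid_def)
  have a1: "act n (length ws) \<tau> (ins_c (n - p + 1, length ws) 1 p x y) (map (emap (lab S ws)) L) = 0"
    if "\<tau> \<in> shuffles_perm p (n - p)" for \<tau>
  proof -
    have "\<tau> permutes {1..n}" using p that by (simp add: shuffles_perm_def)
    from act_coeff[OF alt_ins_c this, of "length ws" "(n - p + 1, length ws)" 1 p x y "map (emap (lab S ws)) L"] V show ?thesis by (simp only: if_False)
  qed
  have a2: "eps T L * (ev x (ctr S T) ws (quo T L) * ev y T [] (sub T L)) = 0" if T: "T \<subseteq> S" "card T = p" for T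
  proof (rule ccontr)
    assume nz: "eps T L * (ev x (ctr S T) ws (quo T L) * ev y T [] (sub T L)) \<noteq> 0"
    have Tn: "T \<noteq> {}" using T p by auto
    have "x \<in> KGra (card (ctr S T)) (length ws)" using KGra_inv_KGra[OF x] card_ctr[OF S(1) T(1) Tn] S(2) T(2) by simp
    then have "valid (ctr S T) ws (quo T L)" using nz S(1) by (intro ev_valid[of x]) (auto simp: ctr_def)
    moreover have "y \<in> KGra (card T) (length [])" using y T by simp
    then have "valid T [] (sub T L)" using nz T S(1) finite_subset by (intro ev_valid[of y]) auto
    ultimately show False using False valid_quo_sub_c[OF S(1) T(1) Tn S(4)] by blast
  qed
  show ?thesis
    by (rule trans[OF sum.neutral sum.neutral[symmetric]]) (use a1 a2 in blast)+
qed

lemma lin_ext_0: "lin_ext n k T 0 = 0"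
  by (rule ext) (simp add: lin_ext_def)

lemma lin_ext_T_0: "lin_ext n k (\<lambda>G. 0) x = 0"
  by (rule ext) (simp add: lin_ext_def)

lemma ins_c_0_left: "ins_c mp i n 0 y = 0" by (cases mp) (simp add: ins_c_def lin_ext_0)
lemma ins_c_0_right: "ins_c mp i n x 0 = 0" by (cases mp) (simp add: ins_c_def lin_ext_0 lin_ext_T_0)
lemma ins_o_0_left: "ins_o mp i nq 0 y = 0" by (cases mp; cases nq) (simp add: ins_o_def lin_ext_0)
lemma ins_o_0_right: "ins_o mp i nq x 0 = 0" by (cases mp; cases nq) (simp add: ins_o_def lin_ext_0 lin_ext_T_0)
lemma act_0: "act n k \<tau> 0 = 0" by (simp add: act_def lin_ext_0)

text \<open>The term with no vertices in the inserted graph has no minimum to contract to;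
  \<open>y0\<close> makes the corresponding insertion vanish, so that this term can be set to
  0.\<close>

lemma sum_shuffles_ins_o:
  fixes x y :: "'k::field_char_0 gvec"
  assumes S: "finite S" "card S = n" "distinct (a @ I @ b)" "S \<inter> set (a @ I @ b) = {}" and r: "r \<le> n"
    and x: "x \<in> KGra r (length a + 1 + length b)" and y: "y \<in> KGra (n - r) (length I)"
    and y0: "n - r = 0 \<Longrightarrow> I = [] \<Longrightarrow> y = 0"
  shows "(\<Sum>\<sigma>\<in>shuffles_perm r (n - r). act n (length (a @ I @ b)) \<sigma> (ins_o (r, length a + 1 + length b) (length a + 1) (n - r, length I) x y)
      (map (emap (lab S (a @ I @ b))) L))
    = (\<Sum>T | T \<subseteq> S \<and> card (S - T) = r. if T \<union> set I = {} then 0 else eps (T \<union> set I) L *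
       (ev x (S - T) (a @ [Min (T \<union> set I)] @ b) (quo (T \<union> set I) L) * ev y T I (sub (T \<union> set I) L)))"
proof -
  let ?ws = "a @ I @ b" and ?z = "ins_o (r, length a + 1 + length b) (length a + 1) (n - r, length I) x y"
  let ?t = "\<lambda>T. if T \<union> set I = {} then 0 else eps (T \<union> set I) L *
       (ev x (S - T) (a @ [Min (T \<union> set I)] @ b) (quo (T \<union> set I) L) * ev y T I (sub (T \<union> set I) L))"
  have cT: "card T = n - r" if "T \<subseteq> S" "card (S - T) = r" for T
    using that S card_mono[OF S(1) that(1)] finite_subset[OF that(1) S(1)] by (simp add: card_Diff_subset)
  have fin: "\<sigma> permutes {1..n}" if "\<sigma> \<in> shuffles_perm r (n - r)" for \<sigma> using that r by (simp add: shuffles_perm_def)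
  show ?thesis
  proof (cases "valid S ?ws L")
    case True
    then have V: "map (emap (lab S ?ws)) L \<in> ographs n (length ?ws)" using lab_ographs[OF S(1), of ?ws L] S(2) by (simp add: valid_def)
    have "(\<Sum>\<sigma>\<in>shuffles_perm r (n - r). act n (length ?ws) \<sigma> ?z (map (emap (lab S ?ws)) L))
      = (\<Sum>\<sigma>\<in>shuffles_perm r (n - r). ?z (map (emap (relabel_black (inv_into UNIV \<sigma>))) (map (emap (lab S ?ws)) L)))"
      by (intro sum.cong[OF refl]) (simp only: act_coeff[OF alt_ins_o fin] V if_True)
    also have "\<dots> = (\<Sum>A | A \<subseteq> S \<and> card A = r. ?z (map (emap (relabel_black (shinv (rk S ` A) n))) (map (emap (lab S ?ws)) L)))"
      using sum_shuffles[OF S(1), of r "n - r" "\<lambda>\<tau>. ?z (map (emap (relabel_black \<tau>)) (map (emap (lab S ?ws)) L))"]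
        S(2) r by (simp only: le_add_diff_inverse)
    also have "\<dots> = (\<Sum>T | T \<subseteq> S \<and> card (S - T) = r. ?z (map (emap (relabel_black (shinv (rk S ` (S - T)) n))) (map (emap (lab S ?ws)) L)))"
    proof (rule sum.reindex_bij_witness[of _ "\<lambda>T. S - T" "\<lambda>A. S - A"])
      fix A assume A: "A \<in> {A. A \<subseteq> S \<and> card A = r}"
      then have "S - (S - A) = A" by auto
      with A show "S - (S - A) = A" "S - A \<in> {T. T \<subseteq> S \<and> card (S - T) = r}"
        "?z (map (emap (relabel_black (shinv (rk S ` (S - (S - A))) n))) (map (emap (lab S ?ws)) L)) =
         ?z (map (emap (relabel_black (shinv (rk S ` A) n))) (map (emap (lab S ?ws)) L))" by auto
    qed auto
    also have "\<dots> = (\<Sum>T | T \<subseteq> S \<and> card (S - T) = r. ?t T)"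
    proof (rule sum.cong[OF refl])
      fix T assume T: "T \<in> {T. T \<subseteq> S \<and> card (S - T) = r}"
      show "?z (map (emap (relabel_black (shinv (rk S ` (S - T)) n))) (map (emap (lab S ?ws)) L)) = ?t T"
      proof (cases "T \<union> set I = {}")
        case e: True
        then have "n - r = 0" "I = []" using cT[of T] T by auto
        then have "y = 0" by (rule y0)
        then show ?thesis using e by (simp add: ins_o_0_right)
      next
        case False
        have "?z = ins_o (card (S - T), length a + 1 + length b) (length a + 1) (card T, length I) x y"
          using T cT[of T] by simp
        moreover have "x \<in> KGra (card (S - T)) (length a + 1 + length b)" "y \<in> KGra (card T) (length I)"
          using x y T cT[of T] by auto
        ultimately show ?thesis
          using ins_o_ev[OF S, of T x y L] T True False
          unfolding if_not_P[OF False] by (simp add: valid_def del: map_map)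
      qed
    qed
    finally show ?thesis .
  next
    case False
    then have V: "map (emap (lab S ?ws)) L \<notin> ographs n (length ?ws)" using lab_ographs[OF S(1), of ?ws L] S(2) by (simp add: valid_def)
    have "act n (length ?ws) \<sigma> ?z (map (emap (lab S ?ws)) L) = 0" if "\<sigma> \<in> shuffles_perm r (n - r)" for \<sigma>
      by (simp only: act_coeff[OF alt_ins_o fin[OF that]] V if_False)
    moreover have a2: "?t T = 0" if T: "T \<subseteq> S" "card (S - T) = r" for T
    proof (rule ccontr)
      assume nz: "?t T \<noteq> 0"
      then have Xn: "T \<union> set I \<noteq> {}" by (auto split: if_splits)
      have nz': "ev x (S - T) (a @ [Min (T \<union> set I)] @ b) (quo (T \<union> set I) L) \<noteq> 0" "ev y T I (sub (T \<union> set I) L) \<noteq> 0"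
        using nz by (auto split: if_splits)
      have "x \<in> KGra (card (S - T)) (length (a @ [Min (T \<union> set I)] @ b))" using x T by simp
      then have "valid (S - T) (a @ [Min (T \<union> set I)] @ b) (quo (T \<union> set I) L)"
        using nz' S(1) by (intro ev_valid[of x]) auto
      moreover have "y \<in> KGra (card T) (length I)" using y cT[OF T] by simp
      then have "valid T I (sub (T \<union> set I) L)" using nz' finite_subset[OF T(1) S(1)] by (intro ev_valid[of y]) auto
      ultimately show False using False valid_quo_sub_o[OF S(1) T(1) Xn S(4)] by blast
    qed
    ultimately show ?thesis
      by (intro trans[OF sum.neutral sum.neutral[symmetric]]) blast+
  qed
qed

definition hC :: "'k conv \<Rightarrow> 'k::field_char_0 chat" where "hC f S L = ev (fst f (card S)) S [] L"
definition hO :: "'k conv \<Rightarrow> 'k::field_char_0 ohat" where "hO f S ws L = ev (snd f (card S) (length ws)) S ws L"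

text \<open>The sign of the open insertion with \<open>a = p\<close>, \<open>i = q - p\<close> and
  \<open>b = k - q\<close>, the lengths of the three pieces into which the list of white vertices is
  cut.\<close>

definition osgn :: "int \<Rightarrow> nat \<Rightarrow> nat \<Rightarrow> nat \<Rightarrow> 'k::field_char_0" where
  "osgn d a i b = (-1) powi (int b * int (i + 1) + d * int (b + a))"

lemma zero_KGra_inv: "0 \<in> KGra_inv n k d" by (simp add: KGra_inv_def KGra_def act_0)

lemma conv_degD:
  assumes "f \<in> conv_deg d"
  shows "fst f 0 = 0" "fst f 1 = 0" "snd f 0 0 = 0" "snd f 0 1 = 0"
    "fst f n \<in> KGra_inv n 0 (d + 2 - 2 * int n)" "snd f n k \<in> KGra_inv n k (d + 1 - 2 * int n - int k)"
proof -
  show a: "fst f 0 = 0" "fst f 1 = 0" "snd f 0 0 = 0" "snd f 0 1 = 0" using assms by (auto simp: conv_deg_def)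
  show "fst f n \<in> KGra_inv n 0 (d + 2 - 2 * int n)"
  proof (cases "n \<ge> 2")
    case False
    then have "n = 0 \<or> n = 1" by auto
    then show ?thesis using a zero_KGra_inv by metis
  qed (use assms in \<open>auto simp: conv_deg_def\<close>)
  show "snd f n k \<in> KGra_inv n k (d + 1 - 2 * int n - int k)"
  proof (cases "n \<ge> 1 \<or> k \<ge> 2")
    case False
    then have "n = 0 \<and> (k = 0 \<or> k = 1)" by auto
    then show ?thesis using a zero_KGra_inv by metis
  qed (use assms in \<open>auto simp: conv_deg_def\<close>)
qed

lemma ev_0: "ev 0 S ws L = 0" by (simp add: ev_def)

lemma hC_small: assumes "f \<in> conv_deg d" "card S < 2" shows "hC f S L = 0"
proof -
  have "card S = 0 \<or> card S = 1" using assms(2) by auto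
  then show ?thesis using conv_degD[OF assms(1)] by (auto simp: hC_def ev_0 ev_def)
qed

text \<open>The sum in \<open>starC\<close> also runs over the subsets with one element and over
  \<open>S\<close> itself. They contribute nothing, because closed components on one vertex are
  zero.\<close>

theorem hC_bullet:
  assumes f: "f \<in> conv_deg df" and g: "g \<in> conv_deg dg" and S: "finite S"
  shows "hC (conv_bullet e f g) S L = starC (hC f) (hC g) S L"
proof -
  define n where "n = card S"
  let ?t = "\<lambda>T. eps T L * (hC f (ctr S T) (quo T L) * hC g T (sub T L))"
  have "hC (conv_bullet e f g) S L = (\<Sum>p = 2..n - 1. \<Sum>\<tau>\<in>shuffles_perm p (n - p).
      act n 0 \<tau> (ins_c (n - p + 1, 0) 1 p (fst f (n - p + 1)) (fst g p)) (map (emap (lab S [])) L))"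
    by (simp add: hC_def ev_def conv_bullet_def case_prod_unfold sum_fun_apply n_def)
  also have "\<dots> = (\<Sum>p = 2..n - 1. \<Sum>T | T \<subseteq> S \<and> card T = p. ?t T)"
  proof (rule sum.cong[OF refl])
    fix p assume p: "p \<in> {2..n - 1}"
    have 1: "fst f (n - p + 1) \<in> KGra_inv (n - p + 1) (length ([] :: nat list)) (df + 2 - 2 * int (n - p + 1))" using conv_degD(5)[OF f, of "n - p + 1"] by (simp only: list.size)
    have 2: "fst g p \<in> KGra p 0" using conv_degD(5)[OF g] KGra_inv_KGra by blast
    have pn: "p \<le> n" using p by auto
    have "(\<Sum>\<tau>\<in>shuffles_perm p (n - p). act n 0 \<tau> (ins_c (n - p + 1, 0) 1 p (fst f (n - p + 1)) (fst g p)) (map (emap (lab S [])) L))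
      = (\<Sum>T | T \<subseteq> S \<and> card T = p. eps T L * (ev (fst f (n - p + 1)) (ctr S T) [] (quo T L) * ev (fst g p) T [] (sub T L)))"
      using sum_shuffles_ins_c[OF S n_def[symmetric] _ _ _ _ 1 2, of L] p pn by simp
    also have "\<dots> = (\<Sum>T | T \<subseteq> S \<and> card T = p. ?t T)"
    proof (rule sum.cong[OF refl])
      fix T assume T: "T \<in> {T. T \<subseteq> S \<and> card T = p}"
      then have "T \<noteq> {}" using p by auto
      then have "card (ctr S T) = n - p + 1" using card_ctr[OF S] T by (simp add: n_def)
      then show "eps T L * (ev (fst f (n - p + 1)) (ctr S T) [] (quo T L) * ev (fst g p) T [] (sub T L)) = ?t T"
        using T by (simp add: hC_def)
    qed
    finally show "(\<Sum>\<tau>\<in>shuffles_perm p (n - p). act n 0 \<tau> (ins_c (n - p + 1, 0) 1 p (fst f (n - p + 1)) (fst g p)) (map (emap (lab S [])) L))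
      = (\<Sum>T | T \<subseteq> S \<and> card T = p. ?t T)" .
  qed
  also have "\<dots> = (\<Sum>T | T \<subseteq> S \<and> card T \<in> {2..n - 1}. ?t T)" by (rule sum_subsets_card[OF S]) simp
  also have "\<dots> = starC (hC f) (hC g) S L"
    unfolding starC_def
  proof (rule sum.mono_neutral_left[OF finite_subc[OF S]])
    show "{T. T \<subseteq> S \<and> card T \<in> {2..n - 1}} \<subseteq> subc S" by (auto simp: subc_def)
    show "\<forall>T\<in>subc S - {T. T \<subseteq> S \<and> card T \<in> {2..n - 1}}. ?t T = 0"
    proof
      fix T assume T: "T \<in> subc S - {T. T \<subseteq> S \<and> card T \<in> {2..n - 1}}"
      then have T': "T \<subseteq> S" "T \<noteq> {}" by (auto simp: subc_def)
      have "card T \<le> n" using card_mono[OF S T'(1)] by (simp add: n_def)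
      then consider "card T < 2" | "card T = n" using T T' by fastforce
      then show "?t T = 0"
      proof cases
        case 1 then show ?thesis using hC_small[OF g] by simp
      next
        case 2
        then have "card (ctr S T) < 2" using card_ctr[OF S T'] by (simp add: n_def)
        then show ?thesis using hC_small[OF f] by simp
      qed
    qed
  qed
  finally show ?thesis .
qed

text \<open>For the closed insertions only the subsets with one element have to be added to the
  range. In the open ones the numbers \<open>p\<close>, \<open>q\<close> and \<open>r\<close>
  disappear into the splittings of \<open>ws\<close> and the subsets of \<open>S\<close>.\<close>

theorem hO_bullet:
  assumes f: "f \<in> conv_deg df" and g: "g \<in> conv_deg dg" and S: "finite S" "distinct ws" "S \<inter> set ws = {}"
  shows "hO (conv_bullet e f g) S ws L = (-1) powi (e * (int (length ws) + 1)) * starC (\<lambda>S. hO f S ws) (hC g) S L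
    + starO (osgn e) (hO f) (hO g) S ws L"
proof -
  define n where "n = card S"
  define k where "k = length ws"
  let ?M = "map (emap (lab S ws)) L"
  let ?t = "\<lambda>T. eps T L * (hO f (ctr S T) ws (quo T L) * hC g T (sub T L))"
  have A: "(\<Sum>p = 2..n. \<Sum>\<tau>\<in>shuffles_perm p (n - p).
            act n k \<tau> (ins_c (n - p + 1, k) 1 p (snd f (n - p + 1) k) (fst g p)) ?M)
    = starC (\<lambda>S. hO f S ws) (hC g) S L"
  proof -
    have "(\<Sum>p = 2..n. \<Sum>\<tau>\<in>shuffles_perm p (n - p).
            act n k \<tau> (ins_c (n - p + 1, k) 1 p (snd f (n - p + 1) k) (fst g p)) ?M)
      = (\<Sum>p = 2..n. \<Sum>T | T \<subseteq> S \<and> card T = p. ?t T)"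
    proof (rule sum.cong[OF refl])
      fix p assume p: "p \<in> {2..n}"
      have 1: "snd f (n - p + 1) k \<in> KGra_inv (n - p + 1) (length ws) (df + 1 - 2 * int (n - p + 1) - int k)" unfolding k_def by (rule conv_degD(6)[OF f])
      have 2: "fst g p \<in> KGra p 0" using conv_degD(5)[OF g] KGra_inv_KGra by blast
      have "(\<Sum>\<tau>\<in>shuffles_perm p (n - p). act n k \<tau> (ins_c (n - p + 1, k) 1 p (snd f (n - p + 1) k) (fst g p)) ?M)
        = (\<Sum>T | T \<subseteq> S \<and> card T = p. eps T L * (ev (snd f (n - p + 1) k) (ctr S T) ws (quo T L) * ev (fst g p) T [] (sub T L)))"
        unfolding k_def using p by (intro sum_shuffles_ins_c[OF S(1) n_def[symmetric] S(2,3) _ _ 1[unfolded k_def] 2]) auto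
      also have "\<dots> = (\<Sum>T | T \<subseteq> S \<and> card T = p. ?t T)"
      proof (rule sum.cong[OF refl])
        fix T assume T: "T \<in> {T. T \<subseteq> S \<and> card T = p}"
        then have "T \<noteq> {}" using p by auto
        then have "card (ctr S T) = n - p + 1" using card_ctr[OF S(1)] T by (simp add: n_def)
        then show "eps T L * (ev (snd f (n - p + 1) k) (ctr S T) ws (quo T L) * ev (fst g p) T [] (sub T L)) = ?t T"
          using T by (simp add: hC_def hO_def k_def)
      qed
      finally show "(\<Sum>\<tau>\<in>shuffles_perm p (n - p). act n k \<tau> (ins_c (n - p + 1, k) 1 p (snd f (n - p + 1) k) (fst g p)) ?M)
        = (\<Sum>T | T \<subseteq> S \<and> card T = p. ?t T)" .
    qed
    also have "\<dots> = (\<Sum>T | T \<subseteq> S \<and> card T \<in> {2..n}. ?t T)" by (rule sum_subsets_card[OF S(1)]) simp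
    also have "\<dots> = starC (\<lambda>S. hO f S ws) (hC g) S L"
      unfolding starC_def
    proof (rule sum.mono_neutral_left[OF finite_subc[OF S(1)]])
      show "{T. T \<subseteq> S \<and> card T \<in> {2..n}} \<subseteq> subc S" by (auto simp: subc_def)
      show "\<forall>T\<in>subc S - {T. T \<subseteq> S \<and> card T \<in> {2..n}}. ?t T = 0"
      proof
        fix T assume T: "T \<in> subc S - {T. T \<subseteq> S \<and> card T \<in> {2..n}}"
        then have T': "T \<subseteq> S" by (auto simp: subc_def)
        have "card T \<le> n" using card_mono[OF S(1) T'(1)] by (simp add: n_def)
        then have "card T < 2" using T T' by fastforce
        then show "?t T = 0" using hC_small[OF g] by simp
      qed
    qed
    finally show ?thesis .
  qed
  let ?s = "\<lambda>T a I b. if T \<union> set I = {} then 0 else osgn e (length a) (length I) (length b) *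
     (eps (T \<union> set I) L * (hO f (S - T) (a @ [Min (T \<union> set I)] @ b) (quo (T \<union> set I) L) * hO g T I (sub (T \<union> set I) L)))"
  have B: "(\<Sum>r = 0..n. \<Sum>\<sigma>\<in>shuffles_perm r (n - r). \<Sum>q = 0..k. \<Sum>p = 0..q.
            (-1) powi (int (k - q) * int (q - p + 1) + e * int (k - q + p)) *
            act n k \<sigma> (ins_o (r, k - q + p + 1) (p + 1) (n - r, q - p)
                          (snd f r (k - q + p + 1)) (snd g (n - r) (q - p))) ?M)
     = starO (osgn e) (hO f) (hO g) S ws L"
  proof -
    let ?z = "\<lambda>r a I b. \<Sum>\<sigma>\<in>shuffles_perm r (n - r). act n (length ws) \<sigma> (ins_o (r, length a + 1 + length b) (length a + 1) (n - r, length I)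
                          (snd f r (length a + 1 + length b)) (snd g (n - r) (length I))) ?M"
    have "(\<Sum>\<sigma>\<in>shuffles_perm r (n - r). \<Sum>q = 0..k. \<Sum>p = 0..q.
            (-1) powi (int (k - q) * int (q - p + 1) + e * int (k - q + p)) *
            act n k \<sigma> (ins_o (r, k - q + p + 1) (p + 1) (n - r, q - p)
                          (snd f r (k - q + p + 1)) (snd g (n - r) (q - p))) ?M)
      = (\<Sum>T | T \<subseteq> S \<and> card (S - T) = r. \<Sum>(a, I, b)\<in>splits ws. ?s T a I b)" if r: "r \<le> n" for r
    proof -
      have "(\<Sum>\<sigma>\<in>shuffles_perm r (n - r). \<Sum>q = 0..k. \<Sum>p = 0..q.
            (-1) powi (int (k - q) * int (q - p + 1) + e * int (k - q + p)) *
            act n k \<sigma> (ins_o (r, k - q + p + 1) (p + 1) (n - r, q - p)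
                          (snd f r (k - q + p + 1)) (snd g (n - r) (q - p))) ?M)
        = (\<Sum>q = 0..k. \<Sum>p = 0..q. (-1) powi (int (k - q) * int (q - p + 1) + e * int (k - q + p)) *
           (\<Sum>\<sigma>\<in>shuffles_perm r (n - r). act n k \<sigma> (ins_o (r, k - q + p + 1) (p + 1) (n - r, q - p)
                          (snd f r (k - q + p + 1)) (snd g (n - r) (q - p))) ?M))"
        by (subst sum.swap, rule sum.cong[OF refl], subst sum.swap) (simp only: sum_distrib_left)
      also have "\<dots> = (\<Sum>q = 0..length ws. \<Sum>p = 0..q.
          osgn e (length (take p ws)) (length (drop p (take q ws))) (length (drop q ws)) * ?z r (take p ws) (drop p (take q ws)) (drop q ws))"
        unfolding k_def
        by (intro sum.cong[OF refl]) (simp add: osgn_def min_def add_ac)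
      also have "\<dots> = (\<Sum>(a, I, b)\<in>splits ws. osgn e (length a) (length I) (length b) * ?z r a I b)"
        by (rule sum_splits)
      also have "\<dots> = (\<Sum>(a, I, b)\<in>splits ws. \<Sum>T | T \<subseteq> S \<and> card (S - T) = r. ?s T a I b)"
      proof (rule sum.cong[OF refl])
        fix x assume "x \<in> splits ws"
        then obtain a I b where xx: "x = (a, I, b)" and ws: "ws = a @ I @ b" by auto
        have 1: "snd f r (length a + 1 + length b) \<in> KGra r (length a + 1 + length b)" using conv_degD(6)[OF f] KGra_inv_KGra by blast
        have 2: "snd g (n - r) (length I) \<in> KGra (n - r) (length I)" using conv_degD(6)[OF g] KGra_inv_KGra by blast
        have 3: "n - r = 0 \<Longrightarrow> I = [] \<Longrightarrow> snd g (n - r) (length I) = 0" using conv_degD(3)[OF g] by simp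
        have cT: "card T = n - r" if "T \<subseteq> S" "card (S - T) = r" for T
          using that card_mono[OF S(1) that(1)] finite_subset[OF that(1) S(1)] by (simp add: card_Diff_subset n_def)
        have "?z r a I b = (\<Sum>T | T \<subseteq> S \<and> card (S - T) = r. if T \<union> set I = {} then 0 else eps (T \<union> set I) L *
             (ev (snd f r (length a + 1 + length b)) (S - T) (a @ [Min (T \<union> set I)] @ b) (quo (T \<union> set I) L) * ev (snd g (n - r) (length I)) T I (sub (T \<union> set I) L)))"
          unfolding ws by (rule sum_shuffles_ins_o[OF S(1) n_def[symmetric] S(2,3)[unfolded ws] r 1 2 3])
        also have "\<dots> = (\<Sum>T | T \<subseteq> S \<and> card (S - T) = r. if T \<union> set I = {} then 0 else eps (T \<union> set I) L *
             (hO f (S - T) (a @ [Min (T \<union> set I)] @ b) (quo (T \<union> set I) L) * hO g T I (sub (T \<union> set I) L)))"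
          by (rule sum.cong[OF refl]) (use cT in \<open>auto simp: hO_def\<close>)
        finally show "(case x of (a, I, b) \<Rightarrow> osgn e (length a) (length I) (length b) * ?z r a I b)
          = (case x of (a, I, b) \<Rightarrow> \<Sum>T | T \<subseteq> S \<and> card (S - T) = r. ?s T a I b)"
          unfolding xx prod.case by (simp only: sum_distrib_left) (intro sum.cong[OF refl], simp)
      qed
      also have "\<dots> = (\<Sum>T | T \<subseteq> S \<and> card (S - T) = r. \<Sum>(a, I, b)\<in>splits ws. ?s T a I b)"
        by (simp only: case_prod_unfold) (rule sum.swap)
      finally show ?thesis .
    qed
    then have "(\<Sum>r = 0..n. \<Sum>\<sigma>\<in>shuffles_perm r (n - r). \<Sum>q = 0..k. \<Sum>p = 0..q.
            (-1) powi (int (k - q) * int (q - p + 1) + e * int (k - q + p)) *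
            act n k \<sigma> (ins_o (r, k - q + p + 1) (p + 1) (n - r, q - p)
                          (snd f r (k - q + p + 1)) (snd g (n - r) (q - p))) ?M)
      = (\<Sum>r = 0..n. \<Sum>T | T \<subseteq> S \<and> card (S - T) = r. \<Sum>(a, I, b)\<in>splits ws. ?s T a I b)"
      by (intro sum.cong[OF refl]) auto
    also have "\<dots> = (\<Sum>T\<in>(\<Union>r\<in>{0..n}. {T. T \<subseteq> S \<and> card (S - T) = r}). \<Sum>(a, I, b)\<in>splits ws. ?s T a I b)"
      by (rule sum.UNION_disjoint[symmetric]) (use S in auto)
    also have "(\<Union>r\<in>{0..n}. {T. T \<subseteq> S \<and> card (S - T) = r}) = Pow S"
      using card_mono[OF S(1)] by (auto simp: n_def intro: card_mono)
    also have "(\<Sum>T\<in>Pow S. \<Sum>(a, I, b)\<in>splits ws. ?s T a I b) = (\<Sum>(T, a, I, b)\<in>Pow S \<times> splits ws. ?s T a I b)"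
      by (subst sum.cartesian_product) (simp add: case_prod_unfold)
    also have "\<dots> = (\<Sum>(T, a, I, b)\<in>subo S ws. ?s T a I b)"
      by (rule sum.mono_neutral_right) (use S finite_splits in \<open>auto simp: subo_def\<close>)
    also have "\<dots> = starO (osgn e) (hO f) (hO g) S ws L"
      unfolding starO_def
    proof (rule sum.cong[OF refl])
      fix x assume "x \<in> subo S ws"
      then obtain T a I b where "x = (T, a, I, b)" "T \<union> set I \<noteq> {}" by (auto simp: subo_def)
      then show "(case x of (T, a, I, b) \<Rightarrow> ?s T a I b) = (case x of (T, a, I, b) \<Rightarrow> osgn e (length a) (length I) (length b) *
         (eps (T \<union> set I) L * (hO f (S - T) (a @ [Min (T \<union> set I)] @ b) (quo (T \<union> set I) L) * hO g T I (sub (T \<union> set I) L))))"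
        by (simp only: prod.case if_False)
    qed
    finally show ?thesis .
  qed
  show ?thesis
    unfolding A[symmetric] B[symmetric] hO_def[of "conv_bullet e f g"] ev_def[of "snd (conv_bullet e f g) (card S) (length ws)"]
    by (simp add: conv_bullet_def case_prod_unfold n_def k_def)
qed

section \<open>Nested and disjoint contractions, and the associators they produce\<close>

subsection \<open>Iterated contractions\<close>

lemma minus_one_powi: "(-1) powi z = (if even z then 1 else - 1 :: 'k::field_char_0)"
  by (simp add: power_int_minus_left)

lemma minus_one_powi_add: "(-1) powi i * (-1) powi j = ((-1) powi (i + j) :: 'k::field_char_0)"
  by (simp add: minus_one_powi)

lemma filter_filter_comm: "filter P (filter Q L) = filter Q (filter P L)"
  by (simp add: filter_filter conj_commute)

lemma length_filter_split: "length (filter P L) = length (filter P (filter Q L)) + length (filter P (filter (\<lambda>e. \<not> Q e) L))"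
  by (induction L) auto

text \<open>Both sides count the inversions of sorting the list into three blocks: outside
  \<open>Q\<close>, inside \<open>Q\<close> but outside \<open>P\<close>, inside
  \<open>P\<close>.\<close>

lemma xinv_nested:
  assumes "\<And>e. P e \<Longrightarrow> Q e"
  shows "xinv P (\<lambda>e. \<not> P e) L + xinv Q (\<lambda>e. \<not> Q e) (filter (\<lambda>e. \<not> P e) L)
    = xinv Q (\<lambda>e. \<not> Q e) L + xinv P (\<lambda>e. \<not> P e) (filter Q L)"
proof (induction L)
  case (Cons e L)
  have 1: "filter (\<lambda>e. \<not> Q e) (filter (\<lambda>e. \<not> P e) L) = filter (\<lambda>e. \<not> Q e) L"
    using assms by (auto simp: filter_filter intro!: filter_cong)
  have "length (filter (\<lambda>e. \<not> P e) L) = length (filter (\<lambda>e. \<not> P e) (filter Q L)) + length (filter (\<lambda>e. \<not> P e) (filter (\<lambda>e. \<not> Q e) L))"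
    by (rule length_filter_split)
  also have "filter (\<lambda>e. \<not> P e) (filter (\<lambda>e. \<not> Q e) L) = filter (\<lambda>e. \<not> Q e) L"
    using 1 by (simp only: filter_filter_comm)
  finally show ?case using Cons assms[of e] 1 by auto
qed simp

text \<open>The sides sort the blocks of \<open>P\<close> and \<open>Q\<close> to the end in
  opposite orders. A pair with one entry in each block is an inversion for exactly one of the two
  orders, which accounts for the product of the lengths; the doubled term disappears in the
  sign.\<close>

lemma xinv_parallel:
  assumes "\<And>e. P e \<Longrightarrow> \<not> Q e"
  shows "xinv P (\<lambda>e. \<not> P e) L + xinv Q (\<lambda>e. \<not> Q e) (filter (\<lambda>e. \<not> P e) L) + 2 * xinv Q P L
    = xinv Q (\<lambda>e. \<not> Q e) L + xinv P (\<lambda>e. \<not> P e) (filter (\<lambda>e. \<not> Q e) L) + length (filter P L) * length (filter Q L)"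
proof (induction L)
  case (Cons e L)
  have "filter (\<lambda>e. \<not> P e) (filter Q L) = filter Q L" "filter (\<lambda>e. \<not> Q e) (filter P L) = filter P L"
    using assms by (auto simp: filter_filter intro!: filter_cong)
  then have "length (filter (\<lambda>e. \<not> P e) L) = length (filter Q L) + length (filter (\<lambda>e. \<not> P e) (filter (\<lambda>e. \<not> Q e) L))"
    "length (filter (\<lambda>e. \<not> Q e) L) = length (filter P L) + length (filter (\<lambda>e. \<not> Q e) (filter (\<lambda>e. \<not> P e) L))"
    using length_filter_split[of "\<lambda>e. \<not> P e" L Q] length_filter_split[of "\<lambda>e. \<not> Q e" L P] by simp_all
  then show ?case using Cons assms[of e] by (auto simp: filter_filter_comm)
qed simp

lemma xinv_quo: "xinv P Q (quo X L) = xinv (P \<circ> emap (cn X)) (Q \<circ> emap (cn X)) (filter (\<lambda>e. \<not> inE X e) L)"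
  by (simp add: quo_def xinv_map)

context
  fixes X Y :: "nat set"
  assumes X: "X \<noteq> {}" and fin: "finite Y" and XY: "X \<subseteq> Y"
begin

lemma Min_sub: "Min X \<in> X" using X fin XY finite_subset by (intro Min_in) auto

lemma cn_mem_ctr: "cn X v \<in> ctr Y X \<longleftrightarrow> v \<in> Y"
  using Min_sub XY by (auto simp: cn_def ctr_def)

lemma inE_ctr: "inE (ctr Y X) (emap (cn X) e) \<longleftrightarrow> inE Y e"
  by (cases e) (simp add: inE_def cn_mem_ctr)

lemma inE_mono: "inE X e \<Longrightarrow> inE Y e"
  using XY by (auto simp: inE_def)

text \<open>The purpose of contracting to the minimum: contracting \<open>X\<close> first does not
  change the name of the vertex that stands for \<open>Y\<close>.\<close>

lemma Min_ctr: "Min (ctr Y X) = Min Y"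
proof -
  have "finite X" using fin XY finite_subset by blast
  have "Min Y \<le> Min X" using Min_sub XY fin by auto
  show ?thesis
  proof (rule Min_eqI)
    show "finite (ctr Y X)" using fin by (simp add: ctr_def)
    show "Min Y \<le> y" if "y \<in> ctr Y X" for y
      using that \<open>Min Y \<le> Min X\<close> fin by (auto simp: ctr_def)
    have "Min Y \<in> Y" using fin X XY by (intro Min_in) auto
    moreover have "Min Y = Min X" if "Min Y \<in> X"
      using \<open>Min Y \<le> Min X\<close> that \<open>finite X\<close> by (simp add: order_antisym)
    ultimately show "Min Y \<in> ctr Y X" by (auto simp: ctr_def)
  qed
qed

lemma quo_nested: "quo (ctr Y X) (quo X L) = quo Y L"
proof -
  have "cn (ctr Y X) (cn X v) = cn Y v" for v
    using cn_mem_ctr[of v] Min_ctr XY by (auto simp: cn_def)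
  then have "map (emap (cn (ctr Y X))) (map (emap (cn X)) K) = map (emap (cn Y)) K" for K
    by (auto simp: map_prod_def)
  moreover have "filter (\<lambda>e. \<not> inE (ctr Y X) e) (quo X L) = map (emap (cn X)) (filter (\<lambda>e. \<not> inE Y e) L)"
    unfolding quo_def filter_map comp_def inE_ctr using inE_mono by (auto simp: filter_filter intro!: arg_cong[where f = "map _"] filter_cong)
  ultimately show ?thesis by (simp only: quo_def)
qed

lemma sub_quo_nested: "sub (ctr Y X) (quo X L) = quo X (sub Y L)"
  unfolding quo_def sub_def filter_map comp_def inE_ctr
  by (rule arg_cong[where f = "map _"]) (rule filter_filter_comm)

lemma sub_sub: "sub X (sub Y L) = sub X L"
  using inE_mono by (auto simp: sub_def filter_filter intro!: filter_cong)

lemma eps_nested: "eps X L * eps (ctr Y X) (quo X L) = eps Y L * eps X (sub Y L)"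
proof -
  have "xinv (inE (ctr Y X)) (\<lambda>e. \<not> inE (ctr Y X) e) (quo X L) = xinv (inE Y) (\<lambda>e. \<not> inE Y e) (filter (\<lambda>e. \<not> inE X e) L)"
    unfolding xinv_quo comp_def inE_ctr ..
  then show ?thesis
    using xinv_nested[of "inE X" "inE Y" L] inE_mono unfolding eps_def sub_def by (simp flip: power_add)
qed

end

context
  fixes X Y :: "nat set"
  assumes X: "X \<noteq> {}" "finite X" and XY: "X \<inter> Y = {}"
begin

lemma cn_mem_disjoint: "cn X v \<in> Y \<longleftrightarrow> v \<in> Y"
proof -
  have "Min X \<in> X" using X by simp
  then show ?thesis using XY by (auto simp: cn_def)
qed

lemma inE_disjoint: "inE Y (emap (cn X) e) \<longleftrightarrow> inE Y e"
  by (cases e) (simp add: inE_def cn_mem_disjoint)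

lemma inE_excl: "inE Y e \<Longrightarrow> \<not> inE X e"
  using XY by (auto simp: inE_def)

lemma sub_quo_disjoint: "sub Y (quo X L) = sub Y L"
proof -
  have "sub Y (quo X L) = map (emap (cn X)) (filter (inE Y) (filter (\<lambda>e. \<not> inE X e) L))"
    unfolding quo_def sub_def filter_map comp_def inE_disjoint ..
  also have "filter (inE Y) (filter (\<lambda>e. \<not> inE X e) L) = sub Y L"
    using inE_excl by (auto simp: sub_def filter_filter intro!: filter_cong)
  also have "map (emap (cn X)) (sub Y L) = sub Y L"
    using XY by (intro map_idI) (auto simp: sub_def inE_def cn_def)
  finally show ?thesis .
qed

lemma xinv_quo_disjoint: "xinv (inE Y) (\<lambda>e. \<not> inE Y e) (quo X L) = xinv (inE Y) (\<lambda>e. \<not> inE Y e) (filter (\<lambda>e. \<not> inE X e) L)"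
  unfolding xinv_quo comp_def inE_disjoint ..

lemma quo_quo_disjoint: "quo Y (quo X L) = map (emap (cn Y \<circ> cn X)) (filter (\<lambda>e. \<not> inE Y e) (filter (\<lambda>e. \<not> inE X e) L))"
  unfolding quo_def filter_map comp_def inE_disjoint by (simp add: map_prod.comp comp_def)

end

lemma quo_commute:
  assumes "X \<noteq> {}" "finite X" "Y \<noteq> {}" "finite Y" "X \<inter> Y = {}"
  shows "quo Y (quo X L) = quo X (quo Y L)"
proof -
  have "Min X \<in> X" "Min Y \<in> Y" using assms by auto
  then have "cn Y \<circ> cn X = cn X \<circ> cn Y" using assms(5) by (auto simp: cn_def fun_eq_iff)
  moreover have "Y \<inter> X = {}" using assms(5) by auto
  ultimately show ?thesis
    using quo_quo_disjoint[OF assms(1,2,5), of L] quo_quo_disjoint[OF assms(3,4), of X L]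
    by (simp only: filter_filter_comm[of "\<lambda>e. \<not> inE X e" "\<lambda>e. \<not> inE Y e"])
qed

text \<open>The Koszul sign for exchanging the edges of the two subgraphs, each edge being
  odd.\<close>

lemma eps_commute:
  assumes "X \<noteq> {}" "finite X" "Y \<noteq> {}" "finite Y" "X \<inter> Y = {}"
  shows "eps X L * eps Y (quo X L) = (-1) ^ (length (sub X L) * length (sub Y L)) * (eps Y L * eps X (quo Y L))"
proof -
  have YX: "Y \<inter> X = {}" using assms(5) by auto
  have excl: "inE X e \<Longrightarrow> \<not> inE Y e" for e using inE_excl[OF assms(1,2,5)] by blast
  note * = xinv_quo_disjoint[OF assms(1,2,5)] xinv_quo_disjoint[OF assms(3,4) YX]
  have "xinv (inE X) (\<lambda>e. \<not> inE X e) L + xinv (inE Y) (\<lambda>e. \<not> inE Y e) (quo X L) + 2 * xinv (inE Y) (inE X) L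
    = length (sub X L) * length (sub Y L) + (xinv (inE Y) (\<lambda>e. \<not> inE Y e) L + xinv (inE X) (\<lambda>e. \<not> inE X e) (quo Y L))"
    using xinv_parallel[of "inE X" "inE Y" L, OF excl] unfolding * sub_def by simp
  then have "(-1) ^ (xinv (inE X) (\<lambda>e. \<not> inE X e) L + xinv (inE Y) (\<lambda>e. \<not> inE Y e) (quo X L) + 2 * xinv (inE Y) (inE X) L)
    = ((-1) ^ (length (sub X L) * length (sub Y L) + (xinv (inE Y) (\<lambda>e. \<not> inE Y e) L + xinv (inE X) (\<lambda>e. \<not> inE X e) (quo Y L))) :: 'a)"
    by (simp only:)
  then show ?thesis unfolding eps_def by (simp add: power_add)
qed

subsection \<open>Associators\<close>

lemma ctr_ctr_nested: "T \<subseteq> U \<Longrightarrow> U \<subseteq> S \<Longrightarrow> T \<noteq> {} \<Longrightarrow> finite S \<Longrightarrow> ctr (ctr S T) (ctr U T) = ctr S U"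
proof -
  assume a: "T \<subseteq> U" "U \<subseteq> S" "T \<noteq> {}" "finite S"
  have fU: "finite U" using a finite_subset by blast
  have "Min T \<in> T" using Min_sub[OF a(3) fU a(1)] .
  then have "ctr S T - ctr U T = S - U" using a by (auto simp: ctr_def)
  then show ?thesis unfolding ctr_def[of "ctr S T"] Min_ctr[OF a(3) fU a(1)] by (simp add: ctr_def)
qed

lemma mult_middle: "x * (y * z) = x' * (y' * z') \<Longrightarrow> x * (y * (f * z)) = x' * (y' * (f * z'))" for f :: "'a::comm_monoid_mult"
  by (metis mult.left_commute)

text \<open>The part of a double insertion in which the two inserted graphs sit at different
  vertices of the first graph.\<close>

definition parC :: "'k chat \<Rightarrow> 'k chat \<Rightarrow> 'k chat \<Rightarrow> 'k::field_char_0 chat" where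
  "parC F G H S L = (\<Sum>(T, U)\<in>(SIGMA T:subc S. subc (S - T)). eps T L * eps U (quo T L) *
     (F (ctr (ctr S T) U) (quo U (quo T L)) * (G U (sub U L) * H T (sub T L))))"

lemma subc_ctr_split:
  assumes S: "finite S" and T: "T \<in> subc S"
  shows "subc (ctr S T) = {U \<in> subc (ctr S T). Min T \<in> U} \<union> subc (S - T)"
    "{U \<in> subc (ctr S T). Min T \<in> U} \<inter> subc (S - T) = {}"
proof -
  have "finite T" "T \<noteq> {}" using T S finite_subset[of T S] by (auto simp: subc_def)
  then have "Min T \<in> T" by simp
  then show "subc (ctr S T) = {U \<in> subc (ctr S T). Min T \<in> U} \<union> subc (S - T)"
    "{U \<in> subc (ctr S T). Min T \<in> U} \<inter> subc (S - T) = {}"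
    by (auto simp: subc_def ctr_def)
qed

text \<open>After \<open>T\<close> has been contracted, the second set \<open>U\<close> either
  contains the vertex standing for \<open>T\<close>, and then stems from a set containing
  \<open>T\<close>, or it is disjoint from \<open>T\<close>.\<close>

lemma starC_assoc:
  assumes S: "finite S"
  shows "starC (starC F G) H S L = starC F (starC G H) S L + parC F G H S L"
proof -
  define A where "A T U = eps T L * eps U (quo T L) * (F (ctr (ctr S T) U) (quo U (quo T L)) * (G U (sub U (quo T L)) * H T (sub T L)))" for T U
  have fT: "finite T" "T \<noteq> {}" "Min T \<in> T" "T \<subseteq> S" if "T \<in> subc S" for T
    using that S finite_subset[of T S] by (auto simp: subc_def)
  have fc: "finite (subc (ctr S T))" for T using S by (simp add: finite_subc ctr_def)
  have "starC (starC F G) H S L = (\<Sum>T\<in>subc S. \<Sum>U\<in>subc (ctr S T). A T U)"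
    unfolding starC_def A_def by (simp add: sum_distrib_left sum_distrib_right mult_ac)
  also have "\<dots> = (\<Sum>T\<in>subc S. (\<Sum>U | U \<in> subc (ctr S T) \<and> Min T \<in> U. A T U) + (\<Sum>U\<in>subc (S - T). A T U))"
  proof (rule sum.cong[OF refl])
    fix T assume T: "T \<in> subc S"
    have "finite {U \<in> subc (ctr S T). Min T \<in> U}" using fc by simp
    then show "(\<Sum>U\<in>subc (ctr S T). A T U) = (\<Sum>U | U \<in> subc (ctr S T) \<and> Min T \<in> U. A T U) + (\<Sum>U\<in>subc (S - T). A T U)"
      by (subst subc_ctr_split(1)[OF S T], subst sum.union_disjoint)
        (use subc_ctr_split(2)[OF S T] finite_subc S in auto)
  qed
  also have "\<dots> = (\<Sum>T\<in>subc S. \<Sum>U | U \<in> subc (ctr S T) \<and> Min T \<in> U. A T U) + (\<Sum>T\<in>subc S. \<Sum>U\<in>subc (S - T). A T U)"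
    by (rule sum.distrib)
  also have "(\<Sum>T\<in>subc S. \<Sum>U\<in>subc (S - T). A T U) = parC F G H S L"
    unfolding parC_def
  proof (subst sum.Sigma)
    show "(\<Sum>(T, U)\<in>(SIGMA T:subc S. subc (S - T)). A T U) = (\<Sum>(T, U)\<in>(SIGMA T:subc S. subc (S - T)). eps T L * eps U (quo T L) *
       (F (ctr (ctr S T) U) (quo U (quo T L)) * (G U (sub U L) * H T (sub T L))))"
    proof (rule sum.cong[OF refl])
      fix x assume "x \<in> (SIGMA T:subc S. subc (S - T))"
      then obtain T U where x: "x = (T, U)" "T \<in> subc S" "U \<in> subc (S - T)" by auto
      have "T \<inter> U = {}" using x by (auto simp: subc_def)
      then show "(case x of (T, U) \<Rightarrow> A T U) = (case x of (T, U) \<Rightarrow> eps T L * eps U (quo T L) *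
         (F (ctr (ctr S T) U) (quo U (quo T L)) * (G U (sub U L) * H T (sub T L))))"
        using sub_quo_disjoint[OF fT(2)[OF x(2)] fT(1)[OF x(2)], of U L] by (simp add: x(1) A_def)
    qed
  qed (use S finite_subc in auto)
  also have "(\<Sum>T\<in>subc S. \<Sum>U | U \<in> subc (ctr S T) \<and> Min T \<in> U. A T U) = starC F (starC G H) S L"
  proof -
    have "(\<Sum>T\<in>subc S. \<Sum>U | U \<in> subc (ctr S T) \<and> Min T \<in> U. A T U) = (\<Sum>(T, U)\<in>(SIGMA T:subc S. {U \<in> subc (ctr S T). Min T \<in> U}). A T U)"
      by (rule sum.Sigma) (use S finite_subc fc in auto)
    also have "\<dots> = (\<Sum>(U, T)\<in>(SIGMA U:subc S. subc U). eps U L * eps T (sub U L) * (F (ctr S U) (quo U L) * (G (ctr U T) (quo T (sub U L)) * H T (sub T (sub U L)))))"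
    \<comment> \<open>In one direction the vertex standing for \<open>T\<close> is expanded to
      \<open>T\<close> inside \<open>U\<close>, in the other \<open>T\<close> is contracted inside
      the larger set.\<close>
    proof (rule sum.reindex_bij_witness[of _ "\<lambda>(U, T). (T, ctr U T)" "\<lambda>(T, U). ((U - {Min T}) \<union> T, T)"])
      fix x assume "x \<in> (SIGMA T:subc S. {U \<in> subc (ctr S T). Min T \<in> U})"
      then obtain T U where x: "x = (T, U)" "T \<in> subc S" "U \<in> subc (ctr S T)" "Min T \<in> U" by auto
      have U: "U \<subseteq> insert (Min T) (S - T)" using x by (auto simp: subc_def ctr_def)
      let ?V = "(U - {Min T}) \<union> T"
      have V: "T \<subseteq> ?V" "?V \<subseteq> S" using U fT(4)[OF x(2)] by auto
      then have fV: "finite ?V" using S finite_subset by blast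
      have ct: "ctr ?V T = U" using U x(4) fT(3)[OF x(2)] by (auto simp: ctr_def)
      show "(case case x of (T, U) \<Rightarrow> ((U - {Min T}) \<union> T, T) of (U, T) \<Rightarrow> (T, ctr U T)) = x" by (simp add: x(1) ct)
      show "(case x of (T, U) \<Rightarrow> ((U - {Min T}) \<union> T, T)) \<in> (SIGMA U:subc S. subc U)"
        using V fT(2)[OF x(2)] by (auto simp: x(1) subc_def)
      note N = fT(2)[OF x(2)] fV V(1)
      show "(case case x of (T, U) \<Rightarrow> ((U - {Min T}) \<union> T, T) of (U, T) \<Rightarrow> eps U L * eps T (sub U L) * (F (ctr S U) (quo U L) * (G (ctr U T) (quo T (sub U L)) * H T (sub T (sub U L))))) =
         (case x of (T, U) \<Rightarrow> A T U)"
        using quo_nested[OF N, of L] sub_quo_nested[OF N, of L] sub_sub[OF N, of L] eps_nested[OF N, of L, where 'a = 'a]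
          ctr_ctr_nested[OF V fT(2)[OF x(2)] S] unfolding ct by (simp add: x(1) A_def ct)
    next
      fix x assume "x \<in> (SIGMA U:subc S. subc U)"
      then obtain U T where x: "x = (U, T)" "U \<in> subc S" "T \<in> subc U" by auto
      have T: "T \<in> subc S" "T \<subseteq> U" "U \<subseteq> S" using x by (auto simp: subc_def)
      have M: "Min T \<in> T" using fT(3)[OF T(1)] .
      show "(case case x of (U, T) \<Rightarrow> (T, ctr U T) of (T, U) \<Rightarrow> ((U - {Min T}) \<union> T, T)) = x"
        using M T by (auto simp: x(1) ctr_def)
      show "(case x of (U, T) \<Rightarrow> (T, ctr U T)) \<in> (SIGMA T:subc S. {U \<in> subc (ctr S T). Min T \<in> U})"
        using T by (auto simp: x(1) subc_def ctr_def)
    qed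
    also have "\<dots> = (\<Sum>U\<in>subc S. \<Sum>T\<in>subc U. eps U L * eps T (sub U L) * (F (ctr S U) (quo U L) * (G (ctr U T) (quo T (sub U L)) * H T (sub T (sub U L)))))"
      by (rule sum.Sigma[symmetric]) (use S finite_subc fT in auto)
    also have "\<dots> = starC F (starC G H) S L"
      unfolding starC_def by (simp add: sum_distrib_left sum_distrib_right mult_ac)
    finally show ?thesis .
  qed
  finally show ?thesis .
qed

text \<open>The sets \<open>T\<close> and \<open>U\<close> exchange roles. By assumption the numbers
  of inner edges have the parities of the degrees, so the Koszul sign is the same in all
  terms.\<close>

lemma parC_commute:
  fixes F G H :: "'k::field_char_0 chat"
  assumes S: "finite S" and G: "\<And>U K. G U K \<noteq> 0 \<Longrightarrow> even (int (length K) - dg)"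
    and H: "\<And>U K. H U K \<noteq> 0 \<Longrightarrow> even (int (length K) - dh)"
  shows "parC F G H S L = (-1) powi (dg * dh) * parC F H G S L"
  unfolding parC_def sum_distrib_left
proof (rule sum.reindex_bij_witness[of _ prod.swap prod.swap])
  fix x assume "x \<in> (SIGMA T:subc S. subc (S - T))"
  then obtain T U where x: "x = (T, U)" "T \<in> subc S" "U \<in> subc (S - T)" by auto
  then have TU: "T \<noteq> {}" "finite T" "U \<noteq> {}" "finite U" "T \<inter> U = {}" using S finite_subset by (auto simp: subc_def)
  then have "Min T \<in> T" "Min U \<in> U" by auto
  then have M: "Min T \<in> T" "Min U \<in> U" "Min T \<notin> U" "Min U \<notin> T" using TU(5) by auto
  have cc: "ctr (ctr S T) U = ctr (ctr S U) T" using M TU x by (auto simp: ctr_def subc_def)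
  have "eps T L * eps U (quo T L) * (G U (sub U L) * H T (sub T L))
    = (-1) powi (dg * dh) * (eps U L * eps T (quo U L) * (H T (sub T L) * G U (sub U L)))"
  proof (cases "G U (sub U L) = 0 \<or> H T (sub T L) = 0")
    case False
    then have "even (int (length (sub U L)) - dg)" "even (int (length (sub T L)) - dh)" using G H by blast+
    then have "even (length (sub T L) * length (sub U L)) \<longleftrightarrow> even (dg * dh)" by auto
    then have "(-1) ^ (length (sub T L) * length (sub U L)) = ((-1) powi (dg * dh) :: 'k)"
      by (simp add: minus_one_power_iff minus_one_powi del: even_mult_iff)
    then show ?thesis unfolding eps_commute[OF TU] by (simp add: mult_ac)
  qed auto
  note e = mult_middle[of 1, OF trans[OF mult_1_left this], unfolded mult_1_left]
  show "(-1) powi (dg * dh) * (case prod.swap x of (T, U) \<Rightarrow> eps T L * eps U (quo T L) * (F (ctr (ctr S T) U) (quo U (quo T L)) * (H U (sub U L) * G T (sub T L)))) =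
     (case x of (T, U) \<Rightarrow> eps T L * eps U (quo T L) * (F (ctr (ctr S T) U) (quo U (quo T L)) * (G U (sub U L) * H T (sub T L))))"
    unfolding x(1) prod.swap_def prod.case fst_conv snd_conv cc quo_commute[OF TU] by (simp only: e)
qed (auto simp: subc_def)

lemma finite_fst_subo: "x \<in> subo S ws \<Longrightarrow> finite S \<Longrightarrow> finite (fst x)"
  using finite_subset[of "fst x" S] by (auto simp: subo_def)

subsubsection \<open>A closed and an open graph\<close>

definition parOC :: "(nat \<Rightarrow> nat \<Rightarrow> nat \<Rightarrow> 'k) \<Rightarrow> 'k ohat \<Rightarrow> 'k ohat \<Rightarrow> 'k chat \<Rightarrow> 'k::field_char_0 ohat" where
  "parOC s F G H S ws L = (\<Sum>(T, U, a, I, b)\<in>(SIGMA T:subc S. subo (S - T) ws). s (length a) (length I) (length b) *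
     (eps T L * eps (U \<union> set I) (quo T L) * (F (ctr (S - U) T) (a @ [Min (U \<union> set I)] @ b) (quo (U \<union> set I) (quo T L)) *
       (G U I (sub (U \<union> set I) L) * H T (sub T L)))))"

lemma subo_ctr_split:
  assumes S: "finite S" and T: "T \<in> subc S"
  shows "subo (ctr S T) ws = {x \<in> subo (ctr S T) ws. Min T \<in> fst x} \<union> subo (S - T) ws"
    "{x \<in> subo (ctr S T) ws. Min T \<in> fst x} \<inter> subo (S - T) ws = {}"
proof -
  have "finite T" "T \<noteq> {}" using T S finite_subset[of T S] by (auto simp: subc_def)
  then have "Min T \<in> T" by simp
  then show "subo (ctr S T) ws = {x \<in> subo (ctr S T) ws. Min T \<in> fst x} \<union> subo (S - T) ws"
    "{x \<in> subo (ctr S T) ws. Min T \<in> fst x} \<inter> subo (S - T) ws = {}"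
    by (auto simp: subo_def ctr_def)
qed

text \<open>The dichotomy of \<open>starC_assoc\<close>, applied to the black part \<open>U\<close>
  of the second set. White vertices never lie in the closed set \<open>T\<close>.\<close>

lemma starO_starC_nested:
  fixes F G :: "'k::field_char_0 ohat"
  assumes S: "finite S" "S \<inter> set ws = {}"
  shows "starC (\<lambda>S. starO s F G S ws) H S L =
    starO s F (\<lambda>U I. starC (\<lambda>U. G U I) H U) S ws L + parOC s F G H S ws L"
proof -
  define A where "A T x = (case x of (U, a, I, b) \<Rightarrow> s (length a) (length I) (length b) * (eps T L * eps (U \<union> set I) (quo T L) *
     (F (ctr S T - U) (a @ [Min (U \<union> set I)] @ b) (quo (U \<union> set I) (quo T L)) * (G U I (sub (U \<union> set I) (quo T L)) * H T (sub T L)))))" for T x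
  define B where "B x T = (case x of (U, a, I, b) \<Rightarrow> s (length a) (length I) (length b) * (eps (U \<union> set I) L * eps T (sub (U \<union> set I) L) *
     (F (S - U) (a @ [Min (U \<union> set I)] @ b) (quo (U \<union> set I) L) * (G (ctr U T) I (quo T (sub (U \<union> set I) L)) * H T (sub T (sub (U \<union> set I) L))))))" for x T
  have fT: "finite T" "T \<noteq> {}" "Min T \<in> T" "T \<subseteq> S" if "T \<in> subc S" for T
    using that S finite_subset[of T S] by (auto simp: subc_def)
  have fc: "finite (subo (ctr S T) ws)" for T using S by (simp add: finite_subo ctr_def)
  have "starC (\<lambda>S. starO s F G S ws) H S L = (\<Sum>T\<in>subc S. \<Sum>x\<in>subo (ctr S T) ws. A T x)"
    unfolding starC_def starO_def A_def by (simp add: sum_distrib_left sum_distrib_right case_prod_unfold mult_ac)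
  also have "\<dots> = (\<Sum>T\<in>subc S. (\<Sum>x | x \<in> subo (ctr S T) ws \<and> Min T \<in> fst x. A T x) + (\<Sum>x\<in>subo (S - T) ws. A T x))"
  proof (rule sum.cong[OF refl])
    fix T assume T: "T \<in> subc S"
    have "finite {x \<in> subo (ctr S T) ws. Min T \<in> fst x}" using fc by simp
    then show "(\<Sum>x\<in>subo (ctr S T) ws. A T x) = (\<Sum>x | x \<in> subo (ctr S T) ws \<and> Min T \<in> fst x. A T x) + (\<Sum>x\<in>subo (S - T) ws. A T x)"
      by (subst subo_ctr_split(1)[OF S(1) T], subst sum.union_disjoint)
        (use subo_ctr_split(2)[OF S(1) T] finite_subo S in auto)
  qed
  also have "\<dots> = (\<Sum>T\<in>subc S. \<Sum>x | x \<in> subo (ctr S T) ws \<and> Min T \<in> fst x. A T x) + (\<Sum>T\<in>subc S. \<Sum>x\<in>subo (S - T) ws. A T x)"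
    by (rule sum.distrib)
  also have "(\<Sum>T\<in>subc S. \<Sum>x\<in>subo (S - T) ws. A T x) = parOC s F G H S ws L"
    unfolding parOC_def
  proof (subst sum.Sigma)
    show "(\<Sum>(T, x)\<in>(SIGMA T:subc S. subo (S - T) ws). A T x) = (\<Sum>(T, U, a, I, b)\<in>(SIGMA T:subc S. subo (S - T) ws). s (length a) (length I) (length b) *
     (eps T L * eps (U \<union> set I) (quo T L) * (F (ctr (S - U) T) (a @ [Min (U \<union> set I)] @ b) (quo (U \<union> set I) (quo T L)) *
       (G U I (sub (U \<union> set I) L) * H T (sub T L)))))"
    proof (rule sum.cong[OF refl])
      fix y assume "y \<in> (SIGMA T:subc S. subo (S - T) ws)"
      then obtain T U a I b where y: "y = (T, U, a, I, b)" "T \<in> subc S" "U \<subseteq> S - T" "ws = a @ I @ b" by (auto simp: subo_def)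
      have d: "T \<inter> (U \<union> set I) = {}" using y S fT(4)[OF y(2)] by auto
      have "ctr S T - U = ctr (S - U) T" using fT(3)[OF y(2)] y(3) by (auto simp: ctr_def)
      then show "(case y of (T, x) \<Rightarrow> A T x) = (case y of (T, U, a, I, b) \<Rightarrow> s (length a) (length I) (length b) *
     (eps T L * eps (U \<union> set I) (quo T L) * (F (ctr (S - U) T) (a @ [Min (U \<union> set I)] @ b) (quo (U \<union> set I) (quo T L)) *
       (G U I (sub (U \<union> set I) L) * H T (sub T L)))))"
        using sub_quo_disjoint[OF fT(2)[OF y(2)] fT(1)[OF y(2)] d, of L] by (simp add: y(1) A_def)
    qed
  qed (use S finite_subc finite_subo in auto)
  also have "(\<Sum>T\<in>subc S. \<Sum>x | x \<in> subo (ctr S T) ws \<and> Min T \<in> fst x. A T x) = starO s F (\<lambda>U I. starC (\<lambda>U. G U I) H U) S ws L"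
  proof -
    have "(\<Sum>T\<in>subc S. \<Sum>x | x \<in> subo (ctr S T) ws \<and> Min T \<in> fst x. A T x) = (\<Sum>(T, x)\<in>(SIGMA T:subc S. {x \<in> subo (ctr S T) ws. Min T \<in> fst x}). A T x)"
      by (rule sum.Sigma) (use S finite_subc fc in auto)
    also have "\<dots> = (\<Sum>(x, T)\<in>(SIGMA x:subo S ws. subc (fst x)). B x T)"
    proof (rule sum.reindex_bij_witness[of _ "\<lambda>((U, x), T). (T, (ctr U T, x))" "\<lambda>(T, (U, x)). (((U - {Min T}) \<union> T, x), T)"])
      fix y assume "y \<in> (SIGMA T:subc S. {x \<in> subo (ctr S T) ws. Min T \<in> fst x})"
      then obtain T U a I b where y: "y = (T, (U, (a, I, b)))" "T \<in> subc S" "U \<subseteq> insert (Min T) (S - T)" "Min T \<in> U" "ws = a @ I @ b"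
        by (auto simp: subo_def ctr_def)
      let ?V = "(U - {Min T}) \<union> T"
      have V: "T \<subseteq> ?V" "?V \<subseteq> S" using y(3) fT(4)[OF y(2)] by auto
      then have fV: "finite (?V \<union> set I)" using S finite_subset by blast
      have ct: "ctr ?V T = U" using y(3,4) fT(3)[OF y(2)] by (auto simp: ctr_def)
      have "set I \<inter> T = {}" using S(2) y(5) fT(4)[OF y(2)] by auto
      then have cX: "ctr (?V \<union> set I) T = U \<union> set I" using y(3,4) fT(3)[OF y(2)] by (auto simp: ctr_def)
      have SU: "ctr S T - U = S - ?V" using y(3,4) fT(3)[OF y(2)] by (auto simp: ctr_def)
      show "(\<lambda>((U, x), T). (T, (ctr U T, x))) ((\<lambda>(T, (U, x)). (((U - {Min T}) \<union> T, x), T)) y) = y" by (simp add: y(1) ct)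
      show "(\<lambda>(T, (U, x)). (((U - {Min T}) \<union> T, x), T)) y \<in> (SIGMA x:subo S ws. subc (fst x))"
        using V fT(2)[OF y(2)] y(5) by (auto simp: y(1) subc_def subo_def)
      have "T \<subseteq> ?V \<union> set I" using V by auto
      note N = fT(2)[OF y(2)] fV this
      show "(case (\<lambda>(T, (U, x)). (((U - {Min T}) \<union> T, x), T)) y of (x, T) \<Rightarrow> B x T) = (case y of (T, x) \<Rightarrow> A T x)"
        using quo_nested[OF N, of L] sub_quo_nested[OF N, of L] sub_sub[OF N, of L] eps_nested[OF N, of L, where 'a = 'k] Min_ctr[OF N]
        unfolding cX by (simp add: y(1) A_def B_def ct SU)
    next
      fix y assume "y \<in> (SIGMA x:subo S ws. subc (fst x))"
      moreover obtain U a I b T where y1: "y = ((U, a, I, b), T)" by (metis prod.exhaust)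
      ultimately have y: "y = ((U, (a, I, b)), T)" "U \<subseteq> S" "ws = a @ I @ b" "T \<subseteq> U" "T \<noteq> {}"
        by (simp_all add: subo_def subc_def)
      have T: "T \<in> subc S" using y by (auto simp: subc_def)
      have M: "Min T \<in> T" using fT(3)[OF T] .
      show "(\<lambda>(T, (U, x)). (((U - {Min T}) \<union> T, x), T)) ((\<lambda>((U, x), T). (T, (ctr U T, x))) y) = y"
        using M y(4) by (auto simp: y(1) ctr_def)
      show "(\<lambda>((U, x), T). (T, (ctr U T, x))) y \<in> (SIGMA T:subc S. {x \<in> subo (ctr S T) ws. Min T \<in> fst x})"
        using T y by (auto simp: y(1) subo_def ctr_def)
    qed
    also have "\<dots> = (\<Sum>x\<in>subo S ws. \<Sum>T\<in>subc (fst x). B x T)"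
      by (rule sum.Sigma[symmetric]) (use S finite_subo finite_subc finite_fst_subo in auto)
    also have "\<dots> = starO s F (\<lambda>U I. starC (\<lambda>U. G U I) H U) S ws L"
      unfolding starC_def starO_def B_def by (simp add: sum_distrib_left sum_distrib_right case_prod_unfold mult_ac)
    finally show ?thesis .
  qed
  finally show ?thesis .
qed

text \<open>
  The term in which a closed graph is inserted first and an open one afterwards has no nested part;
  it is the parallel part of the other order.
\<close>

lemma starC_starO_parallel:
  fixes F G :: "'k::field_char_0 ohat"
  assumes S: "finite S" "S \<inter> set ws = {}"
    and G: "\<And>U I K. G U I K \<noteq> 0 \<Longrightarrow> even (int (length K) - (dg + 1 + int (length I)))"
    and H: "\<And>U K. H U K \<noteq> 0 \<Longrightarrow> even (int (length K) - dh)"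
    and s: "\<And>a i b. t a i b = (-1) powi (dh * (dg + 1 + int i)) * s a i b"
  shows "starO s (\<lambda>S ws. starC (\<lambda>S. F S ws) H S) G S ws L = parOC t F G H S ws L"
proof -
  define A where "A x T = (case x of (U, a, I, b) \<Rightarrow> s (length a) (length I) (length b) * (eps (U \<union> set I) L * eps T (quo (U \<union> set I) L) *
     (F (ctr (S - U) T) (a @ [Min (U \<union> set I)] @ b) (quo T (quo (U \<union> set I) L)) * (G U I (sub (U \<union> set I) L) * H T (sub T (quo (U \<union> set I) L))))))" for x T
  have fT: "finite T" "T \<noteq> {}" "Min T \<in> T" "T \<subseteq> S" if "T \<in> subc S" for T
    using that S finite_subset[of T S] by (auto simp: subc_def)
  have "starO s (\<lambda>S ws. starC (\<lambda>S. F S ws) H S) G S ws L = (\<Sum>x\<in>subo S ws. \<Sum>T\<in>subc (S - fst x). A x T)"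
    unfolding starC_def starO_def A_def by (simp add: sum_distrib_left sum_distrib_right case_prod_unfold mult_ac)
  also have "\<dots> = (\<Sum>(x, T)\<in>(SIGMA x:subo S ws. subc (S - fst x)). A x T)"
    by (rule sum.Sigma) (use S finite_subo finite_subc in auto)
  also have "\<dots> = parOC t F G H S ws L"
    unfolding parOC_def
  proof (rule sum.reindex_bij_witness[of _ prod.swap prod.swap])
    fix y assume "y \<in> (SIGMA x:subo S ws. subc (S - fst x))"
    moreover obtain U a I b T where y1: "y = ((U, a, I, b), T)" by (metis prod.exhaust)
    ultimately have y: "y = ((U, a, I, b), T)" "U \<subseteq> S" "ws = a @ I @ b" "T \<subseteq> S - U" "T \<noteq> {}" "U \<union> set I \<noteq> {}"
      by (simp_all add: subo_def subc_def)
    show "prod.swap y \<in> (SIGMA T:subc S. subo (S - T) ws)" using y by (auto simp: subo_def subc_def)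
    let ?X = "U \<union> set I"
    have fin: "finite T" "finite ?X" using y S finite_subset by blast+
    have d: "T \<inter> ?X = {}" "?X \<inter> T = {}" using y S(2) by auto
    have su: "sub T (quo ?X L) = sub T L" by (rule sub_quo_disjoint[OF y(6) fin(2) d(2)])
    have "s (length a) (length I) (length b) * (eps ?X L * eps T (quo ?X L) * (G U I (sub ?X L) * H T (sub T L)))
      = t (length a) (length I) (length b) * (eps T L * eps ?X (quo T L) * (G U I (sub ?X L) * H T (sub T L)))"
    proof (cases "G U I (sub ?X L) = 0 \<or> H T (sub T L) = 0")
      case False
      then have "even (int (length (sub ?X L)) - (dg + 1 + int (length I)))" "even (int (length (sub T L)) - dh)" using G H by blast+
      then have "even (length (sub T L) * length (sub ?X L)) \<longleftrightarrow> even (dh * (dg + 1 + int (length I)))" by auto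
      then have e: "(-1) ^ (length (sub T L) * length (sub ?X L)) = ((-1) powi (dh * (dg + 1 + int (length I))) :: 'k)"
        by (simp add: minus_one_power_iff minus_one_powi del: even_mult_iff)
      have sq: "(-1) powi z * ((-1) powi z * x) = x" for z and x :: 'k by (simp add: minus_one_powi)
      show ?thesis unfolding eps_commute[OF y(5) fin(1) y(6) fin(2) d(1)] e s
        by (simp add: mult_ac sq) (simp only: mult.left_commute[of _ "(-1) powi _"] sq)?
    qed auto
    note e = mult_middle[OF this]
    show "(case prod.swap y of (T, U, a, I, b) \<Rightarrow> t (length a) (length I) (length b) *
     (eps T L * eps (U \<union> set I) (quo T L) * (F (ctr (S - U) T) (a @ [Min (U \<union> set I)] @ b) (quo (U \<union> set I) (quo T L)) *
       (G U I (sub (U \<union> set I) L) * H T (sub T L))))) = (case y of (x, T) \<Rightarrow> A x T)"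
      unfolding y(1) A_def prod.swap_def prod.case fst_conv snd_conv quo_commute[OF y(5) fin(1) y(6) fin(2) d(1)] su by (simp only: e)
  qed (auto simp: subc_def subo_def)
  finally show ?thesis .
qed

subsubsection \<open>Two open graphs\<close>

text \<open>Two disjoint places for insertion. The order of the blocks \<open>I\<close> and
  \<open>J\<close> in \<open>ws\<close> tells left from right; the black sets carry no
  order.\<close>

definition subo2 :: "nat set \<Rightarrow> nat list \<Rightarrow> ((nat set \<times> nat set) \<times> nat list \<times> nat list \<times> nat list \<times> nat list \<times> nat list) set" where
  "subo2 S ws = {((T, U), a, I, c, J, b). T \<subseteq> S \<and> U \<subseteq> S - T \<and> ws = a @ I @ c @ J @ b \<and> T \<union> set I \<noteq> {} \<and> U \<union> set J \<noteq> {}}"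

text \<open>
  In \<open>parL\<close> the graph of \<open>H\<close> sits on the left of the one of \<open>G\<close>, in \<open>parR\<close> on its right.
\<close>

definition parL :: "(nat \<Rightarrow> nat \<Rightarrow> nat \<Rightarrow> 'k) \<Rightarrow> (nat \<Rightarrow> nat \<Rightarrow> nat \<Rightarrow> 'k) \<Rightarrow> 'k ohat \<Rightarrow> 'k ohat \<Rightarrow> 'k ohat \<Rightarrow> 'k::field_char_0 ohat" where
  "parL s t F G H S ws L = (\<Sum>((T, U), a, I, c, J, b)\<in>subo2 S ws.
     s (length a) (length I) (length (c @ J @ b)) * t (length a + 1 + length c) (length J) (length b) *
     (eps (T \<union> set I) L * eps (U \<union> set J) (quo (T \<union> set I) L) *
       (F (S - T - U) (a @ [Min (T \<union> set I)] @ c @ [Min (U \<union> set J)] @ b) (quo (U \<union> set J) (quo (T \<union> set I) L)) *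
         (G U J (sub (U \<union> set J) L) * H T I (sub (T \<union> set I) L)))))"

definition parR :: "(nat \<Rightarrow> nat \<Rightarrow> nat \<Rightarrow> 'k) \<Rightarrow> (nat \<Rightarrow> nat \<Rightarrow> nat \<Rightarrow> 'k) \<Rightarrow> 'k ohat \<Rightarrow> 'k ohat \<Rightarrow> 'k ohat \<Rightarrow> 'k::field_char_0 ohat" where
  "parR s t F G H S ws L = (\<Sum>((T, U), a, I, c, J, b)\<in>subo2 S ws.
     s (length (a @ I @ c)) (length J) (length b) * t (length a) (length I) (length c + 1 + length b) *
     (eps (U \<union> set J) L * eps (T \<union> set I) (quo (U \<union> set J) L) *
       (F (S - T - U) (a @ [Min (T \<union> set I)] @ c @ [Min (U \<union> set J)] @ b) (quo (T \<union> set I) (quo (U \<union> set J) L)) *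
         (G T I (sub (T \<union> set I) L) * H U J (sub (U \<union> set J) L)))))"

lemma append3_eq_cases:
  assumes "a' @ J @ b' = a @ [m] @ b"
  shows "(\<exists>c d. J = c @ [m] @ d \<and> a = a' @ c \<and> b = d @ b') \<or> (\<exists>c. a' = a @ [m] @ c \<and> b = c @ J @ b')
    \<or> (\<exists>c. b' = c @ [m] @ b \<and> a = a' @ J @ c)"
  using assms by (auto simp: append_eq_append_conv2 append_eq_Cons_conv Cons_eq_append_conv)

text \<open>Contracting \<open>T\<close> and \<open>I\<close> leaves their minimum as a white vertex
  between \<open>a\<close> and \<open>b\<close>. The three terms correspond to the second splitting
  having this vertex in its middle, left or right piece; \<open>uv\<close> compares the signs for
  the middle one.\<close>

lemma starO_assoc:
  fixes F G H :: "'k::field_char_0 ohat"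
  assumes S: "finite S" "S \<inter> set ws = {}" "distinct ws"
    and uv: "\<And>a c i d b. s (a + c) i (d + b) * t a (c + 1 + d) b = u a (c + i + d) b * v c i d"
  shows "starO s (starO t F G) H S ws L = starO u F (starO v G H) S ws L + parL s t F G H S ws L + parR s t F G H S ws L"
proof -
  define A where "A x y = (case x of (T, a :: nat list, I, b :: nat list) \<Rightarrow> case y of (U, a', J, b') \<Rightarrow>
     s (length a) (length I) (length b) * t (length a') (length J) (length b') *
     (eps (T \<union> set I) L * eps (U \<union> set J) (quo (T \<union> set I) L) *
     (F (S - T - U) (a' @ [Min (U \<union> set J)] @ b') (quo (U \<union> set J) (quo (T \<union> set I) L)) *
      (G U J (sub (U \<union> set J) (quo (T \<union> set I) L)) * H T I (sub (T \<union> set I) L)))))" for x y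
  define B where "B x y = (case x of (U, a, J, b) \<Rightarrow> case y of (T, c, I, d) \<Rightarrow>
     u (length a) (length J) (length b) * v (length c) (length I) (length d) *
     (eps (U \<union> set J) L * eps (T \<union> set I) (sub (U \<union> set J) L) *
     (F (S - U) (a @ [Min (U \<union> set J)] @ b) (quo (U \<union> set J) L) *
      (G (U - T) (c @ [Min (T \<union> set I)] @ d) (quo (T \<union> set I) (sub (U \<union> set J) L)) * H T I (sub (T \<union> set I) (sub (U \<union> set J) L))))))" for x y
  define Q where "Q x = subo (S - fst x) (fst (snd x) @ [Min (fst x \<union> set (fst (snd (snd x))))] @ snd (snd (snd x)))"
    for x :: "nat set \<times> nat list \<times> nat list \<times> nat list"
  define N where "N = (SIGMA x:subo S ws. subo (fst x) (fst (snd (snd x))))"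
  define i0 where "i0 = (\<lambda>((U :: nat set, a, J :: nat list, b), (T, c, I, d)). ((T, a @ c, I, d @ b), (U - T, a, c @ [Min (T \<union> set I)] @ d, b)))"
  define i1 where "i1 = (\<lambda>((T :: nat set, U :: nat set), a, I, c, J, b). ((T, a, I, c @ J @ b), (U, a @ [Min (T \<union> set I)] @ c, J, b)))"
  define i2 where "i2 = (\<lambda>((T :: nat set, U :: nat set), a, I, c, J, b). ((U, a @ I @ c, J, b), (T, a, I, c @ [Min (U \<union> set J)] @ b)))"
  have finN: "finite N" unfolding N_def using S finite_subo finite_fst_subo by auto
  have finQ: "finite (Q x)" for x unfolding Q_def using S finite_subo by simp
  have inN: "T \<subseteq> U \<and> U \<subseteq> S \<and> ws = a @ (c @ I @ d) @ b \<and> J = c @ I @ d \<and> T \<union> set I \<noteq> {} \<and> finite (U \<union> set J) \<and> T \<union> set I \<subseteq> U \<union> set J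
      \<and> Min (T \<union> set I) \<in> T \<union> set I"
    if "((U, a, J, b), (T, c, I, d)) \<in> N" for U a J b T c I d
  proof -
    have *: "T \<subseteq> U" "U \<subseteq> S" "J = c @ I @ d" "ws = a @ J @ b" "T \<union> set I \<noteq> {}" using that unfolding N_def subo_def by auto
    then have "finite (U \<union> set J)" using S finite_subset by blast
    moreover from this have "finite (T \<union> set I)" using * finite_subset[of T U] by auto
    moreover from this *(5) have "Min (T \<union> set I) \<in> T \<union> set I" by (rule Min_in)
    ultimately show ?thesis using * by auto
  qed
  have in2: "T \<subseteq> S \<and> U \<subseteq> S - T \<and> ws = a @ I @ c @ J @ b \<and> T \<union> set I \<noteq> {} \<and> U \<union> set J \<noteq> {} \<and> finite (T \<union> set I) \<and> finite (U \<union> set J)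
      \<and> (T \<union> set I) \<inter> (U \<union> set J) = {} \<and> Min (T \<union> set I) \<in> T \<union> set I \<and> Min (U \<union> set J) \<in> U \<union> set J"
    if "((T, U), a, I, c, J, b) \<in> subo2 S ws" for T U a I c J b
  proof -
    have *: "T \<subseteq> S" "U \<subseteq> S - T" "ws = a @ I @ c @ J @ b" "T \<union> set I \<noteq> {}" "U \<union> set J \<noteq> {}" using that by (auto simp: subo2_def)
    then have f: "finite (T \<union> set I)" "finite (U \<union> set J)" using S finite_subset by blast+
    have "(T \<union> set I) \<inter> (U \<union> set J) = {}" using * S by auto
    with * f Min_in show ?thesis by meson
  qed
  have fin2: "finite (subo2 S ws)"
  proof (rule finite_subset)
    let ?A = "{xs. set xs \<subseteq> set ws \<and> length xs \<le> length ws}"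
    show "subo2 S ws \<subseteq> (Pow S \<times> Pow S) \<times> ?A \<times> ?A \<times> ?A \<times> ?A \<times> ?A" by (auto simp: subo2_def)
    show "finite ((Pow S \<times> Pow S) \<times> ?A \<times> ?A \<times> ?A \<times> ?A \<times> ?A)"
      using S by (intro finite_cartesian_product finite_lists_length_le) auto
  qed
  have dec: "(SIGMA x:subo S ws. Q x) = i0 ` N \<union> i1 ` subo2 S ws \<union> i2 ` subo2 S ws"
  proof (intro equalityI subsetI)
    fix p assume "p \<in> (SIGMA x:subo S ws. Q x)"
    moreover obtain T a I b U a' J b' where p: "p = ((T, a, I, b), (U, a', J, b'))" by (metis prod.exhaust)
    ultimately have q: "T \<subseteq> S" "ws = a @ I @ b" "T \<union> set I \<noteq> {}" "U \<subseteq> S - T" "a' @ J @ b' = a @ [Min (T \<union> set I)] @ b" "U \<union> set J \<noteq> {}"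
      unfolding Q_def subo_def by auto
    from append3_eq_cases[OF q(5)] show "p \<in> i0 ` N \<union> i1 ` subo2 S ws \<union> i2 ` subo2 S ws"
    proof (elim disjE exE conjE)
      fix c d assume cd: "J = c @ [Min (T \<union> set I)] @ d" "a = a' @ c" "b = d @ b'"
      \<comment> \<open>The contraction is undone: the vertex standing for \<open>T\<close> and
        \<open>I\<close> is replaced by them in the outer set and in the outer block.\<close>
      have "((U \<union> T, a', c @ I @ d, b'), (T, c, I, d)) \<in> N"
        using q cd unfolding N_def subo_def by auto
      moreover have "i0 ((U \<union> T, a', c @ I @ d, b'), (T, c, I, d)) = p"
        using q(4) cd by (auto simp: i0_def p)
      ultimately show ?thesis by (metis UnI1 image_eqI)
    next
      fix c assume c: "a' = a @ [Min (T \<union> set I)] @ c" "b = c @ J @ b'"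
      have "((T, U), a, I, c, J, b') \<in> subo2 S ws" using q c by (auto simp: subo2_def)
      moreover have "i1 ((T, U), a, I, c, J, b') = p" by (simp add: i1_def p c)
      ultimately show ?thesis by (metis UnI1 UnI2 image_eqI)
    next
      fix c assume c: "b' = c @ [Min (T \<union> set I)] @ b" "a = a' @ J @ c"
      have "((U, T), a', J, c, I, b) \<in> subo2 S ws" using q c by (auto simp: subo2_def)
      moreover have "i2 ((U, T), a', J, c, I, b) = p" by (simp add: i2_def p c)
      ultimately show ?thesis by (metis UnI2 image_eqI)
    qed
  next
    fix p assume "p \<in> i0 ` N \<union> i1 ` subo2 S ws \<union> i2 ` subo2 S ws"
    then consider y where "p = i0 y" "y \<in> N" | y where "p = i1 y" "y \<in> subo2 S ws" | y where "p = i2 y" "y \<in> subo2 S ws" by blast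
    then show "p \<in> (SIGMA x:subo S ws. Q x)"
    proof cases
      case 1
      obtain U a J b T c I d where y: "y = ((U, a, J, b), (T, c, I, d))" by (metis prod.exhaust)
      show ?thesis using inN[of U a J b T c I d] 1 unfolding y i0_def Q_def subo_def by auto
    next
      case 2
      obtain T U a I c J b where y: "y = ((T, U), a, I, c, J, b)" by (metis prod.exhaust)
      show ?thesis using in2[of T U a I c J b] 2 unfolding y i1_def Q_def subo_def by auto
    next
      case 3
      obtain T U a I c J b where y: "y = ((T, U), a, I, c, J, b)" by (metis prod.exhaust)
      show ?thesis using in2[of T U a I c J b] 3 unfolding y i2_def Q_def subo_def by auto
    qed
  qed
  text \<open>The contracted vertex distinguishes the three cases and determines the decompositions.\<close>
  have loc: "\<exists>T a I b U a' J b'. p = ((T, a, I, b), (U, a', J, b')) \<and> (p \<in> i0 ` N \<longleftrightarrow> Min (T \<union> set I) \<in> set J)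
      \<and> (p \<in> i1 ` subo2 S ws \<longleftrightarrow> Min (T \<union> set I) \<in> set a') \<and> (p \<in> i2 ` subo2 S ws \<longleftrightarrow> Min (T \<union> set I) \<in> set b')"
    if "p \<in> (SIGMA x:subo S ws. Q x)" for p
  proof -
    obtain T a I b U a' J b' where p: "p = ((T, a, I, b), (U, a', J, b'))" by (metis prod.exhaust)
    have q: "T \<subseteq> S" "ws = a @ I @ b" "T \<union> set I \<noteq> {}" "U \<subseteq> S - T" "a' @ J @ b' = a @ [Min (T \<union> set I)] @ b" "U \<union> set J \<noteq> {}"
      using that unfolding p Q_def subo_def by auto
    let ?m = "Min (T \<union> set I)"
    have "finite (T \<union> set I)" using q(1) S(1) finite_subset by blast
    then have "?m \<in> T \<union> set I" using q(3) by (rule Min_in)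
    then have "?m \<notin> set a" "?m \<notin> set b" using S q(1,2) by auto
    then have "distinct (a @ [?m] @ b)" using S(3) q(2) by auto
    then have d: "distinct (a' @ J @ b')" by (simp only: q(5))
    have n0: "?m \<in> set J" if "p \<in> i0 ` N"
      using that by (auto simp: i0_def p)
    have n1: "?m \<in> set a'" if "p \<in> i1 ` subo2 S ws" using that by (auto simp: i1_def p)
    have n2: "?m \<in> set b'" if "p \<in> i2 ` subo2 S ws" using that by (auto simp: i2_def p)
    have "p \<in> i0 ` N \<union> i1 ` subo2 S ws \<union> i2 ` subo2 S ws" using that dec by simp
    then have "(p \<in> i0 ` N \<longleftrightarrow> ?m \<in> set J) \<and> (p \<in> i1 ` subo2 S ws \<longleftrightarrow> ?m \<in> set a') \<and> (p \<in> i2 ` subo2 S ws \<longleftrightarrow> ?m \<in> set b')"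
      using n0 n1 n2 d by auto
    with p show ?thesis by blast
  qed
  have disj: "i0 ` N \<inter> i1 ` subo2 S ws = {}" "(i0 ` N \<union> i1 ` subo2 S ws) \<inter> i2 ` subo2 S ws = {}"
  proof -
    have "\<not> (p \<in> i0 ` N \<and> p \<in> i1 ` subo2 S ws) \<and> \<not> (p \<in> i0 ` N \<and> p \<in> i2 ` subo2 S ws) \<and> \<not> (p \<in> i1 ` subo2 S ws \<and> p \<in> i2 ` subo2 S ws)" for p
    proof (cases "p \<in> (SIGMA x:subo S ws. Q x)")
      case True
      from loc[OF this] obtain T a I b U a' J b' where p: "p = ((T, a, I, b), (U, a', J, b'))"
        and l: "p \<in> i0 ` N \<longleftrightarrow> Min (T \<union> set I) \<in> set J" "p \<in> i1 ` subo2 S ws \<longleftrightarrow> Min (T \<union> set I) \<in> set a'"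
          "p \<in> i2 ` subo2 S ws \<longleftrightarrow> Min (T \<union> set I) \<in> set b'" by blast
      have q: "T \<subseteq> S" "ws = a @ I @ b" "T \<union> set I \<noteq> {}" "a' @ J @ b' = a @ [Min (T \<union> set I)] @ b"
        using True unfolding p Q_def subo_def by auto
      have "finite (T \<union> set I)" using q(1) S(1) finite_subset by blast
      then have "Min (T \<union> set I) \<in> T \<union> set I" using q(3) by (rule Min_in)
      then have "Min (T \<union> set I) \<notin> set a" "Min (T \<union> set I) \<notin> set b" using S q(1,2) by auto
      then have "distinct (a @ [Min (T \<union> set I)] @ b)" using S(3) q(2) by auto
      then have "distinct (a' @ J @ b')" by (simp only: q(4))
      then show ?thesis unfolding l by auto
    qed (use dec in blast)
    then show "i0 ` N \<inter> i1 ` subo2 S ws = {}" "(i0 ` N \<union> i1 ` subo2 S ws) \<inter> i2 ` subo2 S ws = {}" by blast+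
  qed
  have inj0: "inj_on i0 N"
  proof (rule inj_onI)
    fix y y' assume y: "y \<in> N" "y' \<in> N" "i0 y = i0 y'"
    obtain U a J b T c I d where 1: "y = ((U, a, J, b), (T, c, I, d))" by (metis prod.exhaust)
    obtain U' a' J' b' T' c' I' d' where 2: "y' = ((U', a', J', b'), (T', c', I', d'))" by (metis prod.exhaust)
    have e: "T = T'" "a @ c = a' @ c'" "I = I'" "d @ b = d' @ b'" "U - T = U' - T'" "a = a'" "b = b'"
      using y(3) by (auto simp: 1 2 i0_def)
    note n = inN[OF y(1)[unfolded 1]] inN[OF y(2)[unfolded 2]]
    have "U = U'" using n e(1,5) by blast
    moreover have "c = c'" "d = d'" using e by auto
    ultimately show "y = y'" using n e unfolding 1 2 by auto
  qed
  have inj1: "inj_on i1 (subo2 S ws)" by (rule inj_onI) (auto simp: i1_def)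
  have inj2: "inj_on i2 (subo2 S ws)" by (rule inj_onI) (auto simp: i2_def)
  have "starO s (starO t F G) H S ws L = (\<Sum>x\<in>subo S ws. \<Sum>y\<in>Q x. A x y)"
    unfolding starO_def A_def Q_def by (simp add: sum_distrib_left sum_distrib_right case_prod_unfold mult_ac)
  also have "\<dots> = (\<Sum>(x, y)\<in>(SIGMA x:subo S ws. Q x). A x y)"
    by (rule sum.Sigma) (use S finite_subo finQ in auto)
  also have "\<dots> = (\<Sum>(x, y)\<in>i0 ` N. A x y) + (\<Sum>(x, y)\<in>i1 ` subo2 S ws. A x y) + (\<Sum>(x, y)\<in>i2 ` subo2 S ws. A x y)"
    unfolding dec using finN fin2 disj by (subst sum.union_disjoint, simp, simp, simp) (subst sum.union_disjoint, auto)
  also have "(\<Sum>(x, y)\<in>i0 ` N. A x y) = (\<Sum>(x, y)\<in>N. B x y)"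
  proof (rule sum.reindex_cong[OF inj0 refl])
    fix p assume pN: "p \<in> N"
    obtain U a J b T c I d where p: "p = ((U, a, J, b), (T, c, I, d))" by (metis prod.exhaust)
    note n = inN[OF pN[unfolded p]]
    let ?X = "T \<union> set I" and ?Y = "U \<union> set J"
    have n': "?X \<noteq> {}" "finite ?Y" "?X \<subseteq> ?Y" using n by auto
    have dj: "set (c @ d) \<inter> ?X = {}" "set I \<inter> S = {}" using n S by auto
    have c0: "ctr ?Y ?X = (U - T) \<union> set (c @ [Min ?X] @ d)" using n dj by (auto simp: ctr_def)
    have "S - T - (U - T) = S - U" using n by auto
    then show "(case i0 p of (x, y) \<Rightarrow> A x y) = (case p of (x, y) \<Rightarrow> B x y)"
      using quo_nested[OF n', of L] sub_quo_nested[OF n', of L] sub_sub[OF n', of L] eps_nested[OF n', of L, where 'a = 'k] Min_ctr[OF n']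
        uv[of "length a" "length c" "length I" "length d" "length b"] n
      unfolding c0 p i0_def A_def B_def prod.case by (simp add: add_ac)
  qed
  also have "(\<Sum>(x, y)\<in>N. B x y) = starO u F (starO v G H) S ws L"
    unfolding N_def by (subst sum.Sigma[symmetric])
      (use S finite_subo finite_fst_subo in \<open>auto simp: starO_def B_def sum_distrib_left sum_distrib_right case_prod_unfold mult_ac\<close>)
  also have "(\<Sum>(x, y)\<in>i1 ` subo2 S ws. A x y) = parL s t F G H S ws L"
    unfolding parL_def
  proof (rule sum.reindex_cong[OF inj1 refl], goal_cases)
    case (1 p)
    note pN = 1
    obtain T U a I c J b where p: "p = ((T, U), a, I, c, J, b)" by (metis prod.exhaust)
    have n: "T \<union> set I \<noteq> {}" "finite (T \<union> set I)" "(T \<union> set I) \<inter> (U \<union> set J) = {}" using in2[OF pN[unfolded p]] by auto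
    show ?case
      using sub_quo_disjoint[OF n, of L] unfolding p i1_def A_def prod.case by (simp add: add_ac)
  qed
  also have "(\<Sum>(x, y)\<in>i2 ` subo2 S ws. A x y) = parR s t F G H S ws L"
    unfolding parR_def
  proof (rule sum.reindex_cong[OF inj2 refl], goal_cases)
    case (1 p)
    note pN = 1
    obtain T U a I c J b where p: "p = ((T, U), a, I, c, J, b)" by (metis prod.exhaust)
    have n: "U \<union> set J \<noteq> {}" "finite (U \<union> set J)" "(U \<union> set J) \<inter> (T \<union> set I) = {}" using in2[OF pN[unfolded p]] by auto
    have "S - U - T = S - T - U" by auto
    then show ?case
      using sub_quo_disjoint[OF n, of L] unfolding p i2_def A_def prod.case by (simp add: add_ac)
  qed
  finally show ?thesis .
qed

text \<open>On both sides \<open>G\<close> and \<open>H\<close> occupy the same places and only the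
  order of the contractions differs. The assumption \<open>st\<close> combines the Koszul sign with
  the sign functions.\<close>

lemma parL_parR:
  fixes F G H :: "'k::field_char_0 ohat"
  assumes S: "finite S" "S \<inter> set ws = {}" "distinct ws"
    and G: "\<And>U I K. G U I K \<noteq> 0 \<Longrightarrow> even (int (length K) - (dg + 1 + int (length I)))"
    and H: "\<And>U I K. H U I K \<noteq> 0 \<Longrightarrow> even (int (length K) - (dh + 1 + int (length I)))"
    and st: "\<And>a i c j b. s a i (c + j + b) * t (a + 1 + c) j b * (-1) powi ((dh + 1 + int i) * (dg + 1 + int j))
      = z * (s' (a + i + c) j b * t' a i (c + 1 + b))"
  shows "parL s t F G H S ws L = z * parR s' t' F H G S ws L"
  unfolding parL_def parR_def sum_distrib_left
proof (rule sum.cong[OF refl], goal_cases)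
  case (1 p)
  moreover obtain T U a I c J b where p: "p = ((T, U), a, I, c, J, b)" by (metis prod.exhaust)
  ultimately have q: "T \<subseteq> S" "U \<subseteq> S - T" "ws = a @ I @ c @ J @ b" "T \<union> set I \<noteq> {}" "U \<union> set J \<noteq> {}" by (auto simp: subo2_def)
  let ?X = "T \<union> set I" and ?Y = "U \<union> set J"
  have f: "finite ?X" "finite ?Y" using q S finite_subset by blast+
  have d: "?X \<inter> ?Y = {}" using q S by auto
  have "s (length a) (length I) (length (c @ J @ b)) * t (length a + 1 + length c) (length J) (length b) *
      (eps ?X L * eps ?Y (quo ?X L) * (G U J (sub ?Y L) * H T I (sub ?X L)))
    = z * (s' (length (a @ I @ c)) (length J) (length b) * t' (length a) (length I) (length c + 1 + length b)) *
      (eps ?Y L * eps ?X (quo ?Y L) * (H T I (sub ?X L) * G U J (sub ?Y L)))"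
  proof (cases "G U J (sub ?Y L) = 0 \<or> H T I (sub ?X L) = 0")
    case False
    then have "even (int (length (sub ?Y L)) - (dg + 1 + int (length J)))" "even (int (length (sub ?X L)) - (dh + 1 + int (length I)))"
      using G H by blast+
    then have "even (length (sub ?X L) * length (sub ?Y L)) \<longleftrightarrow> even ((dh + 1 + int (length I)) * (dg + 1 + int (length J)))" by auto
    then have e: "(-1) ^ (length (sub ?X L) * length (sub ?Y L)) = ((-1) powi ((dh + 1 + int (length I)) * (dg + 1 + int (length J))) :: 'k)"
      by (simp add: minus_one_power_iff minus_one_powi del: even_mult_iff)
    have "s (length a) (length I) (length (c @ J @ b)) * t (length a + 1 + length c) (length J) (length b) * (-1) powi ((dh + 1 + int (length I)) * (dg + 1 + int (length J)))
      = z * (s' (length (a @ I @ c)) (length J) (length b) * t' (length a) (length I) (length c + 1 + length b))"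
      using st[of "length a" "length I" "length c" "length J" "length b"] by (simp add: add.assoc)
    then show ?thesis unfolding eps_commute[OF q(4) f(1) q(5) f(2) d] e by (metis (no_types, lifting) mult.assoc mult.commute mult.left_commute)
  qed auto
  note e = mult_middle[OF this]
  show ?case
    unfolding p prod.case quo_commute[OF q(4) f(1) q(5) f(2) d] using e by (simp only: mult.assoc)
qed

section \<open>The graded Lie algebra axioms, filtration and completeness\<close>

section \<open>The convolution Lie algebra\<close>

subsection \<open>Closure under the pre-Lie product\<close>

text \<open>Compatibility of \<open>\<chi>\<close> is demanded only at ends of edges of
  \<open>K\<close>, because the map induced on a quotient graph is not controlled at the vertices
  that have been contracted away.\<close>

lemma ev_map:
  assumes x: "x \<in> KGra_inv (card S) (length ws) d" and S: "finite S" and \<chi>: "bij_betw \<chi> S S'"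
    and V: "\<And>e v. e \<in> set K \<Longrightarrow> v = fst e \<or> v = snd e \<Longrightarrow> (\<chi> v \<in> S' \<longleftrightarrow> v \<in> S) \<and> (\<chi> v \<in> set ws' \<longleftrightarrow> v \<in> set ws) \<and> (v \<in> set ws \<longrightarrow> wpos ws' (\<chi> v) = wpos ws v)"
  shows "ev x S' ws' (map (emap \<chi>) K) = ev x S ws K"
proof -
  have S': "finite S'" "card S' = card S" using \<chi> S bij_betw_finite bij_betw_same_card by metis+
  have l: "lab S' ws' (\<chi> v) = glab (rk S' \<circ> \<chi>) S ws v" if "e \<in> set K" "v = fst e \<or> v = snd e" for e v
    using V[OF that] by (auto simp: glab_def)
  have "map (emap (lab S' ws')) (map (emap \<chi>) K) = map (emap (glab (rk S' \<circ> \<chi>) S ws)) K"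
    using l by (auto simp: map_prod_def)
  moreover have "bij_betw (rk S' \<circ> \<chi>) S {1..card S}"
    using bij_betw_trans[OF \<chi> rk_bij[OF S'(1)]] S'(2) by simp
  ultimately show ?thesis using ev_glab[OF x S refl, of "rk S' \<circ> \<chi>" ws K] by (simp add: ev_def del: map_map)
qed

context
  fixes \<pi> :: "nat \<Rightarrow> nat" and X :: "nat set"
  assumes \<pi>: "inj \<pi>" and X: "X \<noteq> {}" "finite X"
begin

text \<open>The map induced by \<open>\<pi>\<close> on the quotient: \<open>\<pi>\<close> need not
  send the minimum of \<open>X\<close> to the minimum of the image, so the contracted vertex is
  treated separately.\<close>

definition xmap :: "nat \<Rightarrow> nat" where "xmap v = (if v = Min X then Min (\<pi> ` X) else \<pi> v)"

lemma inE_image: "inE (\<pi> ` X) (emap \<pi> e) \<longleftrightarrow> inE X e"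
  using \<pi> by (cases e) (simp add: inE_def inj_image_mem_iff)

lemma eps_image: "eps (\<pi> ` X) (map (emap \<pi>) L) = eps X L"
  by (simp add: eps_def xinv_map comp_def inE_image)

lemma sub_image: "sub (\<pi> ` X) (map (emap \<pi>) L) = map (emap \<pi>) (sub X L)"
  by (simp add: sub_def filter_map comp_def inE_image)

lemma Min_image_mem: "Min X \<in> X" "Min (\<pi> ` X) \<in> \<pi> ` X"
  using X by (auto intro!: Min_in)

lemma cn_image: "cn (\<pi> ` X) (\<pi> v) = xmap (cn X v)"
  using \<pi> Min_image_mem by (auto simp: cn_def xmap_def inj_image_mem_iff)

lemma quo_image: "quo (\<pi> ` X) (map (emap \<pi>) L) = map (emap xmap) (quo X L)"
  by (simp add: quo_def filter_map comp_def inE_image map_prod.comp cn_image)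

lemma quo_verts: "e \<in> set (quo X L) \<Longrightarrow> v = fst e \<or> v = snd e \<Longrightarrow> v = Min X \<or> v \<notin> X"
  by (auto simp: quo_def cn_def split: if_splits)

end

lemma hC_ctr_image:
  assumes x: "x \<in> KGra_inv (card (ctr S T)) (length ws) d" and \<pi>: "\<pi> permutes S" and S: "finite S" "S \<inter> set ws = {}"
    and T: "T \<subseteq> S" "T \<noteq> {}"
  shows "ev x (ctr S (\<pi> ` T)) ws (quo (\<pi> ` T) (map (emap \<pi>) L)) = ev x (ctr S T) ws (quo T L)"
proof -
  have inj: "inj \<pi>" using \<pi> by (rule permutes_inj)
  have fT: "finite T" using T S finite_subset by blast
  note M = Min_image_mem[OF inj T(2) fT]
  have TS: "\<pi> ` T \<subseteq> S" using T permutes_image[OF \<pi>] by blast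
  have mem: "\<pi> v \<in> \<pi> ` T \<longleftrightarrow> v \<in> T" "\<pi> v \<in> S \<longleftrightarrow> v \<in> S" for v
    using inj permutes_in_image[OF \<pi>] by (auto simp: inj_image_mem_iff)
  have fixd: "\<pi> v = v" if "v \<notin> S" for v using \<pi> that by (simp add: permutes_def)
  have xm: "xmap \<pi> T (Min T) = Min (\<pi> ` T)" "v \<noteq> Min T \<Longrightarrow> xmap \<pi> T v = \<pi> v" for v
    by (simp_all add: xmap_def[OF inj T(2) fT])
  have "bij_betw (xmap \<pi> T) (S - T) (S - \<pi> ` T)"
  proof -
    have "bij_betw \<pi> (S - T) (\<pi> ` (S - T))" using inj_on_subset[OF inj subset_UNIV] by (simp add: bij_betw_def)
    moreover have "\<pi> ` (S - T) = S - \<pi> ` T" using inj permutes_image[OF \<pi>] by (simp add: image_set_diff)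
    ultimately have "bij_betw \<pi> (S - T) (S - \<pi> ` T)" by simp
    then show ?thesis by (rule bij_betw_cong[THEN iffD1, rotated]) (use M in \<open>auto simp: xmap_def[OF inj T(2) fT]\<close>)
  qed
  moreover have "bij_betw (xmap \<pi> T) {Min T} {Min (\<pi> ` T)}" by (simp add: bij_betw_def xm)
  ultimately have b: "bij_betw (xmap \<pi> T) (ctr S T) (ctr S (\<pi> ` T))"
    unfolding ctr_def using bij_betw_combine[of "xmap \<pi> T" "{Min T}" "{Min (\<pi> ` T)}" "S - T" "S - \<pi> ` T"] M by auto
  show ?thesis unfolding quo_image[OF inj T(2) fT]
  proof (rule ev_map[OF x _ b])
    show "finite (ctr S T)" using S by (simp add: ctr_def)
    fix e v assume "e \<in> set (quo T L)" "v = fst e \<or> v = snd e"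
    from quo_verts[OF inj T(2) fT this] show "(xmap \<pi> T v \<in> ctr S (\<pi> ` T)) = (v \<in> ctr S T) \<and> (xmap \<pi> T v \<in> set ws) = (v \<in> set ws) \<and>
         (v \<in> set ws \<longrightarrow> wpos ws (xmap \<pi> T v) = wpos ws v)"
    proof
      assume v: "v = Min T"
      have "Min T \<notin> set ws" "Min (\<pi> ` T) \<notin> set ws" using M T TS S by auto
      then show ?thesis by (simp add: v xm ctr_def)
    next
      assume v: "v \<notin> T"
      then have "v \<noteq> Min T" "\<pi> v \<noteq> Min (\<pi> ` T)" using M mem by metis+
      moreover have "\<pi> v \<in> set ws \<longleftrightarrow> v \<in> set ws" using mem(2)[of v] fixd[of v] S by auto
      moreover have "v \<in> set ws \<Longrightarrow> \<pi> v = v" using fixd S by auto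
      ultimately show ?thesis using v mem by (auto simp: xm ctr_def)
    qed
  qed
qed

lemma hO_image:
  assumes x: "x \<in> KGra_inv (card (S - T)) (length (a @ [Min (T \<union> set I)] @ b)) d" and \<pi>: "\<pi> permutes S"
    and S: "finite S" "S \<inter> set (a @ I @ b) = {}" "distinct (a @ I @ b)"
    and T: "T \<subseteq> S" "T \<union> set I \<noteq> {}"
  shows "ev x (S - \<pi> ` T) (a @ [Min (\<pi> ` T \<union> set I)] @ b) (quo (\<pi> ` T \<union> set I) (map (emap \<pi>) L))
    = ev x (S - T) (a @ [Min (T \<union> set I)] @ b) (quo (T \<union> set I) L)"
proof -
  let ?X = "T \<union> set I"
  have inj: "inj \<pi>" using \<pi> by (rule permutes_inj)
  have fX: "finite ?X" using T S finite_subset by blast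
  have TS: "\<pi> ` T \<subseteq> S" using T permutes_image[OF \<pi>] by blast
  have mem: "\<pi> v \<in> \<pi> ` Y \<longleftrightarrow> v \<in> Y" "\<pi> v \<in> S \<longleftrightarrow> v \<in> S" for v Y
    using inj permutes_in_image[OF \<pi>] by (auto simp: inj_image_mem_iff)
  have fixd: "\<pi> v = v" if "v \<notin> S" for v using \<pi> that by (simp add: permutes_def)
  have "\<pi> ` set I = set I"
  proof -
    have "\<pi> v = v" if "v \<in> set I" for v using fixd that S(2) by auto
    then show ?thesis by auto
  qed
  then have pX: "\<pi> ` T \<union> set I = \<pi> ` ?X" by (simp add: image_Un)
  note M = Min_image_mem[OF inj T(2) fX]
  have M2: "Min ?X \<notin> S - T" "Min (\<pi> ` ?X) \<notin> S - \<pi> ` T" using M S(2) unfolding pX[symmetric] by auto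
  have Mab: "Min ?X \<notin> set a \<union> set b" "Min (\<pi> ` ?X) \<notin> set a \<union> set b"
    using M S(2,3) T TS unfolding pX[symmetric] by auto
  have xm: "xmap \<pi> ?X (Min ?X) = Min (\<pi> ` ?X)" "v \<noteq> Min ?X \<Longrightarrow> xmap \<pi> ?X v = \<pi> v" for v
    by (simp_all add: xmap_def[OF inj T(2) fX])
  have b: "bij_betw (xmap \<pi> ?X) (S - T) (S - \<pi> ` T)"
  proof -
    have "bij_betw \<pi> (S - T) (\<pi> ` (S - T))" using inj_on_subset[OF inj subset_UNIV] by (simp add: bij_betw_def)
    moreover have "\<pi> ` (S - T) = S - \<pi> ` T" using inj permutes_image[OF \<pi>] by (simp add: image_set_diff)
    ultimately have "bij_betw \<pi> (S - T) (S - \<pi> ` T)" by simp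
    then show ?thesis by (rule bij_betw_cong[THEN iffD1, rotated]) (use M2 in \<open>auto simp: xmap_def[OF inj T(2) fX]\<close>)
  qed
  show ?thesis unfolding pX quo_image[OF inj T(2) fX]
  proof (rule ev_map[OF x _ b])
    show "finite (S - T)" using S by simp
    fix e v assume "e \<in> set (quo ?X L)" "v = fst e \<or> v = snd e"
    from quo_verts[OF inj T(2) fX this] show "(xmap \<pi> ?X v \<in> S - \<pi> ` T) = (v \<in> S - T) \<and> (xmap \<pi> ?X v \<in> set (a @ [Min (\<pi> ` ?X)] @ b)) = (v \<in> set (a @ [Min ?X] @ b)) \<and>
         (v \<in> set (a @ [Min ?X] @ b) \<longrightarrow> wpos (a @ [Min (\<pi> ` ?X)] @ b) (xmap \<pi> ?X v) = wpos (a @ [Min ?X] @ b) v)"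
    proof
      assume v: "v = Min ?X"
      show ?thesis using M2 Mab unfolding v xm by (auto simp: wpos_append wpos_single)
    next
      assume v: "v \<notin> ?X"
      then have n: "v \<noteq> Min ?X" "\<pi> v \<noteq> Min (\<pi> ` ?X)" using M mem(1)[of v ?X] by metis+
      have ab: "\<pi> v \<in> set a \<longleftrightarrow> v \<in> set a" "\<pi> v \<in> set b \<longleftrightarrow> v \<in> set b" using mem(2)[of v] fixd[of v] S(2) by auto
      have f: "v \<in> set a \<union> set b \<Longrightarrow> \<pi> v = v" using fixd S(2) by auto
      have "\<pi> v \<in> S - \<pi> ` T \<longleftrightarrow> v \<in> S - T" using mem by auto
      moreover have "wpos (a @ [Min (\<pi> ` ?X)] @ b) v = wpos (a @ [Min ?X] @ b) v" if "v \<in> set a \<union> set b"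
        using n f[OF that] by (simp add: wpos_append wpos_Cons)
      ultimately show ?thesis using n ab f by (auto simp: xm)
    qed
  qed
qed

lemma ev_image:
  assumes "x \<in> KGra_inv (card T) (length I) d" "\<pi> permutes S" "finite S" "T \<subseteq> S" "S \<inter> set I = {}"
  shows "ev x (\<pi> ` T) I (map (emap \<pi>) (sub X L)) = ev x T I (sub X L)"
proof (rule ev_map[OF assms(1)])
  have inj: "inj \<pi>" using assms(2) by (rule permutes_inj)
  show "finite T" using assms finite_subset by blast
  show "bij_betw \<pi> T (\<pi> ` T)" using inj_on_subset[OF inj subset_UNIV] by (simp add: bij_betw_def)
  fix e v
  have "\<pi> v = v" if "v \<notin> S" using assms(2) that by (simp add: permutes_def)
  moreover have "\<pi> v \<in> S \<longleftrightarrow> v \<in> S" using permutes_in_image[OF assms(2)] .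
  ultimately show "(\<pi> v \<in> \<pi> ` T) = (v \<in> T) \<and> (\<pi> v \<in> set I) = (v \<in> set I) \<and> (v \<in> set I \<longrightarrow> wpos I (\<pi> v) = wpos I v)"
    using inj assms(5) by (auto simp: inj_image_mem_iff)
qed

text \<open>Renaming the black vertices only permutes the summands; it is the source of invariance
  of the product.\<close>

lemma starC_image:
  assumes F: "\<And>T. T \<in> subc S \<Longrightarrow> x (card (ctr S T)) \<in> KGra_inv (card (ctr S T)) (length ws) (dF T)"
    and G: "\<And>T. T \<in> subc S \<Longrightarrow> y (card T) \<in> KGra_inv (card T) 0 (dG T)"
    and \<pi>: "\<pi> permutes S" and S: "finite S" "S \<inter> set ws = {}"
  shows "starC (\<lambda>S. ev (x (card S)) S ws) (\<lambda>S. ev (y (card S)) S []) S (map (emap \<pi>) L)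
    = starC (\<lambda>S. ev (x (card S)) S ws) (\<lambda>S. ev (y (card S)) S []) S L"
  unfolding starC_def
proof (rule sum.reindex_bij_witness[of _ "\<lambda>T. \<pi> ` T" "\<lambda>T. inv_into UNIV \<pi> ` T"])
  have inj: "inj \<pi>" using \<pi> by (rule permutes_inj)
  have inv: "inv_into UNIV \<pi> permutes S" using \<pi> by (rule permutes_inv)
  have ii: "inv_into UNIV \<pi> ` \<pi> ` T = T" "\<pi> ` inv_into UNIV \<pi> ` T = T" for T
    using permutes_inverses[OF \<pi>] by (auto simp: image_iff)
  show "inv_into UNIV \<pi> ` \<pi> ` T = T" "\<pi> ` inv_into UNIV \<pi> ` T = T" for T by (rule ii)+
  show "\<pi> ` T \<in> subc S" if "T \<in> subc S" for T using that permutes_image[OF \<pi>] by (auto simp: subc_def)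
  show "inv_into UNIV \<pi> ` T \<in> subc S" if "T \<in> subc S" for T using that permutes_image[OF inv] by (auto simp: subc_def)
  fix T assume T': "T \<in> subc S"
  define U where "U = inv_into UNIV \<pi> ` T"
  have TU: "T = \<pi> ` U" by (simp add: U_def ii)
  have U: "U \<in> subc S" using T' permutes_image[OF inv] by (auto simp: subc_def U_def)
  then have U': "U \<subseteq> S" "U \<noteq> {}" by (auto simp: subc_def)
  then have fU: "finite U" using S finite_subset by blast
  have cc: "card (\<pi> ` U) = card U" using inj_on_subset[OF inj subset_UNIV] by (simp add: card_image)
  have c2: "card (ctr S (\<pi> ` U)) = card (ctr S U)"
    using card_ctr[OF S(1) U'] card_ctr[OF S(1), of "\<pi> ` U"] U' permutes_image[OF \<pi>] cc by auto
  show "eps (inv_into UNIV \<pi> ` T) L * (ev (x (card (ctr S (inv_into UNIV \<pi> ` T)))) (ctr S (inv_into UNIV \<pi> ` T)) ws (quo (inv_into UNIV \<pi> ` T) L) *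
       ev (y (card (inv_into UNIV \<pi> ` T))) (inv_into UNIV \<pi> ` T) [] (sub (inv_into UNIV \<pi> ` T) L)) =
     eps T (map (emap \<pi>) L) * (ev (x (card (ctr S T))) (ctr S T) ws (quo T (map (emap \<pi>) L)) * ev (y (card T)) T [] (sub T (map (emap \<pi>) L)))"
    unfolding U_def[symmetric] unfolding TU eps_image[OF inj U'(2) fU] cc c2 hC_ctr_image[OF F[OF U] \<pi> S U'] sub_image[OF inj U'(2) fU]
    using ev_image[OF _ \<pi> S(1) U'(1), of "y (card U)" "[]" "dG U" U L] G[OF U] by simp
qed

lemma starO_image:
  assumes F: "\<And>n k. x n k \<in> KGra_inv n k (dF n k)"
    and G: "\<And>n k. y n k \<in> KGra_inv n k (dG n k)"
    and \<pi>: "\<pi> permutes S" and S: "finite S" "S \<inter> set ws = {}" "distinct ws"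
  shows "starO s (\<lambda>S ws. ev (x (card S) (length ws)) S ws) (\<lambda>S ws. ev (y (card S) (length ws)) S ws) S ws (map (emap \<pi>) L)
    = starO s (\<lambda>S ws. ev (x (card S) (length ws)) S ws) (\<lambda>S ws. ev (y (card S) (length ws)) S ws) S ws L"
  unfolding starO_def
proof (rule sum.reindex_bij_witness[of _ "\<lambda>(T, z). (\<pi> ` T, z)" "\<lambda>(T, z). (inv_into UNIV \<pi> ` T, z)"], goal_cases)
  case (1 a)
  then show ?case using permutes_inverses[OF \<pi>] by (cases a) (auto simp: image_iff)
next
  case (2 a)
  then show ?case using permutes_image[OF permutes_inv[OF \<pi>]] by (cases a) (auto simp: subo_def)
next
  case (3 a)
  then show ?case using permutes_inverses[OF \<pi>] by (cases a) (auto simp: image_iff)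
next
  case (4 a)
  then show ?case using permutes_image[OF \<pi>] by (cases a) (auto simp: subo_def)
next
  case (5 p)
  have inj: "inj \<pi>" using \<pi> by (rule permutes_inj)
  obtain T a I b where p: "p = (T, a, I, b)" by (metis prod.exhaust)
  define U where "U = inv_into UNIV \<pi> ` T"
  have TU: "T = \<pi> ` U" unfolding U_def using permutes_inverses[OF \<pi>] by (auto simp: image_iff)
  have q: "T \<subseteq> S" "ws = a @ I @ b" "T \<union> set I \<noteq> {}" using 5 by (auto simp: p subo_def)
  have U': "U \<subseteq> S" "U \<union> set I \<noteq> {}"
    using q permutes_image[OF permutes_inv[OF \<pi>]] by (auto simp: U_def)
  then have fU: "finite (U \<union> set I)" using S finite_subset by blast
  have "\<pi> v = v" if "v \<in> set I" for v using \<pi> that S(2) q(2) by (auto simp: permutes_def)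
  then have "\<pi> ` set I = set I" by auto
  then have pX: "\<pi> ` U \<union> set I = \<pi> ` (U \<union> set I)" by (simp add: image_Un)
  have cc: "card (\<pi> ` U) = card U" using inj_on_subset[OF inj subset_UNIV] by (simp add: card_image)
  have "S - \<pi> ` U = \<pi> ` (S - U)" using inj permutes_image[OF \<pi>] by (simp add: image_set_diff)
  then have c2: "card (S - \<pi> ` U) = card (S - U)" using inj_on_subset[OF inj subset_UNIV] by (simp add: card_image)
  have S': "S \<inter> set (a @ I @ b) = {}" "distinct (a @ I @ b)" "S \<inter> set I = {}" using S q(2) by auto
  have lens: "length (a @ [Min (\<pi> ` U \<union> set I)] @ b) = length (a @ [Min (U \<union> set I)] @ b)" by simp
  show ?case
    unfolding p prod.case U_def[symmetric] unfolding TU c2 cc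
    unfolding lens hO_image[OF F \<pi> S(1) S'(1,2) U']
    unfolding pX eps_image[OF inj U'(2) fU] sub_image[OF inj U'(2) fU] ev_image[OF G \<pi> S(1) U'(1) S'(3)]
    by simp
qed

lemma hC_eta: "hC f = (\<lambda>S. ev (fst f (card S)) S [])"
  by (intro ext) (simp add: hC_def)
lemma hO_eta: "hO f = (\<lambda>S ws. ev (snd f (card S) (length ws)) S ws)"
  by (intro ext) (simp add: hO_def)

text \<open>A standard copy of the vertices in the natural numbers, the white ones following the
  black ones. On it evaluation gives back the coefficients (\<open>ev_std\<close>).\<close>

fun nm :: "nat \<Rightarrow> vertex \<Rightarrow> nat" where
  "nm n (Black i) = i"
| "nm n (White j) = n + j"

definition stdw :: "nat \<Rightarrow> nat \<Rightarrow> nat list" where "stdw n k = [n + 1..<n + k + 1]"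

lemma set_stdw: "set (stdw n k) = {n + 1..n + k}"
  by (auto simp: stdw_def)

lemma length_stdw: "length (stdw n k) = k" by (simp add: stdw_def)

lemma stdw_0: "stdw n 0 = []" by (simp add: stdw_def)

lemma stdw_Suc: "stdw n (Suc k) = stdw n k @ [n + Suc k]" by (simp add: stdw_def)

lemma wpos_stdw: "j \<in> {1..k} \<Longrightarrow> wpos (stdw n k) (n + j) = j"
proof (induction k)
  case (Suc k)
  show ?case
  proof (cases "j = Suc k")
    case True
    then have "n + j \<notin> set (stdw n k)" by (simp add: set_stdw)
    with True show ?thesis by (simp add: stdw_Suc wpos_append wpos_single length_stdw)
  next
    case False
    then have "j \<in> {1..k}" using Suc.prems by auto
    with Suc.IH show ?thesis by (simp add: stdw_Suc wpos_append set_stdw)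
  qed
qed simp

lemma rk_std: assumes "i \<in> {1..n}" shows "rk {1..n} i = i"
proof -
  have "{u \<in> {1..n}. u \<le> i} = {1..i}" using assms by auto
  then show ?thesis by (simp add: rk_def)
qed

lemma lab_nm: "v \<in> verts n k \<Longrightarrow> lab {1..n} (stdw n k) (nm n v) = v"
proof (cases v)
  case (Black i)
  assume "v \<in> verts n k"
  then have "i \<in> {1..n}" using Black by (auto simp: verts_def)
  then show ?thesis using Black rk_std by (simp add: glab_def)
next
  case (White j)
  assume "v \<in> verts n k"
  then have j: "j \<in> {1..k}" using White by (auto simp: verts_def)
  then have "n + j \<notin> {1..n}" "n + j \<in> set (stdw n k)" by (auto simp: set_stdw)
  then show ?thesis using White wpos_stdw[OF j, of n] by (simp only: glab_def nm.simps if_True if_False)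
qed

lemma ev_std:
  assumes "M \<in> ographs n k"
  shows "ev x {1..n} (stdw n k) (map (emap (nm n)) M) = x M"
proof -
  have "map (emap (lab {1..n} (stdw n k))) (map (emap (nm n)) M) = M"
    unfolding map_map
  proof (rule map_idI)
    fix e assume "e \<in> set M"
    then have "fst e \<in> verts n k" "snd e \<in> verts n k" using assms unfolding ographs_iff verts_def by auto
    then show "(emap (lab {1..n} (stdw n k)) \<circ> emap (nm n)) e = e" by (cases e) (simp add: lab_nm del: One_nat_def)
  qed
  then show ?thesis by (simp add: ev_def del: map_map)
qed

lemma std_facts: "finite {1..n}" "card {1..n} = n" "length (stdw n k) = k" "distinct (stdw n k)" "{1..n} \<inter> set (stdw n k) = {}"
  by (auto simp: set_stdw length_stdw) (simp add: stdw_def)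

lemma KGra_invI:
  fixes x :: "'k::field_char_0 gvec"
  assumes "alt x" "\<And>G. G \<notin> ographs n k \<Longrightarrow> x G = 0"
    and deg: "\<And>L. ev x {1..n} (stdw n k) L \<noteq> 0 \<Longrightarrow> - int (length L) = d"
    and inv: "\<And>\<pi> L. \<pi> permutes {1..n} \<Longrightarrow> ev x {1..n} (stdw n k) (map (emap \<pi>) L) = ev x {1..n} (stdw n k) L"
  shows "x \<in> KGra_inv n k d"
proof -
  have K: "x \<in> KGra n k" using assms(1,2) by (auto simp: KGra_def alt_def)
  moreover have "- int (length G) = d" if "x G \<noteq> 0" for G
  proof -
    have "G \<in> ographs n k" using assms(2) that by blast
    from ev_std[OF this, of x] that deg[of "map (emap (nm n)) G"] show ?thesis by simp
  qed
  moreover have "act n k \<tau> x = x" if t: "\<tau> permutes {1..n}" for \<tau>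
  proof
    fix G
    let ?\<pi> = "inv_into UNIV \<tau>"
    have p: "?\<pi> permutes {1..n}" using t by (rule permutes_inv)
    let ?G = "map (emap (relabel_black ?\<pi>)) G"
    have "x ?G = x G"
    proof (cases "G \<in> ographs n k")
      case True
      then have G': "?G \<in> ographs n k" by (simp only: map_relabel_ographs[OF p])
      have "nm n (relabel_black ?\<pi> v) = ?\<pi> (nm n v)" if "v \<in> verts n k" for v
      proof (cases v)
        case (White j)
        then have "n + j \<notin> {1..n}" using that by (auto simp: verts_def)
        then show ?thesis using p White by (simp add: permutes_def)
      qed simp
      note nmr = this
      have "map (emap (nm n)) ?G = map (emap ?\<pi>) (map (emap (nm n)) G)"
        unfolding map_map
      proof (rule map_cong[OF refl])
        fix e assume "e \<in> set G"
        then have "fst e \<in> verts n k" "snd e \<in> verts n k" using True unfolding ographs_iff verts_def by auto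
        then show "(emap (nm n) \<circ> emap (relabel_black ?\<pi>)) e = (emap ?\<pi> \<circ> emap (nm n)) e" by (cases e) (simp add: nmr)
      qed
      then show ?thesis using ev_std[OF True, of x] ev_std[OF G', of x] inv[OF p] by metis
    next
      case False
      then have "?G \<notin> ographs n k" by (simp only: map_relabel_ographs[OF p] not_False_eq_True)
      with False assms(2) show ?thesis by simp
    qed
    then show "act n k \<tau> x G = x G" using act_coeff_KGra[OF K t] by simp
  qed
  ultimately show ?thesis by (simp add: KGra_inv_def)
qed

lemma length_sub_quo: "length (sub X L) + length (quo X L) = length L"
  by (simp add: sub_def quo_def sum_length_filter_compl)

lemma hC_deg: "f \<in> conv_deg d \<Longrightarrow> hC f S L \<noteq> 0 \<Longrightarrow> - int (length L) = d + 2 - 2 * int (card S)"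
  using conv_degD(5)[of f d "card S"] unfolding hC_def ev_def KGra_inv_def by fastforce

lemma hO_deg: "f \<in> conv_deg d \<Longrightarrow> hO f S ws L \<noteq> 0 \<Longrightarrow> - int (length L) = d + 1 - 2 * int (card S) - int (length ws)"
  using conv_degD(6)[of f d "card S" "length ws"] unfolding hO_def ev_def KGra_inv_def by fastforce

lemma starC_nz: assumes "starC F G S L \<noteq> 0"
  obtains T where "T \<in> subc S" "F (ctr S T) (quo T L) \<noteq> 0" "G T (sub T L) \<noteq> 0"
proof -
  have "\<exists>T\<in>subc S. eps T L * (F (ctr S T) (quo T L) * G T (sub T L)) \<noteq> 0"
    using assms unfolding starC_def by (meson sum.neutral)
  then show ?thesis using that by auto
qed

lemma starO_nz: assumes "starO s F G S ws L \<noteq> 0"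
  obtains T a I b where "(T, a, I, b) \<in> subo S ws" "F (S - T) (a @ [Min (T \<union> set I)] @ b) (quo (T \<union> set I) L) \<noteq> 0" "G T I (sub (T \<union> set I) L) \<noteq> 0"
proof -
  have "\<exists>x\<in>subo S ws. (case x of (T, a, I, b) \<Rightarrow> s (length a) (length I) (length b) *
     (eps (T \<union> set I) L * (F (S - T) (a @ [Min (T \<union> set I)] @ b) (quo (T \<union> set I) L) * G T I (sub (T \<union> set I) L)))) \<noteq> 0"
    using assms unfolding starO_def by (meson sum.neutral)
  then show ?thesis using that by auto
qed

lemma int_card_ctr: "finite S \<Longrightarrow> T \<in> subc S \<Longrightarrow> int (card (ctr S T)) + int (card T) = int (card S) + 1"
  using card_ctr[of S T] card_mono[of S T] by (auto simp: subc_def)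

lemma hC_bullet_deg:
  assumes f: "f \<in> conv_deg df" and g: "g \<in> conv_deg dg" and S: "finite S" and nz: "hC (conv_bullet e f g) S L \<noteq> 0"
  shows "- int (length L) = (df + dg) + 2 - 2 * int (card S)"
proof -
  have "starC (hC f) (hC g) S L \<noteq> 0" using nz hC_bullet[OF f g S] by simp
  then obtain T where T: "T \<in> subc S" "hC f (ctr S T) (quo T L) \<noteq> 0" "hC g T (sub T L) \<noteq> 0" by (rule starC_nz)
  show ?thesis using hC_deg[OF f T(2)] hC_deg[OF g T(3)] int_card_ctr[OF S T(1)] length_sub_quo[of T L] by simp
qed

lemma hO_bullet_deg:
  assumes f: "f \<in> conv_deg df" and g: "g \<in> conv_deg dg" and S: "finite S" "distinct ws" "S \<inter> set ws = {}"
    and nz: "hO (conv_bullet e f g) S ws L \<noteq> 0"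
  shows "- int (length L) = (df + dg) + 1 - 2 * int (card S) - int (length ws)"
proof -
  have "starC (\<lambda>S. hO f S ws) (hC g) S L \<noteq> 0 \<or> starO (osgn e) (hO f) (hO g) S ws L \<noteq> 0"
    using nz hO_bullet[OF f g S] by auto
  then show ?thesis
  proof
    assume "starC (\<lambda>S. hO f S ws) (hC g) S L \<noteq> 0"
    then obtain T where T: "T \<in> subc S" "hO f (ctr S T) ws (quo T L) \<noteq> 0" "hC g T (sub T L) \<noteq> 0" by (rule starC_nz)
    show ?thesis using hO_deg[OF f T(2)] hC_deg[OF g T(3)] int_card_ctr[OF S(1) T(1)] length_sub_quo[of T L] by simp
  next
    assume "starO (osgn e) (hO f) (hO g) S ws L \<noteq> 0"
    then obtain T a I b where T: "(T, a, I, b) \<in> subo S ws" "hO f (S - T) (a @ [Min (T \<union> set I)] @ b) (quo (T \<union> set I) L) \<noteq> 0"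
      "hO g T I (sub (T \<union> set I) L) \<noteq> 0" by (rule starO_nz)
    have q: "T \<subseteq> S" "ws = a @ I @ b" using T(1) by (auto simp: subo_def)
    have "int (card (S - T)) + int (card T) = int (card S)"
      using q(1) S(1) card_mono[OF S(1) q(1)] finite_subset[OF q(1) S(1)] by (simp add: card_Diff_subset)
    then show ?thesis using hO_deg[OF f T(2)] hO_deg[OF g T(3)] length_sub_quo[of "T \<union> set I" L] q(2) by simp
  qed
qed

lemma fst_bullet_supp:
  "alt (fst (conv_bullet e f g) n)" "G \<notin> ographs n 0 \<Longrightarrow> fst (conv_bullet e f g) n G = 0"
proof -
  have e: "fst (conv_bullet e f g) n = (\<lambda>L. \<Sum>p = 2..n - 1. \<Sum>\<tau>\<in>shuffles_perm p (n - p).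
        act n 0 \<tau> (ins_c (n - p + 1, 0) 1 p (fst f (n - p + 1)) (fst g p)) L)"
    by (rule ext) (simp add: conv_bullet_def case_prod_unfold sum_fun_apply)
  show "alt (fst (conv_bullet e f g) n)" unfolding e by (intro alt_sum alt_act)
  assume G: "G \<notin> ographs n 0"
  have "act n 0 \<tau> (ins_c (n - p + 1, 0) 1 p (fst f (n - p + 1)) (fst g p)) G = 0" if "\<tau> \<in> shuffles_perm p (n - p)" "p \<le> n" for p \<tau>
  proof -
    have "\<tau> permutes {1..n}" using that by (simp add: shuffles_perm_def)
    then show ?thesis by (simp only: act_coeff[OF alt_ins_c] G if_False)
  qed
  then show "fst (conv_bullet e f g) n G = 0" unfolding e by (intro sum.neutral ballI) auto
qed

lemma snd_bullet_supp:
  "alt (snd (conv_bullet e f g) n k)" "G \<notin> ographs n k \<Longrightarrow> snd (conv_bullet e f g) n k G = 0"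
proof -
  have e: "snd (conv_bullet e f g) n k = (\<lambda>L.
       (-1) powi (e * (int k + 1)) *
         (\<Sum>p = 2..n. \<Sum>\<tau>\<in>shuffles_perm p (n - p).
            act n k \<tau> (ins_c (n - p + 1, k) 1 p (snd f (n - p + 1) k) (fst g p)) L)
       + (\<Sum>r = 0..n. \<Sum>\<sigma>\<in>shuffles_perm r (n - r). \<Sum>q = 0..k. \<Sum>p = 0..q.
            (-1) powi (int (k - q) * int (q - p + 1) + e * int (k - q + p)) *
            act n k \<sigma> (ins_o (r, k - q + p + 1) (p + 1) (n - r, q - p)
                          (snd f r (k - q + p + 1)) (snd g (n - r) (q - p))) L))"
    by (rule ext) (simp add: conv_bullet_def case_prod_unfold)
  show "alt (snd (conv_bullet e f g) n k)" unfolding e by (intro alt_add alt_scale alt_sum alt_act)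
  assume G: "G \<notin> ographs n k"
  have 1: "act n k \<tau> (ins_c mp i n' x y) G = 0" if "\<tau> \<in> shuffles_perm p (n - p)" "p \<le> n" for p \<tau> mp i n' x y
  proof -
    have "\<tau> permutes {1..n}" using that by (simp add: shuffles_perm_def)
    then show ?thesis by (simp only: act_coeff[OF alt_ins_c] G if_False)
  qed
  have 2: "act n k \<tau> (ins_o mp i n' x y) G = 0" if "\<tau> \<in> shuffles_perm p (n - p)" "p \<le> n" for p \<tau> mp i n' x y
  proof -
    have "\<tau> permutes {1..n}" using that by (simp add: shuffles_perm_def)
    then show ?thesis by (simp only: act_coeff[OF alt_ins_o] G if_False)
  qed
  have "(\<Sum>p = 2..n. \<Sum>\<tau>\<in>shuffles_perm p (n - p).
            act n k \<tau> (ins_c (n - p + 1, k) 1 p (snd f (n - p + 1) k) (fst g p)) G) = 0"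
    by (intro sum.neutral ballI) (auto intro: 1)
  moreover have "(\<Sum>r = 0..n. \<Sum>\<sigma>\<in>shuffles_perm r (n - r). \<Sum>q = 0..k. \<Sum>p = 0..q.
            (-1) powi (int (k - q) * int (q - p + 1) + e * int (k - q + p)) *
            act n k \<sigma> (ins_o (r, k - q + p + 1) (p + 1) (n - r, q - p)
                          (snd f r (k - q + p + 1)) (snd g (n - r) (q - p))) G) = 0"
    by (intro sum.neutral ballI) (auto intro: 2)
  ultimately show "snd (conv_bullet e f g) n k G = 0" unfolding e by simp
qed

text \<open>Degrees and invariance are read off from the sums over subsets, which do not refer to
  labels. The argument \<open>e\<close> enters through signs only and is left arbitrary.\<close>

theorem conv_bullet_closed:
  assumes f: "f \<in> conv_deg df" and g: "g \<in> conv_deg dg"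
  shows "conv_bullet e f g \<in> conv_deg (df + dg)"
proof -
  let ?h = "conv_bullet e f g"
  have c: "fst ?h n \<in> KGra_inv n 0 (df + dg + 2 - 2 * int n)" for n
  proof (rule KGra_invI[OF fst_bullet_supp])
    note s = std_facts(1,2)[of n]
    have h: "ev (fst ?h n) {1..n} (stdw n 0) L = hC ?h {1..n} L" for L by (simp add: hC_def stdw_0)
    show "- int (length L) = df + dg + 2 - 2 * int n" if "ev (fst ?h n) {1..n} (stdw n 0) L \<noteq> 0" for L
      using hC_bullet_deg[OF f g s(1), of e L] that unfolding h s(2) by simp
    show "ev (fst ?h n) {1..n} (stdw n 0) (map (emap \<pi>) L) = ev (fst ?h n) {1..n} (stdw n 0) L"
      if p: "\<pi> permutes {1..n}" for \<pi> L
    proof -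
      have "starC (hC f) (hC g) {1..n} (map (emap \<pi>) L) = starC (hC f) (hC g) {1..n} L"
        unfolding hC_eta
        by (rule starC_image[where ws = "[]", OF _ _ p s(1)]) (use conv_degD(5)[OF f] conv_degD(5)[OF g] in auto)
      then show ?thesis unfolding h hC_bullet[OF f g s(1)] .
    qed
  qed
  have o: "snd ?h n k \<in> KGra_inv n k (df + dg + 1 - 2 * int n - int k)" for n k
  proof (rule KGra_invI[OF snd_bullet_supp])
    note s = std_facts(1,2)[of n] std_facts(3-5)[of n k]
    have h: "ev (snd ?h n k) {1..n} (stdw n k) L = hO ?h {1..n} (stdw n k) L" for L by (simp add: hO_def length_stdw)
    show "- int (length L) = df + dg + 1 - 2 * int n - int k" if "ev (snd ?h n k) {1..n} (stdw n k) L \<noteq> 0" for L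
      using hO_bullet_deg[OF f g s(1,4,5), of e L] that unfolding h s(2,3) by simp
    show "ev (snd ?h n k) {1..n} (stdw n k) (map (emap \<pi>) L) = ev (snd ?h n k) {1..n} (stdw n k) L"
      if p: "\<pi> permutes {1..n}" for \<pi> L
    proof -
      have "starC (\<lambda>S. hO f S (stdw n k)) (hC g) {1..n} (map (emap \<pi>) L) = starC (\<lambda>S. hO f S (stdw n k)) (hC g) {1..n} L"
        unfolding hO_eta hC_eta
        by (rule starC_image[where x = "\<lambda>m. snd f m (length (stdw n k))", OF _ _ p s(1,5)]) (rule conv_degD(6)[OF f], rule conv_degD(5)[OF g])
      moreover have "starO (osgn e) (hO f) (hO g) {1..n} (stdw n k) (map (emap \<pi>) L) = starO (osgn e) (hO f) (hO g) {1..n} (stdw n k) L"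
        unfolding hO_eta by (rule starO_image[OF conv_degD(6)[OF f] conv_degD(6)[OF g] p s(1,5,4)])
      ultimately show ?thesis unfolding h hO_bullet[OF f g s(1,4,5)] by simp
    qed
  qed
  have z: "fst ?h 0 = 0" "fst ?h 1 = 0" by (simp_all add: conv_bullet_def case_prod_unfold)
  \<comment> \<open>For the index \<open>(0, 1)\<close> the inserted graph is either the component
    of \<open>g\<close> without vertices, or it fills a component of \<open>f\<close> with a single
    white vertex and nothing else.\<close>
  note g0 = conv_degD(3)[OF g] and f1 = conv_degD(4)[OF f]
  have "snd ?h 0 0 = 0" "snd ?h 0 1 = 0"
    by (rule ext, simp add: conv_bullet_def case_prod_unfold g0 ins_o_0_right act_0)
      (rule ext, simp add: conv_bullet_def case_prod_unfold g0 f1[unfolded One_nat_def] ins_o_0_left ins_o_0_right act_0)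
  with z c o show ?thesis by (auto simp: conv_deg_def case_prod_unfold)
qed

lemma KGra_inv_ext:
  assumes "x \<in> KGra_inv n k d" "y \<in> KGra_inv n k d'" "\<And>L. ev x {1..n} (stdw n k) L = ev y {1..n} (stdw n k) L"
  shows "x = y"
proof
  fix M
  show "x M = y M"
  proof (cases "M \<in> ographs n k")
    case True
    from ev_std[OF this, of x] ev_std[OF this, of y] assms(3) show ?thesis by simp
  next
    case False
    then have "x M = 0" "y M = 0" using assms(1,2) unfolding KGra_inv_def KGra_def by blast+
    then show ?thesis by simp
  qed
qed

lemma conv_ext:
  assumes f: "f \<in> conv_deg d" and g: "g \<in> conv_deg d'"
    and C: "\<And>S L. finite S \<Longrightarrow> hC f S L = hC g S L"
    and O: "\<And>S ws L. finite S \<Longrightarrow> distinct ws \<Longrightarrow> S \<inter> set ws = {} \<Longrightarrow> hO f S ws L = hO g S ws L"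
  shows "f = g"
proof (rule prod_eqI)
  show "fst f = fst g"
  proof
    fix n
    show "fst f n = fst g n"
      by (rule KGra_inv_ext[OF conv_degD(5)[OF f] conv_degD(5)[OF g]]) (use C[of "{1..n}"] in \<open>simp add: hC_def stdw_0\<close>)
  qed
  show "snd f = snd g"
  proof (intro ext)
    fix n k L
    have "snd f n k = snd g n k"
      by (rule KGra_inv_ext[OF conv_degD(6)[OF f] conv_degD(6)[OF g]])
        (use O[OF std_facts(1) std_facts(4,5), of n k] in \<open>simp add: hO_def length_stdw\<close>)
    then show "snd f n k L = snd g n k L" by simp
  qed
qed

subsection \<open>Linearity and filtration\<close>

definition csc :: "'k \<Rightarrow> 'k conv \<Rightarrow> 'k::field_char_0 conv" where
  "csc c f = ((\<lambda>n L. c * fst f n L), (\<lambda>n k L. c * snd f n k L))"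

lemma fst_csc: "fst (csc c f) n = (\<lambda>L. c * fst f n L)" by (simp add: csc_def)
lemma snd_csc: "snd (csc c f) n k = (\<lambda>L. c * snd f n k L)" by (simp add: csc_def)

lemma lin_ext_add: "lin_ext n k T (\<lambda>L. x L + y L) = (\<lambda>L. lin_ext n k T x L + lin_ext n k T y L)"
  by (simp add: lin_ext_def sum.distrib add_divide_distrib distrib_right)
lemma lin_ext_scale: "lin_ext n k T (\<lambda>L. c * x L) = (\<lambda>L. c * lin_ext n k T x L)"
  by (simp add: lin_ext_def sum_distrib_left mult.assoc)
lemma lin_ext_T_add: "lin_ext n k (\<lambda>G L. T G L + T' G L) x = (\<lambda>L. lin_ext n k T x L + lin_ext n k T' x L)"
  by (simp add: lin_ext_def sum.distrib distrib_left)
lemma lin_ext_T_scale: "lin_ext n k (\<lambda>G L. c * T G L) x = (\<lambda>L. c * lin_ext n k T x L)"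
  by (simp add: lin_ext_def sum_distrib_left mult.left_commute)

lemmas lin_ext_linear = lin_ext_add lin_ext_scale lin_ext_T_add lin_ext_T_scale

lemma ins_c_linear:
  "ins_c mp i n (\<lambda>L. x L + x' L) y = (\<lambda>L. ins_c mp i n x y L + ins_c mp i n x' y L)"
  "ins_c mp i n (\<lambda>L. c * x L) y = (\<lambda>L. c * ins_c mp i n x y L)"
  "ins_c mp i n x (\<lambda>L. y L + y' L) = (\<lambda>L. ins_c mp i n x y L + ins_c mp i n x y' L)"
  "ins_c mp i n x (\<lambda>L. c * y L) = (\<lambda>L. c * ins_c mp i n x y L)"
  by (cases mp; simp add: ins_c_def lin_ext_linear)+

lemma ins_o_linear:
  "ins_o mp i nq (\<lambda>L. x L + x' L) y = (\<lambda>L. ins_o mp i nq x y L + ins_o mp i nq x' y L)"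
  "ins_o mp i nq (\<lambda>L. c * x L) y = (\<lambda>L. c * ins_o mp i nq x y L)"
  "ins_o mp i nq x (\<lambda>L. y L + y' L) = (\<lambda>L. ins_o mp i nq x y L + ins_o mp i nq x y' L)"
  "ins_o mp i nq x (\<lambda>L. c * y L) = (\<lambda>L. c * ins_o mp i nq x y L)"
  by (cases mp; cases nq; simp add: ins_o_def lin_ext_linear)+

lemma act_linear:
  "act n k \<tau> (\<lambda>L. x L + x' L) = (\<lambda>L. act n k \<tau> x L + act n k \<tau> x' L)"
  "act n k \<tau> (\<lambda>L. c * x L) = (\<lambda>L. c * act n k \<tau> x L)"
  by (simp_all add: act_def lin_ext_linear)

lemma fst_bullet: "fst (conv_bullet e f g) n L = (\<Sum>p = 2..n - 1. \<Sum>\<tau>\<in>shuffles_perm p (n - p).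
        act n 0 \<tau> (ins_c (n - p + 1, 0) 1 p (fst f (n - p + 1)) (fst g p)) L)"
  by (simp add: conv_bullet_def case_prod_unfold sum_fun_apply)

lemma snd_bullet: "snd (conv_bullet e f g) n k L =
       (-1) powi (e * (int k + 1)) *
         (\<Sum>p = 2..n. \<Sum>\<tau>\<in>shuffles_perm p (n - p).
            act n k \<tau> (ins_c (n - p + 1, k) 1 p (snd f (n - p + 1) k) (fst g p)) L)
       + (\<Sum>r = 0..n. \<Sum>\<sigma>\<in>shuffles_perm r (n - r). \<Sum>q = 0..k. \<Sum>p = 0..q.
            (-1) powi (int (k - q) * int (q - p + 1) + e * int (k - q + p)) *
            act n k \<sigma> (ins_o (r, k - q + p + 1) (p + 1) (n - r, q - p)
                          (snd f r (k - q + p + 1)) (snd g (n - r) (q - p))) L)"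
  by (simp add: conv_bullet_def case_prod_unfold)

lemma fst_add: "fst (f + g) n = (\<lambda>L. fst f n L + fst g n L)" for f g :: "'k::field_char_0 conv"
  by (simp add: plus_fun_def)
lemma snd_add: "snd (f + g) n k = (\<lambda>L. snd f n k L + snd g n k L)" for f g :: "'k::field_char_0 conv"
  by (simp add: plus_fun_def)

lemma conv_eqI: "(\<And>n L. fst f n L = fst g n L) \<Longrightarrow> (\<And>n k L. snd f n k L = snd g n k L) \<Longrightarrow> f = g"
  for f g :: "'k::field_char_0 conv"
  by (intro prod_eqI ext)

lemma conv_bullet_linear:
  "conv_bullet e (f + f') g = conv_bullet e f g + conv_bullet e f' g"
  "conv_bullet e (csc c f) g = csc c (conv_bullet e f g)"
  "conv_bullet e f (g + g') = conv_bullet e f g + conv_bullet e f g'"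
  "conv_bullet e f (csc c g) = csc c (conv_bullet e f g)"
  by (rule conv_eqI;
      simp only: fst_bullet snd_bullet fst_add snd_add fst_csc snd_csc ins_c_linear ins_o_linear act_linear sum.distrib distrib_left sum_distrib_left;
      simp only: mult.left_commute[of c] add_ac)+

lemma csc_linear: "csc c (f + g) = csc c f + csc c g" "csc (c + d) f = csc c f + csc d f" "csc c (csc d f) = csc (c * d) f" "csc 1 f = f"
  by (rule conv_eqI; simp add: fst_csc snd_csc algebra_simps)+

lemma hats_linear: "hC (f + g) S L = hC f S L + hC g S L" "hC (csc c f) S L = c * hC f S L"
  "hO (f + g) S ws L = hO f S ws L + hO g S ws L" "hO (csc c f) S ws L = c * hO f S ws L"
  by (simp_all add: hC_def hO_def ev_def fst_csc snd_csc)

lemma KGra_inv_iff: "x \<in> KGra_inv n k d \<longleftrightarrow> (\<forall>G. x G \<noteq> 0 \<longrightarrow> G \<in> ographs n k \<and> - int (length G) = d) \<and> alt x \<and>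
    (\<forall>\<tau>. \<tau> permutes {1..n} \<longrightarrow> act n k \<tau> x = x)"
  unfolding KGra_inv_def KGra_def alt_def by blast

lemma KGra_inv_linear:
  assumes x: "x \<in> KGra_inv n k d"
  shows "(\<lambda>L. c * x L) \<in> KGra_inv n k d" "y \<in> KGra_inv n k d \<Longrightarrow> (\<lambda>L. x L + y L) \<in> KGra_inv n k d"
proof -
  show "(\<lambda>L. c * x L) \<in> KGra_inv n k d"
    unfolding KGra_inv_iff act_linear using x[unfolded KGra_inv_iff] by (auto intro: alt_scale)
  assume y: "y \<in> KGra_inv n k d"
  have "G \<in> ographs n k \<and> - int (length G) = d" if "x G + y G \<noteq> 0" for G
  proof -
    have "x G \<noteq> 0 \<or> y G \<noteq> 0" using that by auto
    then show ?thesis using x y unfolding KGra_inv_iff by blast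
  qed
  moreover have "alt (\<lambda>L. x L + y L)" using x y unfolding KGra_inv_iff by (intro alt_add) auto
  moreover have "act n k \<tau> (\<lambda>L. x L + y L) = (\<lambda>L. x L + y L)" if "\<tau> permutes {1..n}" for \<tau>
    unfolding act_linear using x y that unfolding KGra_inv_iff by simp
  ultimately show "(\<lambda>L. x L + y L) \<in> KGra_inv n k d" unfolding KGra_inv_iff by blast
qed

lemma conv_deg_iff: "f \<in> conv_deg d \<longleftrightarrow> fst f 0 = 0 \<and> fst f 1 = 0 \<and> (\<forall>n. fst f n \<in> KGra_inv n 0 (d + 2 - 2 * int n)) \<and>
     snd f 0 0 = 0 \<and> snd f 0 1 = 0 \<and> (\<forall>n k. snd f n k \<in> KGra_inv n k (d + 1 - 2 * int n - int k))"
  using conv_degD[of f d] unfolding conv_deg_def case_prod_unfold by blast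

lemma conv_deg_linear:
  assumes "f \<in> conv_deg d"
  shows "csc c f \<in> conv_deg d" "g \<in> conv_deg d \<Longrightarrow> f + g \<in> conv_deg d"
proof -
  show "csc c f \<in> conv_deg d"
    using assms unfolding conv_deg_iff fst_csc snd_csc by (auto intro: KGra_inv_linear simp: zero_fun_def)
  assume "g \<in> conv_deg d"
  then show "f + g \<in> conv_deg d"
    using assms unfolding conv_deg_iff fst_add snd_add by (auto intro: KGra_inv_linear simp: zero_fun_def)
qed

lemma zero_conv_deg: "0 \<in> conv_deg d"
  by (simp add: conv_deg_iff zero_KGra_inv)

text \<open>An insertion consumes one vertex, so the numbers of vertices of the two graphs add up to
  one more than the result has; if the second exceeds \<open>b\<close>, the first is at most
  \<open>a\<close>.\<close>

lemma conv_bullet_filt: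
  assumes f: "f \<in> conv_filt a" and g: "g \<in> conv_filt b"
  shows "conv_bullet e f g \<in> conv_filt (a + b)"
proof -
  have ff: "fst f n = 0" if "n \<le> a" for n using f that by (auto simp: conv_filt_def)
  have fs: "snd f n k = 0" if "n + k \<le> a" for n k using f that by (auto simp: conv_filt_def)
  have gf: "fst g n = 0" if "n \<le> b" for n using g that by (auto simp: conv_filt_def)
  have gs: "snd g n k = 0" if "n + k \<le> b" for n k using g that by (auto simp: conv_filt_def)
  have c: "fst (conv_bullet e f g) n L = 0" if n: "n \<le> a + b" for n L
  proof -
    have "ins_c (n - p + 1, 0) 1 p (fst f (n - p + 1)) (fst g p) = 0" if p: "p \<in> {2..n - 1}" for p
    proof (cases "p \<le> b")
      case True then show ?thesis by (simp add: gf ins_c_0_right)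
    next
      case False
      then have "n - p + 1 \<le> a" using n p by auto
      then show ?thesis using ff[of "n - p + 1"] by (simp add: ins_c_0_left)
    qed
    then show ?thesis unfolding fst_bullet by (simp add: act_0)
  qed
  have o: "snd (conv_bullet e f g) n k L = 0" if n: "n + k \<le> a + b" for n k L
  proof -
    have 1: "ins_c (n - p + 1, k) 1 p (snd f (n - p + 1) k) (fst g p) = 0" if p: "p \<in> {2..n}" for p
    proof (cases "p \<le> b")
      case True then show ?thesis by (simp add: gf ins_c_0_right)
    next
      case False
      then have "n - p + 1 + k \<le> a" using n p by auto
      then show ?thesis using fs[of "n - p + 1" k] by (simp add: ins_c_0_left)
    qed
    have 2: "ins_o (r, k - q + p + 1) (p + 1) (n - r, q - p) (snd f r (k - q + p + 1)) (snd g (n - r) (q - p)) = 0"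
      if p: "r \<in> {0..n}" "q \<in> {0..k}" "p \<in> {0..q}" for p q r
    proof (cases "n - r + (q - p) \<le> b")
      case True then show ?thesis by (simp add: gs ins_o_0_right)
    next
      case False
      then have "r + (k - q + p + 1) \<le> a" using n p by auto
      then show ?thesis using fs[of r "k - q + p + 1"] by (simp only: ins_o_0_left)
    qed
    have "(\<Sum>p = 2..n. \<Sum>\<tau>\<in>shuffles_perm p (n - p).
            act n k \<tau> (ins_c (n - p + 1, k) 1 p (snd f (n - p + 1) k) (fst g p)) L) = 0"
      by (intro sum.neutral ballI) (subst 1, assumption, subst act_0, simp)
    moreover have "(\<Sum>r = 0..n. \<Sum>\<sigma>\<in>shuffles_perm r (n - r). \<Sum>q = 0..k. \<Sum>p = 0..q.
            (-1) powi (int (k - q) * int (q - p + 1) + e * int (k - q + p)) *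
            act n k \<sigma> (ins_o (r, k - q + p + 1) (p + 1) (n - r, q - p)
                          (snd f r (k - q + p + 1)) (snd g (n - r) (q - p))) L) = 0"
      by (intro sum.neutral ballI) (subst 2, assumption+, subst act_0, simp)
    ultimately show ?thesis unfolding snd_bullet by simp
  qed
  show ?thesis unfolding conv_filt_def using c o by (auto simp: case_prod_unfold intro!: ext)
qed

lemma conv_filt_linear:
  "f \<in> conv_filt a \<Longrightarrow> csc c f \<in> conv_filt a" "f \<in> conv_filt a \<Longrightarrow> g \<in> conv_filt a \<Longrightarrow> f + g \<in> conv_filt a" "0 \<in> conv_filt a"
  by (auto simp: conv_filt_def csc_def zero_fun_def plus_prod_def zero_prod_def)

subsection \<open>The graded pre-Lie identity\<close>

lemma starC_cong: "(\<And>T L. T \<in> subc S \<Longrightarrow> F (ctr S T) L = F' (ctr S T) L) \<Longrightarrow> (\<And>T L. T \<in> subc S \<Longrightarrow> G T L = G' T L)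
   \<Longrightarrow> starC F G S L = starC F' G' S L"
  unfolding starC_def by (rule sum.cong) auto

lemma starO_cong:
  assumes "\<And>T a I b m L. (T, a, I, b) \<in> subo S ws \<Longrightarrow> m = Min (T \<union> set I) \<Longrightarrow> F (S - T) (a @ [m] @ b) L = F' (S - T) (a @ [m] @ b) L"
    and "\<And>T a I b L. (T, a, I, b) \<in> subo S ws \<Longrightarrow> G T I L = G' T I L"
  shows "starO s F G S ws L = starO s F' G' S ws L"
  unfolding starO_def by (rule sum.cong[OF refl]) (use assms in auto)

lemma starC_left: "starC (\<lambda>S L. c * F S L + F' S L) G S L = c * starC F G S L + starC F' G S L"
  unfolding starC_def sum_distrib_left sum.distrib[symmetric] by (rule sum.cong) (auto simp: algebra_simps)

lemma starO_left: "starO s (\<lambda>S ws L. c (length ws) * F S ws L + F' S ws L) G S ws L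
    = starO (\<lambda>a i b. s a i b * c (a + 1 + b)) F G S ws L + starO s F' G S ws L"
  unfolding starO_def sum.distrib[symmetric] by (rule sum.cong) (auto simp: algebra_simps)

lemma starO_right: "starO s F (\<lambda>S ws L. c (length ws) * G S ws L + G' S ws L) S ws L
    = starO (\<lambda>a i b. s a i b * c i) F G S ws L + starO s F G' S ws L"
  unfolding starO_def sum.distrib[symmetric] by (rule sum.cong) (auto simp: algebra_simps)

lemma starO_scale: assumes "\<And>a i b. a + i + b = length ws \<Longrightarrow> c * s a i b = s' a i b"
  shows "c * starO s F G S ws L = starO s' F G S ws L"
  unfolding starO_def sum_distrib_left
proof (rule sum.cong[OF refl])
  fix x assume "x \<in> subo S ws"
  then obtain T a I b where x: "x = (T, a, I, b)" "ws = a @ I @ b" by (auto simp: subo_def)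
  then have "c * s (length a) (length I) (length b) = s' (length a) (length I) (length b)" by (intro assms) simp
  then show "c * (case x of (T, a, I, b) \<Rightarrow> s (length a) (length I) (length b) *
     (eps (T \<union> set I) L * (F (S - T) (a @ [Min (T \<union> set I)] @ b) (quo (T \<union> set I) L) * G T I (sub (T \<union> set I) L)))) =
     (case x of (T, a, I, b) \<Rightarrow> s' (length a) (length I) (length b) *
     (eps (T \<union> set I) L * (F (S - T) (a @ [Min (T \<union> set I)] @ b) (quo (T \<union> set I) L) * G T I (sub (T \<union> set I) L))))"
    unfolding x(1) prod.case mult.assoc[symmetric, of c] by (simp only:)
qed

lemma parOC_scale: assumes "\<And>a i b. a + i + b = length ws \<Longrightarrow> c * s a i b = s' a i b"
  shows "c * parOC s F G H S ws L = parOC s' F G H S ws L"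
  unfolding parOC_def sum_distrib_left
proof (rule sum.cong[OF refl], goal_cases)
  case (1 x)
  then obtain T U a I b where x: "x = (T, U, a, I, b)" "ws = a @ I @ b" by (auto simp: subo_def)
  then have "c * s (length a) (length I) (length b) = s' (length a) (length I) (length b)" by (intro assms) simp
  then show ?case
    unfolding x(1) prod.case mult.assoc[symmetric, of c] by (simp only:)
qed

lemma hC_parity: "f \<in> conv_deg d \<Longrightarrow> hC f U K \<noteq> 0 \<Longrightarrow> even (int (length K) - d)"
  using hC_deg[of f d U K] by presburger

lemma hO_parity: "f \<in> conv_deg d \<Longrightarrow> hO f U I K \<noteq> 0 \<Longrightarrow> even (int (length K) - (d + 1 + int (length I)))"
  using hO_deg[of f d U I K] by presburger

text \<open>Only parities matter, so this instance of \<open>st\<close> in \<open>parL_parR\<close>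
  is a finite check; likewise \<open>osgn_nested\<close> for \<open>uv\<close> in
  \<open>starO_assoc\<close>.\<close>

lemma osgn_swap: "osgn dh a i (c + j + b) * osgn dg (a + 1 + c) j b * (-1) powi ((dh + 1 + int i) * (dg + 1 + int j))
    = (-1) powi (dg * dh) * (osgn dg (a + i + c) j b * (osgn dh a i (c + 1 + b) :: 'k::field_char_0))"
  by (cases "even dg"; cases "even dh"; cases "even a"; cases "even i"; cases "even c"; cases "even j"; cases "even b")
    (simp_all add: osgn_def minus_one_powi)

lemma osgn_nested: "osgn dh (a + c) i (d + b) * osgn dg a (c + 1 + d) b
    = osgn (dg + dh) a (c + i + d) b * (osgn dh c i d :: 'k::field_char_0)"
  by (cases "even dg"; cases "even dh"; cases "even a"; cases "even i"; cases "even c"; cases "even d"; cases "even b")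
    (simp_all add: osgn_def minus_one_powi)

text \<open>The terms beyond the iterated product are arranged so that exchanging \<open>g\<close>
  and \<open>h\<close> permutes them up to the sign of the exchange: \<open>parC\<close> goes to
  itself, the two \<open>parOC\<close> terms go to each other, and \<open>parL\<close> to
  \<open>parR\<close>.\<close>

lemma hO_assoc:
  assumes f: "f \<in> conv_deg df" and g: "g \<in> conv_deg dg" and h: "h \<in> conv_deg dh" and S: "finite S" "distinct ws" "S \<inter> set ws = {}"
  shows "hO (conv_bullet dh (conv_bullet dg f g) h) S ws L = hO (conv_bullet (dg + dh) f (conv_bullet dh g h)) S ws L
    + ((-1) powi ((dg + dh) * (int (length ws) + 1)) * parC (\<lambda>S. hO f S ws) (hC g) (hC h) S L
      + (-1) powi (dh * (int (length ws) + 1)) * parOC (osgn dg) (hO f) (hO g) (hC h) S ws L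
      + (-1) powi (dg * dh) * ((-1) powi (dg * (int (length ws) + 1)) * parOC (osgn dh) (hO f) (hO h) (hC g) S ws L)
      + (parL (osgn dh) (osgn dg) (hO f) (hO g) (hO h) S ws L + parR (osgn dh) (osgn dg) (hO f) (hO g) (hO h) S ws L))"
proof -
  let ?k = "length ws"
  let ?F = "hO f" and ?Gc = "hC g" and ?Go = "hO g" and ?Hc = "hC h" and ?Ho = "hO h"
  define cg where "cg k = ((-1) powi (dg * (int k + 1)) :: 'a)" for k
  define ch where "ch k = ((-1) powi (dh * (int k + 1)) :: 'a)" for k
  define cgh where "cgh k = ((-1) powi ((dg + dh) * (int k + 1)) :: 'a)" for k
  have fg: "conv_bullet dg f g \<in> conv_deg (df + dg)" and gh: "conv_bullet dh g h \<in> conv_deg (dg + dh)"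
    using conv_bullet_closed f g h by blast+
  have sub: "finite T \<and> T \<inter> set I = {} \<and> distinct I \<and> finite (S - T) \<and> distinct (a @ [Min (T \<union> set I)] @ b) \<and> (S - T) \<inter> set (a @ [Min (T \<union> set I)] @ b) = {}"
    if "(T, a, I, b) \<in> subo S ws" for T a I b
  proof -
    have q: "T \<subseteq> S" "ws = a @ I @ b" "T \<union> set I \<noteq> {}" using that by (auto simp: subo_def)
    then have "finite (T \<union> set I)" using S finite_subset by blast
    then have "Min (T \<union> set I) \<in> T \<union> set I" using q(3) by (rule Min_in)
    then show ?thesis using q S finite_subset[OF q(1) S(1)] by auto
  qed
  have ctr: "finite (ctr S T) \<and> ctr S T \<inter> set ws = {}" if "T \<in> subc S" for T
  proof -
    have q: "T \<subseteq> S" "T \<noteq> {}" using that by (auto simp: subc_def)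
    then have "Min T \<in> T" using S finite_subset by (intro Min_in) auto
    then show ?thesis using q S by (auto simp: ctr_def)
  qed
  have "hO (conv_bullet dh (conv_bullet dg f g) h) S ws L
     = ch ?k * starC (\<lambda>S. hO (conv_bullet dg f g) S ws) ?Hc S L + starO (osgn dh) (hO (conv_bullet dg f g)) ?Ho S ws L"
    unfolding ch_def by (rule hO_bullet[OF fg h S])
  also have "starC (\<lambda>S. hO (conv_bullet dg f g) S ws) ?Hc S L
     = starC (\<lambda>S L. cg ?k * starC (\<lambda>S. ?F S ws) ?Gc S L + starO (osgn dg) ?F ?Go S ws L) ?Hc S L"
    unfolding cg_def by (rule starC_cong) (use hO_bullet[OF f g] ctr S(2) in auto)
  also have "\<dots> = cg ?k * (starC (\<lambda>S. ?F S ws) (starC ?Gc ?Hc) S L + parC (\<lambda>S. ?F S ws) ?Gc ?Hc S L)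
      + (starO (osgn dg) ?F (\<lambda>U I. starC (\<lambda>U. ?Go U I) ?Hc U) S ws L + parOC (osgn dg) ?F ?Go ?Hc S ws L)"
    unfolding starC_left starC_assoc[OF S(1)] starO_starC_nested[OF S(1,3)] ..
  also have "starO (osgn dh) (hO (conv_bullet dg f g)) ?Ho S ws L
     = starO (osgn dh) (\<lambda>S ws L. cg (length ws) * starC (\<lambda>S. ?F S ws) ?Gc S L + starO (osgn dg) ?F ?Go S ws L) ?Ho S ws L"
    unfolding cg_def
  proof (rule starO_cong)
    fix T a I b m K assume x: "(T, a, I, b) \<in> subo S ws" "m = Min (T \<union> set I)"
    show "hO (conv_bullet dg f g) (S - T) (a @ [m] @ b) K = (-1) powi (dg * (int (length (a @ [m] @ b)) + 1)) *
        starC (\<lambda>S. ?F S (a @ [m] @ b)) ?Gc (S - T) K + starO (osgn dg) ?F ?Go (S - T) (a @ [m] @ b) K"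
      unfolding x(2) using sub[OF x(1)] by (intro hO_bullet[OF f g]) blast+
  qed simp
  also have "\<dots> = starO (\<lambda>a i b. osgn dh a i b * cg (a + 1 + b)) (\<lambda>S ws. starC (\<lambda>S. ?F S ws) ?Gc S) ?Ho S ws L
     + starO (osgn dh) (starO (osgn dg) ?F ?Go) ?Ho S ws L"
    by (rule starO_left)
  also have "starO (osgn dh) (starO (osgn dg) ?F ?Go) ?Ho S ws L
     = starO (osgn (dg + dh)) ?F (starO (osgn dh) ?Go ?Ho) S ws L + parL (osgn dh) (osgn dg) ?F ?Go ?Ho S ws L + parR (osgn dh) (osgn dg) ?F ?Go ?Ho S ws L"
    by (rule starO_assoc[OF S(1,3,2)]) (rule osgn_nested)
  also have "starO (\<lambda>a i b. osgn dh a i b * cg (a + 1 + b)) (\<lambda>S ws. starC (\<lambda>S. ?F S ws) ?Gc S) ?Ho S ws L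
     = parOC (\<lambda>a i b. (-1) powi (dg * (dh + 1 + int i)) * (osgn dh a i b * cg (a + 1 + b))) ?F ?Ho ?Gc S ws L"
    by (rule starC_starO_parallel[OF S(1,3) hO_parity[OF h] hC_parity[OF g] refl])
  also have "\<dots> = ((-1) powi (dg * dh) * cg ?k) * parOC (osgn dh) ?F ?Ho ?Gc S ws L"
  proof (rule parOC_scale[symmetric])
    fix a i b assume k: "a + i + b = ?k"
    show "(-1) powi (dg * dh) * cg ?k * osgn dh a i b = (-1) powi (dg * (dh + 1 + int i)) * (osgn dh a i b * cg (a + 1 + b))"
      unfolding k[symmetric] cg_def by (auto simp: osgn_def minus_one_powi)
  qed
  finally have L: "hO (conv_bullet dh (conv_bullet dg f g) h) S ws L =
     ch ?k * (cg ?k * (starC (\<lambda>S. ?F S ws) (starC ?Gc ?Hc) S L + parC (\<lambda>S. ?F S ws) ?Gc ?Hc S L)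
      + (starO (osgn dg) ?F (\<lambda>U I. starC (\<lambda>U. ?Go U I) ?Hc U) S ws L + parOC (osgn dg) ?F ?Go ?Hc S ws L))
     + ((-1) powi (dg * dh) * cg ?k * parOC (osgn dh) ?F ?Ho ?Gc S ws L
      + (starO (osgn (dg + dh)) ?F (starO (osgn dh) ?Go ?Ho) S ws L + parL (osgn dh) (osgn dg) ?F ?Go ?Ho S ws L + parR (osgn dh) (osgn dg) ?F ?Go ?Ho S ws L))" .
  have "hO (conv_bullet (dg + dh) f (conv_bullet dh g h)) S ws L
     = cgh ?k * starC (\<lambda>S. ?F S ws) (hC (conv_bullet dh g h)) S L + starO (osgn (dg + dh)) ?F (hO (conv_bullet dh g h)) S ws L"
    unfolding cgh_def by (rule hO_bullet[OF f gh S])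
  also have "starC (\<lambda>S. ?F S ws) (hC (conv_bullet dh g h)) S L = starC (\<lambda>S. ?F S ws) (starC ?Gc ?Hc) S L"
  proof (rule starC_cong[OF refl])
    fix T K assume "T \<in> subc S"
    then have "finite T" using S finite_subset by (auto simp: subc_def)
    then show "hC (conv_bullet dh g h) T K = starC ?Gc ?Hc T K" by (rule hC_bullet[OF g h])
  qed
  also have "starO (osgn (dg + dh)) ?F (hO (conv_bullet dh g h)) S ws L
     = starO (osgn (dg + dh)) ?F (\<lambda>T I L. ch (length I) * starC (\<lambda>T. ?Go T I) ?Hc T L + starO (osgn dh) ?Go ?Ho T I L) S ws L"
    unfolding ch_def by (rule starO_cong[OF refl]) (use hO_bullet[OF g h] sub in auto)
  also have "\<dots> = starO (\<lambda>a i b. osgn (dg + dh) a i b * ch i) ?F (\<lambda>T I. starC (\<lambda>T. ?Go T I) ?Hc T) S ws L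
     + starO (osgn (dg + dh)) ?F (starO (osgn dh) ?Go ?Ho) S ws L"
    by (rule starO_right)
  also have "starO (\<lambda>a i b. osgn (dg + dh) a i b * ch i) ?F (\<lambda>T I. starC (\<lambda>T. ?Go T I) ?Hc T) S ws L
     = ch ?k * starO (osgn dg) ?F (\<lambda>T I. starC (\<lambda>T. ?Go T I) ?Hc T) S ws L"
  proof (rule starO_scale[symmetric])
    fix a i b assume k: "a + i + b = ?k"
    show "ch ?k * osgn dg a i b = osgn (dg + dh) a i b * ch i"
      unfolding k[symmetric] ch_def by (auto simp: osgn_def minus_one_powi)
  qed
  finally have R: "hO (conv_bullet (dg + dh) f (conv_bullet dh g h)) S ws L =
     cgh ?k * starC (\<lambda>S. ?F S ws) (starC ?Gc ?Hc) S L + (ch ?k * starO (osgn dg) ?F (\<lambda>T I. starC (\<lambda>T. ?Go T I) ?Hc T) S ws L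
     + starO (osgn (dg + dh)) ?F (starO (osgn dh) ?Go ?Ho) S ws L)" .
  have cc: "ch ?k * cg ?k = cgh ?k" unfolding ch_def cg_def cgh_def minus_one_powi_add by (simp add: algebra_simps)
  show ?thesis unfolding L R cgh_def[symmetric] ch_def[symmetric] cg_def[symmetric] cc[symmetric]
    by (simp add: algebra_simps)
qed

text \<open>Graded symmetry of the associator in its last two arguments, with the subtracted
  products moved to the other side. It follows from the symmetry of the parallel parts.\<close>

theorem conv_preLie:
  assumes f: "f \<in> conv_deg df" and g: "g \<in> conv_deg dg" and h: "h \<in> conv_deg dh"
  shows "conv_bullet dh (conv_bullet dg f g) h + csc ((-1) powi (dg * dh)) (conv_bullet (dg + dh) f (conv_bullet dg h g))
    = csc ((-1) powi (dg * dh)) (conv_bullet dg (conv_bullet dh f h) g) + conv_bullet (dg + dh) f (conv_bullet dh g h)"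
    (is "?A + csc ?z ?B = csc ?z ?C + ?D")
proof -
  note cl = conv_bullet_closed
  have fg: "conv_bullet dg f g \<in> conv_deg (df + dg)" and gh: "conv_bullet dh g h \<in> conv_deg (dg + dh)"
    and fh: "conv_bullet dh f h \<in> conv_deg (df + dh)" and hg: "conv_bullet dg h g \<in> conv_deg (dh + dg)"
    using cl f g h by blast+
  have deg: "?A \<in> conv_deg (df + dg + dh)" "?B \<in> conv_deg (df + dg + dh)" "?C \<in> conv_deg (df + dg + dh)" "?D \<in> conv_deg (df + dg + dh)"
    using cl[OF fg h] cl[OF f hg] cl[OF fh g] cl[OF f gh] by (simp_all add: add_ac)
  have z2: "?z * ?z = (1 :: 'a)" by (simp add: minus_one_powi)
  show ?thesis
  proof (rule conv_ext)
    show "?A + csc ?z ?B \<in> conv_deg (df + dg + dh)" "csc ?z ?C + ?D \<in> conv_deg (df + dg + dh)"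
      by (intro conv_deg_linear deg)+
    fix S :: "nat set" and L assume S: "finite S"
    \<comment> \<open>Closed components of the product contain no sign depending on a degree, so the
      degree argument \<open>e\<close> may differ from the one used elsewhere.\<close>
    have a: "hC (conv_bullet d' (conv_bullet d f' g') h') S L = hC (conv_bullet e f' (conv_bullet d' g' h')) S L + parC (hC f') (hC g') (hC h') S L"
      if "f' \<in> conv_deg d1" "g' \<in> conv_deg d" "h' \<in> conv_deg d'" for f' g' h' :: "'a conv" and d1 d d' e
    proof -
      have 1: "starC (hC (conv_bullet d f' g')) (hC h') S L = starC (starC (hC f') (hC g')) (hC h') S L"
        by (rule starC_cong) (use hC_bullet[OF that(1,2)] S in \<open>auto simp: ctr_def\<close>)
      have 2: "starC (hC f') (hC (conv_bullet d' g' h')) S L = starC (hC f') (starC (hC g') (hC h')) S L"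
      proof (rule starC_cong[OF refl])
        fix T K assume "T \<in> subc S"
        then have "finite T" using S finite_subset by (auto simp: subc_def)
        then show "hC (conv_bullet d' g' h') T K = starC (hC g') (hC h') T K" by (rule hC_bullet[OF that(2,3)])
      qed
      show ?thesis
        unfolding hC_bullet[OF cl[OF that(1,2)] that(3) S] hC_bullet[OF that(1) cl[OF that(2,3)] S] 1 2 by (rule starC_assoc[OF S])
    qed
    have p: "parC (hC f) (hC g) (hC h) S L = ?z * parC (hC f) (hC h) (hC g) S L"
      by (rule parC_commute[OF S hC_parity[OF g] hC_parity[OF h]])
    show "hC (?A + csc ?z ?B) S L = hC (csc ?z ?C + ?D) S L"
      unfolding hats_linear a[OF f g h, of "dg + dh"] a[OF f h g, of "dg + dh"] p by (simp add: algebra_simps)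
  next
    fix S :: "nat set" and ws L assume S: "finite S" "distinct ws" "S \<inter> set ws = {}"
    note A = hO_assoc[OF f g h S, of L] and C = hO_assoc[OF f h g S, of L, unfolded add.commute[of dh dg] mult.commute[of dh dg]]
    have p1: "parC (\<lambda>S. hO f S ws) (hC g) (hC h) S L = ?z * parC (\<lambda>S. hO f S ws) (hC h) (hC g) S L"
      by (rule parC_commute[OF S(1) hC_parity[OF g] hC_parity[OF h]])
    have p2: "parL (osgn dh) (osgn dg) (hO f) (hO g) (hO h) S ws L = ?z * parR (osgn dg) (osgn dh) (hO f) (hO h) (hO g) S ws L"
      by (rule parL_parR[OF S(1,3,2) hO_parity[OF g] hO_parity[OF h]]) (assumption | rule osgn_swap)+
    have p3: "parL (osgn dg) (osgn dh) (hO f) (hO h) (hO g) S ws L = ?z * parR (osgn dh) (osgn dg) (hO f) (hO g) (hO h) S ws L"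
      by (rule parL_parR[OF S(1,3,2) hO_parity[OF h] hO_parity[OF g]]) (assumption | rule osgn_swap[unfolded mult.commute[of dg dh]] | rule osgn_swap[of dg _ _ _ _ _ dh, unfolded mult.commute[of dh dg]])+
    have z3: "?z * (?z * x) = x" for x :: 'a using z2 by (simp flip: mult.assoc)
    show "hO (?A + csc ?z ?B) S ws L = hO (csc ?z ?C + ?D) S ws L"
      unfolding hats_linear A C p1 p2 p3 by (simp add: algebra_simps z3)
  qed
qed

subsection \<open>The bracket\<close>

lemma conv_bracket_eq: "conv_bracket d e f g = conv_bullet e f g + csc (- ((-1) powi (d * e))) (conv_bullet d g f)"
  by (rule conv_eqI) (simp_all add: conv_bracket_def fst_csc snd_csc)

lemma conv_bracket_closed: "f \<in> conv_deg d \<Longrightarrow> g \<in> conv_deg e \<Longrightarrow> conv_bracket d e f g \<in> conv_deg (d + e)"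
  unfolding conv_bracket_eq using conv_bullet_closed[of f d g e] conv_bullet_closed[of g e f d]
  by (intro conv_deg_linear) (auto simp: add.commute)

lemma conv_bracket_linear:
  "conv_bracket d e (f + f') g = conv_bracket d e f g + conv_bracket d e f' g"
  "conv_bracket d e (csc c f) g = csc c (conv_bracket d e f g)"
  "conv_bracket d e f (g + g') = conv_bracket d e f g + conv_bracket d e f g'"
  "conv_bracket d e f (csc c g) = csc c (conv_bracket d e f g)"
  unfolding conv_bracket_eq conv_bullet_linear csc_linear by (simp_all add: mult.commute)

lemma conv_bracket_filt: "f \<in> conv_filt a \<Longrightarrow> g \<in> conv_filt b \<Longrightarrow> conv_bracket d e f g \<in> conv_filt (a + b)"
  unfolding conv_bracket_eq using conv_bullet_filt[of f a g b] conv_bullet_filt[of g b f a]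
  by (intro conv_filt_linear) (auto simp: add.commute)

lemma conv_bracket_antisym: "conv_bracket d e f g = csc (- ((-1) powi (d * e))) (conv_bracket e d g f)"
  unfolding conv_bracket_eq csc_linear by (simp add: mult.commute[of e d] minus_one_powi csc_linear add.commute)

text \<open>The commutator of a graded pre-Lie product is a Lie bracket: the pre-Lie identity is
  used once with each of \<open>x\<close>, \<open>y\<close>, \<open>z\<close> in the first
  place.\<close>

theorem conv_jacobi:
  fixes x y z :: "'k::field_char_0 conv"
  assumes x: "x \<in> conv_deg d1" and y: "y \<in> conv_deg d2" and z: "z \<in> conv_deg d3"
  shows "conv_bracket d1 (d2 + d3) x (conv_bracket d2 d3 y z) =
    conv_bracket (d1 + d2) d3 (conv_bracket d1 d2 x y) z
    + csc ((-1) powi (d1 * d2)) (conv_bracket d2 (d1 + d3) y (conv_bracket d1 d3 x z))" (is "?L = ?R")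
proof -
  define s12 where "s12 = ((-1) powi (d1 * d2) :: 'k)"
  define s13 where "s13 = ((-1) powi (d1 * d3) :: 'k)"
  define s23 where "s23 = ((-1) powi (d2 * d3) :: 'k)"
  have s: "(-1) powi (d1 * (d2 + d3)) = s12 * s13" "(-1) powi ((d1 + d2) * d3) = s13 * s23" "(-1) powi (d2 * (d1 + d3)) = s12 * s23"
    "(-1) powi (d1 * d2) = s12" "(-1) powi (d1 * d3) = s13" "(-1) powi (d2 * d3) = s23"
    by (simp_all add: s12_def s13_def s23_def minus_one_powi_add algebra_simps)
  have q: "s12 * s12 = 1" "s13 * s13 = 1" "s23 * s23 = 1" by (simp_all add: s12_def s13_def s23_def minus_one_powi)
  note p1 = conv_preLie[OF x y z] and p2 = conv_preLie[OF y x z] and p3 = conv_preLie[OF z x y]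
  note p = p1[unfolded s] p2[unfolded s] p3[unfolded s]
  \<comment> \<open>The functional \<open>\<phi>\<close> stands for taking one coefficient; this
    turns the identity into one between twelve scalars, the values of the twelve iterated
    products.\<close>
  have main: "\<phi> ?L = \<phi> ?R"
    if \<phi>: "\<And>f g. \<phi> (f + g) = \<phi> f + \<phi> g" "\<And>c f. \<phi> (csc c f) = c * \<phi> f" for \<phi> :: "'k conv \<Rightarrow> 'k"
  proof -
    note e = p[THEN arg_cong[where f = \<phi>], unfolded \<phi>]
    define P1 where "P1 = \<phi> (conv_bullet d3 (conv_bullet d2 x y) z)"
    define P2 where "P2 = \<phi> (conv_bullet d2 (conv_bullet d3 x z) y)"
    define P3 where "P3 = \<phi> (conv_bullet d3 (conv_bullet d1 y x) z)"
    define P4 where "P4 = \<phi> (conv_bullet d1 (conv_bullet d3 y z) x)"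
    define P5 where "P5 = \<phi> (conv_bullet d2 (conv_bullet d1 z x) y)"
    define P6 where "P6 = \<phi> (conv_bullet d1 (conv_bullet d2 z y) x)"
    define Q1 where "Q1 = \<phi> (conv_bullet (d2 + d3) x (conv_bullet d3 y z))"
    define Q2 where "Q2 = \<phi> (conv_bullet (d2 + d3) x (conv_bullet d2 z y))"
    define Q3 where "Q3 = \<phi> (conv_bullet (d1 + d3) y (conv_bullet d3 x z))"
    define Q4 where "Q4 = \<phi> (conv_bullet (d1 + d3) y (conv_bullet d1 z x))"
    define Q5 where "Q5 = \<phi> (conv_bullet (d1 + d2) z (conv_bullet d2 x y))"
    define Q6 where "Q6 = \<phi> (conv_bullet (d1 + d2) z (conv_bullet d1 y x))"
    have e1: "P1 + s23 * Q2 = s23 * P2 + Q1" and e2: "P3 + s13 * Q4 = s13 * P4 + Q3" and e3: "P5 + s12 * Q6 = s12 * P6 + Q5"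
      using e unfolding P1_def P2_def P3_def P4_def P5_def P6_def Q1_def Q2_def Q3_def Q4_def Q5_def Q6_def
      by (simp_all add: add.commute)
    have L: "\<phi> ?L = Q1 - s23 * Q2 - s12 * s13 * (P4 - s23 * P6)"
      unfolding conv_bracket_eq conv_bullet_linear csc_linear \<phi> s P4_def P6_def Q1_def Q2_def
      by (simp add: algebra_simps)
    have R: "\<phi> ?R = P1 - s12 * P3 - s13 * s23 * (Q5 - s12 * Q6) + s12 * (Q3 - s13 * Q4 - s12 * s23 * (P2 - s13 * P5))"
      unfolding conv_bracket_eq conv_bullet_linear csc_linear \<phi> s P1_def P2_def P3_def P5_def Q3_def Q4_def Q5_def Q6_def
      by (simp add: algebra_simps)
    have P: "P1 = s23 * P2 + Q1 - s23 * Q2" "P3 = s13 * P4 + Q3 - s13 * Q4" "P5 = s12 * P6 + Q5 - s12 * Q6"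
      using e1 e2 e3 by (simp_all add: algebra_simps)
    \<comment> \<open>Inserting the possible values of the three signs leaves linear
      identities.\<close>
    have "s12 = 1 \<or> s12 = -1" "s13 = 1 \<or> s13 = -1" "s23 = 1 \<or> s23 = -1"
      by (simp_all add: s12_def s13_def s23_def minus_one_powi)
    then show ?thesis unfolding L R P by (elim disjE) (simp_all add: algebra_simps)
  qed
  show ?thesis
    by (rule conv_eqI; rule main; simp add: fst_csc snd_csc)
qed

lemma conv_filt_anti: "m \<le> n \<Longrightarrow> conv_filt n \<subseteq> conv_filt m"
  by (auto simp: conv_filt_def)

lemma conv_deg_filt_0: "x \<in> conv_deg d \<Longrightarrow> x \<in> conv_filt 0"
  by (auto simp: conv_filt_def conv_deg_def)

lemma conv_filt_iff: "f \<in> conv_filt m \<longleftrightarrow> (\<forall>n\<le>m. fst f n = 0) \<and> (\<forall>n k. n + k \<le> m \<longrightarrow> snd f n k = 0)"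
  by (simp add: conv_filt_def case_prod_unfold)

lemma conv_filt_sep: "(\<And>m. x \<in> conv_filt m) \<Longrightarrow> x = 0"
proof -
  assume x: "\<And>m. x \<in> conv_filt m"
  have "fst x n = 0" "snd x n k = 0" for n k
    using x[of "n + k"] by (simp_all add: conv_filt_iff)
  then show ?thesis by (intro prod_eqI ext) simp_all
qed

lemma fst_sum_conv: "fst (sum \<phi> A) n L = (\<Sum>j\<in>A. fst (\<phi> j) n L)" for \<phi> :: "'a \<Rightarrow> 'k::field_char_0 conv"
  by (induction A rule: infinite_finite_induct) auto
lemma snd_sum_conv: "snd (sum \<phi> A) n k L = (\<Sum>j\<in>A. snd (\<phi> j) n k L)" for \<phi> :: "'a \<Rightarrow> 'k::field_char_0 conv"
  by (induction A rule: infinite_finite_induct) auto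

lemma sum_conv_deg: "(\<And>j. j \<in> A \<Longrightarrow> \<phi> j \<in> conv_deg d) \<Longrightarrow> sum \<phi> A \<in> conv_deg d"
  by (induction A rule: infinite_finite_induct) (auto simp: zero_conv_deg intro: conv_deg_linear)

text \<open>The \<open>j\<close>-th term has no component with at most \<open>j\<close> vertices, so
  each component of the sum is finite.\<close>

lemma conv_complete:
  fixes \<phi> :: "nat \<Rightarrow> 'k::field_char_0 conv"
  assumes \<phi>: "\<And>j. \<phi> j \<in> conv_deg d" "\<And>j. \<phi> j \<in> conv_filt j"
  shows "\<exists>s\<in>conv_deg d. \<forall>N. s - (\<Sum>j\<le>N. \<phi> j) \<in> conv_filt N"
proof -
  define s :: "'k conv" where "s = ((\<lambda>n L. \<Sum>j\<le>n. fst (\<phi> j) n L), (\<lambda>n k L. \<Sum>j\<le>n + k. snd (\<phi> j) n k L))"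
  have z1: "fst (\<phi> j) n = 0" if "n \<le> j" for n j using \<phi>(2)[of j] that by (auto simp: conv_filt_iff)
  have z2: "snd (\<phi> j) n k = 0" if "n + k \<le> j" for n k j using \<phi>(2)[of j] that by (auto simp: conv_filt_iff)
  have s1: "fst s n L = fst (\<Sum>j\<le>N. \<phi> j) n L" if "n \<le> N" for n L N
    unfolding s_def fst_conv fst_sum_conv by (rule sum.mono_neutral_left) (use that z1 in auto)
  have s2: "snd s n k L = snd (\<Sum>j\<le>N. \<phi> j) n k L" if "n + k \<le> N" for n k L N
    unfolding s_def snd_conv snd_sum_conv by (rule sum.mono_neutral_left) (use that z2 in auto)
  have "s \<in> conv_deg d"
  proof -
    have a: "fst s n = fst (\<Sum>j\<le>n. \<phi> j) n" for n by (rule ext) (rule s1, simp)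
    have b: "snd s n k = snd (\<Sum>j\<le>n + k. \<phi> j) n k" for n k by (rule ext) (rule s2, simp)
    have c: "(\<Sum>j\<le>N. \<phi> j) \<in> conv_deg d" for N using \<phi>(1) by (rule sum_conv_deg)
    show ?thesis unfolding conv_deg_iff a b by (intro conjI allI conv_degD[OF c])
  qed
  moreover have "s - (\<Sum>j\<le>N. \<phi> j) \<in> conv_filt N" for N
    unfolding conv_filt_iff using s1 s2 by (auto intro!: ext)
  ultimately show ?thesis by blast
qed

section \<open>Exponentials of adjoint actions in a complete filtered graded Lie algebra\<close>

section \<open>Complete filtered graded Lie algebras\<close>

definition words_le :: "nat \<Rightarrow> bool list set" where "words_le N = {w. length w \<le> N}"

lemma words_le_eq: "words_le N = (\<Union>j\<le>N. words j)" by (auto simp: words_le_def)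

lemma finite_words_le: "finite (words_le N)" by (simp add: words_le_eq)

lemma sum_words_le: "(\<Sum>j\<le>N. \<Sum>w\<in>words j. h w) = (\<Sum>w\<in>words_le N. h w)"
  unfolding words_le_eq by (rule sum.UNION_disjoint[symmetric]) auto

lemma sum_words_snoc: "(\<Sum>w\<in>words (Suc n). f w) = (\<Sum>a\<in>UNIV. \<Sum>w\<in>words n. f (w @ [a]))"
proof -
  have "(\<Sum>w\<in>words (Suc n). f w) = (\<Sum>p\<in>UNIV \<times> words n. f (snd p @ [fst p]))"
    by (rule sum.reindex_bij_witness[of _ "\<lambda>p. snd p @ [fst p]" "\<lambda>w. (last w, butlast w)"])
      (auto simp: length_Suc_conv_rev)
  then show ?thesis by (simp add: sum.cartesian_product case_prod_unfold)
qed

text \<open>The bracket takes the degrees as arguments because its signs depend on them and an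
  element does not determine its degree. Bilinearity, antisymmetry and the filtration estimate hold
  for any such arguments; closure and the Jacobi identity require the elements to lie in the
  corresponding \<open>C d\<close>.\<close>

locale filtered_lie = vector_space sc
  for sc :: "'k::field_char_0 \<Rightarrow> 'a::ab_group_add \<Rightarrow> 'a" (infixr "*s" 75) +
  fixes C :: "int \<Rightarrow> 'a set" and F :: "nat \<Rightarrow> 'a set" and br :: "int \<Rightarrow> int \<Rightarrow> 'a \<Rightarrow> 'a \<Rightarrow> 'a"
  assumes C_sub: "subspace (C d)" and F_sub: "subspace (F n)"
    and F_anti: "m \<le> n \<Longrightarrow> F n \<subseteq> F m" and C_F0: "x \<in> C d \<Longrightarrow> x \<in> F 0"
    and F_sep: "(\<And>n. x \<in> F n) \<Longrightarrow> x = 0"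
    and complete: "(\<And>j. \<phi> j \<in> C d) \<Longrightarrow> (\<And>j. \<phi> j \<in> F j) \<Longrightarrow> \<exists>s\<in>C d. \<forall>N. s - (\<Sum>j\<le>N. \<phi> j) \<in> F N"
    and br_add_left: "br d e (x + x') y = br d e x y + br d e x' y"
    and br_scale_left: "br d e (c *s x) y = c *s br d e x y"
    and br_add_right: "br d e x (y + y') = br d e x y + br d e x y'"
    and br_scale_right: "br d e x (c *s y) = c *s br d e x y"
    and br_C: "x \<in> C d \<Longrightarrow> y \<in> C e \<Longrightarrow> br d e x y \<in> C (d + e)"
    and br_F: "x \<in> F m \<Longrightarrow> y \<in> F n \<Longrightarrow> br d e x y \<in> F (m + n)"
    and br_antisym: "br d e x y = (- ((-1) powi (d * e))) *s br e d y x"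
    and jacobi: "x \<in> C d1 \<Longrightarrow> y \<in> C d2 \<Longrightarrow> z \<in> C d3 \<Longrightarrow>
      br d1 (d2 + d3) x (br d2 d3 y z) = br (d1 + d2) d3 (br d1 d2 x y) z + (-1) powi (d1 * d2) *s br d2 (d1 + d3) y (br d1 d3 x z)"
begin

lemma br_zero [simp]: "br d e 0 y = 0" "br d e x 0 = 0"
  using br_scale_left[of d e 0 0 y] br_scale_right[of d e x 0 0] by simp_all

lemma br_diff: "br d e (x - x') y = br d e x y - br d e x' y" "br d e x (y - y') = br d e x y - br d e x y'"
  using br_add_left[of d e "x - x'" x' y] br_add_right[of d e x "y - y'" y'] by (simp_all add: algebra_simps)

lemma br_minus: "br d e (- x) y = - br d e x y" "br d e x (- y) = - br d e x y"
  using br_diff(1)[of d e 0 x y] br_diff(2)[of d e x 0 y] by simp_all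

lemma br_sum: "br d e (sum f A) y = (\<Sum>a\<in>A. br d e (f a) y)" "br d e x (sum f A) = (\<Sum>a\<in>A. br d e x (f a))"
  by (induction A rule: infinite_finite_induct; simp add: br_add_left br_add_right)+

lemmas C_closed = subspace_0[OF C_sub] subspace_add[OF C_sub] subspace_diff[OF C_sub] subspace_scale[OF C_sub] subspace_sum[OF C_sub] subspace_neg[OF C_sub]
lemmas F_closed = subspace_0[OF F_sub] subspace_add[OF F_sub] subspace_diff[OF F_sub] subspace_scale[OF F_sub] subspace_sum[OF F_sub] subspace_neg[OF F_sub]

definition ceq :: "nat \<Rightarrow> 'a \<Rightarrow> 'a \<Rightarrow> bool" where "ceq N x y \<longleftrightarrow> x - y \<in> F N"

lemma ceq_refl: "ceq N x x" by (simp add: ceq_def F_closed)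
lemma ceq_sym: "ceq N x y \<Longrightarrow> ceq N y x" unfolding ceq_def using F_closed(6)[of "x - y"] by simp
lemma ceq_trans: "ceq N x y \<Longrightarrow> ceq N y z \<Longrightarrow> ceq N x z" unfolding ceq_def using F_closed(2)[of "x - y" N "y - z"] by simp
lemma ceq_sum: "(\<And>a. a \<in> A \<Longrightarrow> ceq N (f a) (g a)) \<Longrightarrow> ceq N (sum f A) (sum g A)"
  unfolding ceq_def sum_subtractf[symmetric] by (rule F_closed(5))
lemma ceq_scale: "ceq N x y \<Longrightarrow> ceq N (c *s x) (c *s y)"
  unfolding ceq_def scale_right_diff_distrib[symmetric] by (rule F_closed(4))
lemma ceq_eq: "(\<And>N. ceq N x y) \<Longrightarrow> x = y"
  using F_sep[of "x - y"] by (simp add: ceq_def)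
lemma F_mono: "x \<in> F M \<Longrightarrow> N \<le> M \<Longrightarrow> x \<in> F N" using F_anti[of N M] by auto

lemma br_ceq_right: assumes "x \<in> C d" "ceq N y y'" shows "ceq N (br d e x y) (br d e x y')"
  using br_F[OF C_F0[OF assms(1)], of "y - y'" N d e] assms(2) by (simp add: ceq_def br_diff)
lemma br_ceq_left: assumes "ceq N x x'" "y \<in> C e" shows "ceq N (br d e x y) (br d e x' y)"
  using br_F[of "x - x'" N y 0 d e] C_F0[OF assms(2)] assms(1) by (simp add: ceq_def br_diff)

text \<open>The limit of the partial sums; it is unique because the filtration is separated.\<close>

definition lim :: "(nat \<Rightarrow> 'a) \<Rightarrow> 'a" where "lim \<phi> = (THE s. \<forall>N. ceq N s (\<Sum>j\<le>N. \<phi> j))"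

lemma lim_eq: assumes "\<And>N. ceq N s (\<Sum>j\<le>N. \<phi> j)" shows "lim \<phi> = s"
  unfolding lim_def
proof (rule the_equality)
  show "\<And>t. \<forall>N. ceq N t (\<Sum>j\<le>N. \<phi> j) \<Longrightarrow> t = s"
    using assms by (blast intro: ceq_eq ceq_trans ceq_sym)
qed (use assms in blast)

lemma lim_props:
  assumes "\<And>j. \<phi> j \<in> C d" "\<And>j. \<phi> j \<in> F j"
  shows "lim \<phi> \<in> C d" "ceq N (lim \<phi>) (\<Sum>j\<le>N. \<phi> j)"
proof -
  obtain s where s: "s \<in> C d" "\<And>N. ceq N s (\<Sum>j\<le>N. \<phi> j)" using complete[OF assms] unfolding ceq_def by blast
  have "lim \<phi> = s" by (rule lim_eq) (rule s)
  then show "lim \<phi> \<in> C d" "ceq N (lim \<phi>) (\<Sum>j\<le>N. \<phi> j)" using s by auto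
qed

text \<open>The elements that can be exponentiated: their adjoint action preserves degrees and
  raises the filtration.\<close>

definition G :: "'a set" where "G = C 0 \<inter> F 1"

lemma ad_closed: assumes "x \<in> G" "v \<in> C d" "v \<in> F a" shows "br 0 d x v \<in> C d" "br 0 d x v \<in> F (Suc a)"
  using br_C[of x 0 v d] br_F[of x 1 v a 0 d] assms by (auto simp: G_def)

lemma ad_power_closed: assumes "x \<in> G" "v \<in> C d" "v \<in> F a"
  shows "(br 0 d x ^^ j) v \<in> C d \<and> (br 0 d x ^^ j) v \<in> F (a + j)"
proof (induction j)
  case (Suc j) then show ?case using ad_closed[OF assms(1), of "(br 0 d x ^^ j) v" d "a + j"] by simp
qed (use assms in simp)

subsection \<open>The exponential\<close>

definition ex :: "int \<Rightarrow> 'a \<Rightarrow> 'a \<Rightarrow> 'a" where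
  "ex d x v = lim (\<lambda>j. (1 / fact j) *s (br 0 d x ^^ j) v)"

lemma ex_props: assumes "x \<in> G" "v \<in> C d"
  shows "ex d x v \<in> C d" "ceq N (ex d x v) (\<Sum>j\<le>N. (1 / fact j) *s (br 0 d x ^^ j) v)"
proof -
  have *: "(br 0 d x ^^ j) v \<in> C d \<and> (br 0 d x ^^ j) v \<in> F j" for j
    using ad_power_closed[OF assms C_F0[OF assms(2)], of j] by simp
  show "ex d x v \<in> C d" "ceq N (ex d x v) (\<Sum>j\<le>N. (1 / fact j) *s (br 0 d x ^^ j) v)"
    unfolding ex_def by (rule lim_props; use * in \<open>auto intro: C_closed F_closed\<close>)+
qed

lemma ex_fixed: assumes "br 0 d x v = 0" shows "ex d x v = v"
  unfolding ex_def
proof (rule lim_eq)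
  fix N
  have "(br 0 d x ^^ j) v = 0" if "j > 0" for j
    using that
  proof (induction j)
    case (Suc j) then show ?case using assms by (cases j) auto
  qed simp
  then have "(\<Sum>j\<le>N. (1 / fact j) *s (br 0 d x ^^ j) v) = (\<Sum>j\<le>N. if j = 0 then v else 0)"
    by (intro sum.cong) auto
  then show "ceq N v (\<Sum>j\<le>N. (1 / fact j) *s (br 0 d x ^^ j) v)" by (simp add: ceq_refl)
qed

lemma ad_power_br:
  assumes x: "x \<in> C 0" and u: "u \<in> C d" and v: "v \<in> C e"
  shows "(br 0 (d + e) x ^^ n) (br d e u v) = (\<Sum>k\<le>n. of_nat (n choose k) *s br d e ((br 0 d x ^^ k) u) ((br 0 e x ^^ (n - k)) v))"
proof (induction n)
  case (Suc n)
  have cl: "(br 0 d x ^^ k) u \<in> C d" "(br 0 e x ^^ k) v \<in> C e" for k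
    by (induction k) (use u v br_C[OF x] in fastforce)+
  let ?t = "\<lambda>k l. br d e ((br 0 d x ^^ k) u) ((br 0 e x ^^ l) v)"
  have der: "br 0 (d + e) x (?t k l) = ?t (Suc k) l + ?t k (Suc l)" for k l
    using jacobi[OF x cl(1)[of k] cl(2)[of l]] by simp
  have "(br 0 (d + e) x ^^ Suc n) (br d e u v) = (\<Sum>k\<le>n. of_nat (n choose k) *s ?t (Suc k) (n - k)) + (\<Sum>k\<le>n. of_nat (n choose k) *s ?t k (Suc n - k))"
    unfolding funpow.simps comp_apply Suc br_sum br_scale_right der scale_right_distrib sum.distrib
    by (intro arg_cong2[where f = plus] refl sum.cong) (simp add: Suc_diff_le)
  also have "(\<Sum>k\<le>n. of_nat (n choose k) *s ?t k (Suc n - k)) = (\<Sum>k\<le>Suc n. of_nat (n choose k) *s ?t k (Suc n - k))"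
    by (simp add: binomial_eq_0)
  also have "\<dots> = ?t 0 (Suc n) + (\<Sum>k\<le>n. of_nat (n choose Suc k) *s ?t (Suc k) (n - k))"
    by (subst sum.atMost_Suc_shift) simp
  also have "(\<Sum>k\<le>n. of_nat (n choose k) *s ?t (Suc k) (n - k)) + (?t 0 (Suc n) + (\<Sum>k\<le>n. of_nat (n choose Suc k) *s ?t (Suc k) (n - k)))
    = ?t 0 (Suc n) + (\<Sum>k\<le>n. of_nat (Suc n choose Suc k) *s ?t (Suc k) (n - k))"
    by (simp add: scale_left_distrib sum.distrib del: funpow.simps)
  also have "\<dots> = (\<Sum>k\<le>Suc n. of_nat (Suc n choose k) *s ?t k (Suc n - k))"
    by (subst sum.atMost_Suc_shift) simp
  finally show ?case .
qed simp

text \<open>The exponential of a derivation is an automorphism. Modulo \<open>F N\<close> the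
  product of the two truncated series may be cut to the triangle \<open>i + j \<le> N\<close>, where
  the Leibniz rule \<open>ad_power_br\<close> applies.\<close>

lemma ex_bracket:
  assumes x: "x \<in> G" and u: "u \<in> C d" and v: "v \<in> C e"
  shows "ex (d + e) x (br d e u v) = br d e (ex d x u) (ex e x v)"
proof (rule ceq_eq)
  fix N
  have x0: "x \<in> C 0" using x by (simp add: G_def)
  let ?U = "\<lambda>i. (1 / fact i) *s (br 0 d x ^^ i) u" and ?V = "\<lambda>j. (1 / fact j) *s (br 0 e x ^^ j) v"
  have UC: "?U i \<in> C d" "?U i \<in> F i" for i
    using ad_power_closed[OF x u C_F0[OF u], of i] by (auto intro: C_closed F_closed)
  have VC: "?V i \<in> C e" "?V i \<in> F i" for i
    using ad_power_closed[OF x v C_F0[OF v], of i] by (auto intro: C_closed F_closed)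
  have c1: "ceq N (br d e (ex d x u) (ex e x v)) (br d e (\<Sum>i\<le>N. ?U i) (ex e x v))"
    by (rule br_ceq_left[OF ex_props(2)[OF x u] ex_props(1)[OF x v]])
  have c2: "ceq N (br d e (\<Sum>i\<le>N. ?U i) (ex e x v)) (br d e (\<Sum>i\<le>N. ?U i) (\<Sum>j\<le>N. ?V j))"
    by (rule br_ceq_right[OF C_closed(5)[OF UC(1)] ex_props(2)[OF x v]])
  have c3: "ceq N (br d e (\<Sum>i\<le>N. ?U i) (\<Sum>j\<le>N. ?V j)) (\<Sum>(i,j)\<in>{(i,j). i + j \<le> N}. br d e (?U i) (?V j))"
  proof -
    have "br d e (\<Sum>i\<le>N. ?U i) (\<Sum>j\<le>N. ?V j) = (\<Sum>(i,j)\<in>{..N} \<times> {..N}. br d e (?U i) (?V j))"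
      by (simp only: br_sum(1)) (simp only: br_sum(2) sum.cartesian_product)
    also have "\<dots> = (\<Sum>(i,j)\<in>{(i,j). i + j \<le> N}. br d e (?U i) (?V j)) + (\<Sum>(i,j)\<in>{..N} \<times> {..N} - {(i,j). i + j \<le> N}. br d e (?U i) (?V j))"
      by (subst sum.subset_diff[of "{(i,j). i + j \<le> N}"]) (auto simp: add.commute)
    finally have "br d e (\<Sum>i\<le>N. ?U i) (\<Sum>j\<le>N. ?V j) - (\<Sum>(i,j)\<in>{(i,j). i + j \<le> N}. br d e (?U i) (?V j))
       = (\<Sum>(i,j)\<in>{..N} \<times> {..N} - {(i,j). i + j \<le> N}. br d e (?U i) (?V j))" by simp
    moreover have "(\<Sum>(i,j)\<in>{..N} \<times> {..N} - {(i,j). i + j \<le> N}. br d e (?U i) (?V j)) \<in> F N"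
    proof (rule F_closed(5))
      fix p assume "p \<in> {..N} \<times> {..N} - {(i,j). i + j \<le> N}"
      then obtain i j where "p = (i, j)" "N \<le> i + j" by auto
      then show "(case p of (i, j) \<Rightarrow> br d e (?U i) (?V j)) \<in> F N"
        using F_mono[OF br_F[OF UC(2)[of i] VC(2)[of j]]] by simp
    qed
    ultimately show ?thesis by (simp add: ceq_def)
  qed
  have c4: "(\<Sum>(i,j)\<in>{(i,j). i + j \<le> N}. br d e (?U i) (?V j)) = (\<Sum>n\<le>N. (1 / fact n) *s (br 0 (d + e) x ^^ n) (br d e u v))"
  proof -
    have "(\<Sum>(i,j)\<in>{(i,j). i + j \<le> N}. br d e (?U i) (?V j)) = (\<Sum>n\<le>N. \<Sum>i\<le>n. br d e (?U i) (?V (n - i)))"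
      by (rule sum.triangle_reindex_eq)
    also have "\<dots> = (\<Sum>n\<le>N. (1 / fact n) *s (br 0 (d + e) x ^^ n) (br d e u v))"
    proof (rule sum.cong[OF refl])
      fix n
      show "(\<Sum>i\<le>n. br d e (?U i) (?V (n - i))) = (1 / fact n) *s (br 0 (d + e) x ^^ n) (br d e u v)"
        unfolding ad_power_br[OF x0 u v] scale_sum_right
        by (rule sum.cong[OF refl]) (simp add: br_scale_left br_scale_right binomial_fact)
    qed
    finally show ?thesis .
  qed
  have "br d e u v \<in> C (d + e)" using br_C u v by blast
  then have c5: "ceq N (ex (d + e) x (br d e u v)) (\<Sum>n\<le>N. (1 / fact n) *s (br 0 (d + e) x ^^ n) (br d e u v))"
    by (rule ex_props(2)[OF x])
  show "ceq N (ex (d + e) x (br d e u v)) (br d e (ex d x u) (ex e x v))"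
    using ceq_trans[OF c5[folded c4] ceq_sym[OF ceq_trans[OF ceq_trans[OF c1 c2] c3]]] .
qed

text \<open>The agreement of the adjoint actions improves by one filtration step at a time: if they
  agree to some order, the terms of the exponential series with exponent at least 2 agree to one
  order more, and equality of the exponentials forces the same for the linear term.\<close>

lemma ex_inj:
  assumes x: "x \<in> G" and y: "y \<in> G" and eq: "\<And>v. v \<in> C d \<Longrightarrow> ex d x v = ex d y v" and v: "v \<in> C d"
  shows "br 0 d x v = br 0 d y v"
proof -
  let ?D = "br 0 d x" and ?E = "br 0 d y"
  have claim: "?D v - ?E v \<in> F (a + Suc m)" if "v \<in> C d" "v \<in> F a" for m a v
    using that
  proof (induction m arbitrary: a v)
    case 0
    then show ?case using ad_closed(2)[OF x 0] ad_closed(2)[OF y 0] by (auto intro: F_closed)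
  next
    case (Suc m)
    note outer = Suc.IH and v = Suc.prems
    have pw: "(?D ^^ j) v - (?E ^^ j) v \<in> F (a + m + j)" for j
    proof (induction j)
      case (Suc j)
      have E: "(?E ^^ j) v \<in> C d" "(?E ^^ j) v \<in> F (a + j)" and D: "(?D ^^ j) v \<in> C d"
        using ad_power_closed[OF y v, of j] ad_power_closed[OF x v, of j] by blast+
      have e: "(?D ^^ Suc j) v - (?E ^^ Suc j) v = ?D ((?D ^^ j) v - (?E ^^ j) v) + (?D ((?E ^^ j) v) - ?E ((?E ^^ j) v))"
        by (simp only: br_diff funpow.simps comp_apply) (simp only: algebra_simps)
      have 1: "?D ((?D ^^ j) v - (?E ^^ j) v) \<in> F (a + m + Suc j)"
        using ad_closed(2)[OF x C_closed(3)[OF D E(1)] Suc.IH] by (simp only: add_Suc_right)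
      have 2: "?D ((?E ^^ j) v) - ?E ((?E ^^ j) v) \<in> F (a + m + Suc j)"
        using outer[OF E] by (simp only: add.assoc add.left_commute add.commute add_Suc_right)
      show ?case unfolding e by (rule F_closed(2)[OF 1 2])
    qed (simp add: F_closed)
    let ?N = "a + Suc (Suc m)"
    have "ceq ?N (\<Sum>j\<le>?N. (1 / fact j) *s (?D ^^ j) v) (\<Sum>j\<le>?N. (1 / fact j) *s (?E ^^ j) v)"
      using ceq_trans[OF ceq_sym[OF ex_props(2)[OF x v(1), of ?N]] ex_props(2)[OF y v(1), of ?N, folded eq[OF v(1)]]] .
    then have "(\<Sum>j\<le>?N. (1 / fact j) *s ((?D ^^ j) v - (?E ^^ j) v)) \<in> F ?N"
      by (simp add: ceq_def scale_right_diff_distrib sum_subtractf)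
    also have "(\<Sum>j\<le>?N. (1 / fact j) *s ((?D ^^ j) v - (?E ^^ j) v)) = (?D v - ?E v) + (\<Sum>j\<in>{..?N} - {1}. (1 / fact j) *s ((?D ^^ j) v - (?E ^^ j) v))"
      by (subst sum.remove[of _ 1]) simp_all
    finally have s: "(?D v - ?E v) + (\<Sum>j\<in>{..?N} - {1}. (1 / fact j) *s ((?D ^^ j) v - (?E ^^ j) v)) \<in> F ?N" .
    have "(\<Sum>j\<in>{..?N} - {1}. (1 / fact j) *s ((?D ^^ j) v - (?E ^^ j) v)) \<in> F ?N"
    proof (rule F_closed(5))
      fix j assume "j \<in> {..?N} - {1}"
      then have "j = 0 \<or> j \<ge> 2" by auto
      then have "(?D ^^ j) v - (?E ^^ j) v \<in> F ?N"
      proof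
        assume "j \<ge> 2"
        then show ?thesis using F_mono[OF pw[of j]] by simp
      qed (simp add: F_closed)
      then show "(1 / fact j) *s ((?D ^^ j) v - (?E ^^ j) v) \<in> F ?N" by (rule F_closed(4))
    qed
    from F_closed(3)[OF s this] show ?case by simp
  qed
  have "ceq N (?D v) (?E v)" for N
    using F_mono[OF claim[OF v C_F0[OF v], of N], of N] by (simp add: ceq_def)
  then show ?thesis by (rule ceq_eq)
qed
end

section \<open>The Campbell-Hausdorff product and its exponential\<close>

subsection \<open>The Campbell--Hausdorff product\<close>

lemma cf_ncZ_single: "cf (ncZ :: 'k::field_char_0 ncps) [a] = 1"
proof -
  have "(\<Sum>j\<le>1. cf (ncZ ^ j :: 'k ncps) [a] / fact j) = cf ncW [a]" by (rule cf_exp_ncZ) simp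
  moreover have "cf (ncW :: 'k ncps) [a] = 1" by (cases a) (simp_all add: ncW_def cf_mult cf_ncexp)
  ultimately show ?thesis by (simp add: cf_1)
qed

lemma dynkin_single: "(dynkin [a] :: 'k::field_char_0) = 1"
  by (simp add: dynkin_def cf_ncZ_single)

context filtered_lie
begin

definition adw :: "int \<Rightarrow> 'a \<Rightarrow> 'a \<Rightarrow> bool list \<Rightarrow> 'a \<Rightarrow> 'a" where
  "adw d x y w v = foldr (\<lambda>a. br 0 d (if a then x else y)) w v"

definition rn :: "'a \<Rightarrow> 'a \<Rightarrow> bool list \<Rightarrow> 'a" where
  "rn x y w = right_nested (br 0 0) (map (\<lambda>a. if a then x else y) w)"

text \<open>Noncommutative series act on homogeneous elements by letting the letters act as
  \<open>ad x\<close> and \<open>ad y\<close>; the product of series becomes composition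
  (\<open>ev_mult\<close>).\<close>

definition ev :: "int \<Rightarrow> 'a \<Rightarrow> 'a \<Rightarrow> 'k ncps \<Rightarrow> 'a \<Rightarrow> 'a" where
  "ev d x y f v = lim (\<lambda>j. \<Sum>w\<in>words j. cf f w *s adw d x y w v)"

definition ch :: "'a \<Rightarrow> 'a \<Rightarrow> 'a" where
  "ch x y = lim (\<lambda>j. \<Sum>w\<in>words j. dynkin w *s rn x y w)"

lemma rn_Nil [simp]: "rn x y [] = 0" and rn_single: "rn x y [a] = (if a then x else y)"
  and rn_Cons: "w \<noteq> [] \<Longrightarrow> rn x y (a # w) = br 0 0 (if a then x else y) (rn x y w)"
  by (simp_all add: rn_def) (cases w; simp)

lemma adw_Nil [simp]: "adw d x y [] v = v"
  and adw_Cons: "adw d x y (a # w) v = br 0 d (if a then x else y) (adw d x y w v)"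
  and adw_append: "adw d x y (w @ u) v = adw d x y w (adw d x y u v)"
  by (simp_all add: adw_def)

lemma adw_linear: "adw d x y w (c *s v) = c *s adw d x y w v" "adw d x y w (sum h B) = (\<Sum>b\<in>B. adw d x y w (h b))"
  "adw d x y w (v - v') = adw d x y w v - adw d x y w v'"
  by (induction w) (simp_all add: adw_Cons br_scale_right br_sum br_diff)

lemma adw_replicate: "adw d x y (replicate j a) v = (br 0 d (if a then x else y) ^^ j) v"
  by (induction j) (simp_all add: adw_Cons)

context
  fixes x y assumes x: "x \<in> G" and y: "y \<in> G"
begin

lemma letter_G: "(if a then x else y) \<in> G" using x y by simp

lemma adw_closed: assumes "v \<in> C d" "v \<in> F a"
  shows "adw d x y w v \<in> C d" "adw d x y w v \<in> F (a + length w)"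
proof -
  have "adw d x y w v \<in> C d \<and> adw d x y w v \<in> F (a + length w)"
  proof (induction w)
    case (Cons b w)
    then show ?case using ad_closed[OF letter_G[of b], of "adw d x y w v" d "a + length w"] by (simp add: adw_Cons)
  qed (use assms in simp)
  then show "adw d x y w v \<in> C d" "adw d x y w v \<in> F (a + length w)" by auto
qed

lemma adw_F: assumes "v \<in> F a" shows "adw d x y w v \<in> F a"
proof (induction w)
  case (Cons b w)
  show ?case using br_F[OF C_F0 Cons, of "if b then x else y" 0 0 d] letter_G[of b] by (simp add: adw_Cons G_def)
qed (use assms in simp)

lemma ev_props: assumes v: "v \<in> C d"
  shows "ev d x y f v \<in> C d" "ceq N (ev d x y f v) (\<Sum>w\<in>words_le N. cf f w *s adw d x y w v)"
proof -
  have 1: "(\<Sum>w\<in>words j. cf f w *s adw d x y w v) \<in> C d" for j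
    by (intro C_closed(5) C_closed(4) adw_closed(1)[OF v C_F0[OF v]])
  have 2: "(\<Sum>w\<in>words j. cf f w *s adw d x y w v) \<in> F j" for j
    by (intro F_closed(5) F_closed(4)) (use adw_closed(2)[OF v C_F0[OF v]] in auto)
  show "ev d x y f v \<in> C d" unfolding ev_def by (rule lim_props(1)[OF 1 2])
  show "ceq N (ev d x y f v) (\<Sum>w\<in>words_le N. cf f w *s adw d x y w v)"
    using lim_props(2)[OF 1 2, of N] unfolding ev_def sum_words_le .
qed

lemma ev_mult: assumes v: "v \<in> C d" shows "ev d x y (f * g) v = ev d x y f (ev d x y g v)"
proof (rule ceq_eq)
  fix N
  let ?S = "{(w, u). length w + length u \<le> N}" and ?h = "\<lambda>(w, u). (cf f w * cf g u) *s adw d x y (w @ u) v"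
  have fin: "finite (words_le N \<times> words_le N)" by (simp add: finite_words_le)
  have sub: "?S \<subseteq> words_le N \<times> words_le N" by (auto simp: words_le_def)
  have "ceq N (ev d x y (f * g) v) (\<Sum>t\<in>words_le N. cf (f * g) t *s adw d x y t v)" by (rule ev_props(2)[OF v])
  also have "(\<Sum>t\<in>words_le N. cf (f * g) t *s adw d x y t v) = (\<Sum>(t, i)\<in>(SIGMA t:words_le N. {..length t}). (cf f (take i t) * cf g (drop i t)) *s adw d x y t v)"
    unfolding cf_mult scale_sum_left by (rule sum.Sigma) (auto simp: finite_words_le)
  also have "\<dots> = sum ?h ?S"
    by (rule sum.reindex_bij_witness[of _ "\<lambda>(w, u). (w @ u, length w)" "\<lambda>(t, i). (take i t, drop i t)"])
      (auto simp: words_le_def)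
  finally have L: "ceq N (ev d x y (f * g) v) (sum ?h ?S)" .
  have "sum ?h (words_le N \<times> words_le N) = sum ?h ?S + sum ?h (words_le N \<times> words_le N - ?S)"
    using sum.subset_diff[OF sub fin, of ?h] by (simp add: add.commute)
  moreover have "sum ?h (words_le N \<times> words_le N - ?S) \<in> F N"
  proof (rule F_closed(5))
    fix p assume "p \<in> words_le N \<times> words_le N - ?S"
    then obtain w u where p: "p = (w, u)" "N \<le> length (w @ u)" by auto
    show "?h p \<in> F N" unfolding p prod.case
      by (rule F_closed(4)) (rule F_mono[OF adw_closed(2)[OF v C_F0[OF v]]], use p in simp)
  qed
  ultimately have M: "ceq N (sum ?h (words_le N \<times> words_le N)) (sum ?h ?S)" by (simp add: ceq_def)
  have "ceq N (ev d x y f (ev d x y g v)) (\<Sum>w\<in>words_le N. cf f w *s adw d x y w (ev d x y g v))"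
    by (rule ev_props(2)[OF ev_props(1)[OF v]])
  moreover have "ceq N (\<Sum>w\<in>words_le N. cf f w *s adw d x y w (ev d x y g v))
     (\<Sum>w\<in>words_le N. cf f w *s adw d x y w (\<Sum>u\<in>words_le N. cf g u *s adw d x y u v))"
    by (intro ceq_sum ceq_scale) (use adw_F ev_props(2)[OF v] in \<open>simp add: ceq_def adw_linear(3)[symmetric]\<close>)
  moreover have "(\<Sum>w\<in>words_le N. cf f w *s adw d x y w (\<Sum>u\<in>words_le N. cf g u *s adw d x y u v)) = sum ?h (words_le N \<times> words_le N)"
    by (simp add: adw_linear adw_append scale_sum_right sum.cartesian_product)
  ultimately have R: "ceq N (ev d x y f (ev d x y g v)) (sum ?h (words_le N \<times> words_le N))" using ceq_trans by simp
  show "ceq N (ev d x y (f * g) v) (ev d x y f (ev d x y g v))"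
    using ceq_trans[OF L ceq_sym[OF ceq_trans[OF R M]]] .
qed

lemma ev_one: assumes v: "v \<in> C d" shows "ev d x y 1 v = v"
proof (rule ceq_eq)
  fix N
  have "(\<Sum>w\<in>words_le N. cf 1 w *s adw d x y w v) = (\<Sum>w\<in>words_le N. if w = [] then v else 0)"
    by (rule sum.cong) (auto simp: cf_1)
  also have "\<dots> = v" by (simp add: finite_words_le) (simp add: words_le_def)
  finally show "ceq N (ev d x y 1 v) v" using ev_props(2)[OF v, of N 1] by simp
qed

lemma ev_ncexp: assumes v: "v \<in> C d" shows "ev d x y (ncexp a) v = ex d (if a then x else y) v"
proof (rule ceq_eq)
  fix N
  have "(\<Sum>w\<in>words_le N. cf (ncexp a) w *s adw d x y w v) = (\<Sum>j\<le>N. \<Sum>w\<in>words j. if w = replicate j a then (1 / fact j) *s adw d x y w v else 0)"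
    unfolding sum_words_le[symmetric] by (intro sum.cong) (auto simp: cf_ncexp)
  also have "\<dots> = (\<Sum>j\<le>N. (1 / fact j) *s (br 0 d (if a then x else y) ^^ j) v)"
    by (rule sum.cong) (simp_all add: adw_replicate[symmetric])
  finally show "ceq N (ev d x y (ncexp a) v) (ex d (if a then x else y) v)"
    using ceq_trans[OF ev_props(2)[OF v, of N "ncexp a"]] ceq_sym[OF ex_props(2)[OF letter_G v, of N a]] by simp
qed

lemma rn_closed: "rn x y w \<in> C 0" "rn x y w \<in> F (length w)"
proof -
  have "rn x y w \<in> C 0 \<and> rn x y w \<in> F (length w)"
  proof (induction w rule: induct_list012)
    case (2 a) then show ?case using letter_G[of a] by (simp add: rn_single G_def)
  next
    case (3 a b w)
    then show ?case using ad_closed[OF letter_G[of a], of "rn x y (b # w)" 0 "Suc (length w)"] by (simp add: rn_Cons)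
  qed (simp add: C_closed F_closed)
  then show "rn x y w \<in> C 0" "rn x y w \<in> F (length w)" by auto
qed

text \<open>By the Jacobi identity the adjoint action of a nested bracket is the nested commutator
  of adjoint actions, and \<open>ncr\<close> lists the words occurring in it.\<close>

lemma rn_rep: assumes v: "v \<in> C d"
  shows "br 0 d (rn x y w) v = (\<Sum>u\<in>words (length w). cf (ncr w) u *s adw d x y u v)"
  using v
proof (induction w arbitrary: v rule: induct_list012)
  case (2 a)
  then show ?case
    by (cases a) (simp_all add: rn_single sum_words_Suc UNIV_bool cf_letter adw_Cons)
next
  case (3 a b w)
  let ?w = "b # w" and ?x = "if a then x else y" and ?n = "length (b # w)"
  have C0: "?x \<in> C 0" using letter_G[of a] unfolding G_def by blast
  have v': "br 0 d ?x v \<in> C d" using br_C[OF C0 3(3)] by simp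
  have "br 0 d (rn x y (a # ?w)) v = br 0 d ?x (br 0 d (rn x y ?w) v) - br 0 d (rn x y ?w) (br 0 d ?x v)"
    using jacobi[OF C0 rn_closed(1)[of ?w] 3(3)] by (simp add: rn_Cons)
  also have "br 0 d ?x (br 0 d (rn x y ?w) v) = (\<Sum>u\<in>words ?n. cf (ncr ?w) u *s adw d x y (a # u) v)"
    unfolding 3(2)[OF 3(3)] br_sum br_scale_right adw_Cons ..
  also have "\<dots> = (\<Sum>u\<in>words (Suc ?n). cf (letter a * ncr ?w) u *s adw d x y u v)"
    by (cases a) (simp_all only: sum_words_Suc cf_letter_mult_Cons UNIV_bool, simp_all)
  also have "br 0 d (rn x y ?w) (br 0 d ?x v) = (\<Sum>u\<in>words ?n. cf (ncr ?w) u *s adw d x y (u @ [a]) v)"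
    unfolding 3(2)[OF v'] adw_append adw_Cons adw_Nil ..
  also have "\<dots> = (\<Sum>u\<in>words (Suc ?n). cf (ncr ?w * letter a) u *s adw d x y u v)"
    by (cases a) (simp_all only: sum_words_snoc cf_mult_letter_snoc UNIV_bool, simp_all)
  finally show ?case
    by (simp only: ncr_Cons[OF list.distinct(2)] cf_diff scale_left_diff_distrib sum_subtractf list.size) simp
qed simp

lemma ch_props: "ch x y \<in> G" "ceq N (ch x y) (\<Sum>w\<in>words_le N. dynkin w *s rn x y w)"
proof -
  have 1: "(\<Sum>w\<in>words j. dynkin w *s rn x y w) \<in> C 0" for j
    by (intro C_closed(5) C_closed(4) rn_closed)
  have 2: "(\<Sum>w\<in>words j. dynkin w *s rn x y w) \<in> F j" for j
    by (intro F_closed(5) F_closed(4)) (use rn_closed(2) in auto)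
  show *: "ceq N (ch x y) (\<Sum>w\<in>words_le N. dynkin w *s rn x y w)" for N
    using lim_props(2)[OF 1 2, of N] unfolding ch_def sum_words_le .
  have "(\<Sum>w\<in>words_le 1. dynkin w *s rn x y w) \<in> F 1"
  proof (intro F_closed(5) F_closed(4))
    fix w :: "bool list"
    show "rn x y w \<in> F 1"
      by (cases w) (use rn_closed(2)[of w] F_mono[of _ "length w" 1] in \<open>auto simp: F_closed\<close>)
  qed
  then have "ch x y \<in> F 1" using F_closed(2)[OF *[of 1, unfolded ceq_def]] by fastforce
  then show "ch x y \<in> G" using lim_props(1)[OF 1 2] by (simp add: ch_def G_def)
qed

text \<open>The point where Dynkin's formula is used: \<open>dynkin_words\<close> adds up the nested
  commutators to the logarithm.\<close>

lemma br_ch: assumes v: "v \<in> C d" shows "br 0 d (ch x y) v = ev d x y ncZ v"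
proof (rule ceq_eq)
  fix N
  have "ceq N (br 0 d (ch x y) v) (br 0 d (\<Sum>w\<in>words_le N. dynkin w *s rn x y w) v)"
    by (rule br_ceq_left[OF ch_props(2) v])
  also have "br 0 d (\<Sum>w\<in>words_le N. dynkin w *s rn x y w) v
      = (\<Sum>j\<le>N. \<Sum>w\<in>words j. \<Sum>u\<in>words j. (dynkin w * cf (ncr w) u) *s adw d x y u v)"
    unfolding sum_words_le[symmetric] br_sum br_scale_left rn_rep[OF v] scale_sum_right
    by (intro sum.cong refl) auto
  also have "\<dots> = (\<Sum>j\<le>N. \<Sum>u\<in>words j. cf ncZ u *s adw d x y u v)"
  proof (rule sum.cong[OF refl])
    fix j
    have "(\<Sum>w\<in>words j. \<Sum>u\<in>words j. (dynkin w * cf (ncr w) u) *s adw d x y u v)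
       = (\<Sum>u\<in>words j. (\<Sum>w\<in>words j. dynkin w * cf (ncr w) u) *s adw d x y u v)"
      unfolding scale_sum_left by (rule sum.swap)
    also have "\<dots> = (\<Sum>u\<in>words j. cf ncZ u *s adw d x y u v)"
      by (rule sum.cong) (simp_all add: dynkin_words)
    finally show "(\<Sum>w\<in>words j. \<Sum>u\<in>words j. (dynkin w * cf (ncr w) u) *s adw d x y u v) = (\<Sum>u\<in>words j. cf ncZ u *s adw d x y u v)" .
  qed
  finally have "ceq N (br 0 d (ch x y) v) (\<Sum>u\<in>words_le N. cf ncZ u *s adw d x y u v)" by (simp only: sum_words_le)
  then show "ceq N (br 0 d (ch x y) v) (ev d x y ncZ v)" by (rule ceq_trans[OF _ ceq_sym[OF ev_props(2)[OF v]]])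
qed

text \<open>Since \<open>ad (ch x y)\<close> acts as the series \<open>ncZ\<close>, its exponential
  acts as \<open>exp ncZ = ncW\<close>, which is the product of the two exponentials.\<close>

lemma ex_ch: assumes v: "v \<in> C d" shows "ex d (ch x y) v = ex d x (ex d y v)"
proof -
  have pw: "(br 0 d (ch x y) ^^ j) v = ev d x y (ncZ ^ j) v" for j
  proof (induction j)
    case (Suc j)
    show ?case by (simp add: Suc br_ch[OF ev_props(1)[OF v]] ev_mult[OF v])
  qed (simp add: ev_one[OF v])
  have "ex d (ch x y) v = ev d x y ncW v"
  proof (rule ceq_eq)
    fix N
    have "ceq N (ex d (ch x y) v) (\<Sum>j\<le>N. (1 / fact j) *s ev d x y (ncZ ^ j) v)"
      using ex_props(2)[OF ch_props(1) v] unfolding pw .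
    moreover have "ceq N (\<Sum>j\<le>N. (1 / fact j) *s ev d x y (ncZ ^ j) v)
       (\<Sum>j\<le>N. (1 / fact j) *s (\<Sum>w\<in>words_le N. cf (ncZ ^ j) w *s adw d x y w v))"
      by (intro ceq_sum ceq_scale ev_props(2)[OF v])
    moreover have "(\<Sum>j\<le>N. (1 / fact j) *s (\<Sum>w\<in>words_le N. cf (ncZ ^ j) w *s adw d x y w v))
       = (\<Sum>w\<in>words_le N. (\<Sum>j\<le>N. cf (ncZ ^ j) w / fact j) *s adw d x y w v)"
      unfolding scale_sum_right scale_sum_left by (subst sum.swap) simp
    moreover have "\<dots> = (\<Sum>w\<in>words_le N. cf ncW w *s adw d x y w v)"
      by (rule sum.cong) (simp_all add: cf_exp_ncZ words_le_def)
    ultimately have "ceq N (ex d (ch x y) v) (\<Sum>w\<in>words_le N. cf ncW w *s adw d x y w v)" using ceq_trans by simp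
    then show "ceq N (ex d (ch x y) v) (ev d x y ncW v)" by (rule ceq_trans[OF _ ceq_sym[OF ev_props(2)[OF v]]])
  qed
  then show ?thesis by (simp add: ncW_def ev_mult[OF v] ev_ncexp[OF v] ev_ncexp[OF ex_props(1)[OF y v]])
qed

text \<open>In every word of the logarithm the last letter is applied to \<open>v\<close> first and
  gives 0. Applied to the edge graph, this shows that products of cocycles are cocycles.\<close>

lemma ch_kills: assumes v: "v \<in> C d" and 0: "br 0 d x v = 0" "br 0 d y v = 0"
  shows "br 0 d (ch x y) v = 0"
  unfolding br_ch[OF v]
proof (rule ceq_eq)
  fix N
  have "cf ncZ w *s adw d x y w v = 0" for w
  proof (cases w rule: rev_cases)
    case Nil then show ?thesis using vord_ncZ[where 'a = 'k] by (simp add: vord_def)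
  next
    case (snoc u a)
    have "adw d x y u 0 = 0" using adw_linear(1)[of d x y u 0 0] by simp
    then show ?thesis using 0 by (cases a) (simp_all add: snoc adw_append adw_Cons)
  qed
  then show "ceq N (ev d x y ncZ v) 0" using ev_props(2)[OF v, of N ncZ] by (simp del: scale_eq_0_iff)
qed

text \<open>Only the words with one letter survive, and their coefficient is 1.\<close>

lemma ch_commuting: assumes "br 0 0 x x = 0" "br 0 0 x y = 0" "br 0 0 y x = 0" "br 0 0 y y = 0"
  shows "ch x y = x + y"
proof (rule ceq_eq)
  fix N
  have rn: "rn x y w = 0" if "length w \<ge> 2" for w
    using that
  proof (induction w rule: induct_list012)
    case (3 a b w)
    show ?case by (cases w) (use 3 assms in \<open>auto simp: rn_Cons rn_single\<close>)
  qed auto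
  \<comment> \<open>With \<open>Suc N\<close> in place of \<open>N\<close> both one-letter words are
    in the range even if \<open>N = 0\<close>.\<close>
  have "(\<Sum>w\<in>words_le (Suc N). dynkin w *s rn x y w) = (\<Sum>w\<in>{[True], [False]}. dynkin w *s rn x y w)"
  proof (rule sum.mono_neutral_right)
    show "\<forall>w\<in>words_le (Suc N) - {[True], [False]}. dynkin w *s rn x y w = 0"
    proof
      fix w assume w: "w \<in> words_le (Suc N) - {[True], [False]}"
      show "dynkin w *s rn x y w = 0"
      proof (cases "length w \<ge> 2")
        case False
        then have "w = [] \<or> (\<exists>a. w = [a])" by (cases w; cases "tl w") auto
        then have "w = []" using w by auto
        then show ?thesis by simp
      qed (simp add: rn)
    qed
  qed (rule finite_words_le, auto simp: words_le_def)
  then have "ceq (Suc N) (ch x y) (x + y)"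
    using ch_props(2)[of "Suc N"] by (simp add: dynkin_single rn_single)
  then show "ceq N (ch x y) (x + y)" unfolding ceq_def by (rule F_mono) simp
qed

end

lemma br_self_0: "br 0 0 x x = 0"
proof -
  have "2 *s br 0 0 x x = 0" using br_antisym[of 0 0 x x] by (simp add: scale_left_distrib[of 1 1, simplified] eq_neg_iff_add_eq_0)
  then show ?thesis by simp
qed

lemma G_closed: "0 \<in> G" "x \<in> G \<Longrightarrow> - x \<in> G" by (auto simp: G_def C_closed F_closed)

lemma ch_inverse: assumes "x \<in> G" shows "ch x (- x) = 0" "ch (- x) x = 0"
  using ch_commuting[OF assms G_closed(2)[OF assms]] ch_commuting[OF G_closed(2)[OF assms] assms]
  by (simp_all add: br_minus br_self_0)

lemma ch_zero: assumes "x \<in> G" shows "ch x 0 = x" "ch 0 x = x"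
  using ch_commuting[OF assms G_closed(1)] ch_commuting[OF G_closed(1) assms] by (simp_all add: br_self_0)

lemma ex_zero: "ex d 0 v = v" by (rule ex_fixed) simp

lemma ex_inverse: assumes "x \<in> G" "v \<in> C d" shows "ex d (- x) (ex d x v) = v" "ex d x (ex d (- x) v) = v"
  using ex_ch[OF G_closed(2)[OF assms(1)] assms] ex_ch[OF assms(1) G_closed(2)[OF assms(1)] assms(2)]
  by (simp_all add: ch_inverse[OF assms(1)] ex_zero)

text \<open>Bracketing with \<open>c\<close> is a derivation that kills all four arguments, so
  exchanging the letters of a nested bracket one after the other changes it by brackets with
  \<open>c\<close>. The primitives found for a word lie as deep in the filtration as the word is
  long, hence their weighted sum converges.\<close>

lemma ch_exact:
  assumes x: "x \<in> G" and y: "y \<in> G" and x': "x' \<in> G" and y': "y' \<in> G"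
    and c: "c \<in> C 1" and cyc: "br 1 0 c x = 0" "br 1 0 c y = 0" "br 1 0 c x' = 0" "br 1 0 c y' = 0"
    and ex: "\<eta> \<in> C (-1) \<inter> F 1" "x' - x = br 1 (-1) c \<eta>" "\<theta> \<in> C (-1) \<inter> F 1" "y' - y = br 1 (-1) c \<theta>"
  shows "\<exists>\<zeta>\<in>C (-1) \<inter> F 1. ch x' y' - ch x y = br 1 (-1) c \<zeta>"
proof -
  have dl: "br 0 0 (br 1 (-1) c u) z = br 1 (-1) c (br (-1) 0 u z)" if "u \<in> C (-1)" "z \<in> C 0" "br 1 0 c z = 0" for u z
    using jacobi[OF c that(1,2)] that(3) by simp
  have dr: "br 0 0 z (br 1 (-1) c u) = br 1 (-1) c (br 0 (-1) z u)" if "u \<in> C (-1)" "z \<in> C 0" "br 1 0 c z = 0" for u z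
    using jacobi[OF c that(2,1)] that(3) by simp
  have db: "br 1 0 c (br 0 0 z z') = 0" if "z \<in> C 0" "br 1 0 c z = 0" "z' \<in> C 0" "br 1 0 c z' = 0" for z z'
    using jacobi[OF c that(1,3)] that(2,4) by simp
  have cyc_rn: "br 1 0 c (rn x' y' w) = 0" for w
  proof (induction w rule: induct_list012)
    case (3 a b w)
    then show ?case using db[of "if a then x' else y'" "rn x' y' (b # w)"] rn_closed(1)[OF x' y', of "b # w"] x' y' cyc
      by (simp add: rn_Cons G_def)
  qed (use cyc in \<open>auto simp: rn_single\<close>)
  have "\<exists>\<zeta>. \<zeta> \<in> C (-1) \<and> \<zeta> \<in> F (length w) \<and> rn x' y' w - rn x y w = br 1 (-1) c \<zeta>" for w
  proof (induction w rule: induct_list012)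
    case 1 show ?case by (rule exI[of _ 0]) (simp add: C_closed F_closed)
  next
    case (2 a)
    show ?case by (rule exI[of _ "if a then \<eta> else \<theta>"]) (use ex in \<open>simp add: rn_single\<close>)
  next
    case (3 a b w)
    let ?w = "b # w" and ?x = "if a then x else y" and ?x' = "if a then x' else y'" and ?e = "if a then \<eta> else \<theta>"
    obtain \<zeta> where z: "\<zeta> \<in> C (-1)" "\<zeta> \<in> F (length ?w)" "rn x' y' ?w - rn x y ?w = br 1 (-1) c \<zeta>" using 3 by blast
    have e: "?e \<in> C (-1)" "?e \<in> F 1" "?x' - ?x = br 1 (-1) c ?e" "?x \<in> C 0" "?x \<in> F 1" "br 1 0 c ?x = 0"
      using ex x y cyc by (simp_all add: G_def)
    have "rn x' y' (a # ?w) - rn x y (a # ?w) = br 0 0 (?x' - ?x) (rn x' y' ?w) + br 0 0 ?x (rn x' y' ?w - rn x y ?w)"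
      by (simp only: rn_Cons[OF list.distinct(2)] br_diff) (simp only: algebra_simps)
    also have "\<dots> = br 1 (-1) c (br (-1) 0 ?e (rn x' y' ?w) + br 0 (-1) ?x \<zeta>)"
      unfolding e(3) z(3) br_add_right using dl[OF e(1) rn_closed(1)[OF x' y'] cyc_rn] dr[OF z(1) e(4,6)] by simp
    finally have eq: "rn x' y' (a # ?w) - rn x y (a # ?w) = br 1 (-1) c (br (-1) 0 ?e (rn x' y' ?w) + br 0 (-1) ?x \<zeta>)" .
    have "br (-1) 0 ?e (rn x' y' ?w) + br 0 (-1) ?x \<zeta> \<in> C (-1)"
      using C_closed(2)[OF br_C[OF e(1) rn_closed(1)[OF x' y', of ?w]]] br_C[OF e(4) z(1)] by simp
    moreover have "br (-1) 0 ?e (rn x' y' ?w) + br 0 (-1) ?x \<zeta> \<in> F (length (a # ?w))"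
      using F_closed(2)[OF br_F[OF e(2) rn_closed(2)[OF x' y', of ?w]] br_F[OF e(5) z(2)]] by simp
    ultimately show ?case using eq by blast
  qed
  then obtain Z where Z: "\<And>w. Z w \<in> C (-1)" "\<And>w. Z w \<in> F (length w)" "\<And>w. rn x' y' w - rn x y w = br 1 (-1) c (Z w)"
    by metis
  let ?\<phi> = "\<lambda>j. \<Sum>w\<in>words j. dynkin w *s Z w"
  have 1: "?\<phi> j \<in> C (-1)" for j by (intro C_closed(5) C_closed(4) Z)
  have 2: "?\<phi> j \<in> F j" for j by (intro F_closed(5) F_closed(4)) (use Z(2) in auto)
  have lim: "lim ?\<phi> \<in> C (-1)" "ceq N (lim ?\<phi>) (\<Sum>w\<in>words_le N. dynkin w *s Z w)" for N
    using lim_props(1)[OF 1 2] lim_props(2)[OF 1 2, of N] unfolding sum_words_le .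
  have "(\<Sum>w\<in>words_le 1. dynkin w *s Z w) \<in> F 1"
  proof (rule F_closed(5))
    fix w :: "bool list"
    show "dynkin w *s Z w \<in> F 1"
      by (cases w) (use Z(2)[of w] F_mono[of _ "length w" 1] in \<open>auto simp: F_closed dynkin_Nil\<close>)
  qed
  then have F1: "lim ?\<phi> \<in> F 1" using F_closed(2)[OF lim(2)[of 1, unfolded ceq_def]] by fastforce
  have "ch x' y' - ch x y = br 1 (-1) c (lim ?\<phi>)"
  proof (rule ceq_eq)
    fix N
    have "(\<Sum>w\<in>words_le N. dynkin w *s rn x' y' w) - (\<Sum>w\<in>words_le N. dynkin w *s rn x y w)
       = br 1 (-1) c (\<Sum>w\<in>words_le N. dynkin w *s Z w)"
      by (simp add: br_sum br_scale_right Z(3)[symmetric] scale_right_diff_distrib sum_subtractf)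
    moreover have "ceq N (ch x' y' - ch x y) ((\<Sum>w\<in>words_le N. dynkin w *s rn x' y' w) - (\<Sum>w\<in>words_le N. dynkin w *s rn x y w))"
      using F_closed(3)[OF ch_props(2)[OF x' y', of N, unfolded ceq_def] ch_props(2)[OF x y, of N, unfolded ceq_def]]
      by (simp add: ceq_def algebra_simps)
    ultimately show "ceq N (ch x' y' - ch x y) (br 1 (-1) c (lim ?\<phi>))"
      using br_ceq_right[OF c ceq_sym[OF lim(2)]] ceq_trans by fastforce
  qed
  then show ?thesis using lim(1) F1 by blast
qed

end

section \<open>Embedding the cocycles into the convolution Lie algebra\<close>

section \<open>Cocycles of the graph complex inside the convolution Lie algebra\<close>

interpretation conv: filtered_lie csc conv_deg conv_filt conv_bracket
proof unfold_locales
  show "\<exists>s\<in>conv_deg d. \<forall>N. s - (\<Sum>j\<le>N. \<phi> j) \<in> conv_filt N"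
    if "\<And>j. \<phi> j \<in> conv_deg d" "\<And>j. \<phi> j \<in> conv_filt j" for \<phi> :: "nat \<Rightarrow> 'a conv" and d
    using conv_complete[OF that] .
  show "x = 0" if "\<And>n. x \<in> conv_filt n" for x :: "'a conv" using that by (rule conv_filt_sep)
  show "module.subspace csc (conv_deg d :: 'a conv set)" "module.subspace csc (conv_filt n :: 'a conv set)" for d n
    by (subst module.subspace_def; unfold_locales; auto simp: csc_linear zero_conv_deg conv_deg_linear conv_filt_linear)+
qed ((rule csc_linear conv_bracket_linear conv_bracket_closed conv_bracket_filt conv_filt_anti conv_deg_filt_0 conv_bracket_antisym conv_jacobi; assumption)+)

subsection \<open>Units for insertion\<close>

lemma ographs_mset: assumes "mset G = mset L" shows "G \<in> ographs n k \<longleftrightarrow> L \<in> ographs n k"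
  unfolding ographs_iff mset_eq_setD[OF assms] mset_eq_imp_distinct_iff[OF assms] ..

lemma lin_ext_gr:
  assumes x: "x \<in> KGra n k" shows "lin_ext n k gr x = (x :: 'k::field_char_0 gvec)"
proof
  fix L
  have g: "x G / fact (length G) * gr G L = (if mset G = mset L then x L / fact (length L) else 0)" if "G \<in> ographs n k" for G
  proof (cases "mset G = mset L")
    case True
    then have "length G = length L" by (metis size_mset)
    moreover have "x G * gr G L = x L" using gr_alt[OF _ True alt_KGra[OF x]] that by (auto simp: ographs_def)
    ultimately show ?thesis using True by simp
  qed (simp add: gr_eq_0)
  show "lin_ext n k gr x L = x L"
  proof (cases "L \<in> ographs n k")
    case True
    then have d: "distinct L" by (simp add: ographs_def)
    have sub: "{G. mset G = mset L} \<subseteq> ographs n k"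
      using True ographs_mset by blast
    have "lin_ext n k gr x L = (\<Sum>G\<in>ographs n k. if mset G = mset L then x L / fact (length L) else 0)"
      unfolding lin_ext_def by (rule sum.cong[OF refl g])
    also have "\<dots> = (\<Sum>G | mset G = mset L. x L / fact (length L))"
      by (rule sum.mono_neutral_cong_right) (use sub finite_ographs in auto)
    also have "\<dots> = x L" using card_mset_eq(2)[OF d] by simp
    finally show ?thesis .
  next
    case False
    then have "mset G \<noteq> mset L" if "G \<in> ographs n k" for G
      using that ographs_mset by blast
    then have "lin_ext n k gr x L = 0" unfolding lin_ext_def by (intro sum.neutral ballI) (simp add: g gr_eq_0)
    moreover have "x L = 0" using x False by (auto simp: KGra_def)
    ultimately show ?thesis by simp
  qed
qed

lemma ographs_1_0: "ographs 1 0 = {[]}"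
proof -
  have "G = []" if "G \<in> ographs 1 0" for G
    using that by (cases G) (auto simp: ographs_def)
  then show ?thesis by (auto simp: ographs_def)
qed

lemma gr_Nil: "gr [] L = (if L = [] then 1 else 0 :: 'k::field_char_0)"
  using gr_permute[of "[]" id "[]"] gr_eq_0[of "[]" L] by (auto simp: permute_list_def)

lemma gr_Nil_KGra: "(gr [] :: 'k::field_char_0 gvec) \<in> KGra 1 0"
  using alt_gr[of "[]"] by (auto simp: KGra_def alt_def gr_Nil ographs_def)

lemma gr_Nil_KGra_inv: "(gr [] :: 'k::field_char_0 gvec) \<in> KGra_inv 1 0 0"
proof -
  have "act 1 0 \<tau> (gr []) = (gr [] :: 'k gvec)" if "\<tau> permutes {1..1}" for \<tau>
    by (rule ext) (simp only: act_coeff_KGra[OF gr_Nil_KGra that], simp add: gr_Nil)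
  then show ?thesis unfolding KGra_inv_def using gr_Nil_KGra by (auto simp: gr_Nil simp del: One_nat_def split: if_splits)
qed

lemma lin_ext_gr_Nil: "lin_ext 1 0 T (gr []) = (T [] :: 'k::field_char_0 gvec)"
  by (rule ext) (simp only: lin_ext_def ographs_1_0, simp add: gr_Nil)

lemma reconnect_Nil: "reconnect R [] = {[]}" by (simp add: reconnect_def)

lemma reconnect_single: assumes "\<And>v. R v = {v}" shows "reconnect R G = {G}"
proof -
  have "reconnect R G = {G'. list_all2 (=) G' G}"
    unfolding set_eq_iff reconnect_iff assms by (auto elim!: list.rel_mono_strong)
  then show ?thesis by (simp add: list.rel_eq)
qed

lemma ins_c_unit_left:
  assumes "y \<in> KGra n 0" shows "ins_c (1, 0) 1 n (gr []) y = (y :: 'k::field_char_0 gvec)"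
proof -
  have "shift 0 0 = id" by (rule ext) (case_tac x; simp)
  then show ?thesis unfolding ins_c_def prod.case lin_ext_gr_Nil using lin_ext_gr[OF assms]
    by (simp add: reconnect_Nil prod.map_id0)
qed

lemma ins_c_unit_right:
  assumes "x \<in> KGra m p" shows "ins_c (m, p) 1 1 x (gr []) = (x :: 'k::field_char_0 gvec)"
proof -
  have "black_repl 1 1 v = {v}" for v by (cases v) auto
  then have "reconnect (black_repl 1 1) G = {G}" for G by (rule reconnect_single)
  then show ?thesis unfolding ins_c_def prod.case lin_ext_gr_Nil using lin_ext_gr[OF assms] by simp
qed

lemma shuffles_perm_0: "shuffles_perm n 0 = {id}"
proof -
  have "\<sigma> = id" if \<sigma>: "\<sigma> permutes {1..n}" "strict_mono_on {1..n} \<sigma>" for \<sigma>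
  proof -
    let ?l = "[1..<Suc n]"
    have s: "sorted_wrt (<) (map \<sigma> ?l)"
      unfolding sorted_wrt_map
      by (rule sorted_wrt_mono_rel[of _ "(<)"]) (use \<sigma>(2) in \<open>auto simp: strict_mono_on_def simp del: upt_Suc\<close>)
    have "set (map \<sigma> ?l) = set ?l" using permutes_image[OF \<sigma>(1)] by (simp add: atLeastLessThanSuc_atLeastAtMost del: upt_Suc)
    then have "map \<sigma> ?l = ?l" using s by (intro strict_sorted_equal) (simp_all del: upt_Suc)
    then have "map \<sigma> ?l = map id ?l" by (simp only: list.map_id)
    then have *: "\<forall>i\<in>set ?l. \<sigma> i = id i" unfolding map_eq_conv .
    show ?thesis
    proof
      fix i show "\<sigma> i = id i"
        by (cases "i \<in> {1..n}") (use * permutes_not_in[OF \<sigma>(1), of i] in \<open>auto simp del: upt_Suc\<close>)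
    qed
  qed
  moreover have "id \<in> shuffles_perm n 0" by (auto simp: shuffles_perm_def permutes_id strict_mono_on_def)
  ultimately show ?thesis by (auto simp: shuffles_perm_def)
qed

lemma shuffles_perm_1_1: "shuffles_perm 1 1 = {\<sigma>. \<sigma> permutes {1..2}}"
  by (auto simp: shuffles_perm_def strict_mono_on_def numeral_2_eq_2)

subsection \<open>The element with two vertices and one edge\<close>

lemma edge_graph_coeff: "(edge_graph :: 'k::field_char_0 gvec) H = (if H \<in> ographs 2 0 \<and> length H = 1 then 1 else 0)"
proof -
  have g: "(gr [e] H :: 'k) = (if H = [e] then 1 else 0)" for e
    using gr_permute[of "[e]" id "[e]"] gr_eq_0[of "[e]" H] by (auto simp: permutes_id)
  have "H \<in> ographs 2 0 \<and> length H = 1 \<longleftrightarrow> H = [(Black 1, Black 2)] \<or> H = [(Black 2, Black 1)]"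
  proof
    assume H: "H \<in> ographs 2 0 \<and> length H = 1"
    then obtain u v where e: "H = [(u, v)]" by (cases H) auto
    have "{1..2::nat} = {1, 2}" by auto
    then show "H = [(Black 1, Black 2)] \<or> H = [(Black 2, Black 1)]" using H unfolding e by (auto simp: ographs_def)
  qed (auto simp: ographs_def)
  then show ?thesis unfolding edge_graph_def plus_fun_def g by auto
qed

lemma edge_graph_inv: "(edge_graph :: 'k::field_char_0 gvec) \<in> KGra_inv 2 0 (-1)"
proof -
  have a: "alt (edge_graph :: 'k gvec)"
    unfolding edge_graph_def plus_fun_def using alt_gr[where 'k = 'k] unfolding alt_def by (simp add: distrib_left del: One_nat_def)
  have K: "edge_graph \<in> (KGra 2 0 :: 'k gvec set)" using a by (auto simp: KGra_def alt_def edge_graph_coeff)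
  have "act 2 0 \<tau> edge_graph L = (edge_graph L :: 'k)" if "\<tau> permutes {1..2}" for \<tau> L
    unfolding act_coeff_KGra[OF K that] edge_graph_coeff using map_relabel_ographs[OF permutes_inv[OF that]] by simp
  then show ?thesis using K by (auto simp: KGra_inv_def edge_graph_coeff split: if_splits)
qed

definition edge_conv :: "'k::field_char_0 conv" where
  "edge_conv = J_conv (\<lambda>n. if n = 2 then edge_graph else 0)"

lemma edge_conv_deg: "(edge_conv :: 'k::field_char_0 conv) \<in> conv_deg 1"
  using edge_graph_inv by (simp add: zero_KGra_inv conv_deg_iff edge_conv_def J_conv_def)

subsection \<open>Closed and open components of brackets\<close>

text \<open>The two sums differ in the indices \<open>p = 1\<close> and \<open>p = n\<close>, where
  a component on one vertex is a factor; both elements are assumed to have none.\<close>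

lemma fst_bracket:
  assumes "fst f 1 = 0" "fst g 1 = (0 :: 'k::field_char_0 gvec)"
  shows "fst (conv_bracket d e f g) = dfGC_bracket d e (fst f) (fst g)"
proof -
  have *: "fst (conv_bullet e' f g) n = dfGC_bullet (fst f) (fst g) n" if "fst f 1 = 0" "fst g 1 = 0" for f g :: "'k conv" and e' n
  proof
    fix L
    have "fst (conv_bullet e' f g) n L = (\<Sum>p = 1..n. \<Sum>\<tau>\<in>shuffles_perm p (n - p).
        act n 0 \<tau> (ins_c (n - p + 1, 0) 1 p (fst f (n - p + 1)) (fst g p)) L)"
      unfolding fst_bullet
    proof (rule sum.mono_neutral_left)
      show "\<forall>p\<in>{1..n} - {2..n - 1}. (\<Sum>\<tau>\<in>shuffles_perm p (n - p). act n 0 \<tau> (ins_c (n - p + 1, 0) 1 p (fst f (n - p + 1)) (fst g p)) L) = 0"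
      proof
        fix p assume "p \<in> {1..n} - {2..n - 1}"
        then consider "p = 1" | "p = n" by fastforce
        then have "ins_c (n - p + 1, 0) 1 p (fst f (n - p + 1)) (fst g p) = 0"
          by cases (use that in \<open>simp_all add: ins_c_0_left ins_c_0_right\<close>)
        then show "(\<Sum>\<tau>\<in>shuffles_perm p (n - p). act n 0 \<tau> (ins_c (n - p + 1, 0) 1 p (fst f (n - p + 1)) (fst g p)) L) = 0"
          by (simp add: act_0)
      qed
    qed auto
    then show "fst (conv_bullet e' f g) n L = dfGC_bullet (fst f) (fst g) n L"
      by (simp add: dfGC_bullet_def sum_fun_apply)
  qed
  show ?thesis by (simp add: conv_bracket_def dfGC_bracket_def *[OF assms] *[OF assms(2,1)])
qed

lemma snd_bullet_closed_left: "snd f = 0 \<Longrightarrow> snd (conv_bullet e f g) = (0 :: _ \<Rightarrow> _ \<Rightarrow> 'k::field_char_0 gvec)"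
  by (rule ext)+ (simp add: snd_bullet ins_c_0_left ins_o_0_left act_0)

lemma snd_bullet_closed_right: 
  assumes "snd g = (0 :: _ \<Rightarrow> _ \<Rightarrow> 'k::field_char_0 gvec)"
  shows "snd (conv_bullet e f g) n k L = (-1) powi (e * (int k + 1)) *
     (\<Sum>p = 2..n. \<Sum>\<tau>\<in>shuffles_perm p (n - p). act n k \<tau> (ins_c (n - p + 1, k) 1 p (snd f (n - p + 1) k) (fst g p)) L)"
  by (simp add: snd_bullet assms ins_o_0_right act_0)

lemma snd_bracket_closed:
  assumes "snd f = 0" "snd g = (0 :: _ \<Rightarrow> _ \<Rightarrow> 'k::field_char_0 gvec)" shows "snd (conv_bracket d e f g) = 0"
  by (rule ext)+ (simp add: conv_bracket_def snd_bullet_closed_left assms)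

text \<open>A closed element has no open component to insert something into, so only its insertion
  into the open components of \<open>g\<close> remains.\<close>

lemma snd_bracket_closed_left:
  assumes "snd f = (0 :: _ \<Rightarrow> _ \<Rightarrow> 'k::field_char_0 gvec)"
  shows "snd (conv_bracket 0 e f g) n k L = - (\<Sum>p = 2..n. \<Sum>\<tau>\<in>shuffles_perm p (n - p). act n k \<tau> (ins_c (n - p + 1, k) 1 p (snd g (n - p + 1) k) (fst f p)) L)"
  using snd_bullet_closed_right[OF assms, of 0 g n k L] snd_bullet_closed_left[OF assms, of e g]
  by (simp add: conv_bracket_def)

text \<open>The adjoint action of a closed element on \<open>unit_conv\<close> recovers all its components.\<close>

definition unit_conv :: "'k::field_char_0 conv" where
  "unit_conv = (0, \<lambda>n k. if n = 1 \<and> k = 0 then gr [] else 0)"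

lemma unit_conv_deg: "(unit_conv :: 'k::field_char_0 conv) \<in> conv_deg 1"
  using gr_Nil_KGra_inv by (auto simp: zero_KGra_inv conv_deg_iff unit_conv_def)

lemma snd_bracket_unit:
  assumes f: "f \<in> conv_deg d" "snd f = (0 :: _ \<Rightarrow> _ \<Rightarrow> 'k::field_char_0 gvec)"
  shows "fst f n L = - snd (conv_bracket 0 1 f unit_conv) n 0 L"
proof (cases "n \<ge> 2")
  case True
  have K: "fst f n \<in> KGra n 0" "act n 0 id (fst f n) = fst f n"
    using conv_degD(5)[OF f(1), of n] permutes_id by (auto simp: KGra_inv_def)
  let ?h = "\<lambda>p. \<Sum>\<tau>\<in>shuffles_perm p (n - p). act n 0 \<tau> (ins_c (n - p + 1, 0) 1 p (snd (unit_conv :: 'k conv) (n - p + 1) 0) (fst f p)) L"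
  \<comment> \<open>Only \<open>p = n\<close> survives, where the whole graph is put in place of the
    single vertex of \<open>unit_conv\<close>.\<close>
  have "?h p = 0" if "p \<in> {2..n} - {n}" for p
    using that by (simp add: unit_conv_def ins_c_0_left act_0)
  then have "(\<Sum>p = 2..n. ?h p) = (\<Sum>p\<in>{n}. ?h p)" by (intro sum.mono_neutral_right) (use True in auto)
  also have "\<dots> = fst f n L"
    using ins_c_unit_left[OF K(1)] K(2) by (simp add: shuffles_perm_0 unit_conv_def)
  finally show ?thesis using snd_bracket_closed_left[OF f(2), of 1 unit_conv n 0 L] by simp
next
  case False
  then have "n = 0 \<or> n = 1" by auto
  then have "fst f n = 0" using conv_degD(1,2)[OF f(1)] by auto
  then show ?thesis using False snd_bracket_closed_left[OF f(2), of 1 unit_conv n 0 L] by simp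
qed

subsection \<open>Limits and coefficients\<close>

lemma conv_ceq_coeff:
  assumes "conv.ceq N x y"
  shows "n \<le> N \<Longrightarrow> fst x n L = fst y n L" "n + k \<le> N \<Longrightarrow> snd x n k L = snd y n k L"
proof -
  have *: "x - y \<in> conv_filt N" using assms by (simp add: conv.ceq_def)
  show "fst x n L = fst y n L" if "n \<le> N"
  proof -
    have "fst (x - y) n L = 0" using * that by (simp add: conv_filt_iff)
    then show ?thesis by simp
  qed
  show "snd x n k L = snd y n k L" if "n + k \<le> N"
  proof -
    have "snd (x - y) n k L = 0" using * that by (simp add: conv_filt_iff)
    then show ?thesis by simp
  qed
qed

lemma ex_coeff:
  assumes "\<xi> \<in> conv.G" "f \<in> conv_deg d"
  shows "fst (conv.ex d \<xi> f) n L = (\<Sum>j\<le>n. fst ((conv_bracket 0 d \<xi> ^^ j) f) n L / fact j)"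
    "snd (conv.ex d \<xi> f) n k L = (\<Sum>j\<le>n + k. snd ((conv_bracket 0 d \<xi> ^^ j) f) n k L / fact j)"
  using conv_ceq_coeff(1)[OF conv.ex_props(2)[OF assms, of n], of n L]
    conv_ceq_coeff(2)[OF conv.ex_props(2)[OF assms, of "n + k"], of n k L]
  by (simp_all add: fst_sum_conv snd_sum_conv fst_csc snd_csc)

text \<open>At a fixed coefficient the terms beyond the number of vertices vanish, so the sum with
  finite support is the limit in the filtered Lie algebra.\<close>

lemma exp_ad_eq:
  assumes "\<xi> \<in> conv.G" "f \<in> conv_deg d"
  shows "exp_ad d \<xi> f = conv.ex d \<xi> (f :: 'k::field_char_0 conv)"
proof -
  let ?A = "\<lambda>j. (conv_bracket 0 d \<xi> ^^ j) f"
  have F: "?A j \<in> conv_filt j" for j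
    using conv.ad_power_closed[OF assms conv_deg_filt_0[OF assms(2)], of j] by simp
  have z: "j \<le> n" if "fst (?A j) n L \<noteq> 0" for j n L
    using F[of j] that by (cases "n \<le> j") (simp_all add: conv_filt_iff)
  have z': "j \<le> n + k" if "snd (?A j) n k L \<noteq> 0" for j n k L
    using F[of j] that by (cases "n + k \<le> j") (simp_all add: conv_filt_iff)
  show ?thesis
    by (rule conv_eqI; unfold ex_coeff[OF assms] exp_ad_def fst_conv snd_conv; rule Sum_any.expand_superset)
      (use z z' in auto)
qed

lemma conv_G_D: assumes "x \<in> conv.G" shows "x \<in> conv_deg 0" "x \<in> conv_filt 1" "fst x 1 = 0"
  using assms conv_degD(2)[of x 0] by (simp_all add: conv.G_def)

lemma fst_rn:
  assumes x: "x \<in> conv.G" and y: "y \<in> conv.G"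
  shows "fst (conv.rn x y w) = right_nested (dfGC_bracket 0 0) (map (\<lambda>a. if a then fst x else fst y) w)"
proof (induction w rule: induct_list012)
  case (3 a b w)
  have "fst (if a then x else y) 1 = 0" using conv_G_D(3)[OF x] conv_G_D(3)[OF y] by simp
  moreover have "fst (conv.rn x y (b # w)) 1 = 0" by (rule conv_degD(2)[OF conv.rn_closed(1)[OF x y]])
  ultimately show ?case using 3 fst_bracket[of "if a then x else y" "conv.rn x y (b # w)" 0 0]
    by (simp add: conv.rn_Cons if_distrib[of fst])
qed (simp_all add: conv.rn_single)

lemma map_pword: "map (\<lambda>a. if a then X else Y) (pword ps) = concat (map (\<lambda>(r, s). replicate r X @ replicate s Y) ps)"
  by (induction ps) (auto simp: pword_def)

text \<open>The sum in \<open>CH\<close> runs over lists of exponents, the one in \<open>ch\<close>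
  over words. Grouping the lists by the word they spell gives \<open>dynkin_eq\<close>, and words
  with at least \<open>n\<close> letters do not contribute on \<open>n\<close> vertices.\<close>

lemma fst_ch:
  fixes x y :: "'k::field_char_0 conv"
  assumes x: "x \<in> conv.G" and y: "y \<in> conv.G"
  shows "fst (conv.ch x y) = CH (fst x) (fst y)"
proof (intro ext)
  fix n L
  let ?c = "\<lambda>ps :: (nat \<times> nat) list. ps \<noteq> [] \<and> (\<forall>(r, s) \<in> set ps. r + s > 0)"
  let ?d = "\<lambda>ps. (-1) ^ (length ps - 1) / of_nat (length ps) / (of_nat (length (pword ps)) * pfact ps) :: 'k"
  let ?h = "\<lambda>ps. if ?c ps then ?d ps * fst (conv.rn x y (pword ps)) n L else 0"
  let ?P = "{ps. ?c ps \<and> length (pword ps) \<le> n}"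
  have rn0: "fst (conv.rn x y w) n L = 0" if "n \<le> length w" for w
    using conv.rn_closed(2)[OF x y, of w] that by (simp add: conv_filt_iff)
  have finP: "finite ?P"
  proof (rule finite_subset)
    show "?P \<subseteq> {ps. set ps \<subseteq> {..n} \<times> {..n} \<and> length ps \<le> n}"
      using pword_parts_le length_le_length_pword by fastforce
  qed (simp add: finite_lists_length_le)
  have "CH (fst x) (fst y) n L = Sum_any ?h"
    unfolding CH_def fst_rn[OF x y] map_pword length_pword pfact_def
    by (rule arg_cong[where f = Sum_any], rule ext) simp
  also have "\<dots> = sum ?h ?P"
    by (rule Sum_any.expand_superset[OF finP]) (use rn0 in \<open>auto split: if_splits intro: ccontr\<close>)
  also have "\<dots> = (\<Sum>w\<in>words_le n. sum ?h {ps \<in> ?P. pword ps = w})"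
    by (rule sum.group[symmetric, OF finP finite_words_le]) (auto simp: words_le_def)
  also have "\<dots> = (\<Sum>w\<in>words_le n. dynkin w * fst (conv.rn x y w) n L)"
  proof (rule sum.cong[OF refl])
    fix w assume "w \<in> words_le n"
    then have "{ps \<in> ?P. pword ps = w} = {ps. ps \<noteq> [] \<and> (\<forall>(r, s) \<in> set ps. r + s > 0) \<and> pword ps = w}"
      by (auto simp: words_le_def)
    then show "sum ?h {ps \<in> ?P. pword ps = w} = dynkin w * fst (conv.rn x y w) n L"
      unfolding dynkin_eq sum_distrib_right by (intro sum.cong) auto
  qed
  also have "\<dots> = fst (conv.ch x y) n L"
    using conv_ceq_coeff(1)[OF conv.ch_props(2)[OF x y, of n], of n L] by (simp add: fst_sum_conv fst_csc)
  finally show "fst (conv.ch x y) n L = CH (fst x) (fst y) n L" by simp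
qed

subsection \<open>Cocycles of degree 0\<close>

text \<open>On one vertex an element of degree 0 is a multiple \<open>c\<close> of the graph without
  edges. Inserting it into the edge graph gives \<open>2 c\<close> times that graph, from the two
  shuffles, and the opposite insertion gives \<open>c\<close> times it; the difference forces
  \<open>c = 0\<close>.\<close>

lemma dfGC_cocycle_1:
  fixes \<gamma> :: "'k::field_char_0 gfam"
  assumes \<gamma>: "\<gamma> \<in> dfGC 0" and d: "dfGC_diff 0 \<gamma> = 0"
  shows "\<gamma> 1 = 0"
proof -
  let ?E = "\<lambda>n :: nat. if n = 2 then edge_graph else 0 :: 'k gvec"
  have 1: "\<gamma> 1 \<in> KGra_inv 1 0 0" using \<gamma> by (auto simp: dfGC_def)
  obtain c where \<gamma>1: "\<gamma> 1 = (\<lambda>L. c * gr [] L)"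
  proof
    show "\<gamma> 1 = (\<lambda>L. \<gamma> 1 [] * gr [] L)"
    proof
      fix L show "\<gamma> 1 L = \<gamma> 1 [] * gr [] L"
        using 1 by (cases "L = []") (auto simp: KGra_inv_def KGra_def gr_Nil)
    qed
  qed
  have E: "edge_graph \<in> (KGra 2 0 :: 'k gvec set)" "\<And>\<tau>. \<tau> permutes {1..2} \<Longrightarrow> act 2 0 \<tau> edge_graph = (edge_graph :: 'k gvec)"
    using edge_graph_inv by (auto simp: KGra_inv_def)
  have B: "dfGC_bullet f g 2 = (\<Sum>\<tau>\<in>shuffles_perm 1 1. act 2 0 \<tau> (ins_c (2, 0) 1 1 (f 2) (g 1)))
      + (\<Sum>\<tau>\<in>shuffles_perm 2 0. act 2 0 \<tau> (ins_c (1, 0) 1 2 (f 1) (g 2)))" for f g :: "'k gfam"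
  proof -
    have I: "{1..2::nat} = {1, 2}" and e: "2 - 1 = (1::nat)" "2 - 2 = (0::nat)" "1 + 1 = (2::nat)" "0 + 1 = (1::nat)" "(1::nat) \<noteq> 2"
      by auto
    show ?thesis unfolding dfGC_bullet_def I using e by (simp only: sum.insert finite.intros e) (simp add: numeral_2_eq_2[symmetric])
  qed
  have "dfGC_bullet ?E \<gamma> 2 = (\<Sum>\<tau>\<in>shuffles_perm 1 1. act 2 0 \<tau> (ins_c (2, 0) 1 1 edge_graph (\<gamma> 1)))"
    unfolding B by (simp add: ins_c_0_left act_0)
  also have "\<dots> = (\<Sum>\<tau> | \<tau> permutes {1..2::nat}. (\<lambda>L. c * edge_graph L))"
    unfolding shuffles_perm_1_1 by (rule sum.cong[OF refl])
      (simp only: mem_Collect_eq \<gamma>1 ins_c_linear ins_c_unit_right[OF E(1)] act_linear E(2))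
  finally have a: "dfGC_bullet ?E \<gamma> 2 L = 2 * (c * edge_graph L)" for L
    by (simp add: sum_fun_apply card_permutations[of _ 2])
  have "dfGC_bullet \<gamma> ?E 2 = (\<Sum>\<tau>\<in>shuffles_perm 2 0. act 2 0 \<tau> (ins_c (1, 0) 1 2 (\<gamma> 1) edge_graph))"
    unfolding B by (simp add: ins_c_0_right act_0)
  then have b: "dfGC_bullet \<gamma> ?E 2 = (\<lambda>L. c * edge_graph L)"
    by (subst (asm) \<gamma>1) (simp only: shuffles_perm_0 ins_c_linear ins_c_unit_left[OF E(1)] act_linear E(2)[OF permutes_id] sum.insert[OF finite.emptyI] empty_iff not_False_eq_True sum.empty add_0_right)
  let ?L = "[(Black 1, Black 2)]"
  have "dfGC_diff 0 \<gamma> 2 ?L = 0" using d by simp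
  then have "c * edge_graph ?L = 0" by (simp add: dfGC_diff_def dfGC_bracket_def a b del: One_nat_def)
  then have "c = 0" by (simp add: edge_graph_coeff ographs_def)
  then show ?thesis using \<gamma>1 by (auto simp: zero_fun_def)
qed

text \<open>The image of \<open>Z0\<close> under \<open>J_conv\<close>
  (\<open>J_conv_cocycles\<close>, \<open>cocycles_J\<close>), described within the filtered Lie
  algebra.\<close>

definition cocycles :: "'k::field_char_0 conv set" where
  "cocycles = {x \<in> conv.G. snd x = 0 \<and> conv_bracket 1 0 edge_conv x = 0}"

lemma cocyclesD:
  assumes "x \<in> cocycles"
  shows "x \<in> conv.G" "x \<in> conv_deg 0" "fst x 1 = 0" "snd x = 0" "conv_bracket 1 0 edge_conv x = 0"
  using assms conv_G_D[of x] by (simp_all add: cocycles_def)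

lemma J_conv_simps [simp]: "fst (J_conv \<gamma>) = \<gamma>" "snd (J_conv \<gamma>) = 0"
  by (simp_all add: J_conv_def)

lemma closed_filt: "x \<in> conv_deg d \<Longrightarrow> snd x = 0 \<Longrightarrow> x \<in> conv_filt 1"
  using conv_degD(1,2)[of x d] by (auto simp: conv_filt_iff le_Suc_eq)

lemma fst_edge_bracket:
  assumes "fst x 1 = 0"
  shows "fst (conv_bracket 1 d edge_conv x) = dfGC_diff d (fst x :: 'k::field_char_0 gfam)"
  using fst_bracket[of edge_conv x 1 d] assms by (simp add: edge_conv_def dfGC_diff_def)

lemma J_conv_cocycles: "J_conv \<gamma> \<in> cocycles \<longleftrightarrow> \<gamma> \<in> (Z0 :: 'k::field_char_0 gfam set)"
proof
  assume J: "J_conv \<gamma> \<in> cocycles"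
  then have c: "J_conv \<gamma> \<in> conv_deg 0" "fst (J_conv \<gamma>) 1 = 0" by (rule cocyclesD)+
  have "\<gamma> \<in> dfGC 0" using c(1) by (auto simp: dfGC_def conv_deg_iff)
  moreover have "dfGC_diff 0 \<gamma> = 0" using J fst_edge_bracket[OF c(2), of 0] by (simp add: cocycles_def)
  ultimately show "\<gamma> \<in> Z0" by (simp add: Z0_def)
next
  assume "\<gamma> \<in> Z0"
  then have \<gamma>: "\<gamma> \<in> dfGC 0" "dfGC_diff 0 \<gamma> = 0" by (auto simp: Z0_def)
  then have 1: "\<gamma> 1 = 0" by (rule dfGC_cocycle_1)
  have d: "J_conv \<gamma> \<in> conv_deg 0" using \<gamma>(1) 1 by (auto simp: conv_deg_def dfGC_def J_conv_def zero_KGra_inv)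
  have "snd (conv_bracket 1 0 edge_conv (J_conv \<gamma>)) = 0" by (rule snd_bracket_closed) (simp_all add: edge_conv_def)
  moreover have "fst (conv_bracket 1 0 edge_conv (J_conv \<gamma>)) = 0" using fst_edge_bracket[of "J_conv \<gamma>" 0] 1 \<gamma>(2) by simp
  ultimately have "conv_bracket 1 0 edge_conv (J_conv \<gamma>) = 0" by (simp add: prod_eq_iff)
  then show "J_conv \<gamma> \<in> cocycles" using d closed_filt[OF d] by (simp add: cocycles_def conv.G_def)
qed

lemma cocycles_J: "x \<in> cocycles \<Longrightarrow> J_conv (fst x) = x"
  by (simp add: cocycles_def prod_eq_iff)

lemma snd_rn: assumes "snd x = 0" "snd y = 0" shows "snd (conv.rn x y w) = (0 :: _ \<Rightarrow> _ \<Rightarrow> 'k::field_char_0 gvec)"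
proof (induction w rule: induct_list012)
  case (3 a b w)
  have "snd (if a then x else y) = 0" using assms by simp
  then show ?case unfolding conv.rn_Cons[OF list.distinct(2)] by (rule snd_bracket_closed[OF _ 3(2)])
qed (simp_all add: conv.rn_single assms)

lemma edge_bracket_commute: "conv_bracket 1 0 edge_conv x = 0 \<longleftrightarrow> conv_bracket 0 1 x edge_conv = 0"
  using conv_bracket_antisym[of 1 0 edge_conv x] by (simp add: conv.scale_eq_0_iff)

lemma cocycles_ch: assumes x: "x \<in> cocycles" and y: "y \<in> cocycles" shows "conv.ch x y \<in> (cocycles :: 'k::field_char_0 conv set)"
proof -
  have G: "x \<in> conv.G" "y \<in> conv.G" "snd x = 0" "snd y = 0" using x y by (auto simp: cocycles_def)
  have "snd (conv.ch x y) = 0"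
    using conv_ceq_coeff(2)[OF conv.ch_props(2)[OF G(1,2)] le_refl]
    by (intro ext) (simp add: snd_sum_conv snd_csc snd_rn[OF G(3,4)])
  moreover have "conv_bracket 0 1 (conv.ch x y) edge_conv = 0"
    by (rule conv.ch_kills[OF G(1,2) edge_conv_deg])
      (use edge_bracket_commute cocyclesD(5) x y in blast)+
  ultimately show ?thesis
    using conv.ch_props(1)[OF G(1,2)] by (simp add: cocycles_def edge_bracket_commute)
qed

lemma cocycles_closed: "0 \<in> cocycles" "x \<in> cocycles \<Longrightarrow> - x \<in> cocycles"
  by (simp_all add: cocycles_def conv.G_closed conv.br_minus)

text \<open>Equal exponentials in degree 1 give equal adjoint actions in degree 1, in particular on
  \<open>unit_conv\<close>, from which a closed element is recovered.\<close>

lemma cocycles_eqI: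
  fixes x y :: "'k::field_char_0 conv"
  assumes x: "x \<in> cocycles" and y: "y \<in> cocycles" and eq: "\<And>v :: 'k conv. v \<in> conv_deg 1 \<Longrightarrow> conv.ex 1 x v = conv.ex 1 y v"
  shows "x = y"
proof -
  have G: "x \<in> conv.G" "y \<in> conv.G" "snd x = 0" "snd y = 0" using x y by (auto simp: cocycles_def)
  have "conv_bracket 0 1 x unit_conv = conv_bracket 0 1 y unit_conv"
    by (rule conv.ex_inj[OF G(1,2) eq unit_conv_deg])
  then have "fst x = fst y"
    using snd_bracket_unit[OF conv_G_D(1)[OF G(1)] G(3)] snd_bracket_unit[OF conv_G_D(1)[OF G(2)] G(4)] by (intro ext) simp
  then show ?thesis using G by (simp add: prod_eq_iff)
qed

lemma ch_assoc:
  assumes "x \<in> cocycles" "y \<in> cocycles" "z \<in> cocycles"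
  shows "conv.ch (conv.ch x y) z = conv.ch x (conv.ch y (z :: 'k::field_char_0 conv))"
proof (rule cocycles_eqI)
  have G: "x \<in> conv.G" "y \<in> conv.G" "z \<in> conv.G" using assms by (auto simp: cocycles_def)
  show "conv.ex 1 (conv.ch (conv.ch x y) z) v = conv.ex 1 (conv.ch x (conv.ch y z)) v" if "v \<in> conv_deg 1" for v :: "'k conv"
    using G that by (simp add: conv.ex_ch conv.ch_props conv.ex_props)
qed (intro cocycles_ch assms)+

lemma Z0_J: "\<gamma> \<in> Z0 \<Longrightarrow> J_conv \<gamma> \<in> cocycles" "x \<in> cocycles \<Longrightarrow> fst x \<in> Z0"
  using J_conv_cocycles cocycles_J by metis+

lemma J_conv_CH: assumes "\<gamma> \<in> Z0" "\<gamma>' \<in> Z0"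
  shows "J_conv (CH \<gamma> \<gamma>') = conv.ch (J_conv \<gamma>) (J_conv (\<gamma>' :: 'k::field_char_0 gfam))"
proof -
  have "J_conv (fst (conv.ch (J_conv \<gamma>) (J_conv \<gamma>'))) = conv.ch (J_conv \<gamma>) (J_conv \<gamma>')"
    by (rule cocycles_J[OF cocycles_ch[OF Z0_J(1)[OF assms(1)] Z0_J(1)[OF assms(2)]]])
  moreover have "J_conv \<gamma> \<in> conv.G" "J_conv \<gamma>' \<in> conv.G" using assms Z0_J(1) by (auto simp: cocycles_def)
  ultimately show ?thesis by (simp add: fst_ch)
qed

lemma J_conv_inj: "J_conv \<gamma> = J_conv \<gamma>' \<longleftrightarrow> \<gamma> = \<gamma>'" and J_conv_0: "J_conv 0 = 0" and J_conv_uminus: "J_conv (- \<gamma>) = - J_conv \<gamma>"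
  by (auto simp: J_conv_def zero_prod_def uminus_prod_def)

lemma Z0_CH: assumes "\<gamma> \<in> Z0" "\<gamma>' \<in> Z0" shows "CH \<gamma> \<gamma>' \<in> (Z0 :: 'k::field_char_0 gfam set)"
  unfolding J_conv_cocycles[symmetric] J_conv_CH[OF assms] using cocycles_ch Z0_J(1) assms by blast

lemma Z0_0: "0 \<in> (Z0 :: 'k::field_char_0 gfam set)" and Z0_uminus: "\<gamma> \<in> Z0 \<Longrightarrow> - \<gamma> \<in> (Z0 :: 'k::field_char_0 gfam set)"
  unfolding J_conv_cocycles[symmetric] J_conv_0 J_conv_uminus using cocycles_closed by blast+

lemma CH_unit: assumes "\<gamma> \<in> Z0" shows "CH 0 \<gamma> = \<gamma>" "CH \<gamma> 0 = (\<gamma> :: 'k::field_char_0 gfam)"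
proof -
  have "J_conv \<gamma> \<in> conv.G" using Z0_J(1)[OF assms] by (simp add: cocycles_def)
  then show "CH 0 \<gamma> = \<gamma>" "CH \<gamma> 0 = \<gamma>"
    using J_conv_CH[OF Z0_0 assms] J_conv_CH[OF assms Z0_0] by (simp_all add: J_conv_0 conv.ch_zero J_conv_inj)
qed

lemma CH_inverse: assumes "\<gamma> \<in> Z0" shows "CH (- \<gamma>) \<gamma> = (0 :: 'k::field_char_0 gfam)"
proof -
  have "J_conv \<gamma> \<in> conv.G" using Z0_J(1)[OF assms] by (simp add: cocycles_def)
  then show ?thesis
    using J_conv_CH[OF Z0_uminus[OF assms] assms] by (simp add: J_conv_uminus conv.ch_inverse J_conv_inj[of _ 0, unfolded J_conv_0])
qed

lemma CH_assoc: assumes "\<gamma> \<in> Z0" "\<gamma>' \<in> Z0" "\<gamma>'' \<in> Z0"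
  shows "CH (CH \<gamma> \<gamma>') \<gamma>'' = CH \<gamma> (CH \<gamma>' (\<gamma>'' :: 'k::field_char_0 gfam))"
  using assms ch_assoc[OF Z0_J(1)[OF assms(1)] Z0_J(1)[OF assms(2)] Z0_J(1)[OF assms(3)]]
  by (simp add: J_conv_inj[symmetric] J_conv_CH Z0_CH)

lemma group_exp_Z0: "group (exp_Z0 :: ('k::field_char_0 gfam) monoid)"
  by (rule groupI) (auto simp: exp_Z0_def Z0_CH Z0_0 CH_unit CH_assoc intro!: bexI[of _ "- _"] CH_inverse Z0_uminus)

section \<open>Cocycles acting on stable formality quasi-isomorphisms and on their homotopy
  classes\<close>

section \<open>The actions on SFQs and on homotopy classes\<close>

lemma SFQ_D:
  assumes "\<alpha> \<in> (SFQ :: 'k::field_char_0 conv set)"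
  shows "\<alpha> \<in> conv_deg 1" "conv_bracket 1 1 \<alpha> \<alpha> = 0" "fst \<alpha> = fst edge_conv" "fst \<alpha> 1 = 0"
proof -
  show a: "\<alpha> \<in> conv_deg 1" "conv_bracket 1 1 \<alpha> \<alpha> = 0" using assms by (auto simp: SFQ_def MC_def)
  show "fst \<alpha> 1 = 0" by (rule conv_degD(2)[OF a(1)])
  have "fst \<alpha> n = fst edge_conv n" for n
  proof -
    consider "n = 0" | "n = 1" | "n = 2" | "n \<ge> 3" by linarith
    then show ?thesis
      by cases (use assms conv_degD(1,2)[OF a(1)] in \<open>simp_all add: SFQ_def edge_conv_def\<close>)
  qed
  then show "fst \<alpha> = fst edge_conv" by blast
qed

text \<open>The closed part is kept because \<open>x\<close> is a cocycle. The other boundary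
  conditions concern open components with at most one black vertex, and inserting a closed graph,
  which has at least two vertices, produces no such component.\<close>

lemma ex_SFQ:
  assumes x: "x \<in> cocycles" and \<alpha>: "\<alpha> \<in> SFQ"
  shows "conv.ex 1 x \<alpha> \<in> (SFQ :: 'k::field_char_0 conv set)"
proof -
  note X = cocyclesD[OF x] and A = SFQ_D[OF \<alpha>]
  let ?ad = "conv_bracket 0 1 x"
  have zero_fun_apply: "(0 :: 'k gfam) 1 = 0" by simp
  have fst_cong: "fst (?ad u) = fst (?ad v)" if "fst u 1 = 0" "fst u = fst v" for u v
    using fst_bracket[of x u 0 1] fst_bracket[of x v 0 1] X(3) that by simp
  have f: "fst ((?ad ^^ Suc j) \<alpha>) = 0" for j
  proof (induction j)
    case 0
    have "?ad edge_conv = 0" using X(5) edge_bracket_commute by blast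
    then show ?case using fst_cong[OF A(4) A(3)] by simp
  next
    case (Suc j)
    have "fst (?ad ((?ad ^^ Suc j) \<alpha>)) = fst (?ad 0)" by (rule fst_cong) (simp_all only: Suc fst_zero zero_fun_apply)
    then show ?case by simp
  qed
  have s: "snd ((?ad ^^ Suc j) \<alpha>) n k L = 0" if "n \<le> 1" for j n k L
    using that by (simp add: snd_bracket_closed_left[OF X(4)])
  have "fst (conv.ex 1 x \<alpha>) n L = fst \<alpha> n L" for n L
    unfolding ex_coeff[OF X(1) A(1)] by (simp only: sum.atMost_shift f) simp
  moreover have "snd (conv.ex 1 x \<alpha>) n k L = snd \<alpha> n k L" if "n \<le> 1" for n k L
    unfolding ex_coeff[OF X(1) A(1)] by (simp only: sum.atMost_shift s[OF that]) simp
  moreover have "conv_bracket 1 1 (conv.ex 1 x \<alpha>) (conv.ex 1 x \<alpha>) = 0"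
    using conv.ex_bracket[OF X(1) A(1,1)] A(2) conv.ex_fixed[of 2 x 0] by simp
  moreover have "conv.ex 1 x \<alpha> \<in> conv_deg 1" by (rule conv.ex_props(1)[OF X(1) A(1)])
  moreover have "fst (conv.ex 1 x \<alpha>) = fst \<alpha>" "snd (conv.ex 1 x \<alpha>) 0 = snd \<alpha> 0" "snd (conv.ex 1 x \<alpha>) 1 = snd \<alpha> 1"
    using calculation(1,2) by (intro ext; simp)+
  ultimately show ?thesis using \<alpha> by (simp add: SFQ_def MC_def)
qed

subsection \<open>Homotopies\<close>

lemma homotopy_rel_iff:
  "(\<alpha>, \<alpha>') \<in> homotopy_rel \<longleftrightarrow> \<alpha> \<in> (SFQ :: 'k::field_char_0 conv set) \<and> \<alpha>' \<in> SFQ \<and> (\<exists>\<xi>\<in>conv.G. fst \<xi> = 0 \<and> \<alpha>' = conv.ex 1 \<xi> \<alpha>)"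
proof -
  have "(\<forall>n\<ge>2. fst \<xi> n = 0) \<longleftrightarrow> fst \<xi> = 0" if "\<xi> \<in> conv.G" for \<xi> :: "'k conv"
  proof
    assume *: "\<forall>n\<ge>2. fst \<xi> n = 0"
    have "fst \<xi> n = 0" for n
    proof -
      consider "n = 0" | "n = 1" | "n \<ge> 2" by linarith
      then show ?thesis by cases (use * conv_degD(1,2)[OF conv_G_D(1)[OF that]] in simp_all)
    qed
    then show "fst \<xi> = 0" by (simp add: fun_eq_iff)
  qed simp
  then have "\<xi> \<in> conv_deg 0 \<inter> conv_filt 1 \<and> (\<forall>n\<ge>2. fst \<xi> n = 0) \<and> \<alpha>' = exp_ad 1 \<xi> \<alpha>
      \<longleftrightarrow> \<xi> \<in> conv.G \<and> fst \<xi> = 0 \<and> \<alpha>' = conv.ex 1 \<xi> \<alpha>" if "\<alpha> \<in> SFQ" for \<xi>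
    unfolding conv.G_def[symmetric] using exp_ad_eq[OF _ SFQ_D(1)[OF that], of \<xi>] by (cases "\<xi> \<in> conv.G") simp_all
  then show ?thesis
    unfolding homotopy_rel_def mem_Collect_eq prod.case Bex_def by (cases "\<alpha> \<in> SFQ") simp_all
qed

text \<open>Used to see that a product has no closed components, by replacing the factors with
  others that have the same closed components and a known product.\<close>

lemma fst_ch_cong:
  assumes "x \<in> conv.G" "y \<in> conv.G" "x' \<in> conv.G" "y' \<in> conv.G" "fst x = fst x'" "fst y = fst y'"
  shows "fst (conv.ch x y) = fst (conv.ch x' y')"
  using assms by (simp add: fst_ch)

lemma equiv_homotopy_rel: "equiv (SFQ :: 'k::field_char_0 conv set) homotopy_rel"
proof (rule equivI)
  show "homotopy_rel \<subseteq> SFQ \<times> (SFQ :: 'k conv set)" by (auto simp: homotopy_rel_def)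
  show "refl_on SFQ (homotopy_rel :: ('k conv \<times> 'k conv) set)"
    by (rule refl_onI) (auto simp: homotopy_rel_iff conv.ex_zero intro!: bexI[of _ 0] conv.G_closed)
  show "sym (homotopy_rel :: ('k conv \<times> 'k conv) set)"
  proof (rule symI)
    fix \<alpha> \<beta> :: "'k conv" assume "(\<alpha>, \<beta>) \<in> homotopy_rel"
    then obtain \<xi> where "\<alpha> \<in> SFQ" "\<beta> \<in> SFQ" "\<xi> \<in> conv.G" "fst \<xi> = 0" "\<beta> = conv.ex 1 \<xi> \<alpha>" by (auto simp: homotopy_rel_iff)
    then show "(\<beta>, \<alpha>) \<in> homotopy_rel"
      unfolding homotopy_rel_iff by (intro conjI bexI[of _ "- \<xi>"]) (simp_all add: conv.ex_inverse SFQ_D(1) conv.G_closed)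
  qed
  show "trans (homotopy_rel :: ('k conv \<times> 'k conv) set)"
  proof (rule transI)
    fix \<alpha> \<beta> \<delta> :: "'k conv" assume "(\<alpha>, \<beta>) \<in> homotopy_rel" "(\<beta>, \<delta>) \<in> homotopy_rel"
    then obtain \<xi> \<zeta> where *: "\<alpha> \<in> SFQ" "\<xi> \<in> conv.G" "fst \<xi> = 0" "\<beta> = conv.ex 1 \<xi> \<alpha>" "\<delta> \<in> SFQ" "\<zeta> \<in> conv.G" "fst \<zeta> = 0" "\<delta> = conv.ex 1 \<zeta> \<beta>"
      by (auto simp: homotopy_rel_iff)
    have "fst (conv.ch \<zeta> \<xi>) = 0"
      using fst_ch_cong[OF *(6,2) conv.G_closed(1) conv.G_closed(1)] * by (simp add: conv.ch_zero(1) conv.G_closed)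
    then show "(\<alpha>, \<delta>) \<in> homotopy_rel"
      unfolding homotopy_rel_iff using * conv.ch_props(1)[OF *(6,2)] conv.ex_ch[OF *(6,2) SFQ_D(1)[OF *(1)]] by metis
  qed
qed

text \<open>The new homotopy is \<open>\<xi>\<close> conjugated by \<open>x\<close>. Its closed
  components are those of the product of \<open>x\<close> with its inverse, hence zero.\<close>

lemma homotopy_rel_ex:
  assumes h: "(\<alpha>, \<beta>) \<in> homotopy_rel" and x: "x \<in> (cocycles :: 'k::field_char_0 conv set)"
  shows "(conv.ex 1 x \<alpha>, conv.ex 1 x \<beta>) \<in> homotopy_rel"
proof -
  note X = cocyclesD[OF x]
  obtain \<xi> where *: "\<alpha> \<in> SFQ" "\<beta> \<in> SFQ" "\<xi> \<in> conv.G" "fst \<xi> = 0" "\<beta> = conv.ex 1 \<xi> \<alpha>" using h by (auto simp: homotopy_rel_iff)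
  have m: "- x \<in> conv.G" by (rule conv.G_closed(2)[OF X(1)])
  have c: "conv.ch \<xi> (- x) \<in> conv.G" by (rule conv.ch_props(1)[OF *(3) m])
  let ?\<zeta> = "conv.ch x (conv.ch \<xi> (- x))"
  have "fst (conv.ch \<xi> (- x)) = fst (- x)"
    using fst_ch_cong[OF *(3) m conv.G_closed(1) m] *(4) by (simp add: conv.ch_zero(2)[OF m])
  then have "fst ?\<zeta> = 0"
    using fst_ch_cong[OF X(1) c X(1) m] by (simp add: conv.ch_inverse(1)[OF X(1)])
  moreover have "conv.ex 1 ?\<zeta> (conv.ex 1 x \<alpha>) = conv.ex 1 x \<beta>"
    using SFQ_D(1)[OF *(1)] conv.ex_props(1)[OF X(1) SFQ_D(1)[OF *(1)]]
    by (simp add: conv.ex_ch[OF X(1) c] conv.ex_ch[OF *(3) m] conv.ex_inverse[OF X(1)] *(5))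
  ultimately show ?thesis
    unfolding homotopy_rel_iff using ex_SFQ[OF x *(1)] ex_SFQ[OF x *(2)] conv.ch_props(1)[OF X(1) c] by metis
qed

subsection \<open>Cohomologous cocycles\<close>

text \<open>On one vertex an element of degree -1 would consist of graphs with one edge, hence a
  loop; so \<open>\<eta>\<close> has no component there and embeds into the convolution Lie
  algebra.\<close>

lemma cohomologous_iff:
  "(\<gamma>, \<gamma>') \<in> cohomologous \<longleftrightarrow> \<gamma> \<in> Z0 \<and> \<gamma>' \<in> (Z0 :: 'k::field_char_0 gfam set) \<and>
     (\<exists>\<zeta>\<in>conv_deg (-1) \<inter> conv_filt 1. J_conv \<gamma>' - J_conv \<gamma> = conv_bracket 1 (-1) edge_conv \<zeta>)"
proof -
  have "(\<exists>\<eta>\<in>dfGC (-1). \<gamma>' - \<gamma> = dfGC_diff (-1) \<eta>) \<longleftrightarrow>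
     (\<exists>\<zeta>\<in>conv_deg (-1) \<inter> conv_filt 1. J_conv \<gamma>' - J_conv \<gamma> = conv_bracket 1 (-1) edge_conv \<zeta>)"
  proof
    assume "\<exists>\<eta>\<in>dfGC (-1). \<gamma>' - \<gamma> = dfGC_diff (-1) \<eta>"
    then obtain \<eta> where \<eta>: "\<eta> \<in> dfGC (-1)" "\<gamma>' - \<gamma> = dfGC_diff (-1) \<eta>" by blast
    have "\<eta> 1 \<in> KGra_inv 1 0 (-1)" using \<eta>(1) by (auto simp: dfGC_def)
    then have "\<eta> 1 L = 0" for L
      by (rule_tac ccontr) (use ographs_1_0 in \<open>auto simp: KGra_inv_def KGra_def\<close>)
    then have 1: "\<eta> 1 = 0" by (simp add: fun_eq_iff)
    have d: "J_conv \<eta> \<in> conv_deg (-1)" using \<eta>(1) 1 by (auto simp: conv_deg_def dfGC_def J_conv_def zero_KGra_inv)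
    have "snd (conv_bracket 1 (-1) edge_conv (J_conv \<eta>)) = 0" by (rule snd_bracket_closed) (simp_all add: edge_conv_def)
    moreover have "fst (conv_bracket 1 (-1) edge_conv (J_conv \<eta>)) = \<gamma>' - \<gamma>"
      using fst_edge_bracket[of "J_conv \<eta>" "-1"] 1 \<eta>(2) by simp
    ultimately have "J_conv \<gamma>' - J_conv \<gamma> = conv_bracket 1 (-1) edge_conv (J_conv \<eta>)" by (simp add: prod_eq_iff)
    then show "\<exists>\<zeta>\<in>conv_deg (-1) \<inter> conv_filt 1. J_conv \<gamma>' - J_conv \<gamma> = conv_bracket 1 (-1) edge_conv \<zeta>"
      using d closed_filt[OF d] by auto
  next
    assume "\<exists>\<zeta>\<in>conv_deg (-1) \<inter> conv_filt 1. J_conv \<gamma>' - J_conv \<gamma> = conv_bracket 1 (-1) edge_conv \<zeta>"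
    then obtain \<zeta> where \<zeta>: "\<zeta> \<in> conv_deg (-1)" "J_conv \<gamma>' - J_conv \<gamma> = conv_bracket 1 (-1) edge_conv \<zeta>" by blast
    have "fst (J_conv \<gamma>' - J_conv \<gamma>) = dfGC_diff (-1) (fst \<zeta>)"
      unfolding \<zeta>(2) by (rule fst_edge_bracket[OF conv_degD(2)[OF \<zeta>(1)]])
    then have "\<gamma>' - \<gamma> = dfGC_diff (-1) (fst \<zeta>)" by simp
    moreover have "fst \<zeta> \<in> dfGC (-1)" using \<zeta>(1) by (auto simp: dfGC_def conv_deg_iff)
    ultimately show "\<exists>\<eta>\<in>dfGC (-1). \<gamma>' - \<gamma> = dfGC_diff (-1) \<eta>" by blast
  qed
  then show ?thesis by (simp add: cohomologous_def)
qed

lemma equiv_cohomologous: "equiv (Z0 :: 'k::field_char_0 gfam set) cohomologous"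
proof (rule equivI)
  let ?d = "conv_bracket 1 (-1) (edge_conv :: 'k conv)" and ?B = "conv_deg (-1) \<inter> (conv_filt 1 :: 'k conv set)"
  have B: "0 \<in> ?B" "\<And>x. x \<in> ?B \<Longrightarrow> - x \<in> ?B" "\<And>x y. x \<in> ?B \<Longrightarrow> y \<in> ?B \<Longrightarrow> x + y \<in> ?B"
    by (simp_all add: conv.C_closed conv.F_closed)
  show "cohomologous \<subseteq> Z0 \<times> (Z0 :: 'k gfam set)" by (auto simp: cohomologous_def)
  show "refl_on Z0 (cohomologous :: ('k gfam \<times> 'k gfam) set)"
    by (rule refl_onI) (use B(1) in \<open>force simp: cohomologous_iff\<close>)
  show "sym (cohomologous :: ('k gfam \<times> 'k gfam) set)"
  proof (rule symI)
    fix \<gamma> \<delta> :: "'k gfam" assume "(\<gamma>, \<delta>) \<in> cohomologous"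
    then obtain \<zeta> where z: "\<gamma> \<in> Z0" "\<delta> \<in> Z0" "\<zeta> \<in> ?B" "J_conv \<delta> - J_conv \<gamma> = ?d \<zeta>" unfolding cohomologous_iff by blast
    have "J_conv \<gamma> - J_conv \<delta> = ?d (- \<zeta>)" using z(4) conv.br_minus(2)[of 1 "-1" edge_conv \<zeta>] by (metis minus_diff_eq)
    then show "(\<delta>, \<gamma>) \<in> cohomologous" unfolding cohomologous_iff using z B(2) by blast
  qed
  show "trans (cohomologous :: ('k gfam \<times> 'k gfam) set)"
  proof (rule transI)
    fix \<gamma> \<delta> \<epsilon> :: "'k gfam" assume "(\<gamma>, \<delta>) \<in> cohomologous" "(\<delta>, \<epsilon>) \<in> cohomologous"
    then obtain \<zeta> \<theta> where z: "\<gamma> \<in> Z0" "\<epsilon> \<in> Z0" "\<zeta> \<in> ?B" "J_conv \<delta> - J_conv \<gamma> = ?d \<zeta>" "\<theta> \<in> ?B" "J_conv \<epsilon> - J_conv \<delta> = ?d \<theta>"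
      unfolding cohomologous_iff by blast
    have "J_conv \<epsilon> - J_conv \<gamma> = ?d (\<theta> + \<zeta>)" unfolding conv_bracket_linear z(4)[symmetric] z(6)[symmetric] by simp
    then show "(\<gamma>, \<epsilon>) \<in> cohomologous" unfolding cohomologous_iff using z B(3) by blast
  qed
qed

lemma CH_cohomologous:
  assumes "(\<gamma>, \<gamma>') \<in> cohomologous" "(\<delta>, \<delta>') \<in> (cohomologous :: ('k::field_char_0 gfam \<times> 'k gfam) set)"
  shows "(CH \<gamma> \<delta>, CH \<gamma>' \<delta>') \<in> cohomologous"
proof -
  obtain \<zeta> \<theta> where z: "\<gamma> \<in> Z0" "\<gamma>' \<in> Z0" "\<delta> \<in> Z0" "\<delta>' \<in> Z0"
      "\<zeta> \<in> conv_deg (-1) \<inter> conv_filt 1" "J_conv \<gamma>' - J_conv \<gamma> = conv_bracket 1 (-1) edge_conv \<zeta>"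
      "\<theta> \<in> conv_deg (-1) \<inter> conv_filt 1" "J_conv \<delta>' - J_conv \<delta> = conv_bracket 1 (-1) edge_conv \<theta>"
    using assms unfolding cohomologous_iff by blast
  note J = z(1-4)[THEN Z0_J(1)]
  show ?thesis
    unfolding cohomologous_iff using z
      conv.ch_exact[OF J(1,3,2,4)[THEN cocyclesD(1)] edge_conv_deg J(1,3,2,4)[THEN cocyclesD(5)] z(5-8)]
    by (simp add: J_conv_CH Z0_CH)
qed

text \<open>For odd \<open>\<alpha>\<close> with vanishing square, the Jacobi identity equates the
  double bracket of \<open>\<alpha>\<close> with \<open>\<zeta>\<close> with its own
  negative.\<close>

lemma SFQ_bracket_fixes:
  assumes \<alpha>: "\<alpha> \<in> SFQ" and z: "\<zeta> \<in> conv_deg (-1)"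
  shows "conv_bracket 0 1 (conv_bracket 1 (-1) \<alpha> \<zeta>) \<alpha> = (0 :: 'k::field_char_0 conv)"
proof -
  let ?a = "conv_bracket 1 (-1) \<alpha> \<zeta>"
  let ?X = "conv_bracket 1 0 \<alpha> ?a"
  have "?X = - ?X" using conv_jacobi[OF SFQ_D(1)[OF \<alpha>] SFQ_D(1)[OF \<alpha>] z] SFQ_D(2)[OF \<alpha>] by simp
  then have "?X + ?X = 0" by (simp only: eq_neg_iff_add_eq_0)
  then have "csc 2 ?X = 0" using csc_linear(2)[of 1 1 ?X] by (simp add: csc_linear(4))
  then have "?X = 0" by simp
  then show ?thesis using conv_bracket_antisym[of 0 1 ?a \<alpha>] by simp
qed

text \<open>
  If \<open>D = [edge_conv, \<zeta>]\<close> and \<open>a = [\<alpha>, \<zeta>]\<close>, then \<open>D\<close> and \<open>a\<close> have the same closed components and \<open>exp a\<close>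
  fixes \<open>\<alpha>\<close>; so \<open>exp D\<close> and \<open>exp D exp (-a)\<close>, the exponential of an element without closed components,
  map \<open>\<alpha>\<close> to the same element.
\<close>

lemma cohomologous_homotopy:
  assumes c: "(\<gamma>, \<gamma>') \<in> cohomologous" and \<alpha>: "\<alpha> \<in> (SFQ :: 'k::field_char_0 conv set)"
  shows "(conv.ex 1 (J_conv \<gamma>) \<alpha>, conv.ex 1 (J_conv \<gamma>') \<alpha>) \<in> homotopy_rel"
proof -
  obtain \<theta> where t: "\<gamma> \<in> Z0" "\<gamma>' \<in> Z0" "\<theta> \<in> conv_deg (-1) \<inter> conv_filt 1"
      "J_conv \<gamma>' - J_conv \<gamma> = conv_bracket 1 (-1) edge_conv \<theta>"
    using c unfolding cohomologous_iff by blast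
  let ?x = "J_conv \<gamma>" and ?y = "J_conv \<gamma>'"
  have x: "?x \<in> cocycles" and y: "?y \<in> cocycles" and mx: "- ?x \<in> cocycles"
    using Z0_J(1) t(1,2) cocycles_closed(2) by blast+
  note X = cocyclesD[OF x] and Y = cocyclesD[OF y] and MX = cocyclesD[OF mx] and A = SFQ_D[OF \<alpha>]
  define D where "D = conv.ch (- ?x) ?y"
  have Dc: "D \<in> cocycles" unfolding D_def by (rule cocycles_ch[OF mx y])
  \<comment> \<open>The product \<open>D\<close> is compared with the inverse of \<open>?x\<close>
    times \<open>?x\<close> itself, which is 0: the first factor is unchanged, with primitive 0, and
    the second changes by the given coboundary.\<close>
  have "\<exists>\<zeta>\<in>conv_deg (-1) \<inter> conv_filt 1. conv.ch (- ?x) ?y - conv.ch (- ?x) ?x = conv_bracket 1 (-1) edge_conv \<zeta>"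
    by (rule conv.ch_exact[OF MX(1) X(1) MX(1) Y(1) edge_conv_deg MX(5) X(5) MX(5) Y(5) _ _ t(3,4), of 0])
      (simp_all add: conv.C_closed conv.F_closed)
  then obtain \<zeta> where z: "\<zeta> \<in> conv_deg (-1)" "\<zeta> \<in> conv_filt 1" "D = conv_bracket 1 (-1) edge_conv \<zeta>"
    by (auto simp: D_def conv.ch_inverse[OF X(1)])
  define a where "a = conv_bracket 1 (-1) \<alpha> \<zeta>"
  have a: "a \<in> conv.G"
    using conv_bracket_closed[OF A(1) z(1)] conv_bracket_filt[OF conv_deg_filt_0[OF A(1)] z(2), of 1 "-1"]
    by (simp add: conv.G_def a_def)
  have "fst a = fst D"
    unfolding a_def z(3) using fst_bracket[of \<alpha> \<zeta> 1 "-1"] fst_bracket[of edge_conv \<zeta> 1 "-1"] A(3,4) conv_degD(2)[OF z(1)] by simp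
  moreover have ma: "- a \<in> conv.G" and D: "D \<in> conv.G" and mD: "- D \<in> conv.G"
    using conv.G_closed(2) a cocyclesD(1)[OF Dc] by blast+
  ultimately have 0: "fst (conv.ch D (- a)) = 0"
    using fst_ch_cong[OF D ma D mD] by (simp add: conv.ch_inverse(1)[OF D])
  have "conv.ex 1 (- a) \<alpha> = \<alpha>"
    by (rule conv.ex_fixed) (simp add: conv.br_minus a_def SFQ_bracket_fixes[OF \<alpha> z(1)])
  then have e: "conv.ex 1 (conv.ch D (- a)) \<alpha> = conv.ex 1 D \<alpha>" by (simp add: conv.ex_ch[OF D ma A(1)])
  have "(\<alpha>, conv.ex 1 D \<alpha>) \<in> homotopy_rel"
    unfolding homotopy_rel_iff using \<alpha> ex_SFQ[OF Dc \<alpha>] 0 e conv.ch_props(1)[OF D ma] by metis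
  \<comment> \<open>Applying the exponential of \<open>?x\<close> moves the homotopy to the desired
    ends, because the exponential of \<open>D\<close> is that of \<open>?y\<close> followed by the
    inverse of that of \<open>?x\<close>.\<close>
  then have "(conv.ex 1 ?x \<alpha>, conv.ex 1 ?x (conv.ex 1 D \<alpha>)) \<in> homotopy_rel" by (rule homotopy_rel_ex[OF _ x])
  moreover have "conv.ex 1 ?x (conv.ex 1 D \<alpha>) = conv.ex 1 ?y \<alpha>"
    unfolding D_def conv.ex_ch[OF MX(1) Y(1) A(1)]
    by (rule conv.ex_inverse(2)[OF X(1) conv.ex_props(1)[OF Y(1) A(1)]])
  ultimately show ?thesis by simp
qed

subsection \<open>Group actions\<close>

text \<open>The restriction to \<open>E\<close> is dictated by \<open>BijGroup\<close>, whose
  elements are extensional; bijectivity comes from the inverse group element.\<close>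

lemma group_actionI:
  fixes G (structure)
  assumes "group G" and closed: "\<And>g x. g \<in> carrier G \<Longrightarrow> x \<in> E \<Longrightarrow> f g x \<in> E"
    and one: "\<And>x. x \<in> E \<Longrightarrow> f \<one> x = x"
    and mult: "\<And>g h x. g \<in> carrier G \<Longrightarrow> h \<in> carrier G \<Longrightarrow> x \<in> E \<Longrightarrow> f (g \<otimes> h) x = f g (f h x)"
  shows "group_action G E (\<lambda>g. \<lambda>x\<in>E. f g x)"
proof -
  interpret group G by fact
  have Bij: "(\<lambda>x\<in>E. f g x) \<in> Bij E" if "g \<in> carrier G" for g
  proof -
    have "bij_betw (f g) E E"
      by (rule bij_betw_byWitness[where f' = "f (inv g)"]) (use that closed mult[symmetric] one in \<open>auto simp: image_subset_iff\<close>)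
    then show ?thesis by (simp add: Bij_def)
  qed
  have "(\<lambda>g. \<lambda>x\<in>E. f g x) \<in> hom G (BijGroup E)"
    by (rule homI) (auto simp: BijGroup_def Bij compose_def mult closed intro!: restrict_ext)
  then show ?thesis
    by (simp add: group_action_def group_hom_def group_hom_axioms_def group_BijGroup is_group)
qed

lemma exp_H0_mult:
  assumes "\<gamma> \<in> Z0" "\<delta> \<in> (Z0 :: 'k::field_char_0 gfam set)"
  shows "cohomologous `` {\<gamma>} \<otimes>\<^bsub>exp_H0\<^esub> cohomologous `` {\<delta>} = cohomologous `` {CH \<gamma> \<delta>}"
proof -
  have "congruent2 cohomologous cohomologous (\<lambda>\<gamma> \<delta>. cohomologous `` {CH \<gamma> (\<delta> :: 'k gfam)})"
    by (rule congruent2I') (rule equiv_class_eq[OF equiv_cohomologous CH_cohomologous])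
  from UN_equiv_class2[OF equiv_cohomologous equiv_cohomologous this assms] show ?thesis by (simp add: exp_H0_def)
qed

lemma group_exp_H0: "group (exp_H0 :: ('k::field_char_0 gfam set) monoid)"
proof (rule groupI)
  have carrier: "A \<in> carrier exp_H0 \<longleftrightarrow> (\<exists>\<gamma>\<in>Z0. A = cohomologous `` {\<gamma>})" for A :: "'k gfam set"
    by (auto simp: exp_H0_def quotient_def)
  have one: "\<one>\<^bsub>exp_H0\<^esub> = cohomologous `` {0 :: 'k gfam}" by (simp add: exp_H0_def)
  show "\<one>\<^bsub>exp_H0\<^esub> \<in> carrier (exp_H0 :: ('k gfam set) monoid)" using Z0_0 by (auto simp: carrier one)
  fix A :: "'k gfam set" assume "A \<in> carrier exp_H0"
  then obtain \<gamma> where g: "\<gamma> \<in> Z0" "A = cohomologous `` {\<gamma>}" by (auto simp: carrier)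
  show "\<one>\<^bsub>exp_H0\<^esub> \<otimes>\<^bsub>exp_H0\<^esub> A = A" using g by (simp add: one exp_H0_mult Z0_0 CH_unit)
  show "\<exists>B\<in>carrier exp_H0. B \<otimes>\<^bsub>exp_H0\<^esub> A = \<one>\<^bsub>exp_H0\<^esub>"
  proof (rule bexI)
    show "cohomologous `` {- \<gamma>} \<otimes>\<^bsub>exp_H0\<^esub> A = \<one>\<^bsub>exp_H0\<^esub>"
      unfolding g(2) one exp_H0_mult[OF Z0_uminus[OF g(1)] g(1)] CH_inverse[OF g(1)] ..
    show "cohomologous `` {- \<gamma>} \<in> carrier exp_H0" using Z0_uminus[OF g(1)] by (auto simp: carrier)
  qed
  fix B :: "'k gfam set" assume "B \<in> carrier exp_H0"
  then obtain \<delta> where d: "\<delta> \<in> Z0" "B = cohomologous `` {\<delta>}" by (auto simp: carrier)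
  show "A \<otimes>\<^bsub>exp_H0\<^esub> B \<in> carrier exp_H0" using g d Z0_CH by (auto simp: carrier exp_H0_mult)
  fix C :: "'k gfam set" assume "C \<in> carrier exp_H0"
  then obtain \<epsilon> where e: "\<epsilon> \<in> Z0" "C = cohomologous `` {\<epsilon>}" by (auto simp: carrier)
  show "A \<otimes>\<^bsub>exp_H0\<^esub> B \<otimes>\<^bsub>exp_H0\<^esub> C = A \<otimes>\<^bsub>exp_H0\<^esub> (B \<otimes>\<^bsub>exp_H0\<^esub> C)"
    using g d e by (simp add: exp_H0_mult Z0_CH CH_assoc)
qed

lemma exp_J_SFQ:
  assumes "\<gamma> \<in> Z0" "\<alpha> \<in> (SFQ :: 'k::field_char_0 conv set)"
  shows "exp_ad 1 (J_conv \<gamma>) \<alpha> = conv.ex 1 (J_conv \<gamma>) \<alpha>" "exp_ad 1 (J_conv \<gamma>) \<alpha> \<in> SFQ"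
  using exp_ad_eq[OF cocyclesD(1)[OF Z0_J(1)[OF assms(1)]] SFQ_D(1)[OF assms(2)]] ex_SFQ[OF Z0_J(1)[OF assms(1)] assms(2)]
  by simp_all

lemma exp_J_CH:
  assumes "\<gamma> \<in> Z0" "\<delta> \<in> Z0" "\<alpha> \<in> (SFQ :: 'k::field_char_0 conv set)"
  shows "exp_ad 1 (J_conv (CH \<gamma> \<delta>)) \<alpha> = exp_ad 1 (J_conv \<gamma>) (exp_ad 1 (J_conv \<delta>) \<alpha>)"
proof -
  note J = Z0_J(1)[OF assms(1), THEN cocyclesD(1)] Z0_J(1)[OF assms(2), THEN cocyclesD(1)]
  show ?thesis
    unfolding exp_J_SFQ(1)[OF Z0_CH[OF assms(1,2)] assms(3)] exp_J_SFQ(1)[OF assms(1) exp_J_SFQ(2)[OF assms(2,3)]]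
    unfolding exp_J_SFQ(1)[OF assms(2,3)] J_conv_CH[OF assms(1,2)]
    by (rule conv.ex_ch[OF J SFQ_D(1)[OF assms(3)]])
qed

lemma exp_J_0: "\<alpha> \<in> SFQ \<Longrightarrow> exp_ad 1 (J_conv 0) \<alpha> = (\<alpha> :: 'k::field_char_0 conv)"
  unfolding exp_J_SFQ(1)[OF Z0_0] by (simp add: J_conv_0 conv.ex_zero)

text \<open>Independence of both representatives: first the cocycle is changed at the point
  \<open>\<alpha>\<close>, then the point is changed under the new cocycle.\<close>

lemma exp_J_homotopy:
  assumes "(\<gamma>, \<gamma>') \<in> cohomologous" "(\<alpha>, \<alpha>') \<in> (homotopy_rel :: ('k::field_char_0 conv \<times> 'k conv) set)"
  shows "(exp_ad 1 (J_conv \<gamma>) \<alpha>, exp_ad 1 (J_conv \<gamma>') \<alpha>') \<in> homotopy_rel"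
proof -
  have m: "\<gamma> \<in> Z0" "\<gamma>' \<in> Z0" "\<alpha> \<in> SFQ" "\<alpha>' \<in> SFQ"
    using assms by (auto simp: cohomologous_def homotopy_rel_def)
  have "trans (homotopy_rel :: ('k conv \<times> 'k conv) set)" by (rule equivE[OF equiv_homotopy_rel])
  then show ?thesis
    using cohomologous_homotopy[OF assms(1) m(3)] homotopy_rel_ex[OF assms(2) Z0_J(1)[OF m(2)]] m
    by (simp add: exp_J_SFQ(1)) (blast dest: transD)
qed

theorem corollary6p6:
  shows "group_action exp_Z0 (SFQ :: 'k::field_char_0 conv set)
           (\<lambda>\<gamma>. \<lambda>\<alpha>\<in>SFQ. exp_ad 1 (J_conv \<gamma>) \<alpha>) \<and>
         (\<exists>\<Phi>. group_action exp_H0 ((SFQ :: 'k conv set) // homotopy_rel) \<Phi> \<and>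
            (\<forall>\<gamma>\<in>Z0. \<forall>\<alpha>\<in>SFQ.
               \<Phi> (cohomologous `` {\<gamma>}) (homotopy_rel `` {\<alpha>})
                 = homotopy_rel `` {exp_ad 1 (J_conv \<gamma>) \<alpha>}))"
proof (intro conjI exI ballI)
  show "group_action exp_Z0 (SFQ :: 'k conv set) (\<lambda>\<gamma>. \<lambda>\<alpha>\<in>SFQ. exp_ad 1 (J_conv \<gamma>) \<alpha>)"
    by (rule group_actionI[OF group_exp_Z0]) (simp_all add: exp_Z0_def exp_J_SFQ(2) exp_J_CH exp_J_0)
  let ?f = "\<lambda>(\<gamma> :: 'k gfam) \<alpha>. homotopy_rel `` {exp_ad 1 (J_conv \<gamma>) (\<alpha> :: 'k conv)}"
  let ?F = "\<lambda>A X. \<Union>\<gamma>\<in>A. \<Union>\<alpha>\<in>X. ?f \<gamma> \<alpha>"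
  have "congruent2 cohomologous homotopy_rel ?f"
    by (rule congruent2I') (rule equiv_class_eq[OF equiv_homotopy_rel exp_J_homotopy])
  then have F: "?F (cohomologous `` {\<gamma>}) (homotopy_rel `` {\<alpha>}) = ?f \<gamma> \<alpha>" if "\<gamma> \<in> Z0" "\<alpha> \<in> SFQ" for \<gamma> \<alpha>
    by (rule UN_equiv_class2[OF equiv_cohomologous equiv_homotopy_rel _ that])
  have H: "\<exists>\<gamma>\<in>Z0. A = cohomologous `` {\<gamma>}" if "A \<in> carrier exp_H0" for A :: "'k gfam set"
    using that by (auto simp: exp_H0_def quotient_def)
  have S: "\<exists>\<alpha>\<in>SFQ. X = homotopy_rel `` {\<alpha>}" if "X \<in> SFQ // homotopy_rel" for X :: "'k conv set"
    using that by (auto simp: quotient_def)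
  have one: "\<one>\<^bsub>exp_H0\<^esub> = cohomologous `` {0 :: 'k gfam}" by (simp add: exp_H0_def)
  show "group_action exp_H0 (SFQ // homotopy_rel) (\<lambda>A. \<lambda>X\<in>SFQ // homotopy_rel. ?F A X)"
  proof (rule group_actionI[OF group_exp_H0])
    fix X :: "'k conv set" assume "X \<in> SFQ // homotopy_rel"
    then obtain \<alpha> where a: "\<alpha> \<in> SFQ" "X = homotopy_rel `` {\<alpha>}" using S by blast
    show "?F \<one>\<^bsub>exp_H0\<^esub> X = X" by (simp only: one a(2) F[OF Z0_0 a(1)] exp_J_0[OF a(1)])
    fix A :: "'k gfam set" assume "A \<in> carrier exp_H0"
    then obtain \<gamma> where g: "\<gamma> \<in> Z0" "A = cohomologous `` {\<gamma>}" using H by blast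
    show "?F A X \<in> SFQ // homotopy_rel"
      unfolding a(2) g(2) F[OF g(1) a(1)] by (rule quotientI[OF exp_J_SFQ(2)[OF g(1) a(1)]])
    fix B :: "'k gfam set" assume "B \<in> carrier exp_H0"
    then obtain \<delta> where d: "\<delta> \<in> Z0" "B = cohomologous `` {\<delta>}" using H by blast
    show "?F (A \<otimes>\<^bsub>exp_H0\<^esub> B) X = ?F A (?F B X)"
      unfolding a(2) g(2) d(2) exp_H0_mult[OF g(1) d(1)] F[OF d(1) a(1)] F[OF Z0_CH[OF g(1) d(1)] a(1)]
        F[OF g(1) exp_J_SFQ(2)[OF d(1) a(1)]] exp_J_CH[OF g(1) d(1) a(1)] ..
  qed
  fix \<gamma> :: "'k gfam" and \<alpha> :: "'k conv" assume "\<gamma> \<in> Z0" "\<alpha> \<in> SFQ"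
  then show "(\<lambda>X\<in>SFQ // homotopy_rel. ?F (cohomologous `` {\<gamma>}) X) (homotopy_rel `` {\<alpha>}) = ?f \<gamma> \<alpha>"
    using F quotientI[of \<alpha> SFQ homotopy_rel] by simp
qed

end
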